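(* Let $\Omega=(0,1)\times\mathbb{R}$ and let $b\in L^\infty(\Omega)$ satisfy $b(s,t)\ge0$ for almost all $(s,t)\in\Omega$. Consider the damped wave equation $z_{tt}=z_{ss}-b(s,t)z_t$ on $(0,1)\times(0,\infty)$ with boundary conditions $z(0,t)=z(1,t)=0$, $t>0$, viewed as a non-autonomous Cauchy problem on $X=H_0^1(0,1)\times L^2(0,1)$. Suppose that $b$ is $2$-periodic in $t$, let $\Omega_0=\{(s,t)\in\Omega:0<t<2\}$, and let $$Y=\left\{x\in X:\iint_{\Omega_0}b(s,t)|v(s,t;x)|^2\,d(s,t)=0\right\},$$ where $v(\cdot,\cdot;x)$ is the velocity component of the solution to the undamped wave equation on $(0,1)$ with initial data $x\in X$. Let $Z=Y^\perp$ and let $P$ denote the orthogonal projection onto $Y$. Then the following hold. (i) For any initial value $x\in X$ the solution $z\colon\mathbb{R}_+\to X$ of the damped problem with $z(0)=x$ satisfies $$\|z(t)-z_0(t)\|\to0,\quad t\to\infty,$$ where $z_0\colon\mathbb{R}_+\to X$ is the solution of the undamped wave equation with initial condition $z_0(0)=Px$. In particular, the system is asymptotically periodic, and it is stable if and only if $Y=\{0\}$. (ii) There exist $M,\beta>0$ such that $$\|z(t)-z_0(t)\|\le Me^{-\beta t}\|x\|,\quad t\ge0,\ x\in X,$$ if and only if there exists $\kappa>0$ such that $$\iint_{\Omega_0}b(s,t)|v(s,t;x)|^2\,d(s,t)\ge\kappa^2\|x\|^2\qquad(\ast)$$ for all $x\in Z$. (iii) If $b=\mathbf{1}_\omega$ for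 some open subset $\omega$ of $\Omega$ which is $2$-translation-invariant, then the estimate $(\ast)$ is satisfied, for some $\kappa>0$, for all $x\in X$ provided $\omega$ satisfies the GCC on $(0,2)$. (iv) In any case, there exists a dense subspace $X_0$ of $X$ such that for all $x\in X_0$ the convergence $\|z(t)-z_0(t)\|\to0$ is superpolynomially fast, that is, $\|z(t)-z_0(t)\|=o(t^{-\gamma})$ as $t\to\infty$ for all $\gamma>0$.
   Context: $X=H_0^1(0,1)\times L^2(0,1)$ (complex-valued functions) carries the energy norm $\|(u,v)^T\|^2=\|u'\|_{L^2}^2+\|v\|_{L^2}^2$. The operator $A_0(u,v)^T=(v,u'')^T$ with domain $D(A_0)=(H^2(0,1)\cap H_0^1(0,1))\times H_0^1(0,1)$ generates a unitary group $(T_0(t))_{t\in\mathbb{R}}$ on $X$, with $T_0(2)=I$. The solution of the undamped wave equation with initial data $x\in X$ is $t\mapsto T_0(t)x$, and its velocity component $v(\cdot,t;x)$ is the second component of $T_0(t)x$. The damped problem is $\dot z(t)=(A_0-B(t)B(t)^* )z(t)$, $z(0)=x$, with $B(t)(u,v)^T=(0,b(\cdot,t)^{1/2}v)^T$, so $B(t)B(t)^*(u,v)^T=(0,b(\cdot,t)v)^T$. Its solution is the mild solution, i.e. the continuous function $z\colon\mathbb{R}_+\to X$ with $$z(t)=T_0(t)x-\int_0^tT_0(t-r)B(r)B(r)^*z(r)\,dr,\quad t\ge0.$$ The system is asymptotically periodic if for every $x\in X$ there is a periodic function $z_0\colon\mathbb{R}_+\to X$ with $\|z(t)-z_0(t)\|\to0$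 as $t\to\infty$; it is stable if $\|z(t)\|\to0$ as $t\to\infty$ for every $x\in X$. A set $\omega\subseteq\Omega$ is $2$-translation-invariant if $\omega+\{(0,2)\}=\omega$. It satisfies the geometric control condition (GCC) on $(0,\tau)$ if every characteristic ray intersects $\omega\cap((0,1)\times(0,\tau))$. Here characteristic rays are the curves in $(s,t)$-space traced by points moving in $[0,1]$ with unit speed and reflected at the endpoints $0$ and $1$, i.e. the curves $t\mapsto(\operatorname{dist}(s_0+t,2\mathbb{Z}),t)$, $s_0\in\mathbb{R}$. *)

theory Defs
  imports "HOL-Analysis.Analysis" "HOL-Library.Landau_Symbols"
begin

class complex_vector = real_vector +
  fixes scaleC :: "complex \<Rightarrow> 'a \<Rightarrow> 'a" (infixr "*\<^sub>C" 75)
  assumes scaleC_add_right: "a *\<^sub>C (x + y) = a *\<^sub>C x + a *\<^sub>C y"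
    and scaleC_add_left: "(a + b) *\<^sub>C x = a *\<^sub>C x + b *\<^sub>C x"
    and scaleC_scaleC: "a *\<^sub>C b *\<^sub>C x = (a * b) *\<^sub>C x"
    and scaleC_one: "1 *\<^sub>C x = x"
    and scaleR_scaleC: "r *\<^sub>R x = complex_of_real r *\<^sub>C x"

class complex_inner = complex_vector + real_inner +
  fixes cinner :: "'a \<Rightarrow> 'a \<Rightarrow> complex"
  assumes cinner_commute: "cinner x y = cnj (cinner y x)"
    and cinner_add_left: "cinner (x + y) z = cinner x z + cinner y z"
    and cinner_scaleC_left: "cinner (a *\<^sub>C x) y = a * cinner x y"
    and inner_eq_Re_cinner: "inner x y = Re (cinner x y)"

instantiation prod :: (complex_vector, complex_vector) complex_vector
begin

definition scaleC_prod :: "complex \<Rightarrow> 'a \<times> 'b \<Rightarrow> 'a \<times> 'b"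
  where "a *\<^sub>C x = (a *\<^sub>C fst x, a *\<^sub>C snd x)"

instance
  by standard (simp_all add: scaleC_prod_def prod_eq_iff scaleC_add_right scaleC_add_left
      scaleC_scaleC scaleC_one scaleR_scaleC)

end

instantiation prod :: (complex_inner, complex_inner) complex_inner
begin

definition cinner_prod :: "'a \<times> 'b \<Rightarrow> 'a \<times> 'b \<Rightarrow> complex"
  where "cinner x y = cinner (fst x) (fst y) + cinner (snd x) (snd y)"

instance
proof
  fix x y z :: "'a \<times> 'b" and a :: complex
  show "cinner x y = cnj (cinner y x)"
    unfolding cinner_prod_def using cinner_commute[of "fst x" "fst y"] cinner_commute[of "snd x" "snd y"] by simp
qed (simp_all add: cinner_prod_def scaleC_prod_def inner_prod_def inner_eq_Re_cinner
      cinner_add_left cinner_scaleC_left algebra_simps)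

end

lemma borel_measurable_cnj [measurable (raw)]:
  "f \<in> borel_measurable M \<Longrightarrow> (\<lambda>x. cnj (f x)) \<in> borel_measurable M"
  by (rule borel_measurable_continuous_on[OF continuous_on_cnj[OF continuous_on_id]])

abbreviation unit_interval :: "real measure"
  where "unit_interval \<equiv> lebesgue_on {0<..<1}"

definition square_integrable :: "(real \<Rightarrow> complex) \<Rightarrow> bool"
  where "square_integrable f \<longleftrightarrow> f \<in> borel_measurable unit_interval \<and>
    integrable unit_interval (\<lambda>s. (cmod (f s))\<^sup>2)"

lemma finite_measure_unit_interval: "finite_measure unit_interval"
  by (rule finite_measure_lebesgue_on) auto

lemma square_integrable_measurable[measurable_dest]:
  "square_integrable f \<Longrightarrow> f \<in> borel_measurable unit_interval"
  by (simp add: square_integrable_def)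

lemma square_integrableD: "square_integrable f \<Longrightarrow> integrable unit_interval (\<lambda>s. (cmod (f s))\<^sup>2)"
  by (simp add: square_integrable_def)

lemma square_integrable_dominated:
  assumes "f \<in> borel_measurable unit_interval" "integrable unit_interval g"
    "AE s in unit_interval. (cmod (f s))\<^sup>2 \<le> g s"
  shows "square_integrable f"
  unfolding square_integrable_def
proof
  have [measurable]: "f \<in> borel_measurable unit_interval" by fact
  show "integrable unit_interval (\<lambda>s. (cmod (f s))\<^sup>2)"
  proof (rule Bochner_Integration.integrable_bound[OF assms(2)])
    show "AE s in unit_interval. norm ((cmod (f s))\<^sup>2) \<le> norm (g s)"
      using assms(3) by eventually_elim simp
  qed measurable
qed fact

lemma square_integrable_zero [simp]: "square_integrable (\<lambda>s. 0)"
  by (simp add: square_integrable_def)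

lemma square_integrable_bounded:
  assumes "f \<in> borel_measurable unit_interval" "AE s in unit_interval. cmod (f s) \<le> C"
  shows "square_integrable f"
proof (rule square_integrable_dominated[where g = "\<lambda>_. C\<^sup>2"])
  interpret finite_measure unit_interval by (rule finite_measure_unit_interval)
  show "integrable unit_interval (\<lambda>_. C\<^sup>2)" by simp
  show "AE s in unit_interval. (cmod (f s))\<^sup>2 \<le> C\<^sup>2"
    using assms(2) by eventually_elim (simp add: power_mono)
qed fact

lemma square_integrable_add:
  assumes "square_integrable f" "square_integrable g"
  shows "square_integrable (\<lambda>s. f s + g s)"
proof (rule square_integrable_dominated[where g = "\<lambda>s. 2 * (cmod (f s))\<^sup>2 + 2 * (cmod (g s))\<^sup>2"])
  show "(\<lambda>s. f s + g s) \<in> borel_measurable unit_interval"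
    using assms by measurable
  show "integrable unit_interval (\<lambda>s. 2 * (cmod (f s))\<^sup>2 + 2 * (cmod (g s))\<^sup>2)"
    by (intro Bochner_Integration.integrable_add integrable_mult_right assms[THEN square_integrableD])
  have "(cmod (f s + g s))\<^sup>2 \<le> 2 * (cmod (f s))\<^sup>2 + 2 * (cmod (g s))\<^sup>2" for s
  proof -
    have "(cmod (f s + g s))\<^sup>2 \<le> (cmod (f s) + cmod (g s))\<^sup>2"
      by (simp add: norm_triangle_ineq power_mono)
    also have "\<dots> \<le> 2 * (cmod (f s))\<^sup>2 + 2 * (cmod (g s))\<^sup>2"
      using sum_squares_bound[of "cmod (f s)" "cmod (g s)"] by (simp add: power2_sum)
    finally show ?thesis .
  qed
  then show "AE s in unit_interval. (cmod (f s + g s))\<^sup>2 \<le> 2 * (cmod (f s))\<^sup>2 + 2 * (cmod (g s))\<^sup>2"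
    by simp
qed

lemma square_integrable_mult_const:
  assumes "square_integrable f"
  shows "square_integrable (\<lambda>s. c * f s)"
  using assms unfolding square_integrable_def by (auto simp: norm_mult power_mult_distrib)

lemma square_integrable_minus: "square_integrable f \<Longrightarrow> square_integrable (\<lambda>s. - f s)"
  using square_integrable_mult_const[of f "-1"] by simp

lemma square_integrable_diff:
  "square_integrable f \<Longrightarrow> square_integrable g \<Longrightarrow> square_integrable (\<lambda>s. f s - g s)"
  using square_integrable_add[of f "\<lambda>s. - g s"] square_integrable_minus[of g] by simp

lemma square_integrable_norm: "square_integrable f \<Longrightarrow> square_integrable (\<lambda>s. of_real (cmod (f s)))"
  unfolding square_integrable_def by auto

lemma integrable_mult_square_integrable:
  assumes "square_integrable f" "square_integrable g"
  shows "integrable unit_interval (\<lambda>s. f s * g s)"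
proof (rule Bochner_Integration.integrable_bound[where f = "\<lambda>s. (cmod (f s))\<^sup>2 + (cmod (g s))\<^sup>2"])
  show "integrable unit_interval (\<lambda>s. (cmod (f s))\<^sup>2 + (cmod (g s))\<^sup>2)"
    using assms by (auto dest: square_integrableD)
  show "(\<lambda>s. f s * g s) \<in> borel_measurable unit_interval"
    using assms by measurable
  have "cmod (f s) * cmod (g s) \<le> (cmod (f s))\<^sup>2 + (cmod (g s))\<^sup>2" for s
  proof -
    have "2 * (cmod (f s) * cmod (g s)) \<le> (cmod (f s))\<^sup>2 + (cmod (g s))\<^sup>2"
      using sum_squares_bound[of "cmod (f s)" "cmod (g s)"] by simp
    moreover have "0 \<le> cmod (f s) * cmod (g s)" by simp
    ultimately show ?thesis by linarith
  qed
  then show "AE s in unit_interval. norm (f s * g s) \<le> norm ((cmod (f s))\<^sup>2 + (cmod (g s))\<^sup>2)"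
    by (simp add: norm_mult)
qed

lemma square_integrable_cnj: "square_integrable f \<Longrightarrow> square_integrable (\<lambda>s. cnj (f s))"
  unfolding square_integrable_def
  by (auto intro: borel_measurable_continuous_on[OF continuous_on_cnj[OF continuous_on_id]])

lemma integrable_cinner_square_integrable:
  assumes "square_integrable f" "square_integrable g"
  shows "integrable unit_interval (\<lambda>s. f s * cnj (g s))"
  using integrable_mult_square_integrable[OF assms(1) square_integrable_cnj[OF assms(2)]] .

quotient_type L2 = "real \<Rightarrow> complex" / partial:
  "\<lambda>f g. square_integrable f \<and> square_integrable g \<and> (AE s in unit_interval. f s = g s)"
  morphisms rep_L2 abs_L2
proof (rule part_equivpI)
  show "\<exists>f. square_integrable f \<and> square_integrable f \<and> (AE s in unit_interval. f s = f s)"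
    by (rule exI[of _ "\<lambda>_. 0"]) simp
  show "symp (\<lambda>f g. square_integrable f \<and> square_integrable g \<and> (AE s in unit_interval. f s = g s))"
    by (auto simp: symp_def eq_commute)
  show "transp (\<lambda>f g. square_integrable f \<and> square_integrable g \<and> (AE s in unit_interval. f s = g s))"
  by (rule transpI) (auto elim: eventually_elim2)
qed

instantiation L2 :: complex_inner
begin

lift_definition zero_L2 :: L2 is "\<lambda>s. 0" by simp

lift_definition plus_L2 :: "L2 \<Rightarrow> L2 \<Rightarrow> L2" is "\<lambda>f g s. f s + g s"
  by (auto intro: square_integrable_add elim: eventually_elim2)

lift_definition minus_L2 :: "L2 \<Rightarrow> L2 \<Rightarrow> L2" is "\<lambda>f g s. f s - g s"
  by (auto intro: square_integrable_diff elim: eventually_elim2)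

lift_definition uminus_L2 :: "L2 \<Rightarrow> L2" is "\<lambda>f s. - f s"
  by (auto intro: square_integrable_minus)

lift_definition scaleC_L2 :: "complex \<Rightarrow> L2 \<Rightarrow> L2" is "\<lambda>c f s. c * f s"
  by (auto intro: square_integrable_mult_const)

definition scaleR_L2 :: "real \<Rightarrow> L2 \<Rightarrow> L2" where "r *\<^sub>R f = complex_of_real r *\<^sub>C f" for f :: L2

lift_definition cinner_L2 :: "L2 \<Rightarrow> L2 \<Rightarrow> complex"
  is "\<lambda>f g. LINT s|unit_interval. f s * cnj (g s)"
proof -
  fix f g h k :: "real \<Rightarrow> complex"
  assume 1: "square_integrable f \<and> square_integrable g \<and> (AE s in unit_interval. f s = g s)"
    and 2: "square_integrable h \<and> square_integrable k \<and> (AE s in unit_interval. h s = k s)"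
  then have [measurable]: "f \<in> borel_measurable unit_interval" "g \<in> borel_measurable unit_interval"
    "h \<in> borel_measurable unit_interval" "k \<in> borel_measurable unit_interval"
    by (auto dest: square_integrable_measurable)
  show "(LINT s|unit_interval. f s * cnj (h s)) = (LINT s|unit_interval. g s * cnj (k s))"
  proof (rule integral_cong_AE)
    have "AE s in unit_interval. f s = g s" "AE s in unit_interval. h s = k s" using 1 2 by auto
    then show "AE s in unit_interval. f s * cnj (h s) = g s * cnj (k s)" by eventually_elim simp
  qed measurable
qed

definition inner_L2 :: "L2 \<Rightarrow> L2 \<Rightarrow> real" where "inner f g = Re (cinner f g)" for f g :: L2

definition norm_L2 :: "L2 \<Rightarrow> real" where "norm f = sqrt (inner f f)" for f :: L2

definition sgn_L2 :: "L2 \<Rightarrow> L2" where "sgn f = inverse (norm f) *\<^sub>R f" for f :: L2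

definition dist_L2 :: "L2 \<Rightarrow> L2 \<Rightarrow> real" where "dist f g = norm (f - g)" for f g :: L2

definition uniformity_L2 :: "(L2 \<times> L2) filter"
  where "uniformity_L2 = (INF e\<in>{0<..}. principal {(f, g). dist f g < e})"

definition open_L2 :: "L2 set \<Rightarrow> bool"
  where "open_L2 U = (\<forall>f\<in>U. eventually (\<lambda>(f', g). f' = f \<longrightarrow> g \<in> U) uniformity)"

instance
proof
  fix f g h :: L2 and a b :: complex and r q :: real and U :: "L2 set"
  show "f + g + h = f + (g + h)" by transfer (auto intro!: square_integrable_add simp: add.assoc)
  show "f + g = g + f" by transfer (auto intro!: square_integrable_add simp: add.commute)
  show "0 + f = f" by transfer simp
  show "- f + f = 0" by transfer simp
  show "f - g = f + - g" by transfer (auto intro!: square_integrable_add square_integrable_diff square_integrable_minus)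
  show C1: "a *\<^sub>C (f + g) = a *\<^sub>C f + a *\<^sub>C g" for a and f g :: L2
    by transfer (auto intro!: square_integrable_add square_integrable_mult_const simp: distrib_left)
  show C2: "(a + b) *\<^sub>C f = a *\<^sub>C f + b *\<^sub>C f" for a b and f :: L2
    by transfer (auto intro!: square_integrable_add square_integrable_mult_const simp: distrib_right)
  show C3: "a *\<^sub>C b *\<^sub>C f = (a * b) *\<^sub>C f" for a b and f :: L2
    by transfer (auto intro!: square_integrable_mult_const simp: mult.assoc)
  show C4: "1 *\<^sub>C f = f" for f :: L2 by transfer simp
  show C5: "r *\<^sub>R f = complex_of_real r *\<^sub>C f" for r and f :: L2 by (simp add: scaleR_L2_def)
  show "r *\<^sub>R (f + g) = r *\<^sub>R f + r *\<^sub>R g" by (simp add: C5 C1)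
  show "(r + q) *\<^sub>R f = r *\<^sub>R f + q *\<^sub>R f" by (simp add: C5 C2)
  show "r *\<^sub>R q *\<^sub>R f = (r * q) *\<^sub>R f" by (simp add: C5 C3)
  show "1 *\<^sub>R f = f" by (simp add: C5 C4)
  show I1: "cinner f g = cnj (cinner g f)" for f g :: L2
    by transfer (simp flip: Bochner_Integration.integral_cnj add: mult.commute)
  show I2: "cinner (f + g) h = cinner f h + cinner g h" for f g h :: L2
    by transfer (simp add: distrib_right integrable_cinner_square_integrable)
  show I3: "cinner (a *\<^sub>C f) g = a * cinner f g" for a and f g :: L2
    by transfer (simp add: mult.assoc)
  show "inner f g = Re (cinner f g)" by (simp add: inner_L2_def)
  show "inner f g = inner g f" using I1[of f g] by (simp add: inner_L2_def)
  show "inner (f + g) h = inner f h + inner g h" by (simp add: inner_L2_def I2)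
  show "inner (r *\<^sub>R f) g = r * inner f g" by (simp add: inner_L2_def C5 I3)
  show "0 \<le> inner f f"
    unfolding inner_L2_def
  proof transfer
    fix f :: "real \<Rightarrow> complex"
    have "(LINT s|unit_interval. f s * cnj (f s)) = of_real (LINT s|unit_interval. (cmod (f s))\<^sup>2)"
      by (simp add: complex_norm_square[symmetric] flip: of_real_power integral_complex_of_real)
    then show "0 \<le> Re (LINT s|unit_interval. f s * cnj (f s))" by simp
  qed
  show "inner f f = 0 \<longleftrightarrow> f = 0"
    unfolding inner_L2_def
  proof transfer
    fix f :: "real \<Rightarrow> complex"
    assume f: "square_integrable f \<and> square_integrable f \<and> (AE s in unit_interval. f s = f s)"
    have "(LINT s|unit_interval. f s * cnj (f s)) = of_real (LINT s|unit_interval. (cmod (f s))\<^sup>2)"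
      by (simp add: complex_norm_square[symmetric] flip: of_real_power integral_complex_of_real)
    moreover have "(LINT s|unit_interval. (cmod (f s))\<^sup>2) = 0 \<longleftrightarrow> (AE s in unit_interval. (cmod (f s))\<^sup>2 = 0)"
      by (rule integral_nonneg_eq_0_iff_AE) (use f in \<open>auto dest: square_integrableD\<close>)
    ultimately show "Re (LINT s|unit_interval. f s * cnj (f s)) = 0 \<longleftrightarrow>
        square_integrable f \<and> square_integrable (\<lambda>s. 0) \<and> (AE s in unit_interval. f s = 0)"
      using f by simp
  qed
  show "norm f = sqrt (inner f f)" by (simp add: norm_L2_def)
  show "dist f g = norm (f - g)" by (simp add: dist_L2_def)
  show "sgn f = inverse (norm f) *\<^sub>R f" by (simp add: sgn_L2_def)
  show "uniformity = (INF e\<in>{0<..}. principal {(f :: L2, g). dist f g < e})"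
    by (simp add: uniformity_L2_def)
  show "open U = (\<forall>f\<in>U. eventually (\<lambda>(f', g). f' = f \<longrightarrow> g \<in> U) uniformity)"
    by (simp add: open_L2_def)
qed

end

lemma cinner_scaleC_right: "cinner x (a *\<^sub>C y) = cnj a * cinner x y" for x y :: "'a::complex_inner"
  using cinner_commute[of x "a *\<^sub>C y"] cinner_commute[of x y] by (simp add: cinner_scaleC_left)

lemma norm_scaleC: "norm (a *\<^sub>C x) = cmod a * norm x" for x :: "'a::complex_inner"
proof -
  have "cinner (a *\<^sub>C x) (a *\<^sub>C x) = of_real ((cmod a)\<^sup>2) * cinner x x"
    unfolding complex_norm_square by (simp add: cinner_scaleC_left cinner_scaleC_right)
  then have "(norm (a *\<^sub>C x))\<^sup>2 = (cmod a)\<^sup>2 * (norm x)\<^sup>2"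
    by (simp add: power2_norm_eq_inner inner_eq_Re_cinner)
  then show ?thesis
    by - (rule power2_eq_imp_eq, simp_all add: power_mult_distrib)
qed

lemma scaleC_zero_left [simp]: "0 *\<^sub>C x = 0" for x :: "'a::complex_inner"
  using norm_scaleC[of 0 x] by simp

lemma scaleC_zero_right [simp]: "a *\<^sub>C (0 :: 'a :: complex_inner) = 0"
  using norm_scaleC[of a "0 :: 'a :: complex_inner"] by simp

lemma scaleC_diff_left: "(a - b) *\<^sub>C x = a *\<^sub>C x - b *\<^sub>C x" for x :: "'a::complex_inner"
  using scaleC_add_left[of "a - b" b x] by simp

lemma scaleC_diff_right: "a *\<^sub>C (x - y) = a *\<^sub>C x - a *\<^sub>C y" for x :: "'a::complex_inner"
  using scaleC_add_right[of a "x - y" y] by simp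

(* The class of f; the value 0 outside the square-integrable functions is a convention. *)
definition L2_of :: "(real \<Rightarrow> complex) \<Rightarrow> L2"
  where "L2_of f = (if square_integrable f then abs_L2 f else 0)"

lemma square_integrable_rep [simp]: "square_integrable (rep_L2 x)"
  using Quotient3_rep_reflp[OF Quotient3_L2, of x] by simp

lemma L2_of_rep [simp]: "L2_of (rep_L2 x) = x"
  by (simp add: L2_of_def Quotient3_abs_rep[OF Quotient3_L2])

lemma L2_of_eq_iff:
  "square_integrable f \<Longrightarrow> square_integrable g \<Longrightarrow>
    L2_of f = L2_of g \<longleftrightarrow> (AE s in unit_interval. f s = g s)"
  using Quotient3_rel[OF Quotient3_L2, of f g] by (simp add: L2_of_def)

lemma rep_L2_of: "square_integrable f \<Longrightarrow> AE s in unit_interval. rep_L2 (L2_of f) s = f s"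
  using L2_of_eq_iff[of "rep_L2 (L2_of f)" f] by simp

lemma L2_of_cong_AE:
  assumes "AE s in unit_interval. f s = g s"
    and [measurable]: "f \<in> borel_measurable unit_interval" "g \<in> borel_measurable unit_interval"
  shows "L2_of f = L2_of g"
proof -
  have "integrable unit_interval (\<lambda>s. (cmod (f s))\<^sup>2) \<longleftrightarrow> integrable unit_interval (\<lambda>s. (cmod (g s))\<^sup>2)"
  proof (rule integrable_cong_AE)
    show "AE s in unit_interval. (cmod (f s))\<^sup>2 = (cmod (g s))\<^sup>2"
      using assms(1) by eventually_elim simp
  qed measurable
  then have "square_integrable f \<longleftrightarrow> square_integrable g"
    by (simp add: square_integrable_def)
  then show ?thesis
    using L2_of_eq_iff[of f g] assms(1) by (auto simp: L2_of_def)
qed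

lemma L2_of_add: "square_integrable f \<Longrightarrow> square_integrable g \<Longrightarrow> L2_of (\<lambda>s. f s + g s) = L2_of f + L2_of g"
  by (simp add: L2_of_def plus_L2.abs_eq square_integrable_add)

lemma L2_of_diff: "square_integrable f \<Longrightarrow> square_integrable g \<Longrightarrow> L2_of (\<lambda>s. f s - g s) = L2_of f - L2_of g"
  by (simp add: L2_of_def minus_L2.abs_eq square_integrable_diff)

lemma L2_of_scaleC: "square_integrable f \<Longrightarrow> L2_of (\<lambda>s. c * f s) = c *\<^sub>C L2_of f"
  by (simp add: L2_of_def scaleC_L2.abs_eq square_integrable_mult_const)

lemma L2_of_zero [simp]: "L2_of (\<lambda>s. 0) = 0"
  by (simp add: L2_of_def zero_L2_def)

lemma cinner_L2_of:
  "square_integrable f \<Longrightarrow> square_integrable g \<Longrightarrow>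
    cinner (L2_of f) (L2_of g) = (LINT s|unit_interval. f s * cnj (g s))"
  by (simp add: L2_of_def cinner_L2.abs_eq)

lemma norm_L2_of:
  assumes "square_integrable f"
  shows "(norm (L2_of f))\<^sup>2 = (LINT s|unit_interval. (cmod (f s))\<^sup>2)"
proof -
  have "(LINT s|unit_interval. f s * cnj (f s)) = of_real (LINT s|unit_interval. (cmod (f s))\<^sup>2)"
    by (simp add: complex_norm_square[symmetric] flip: of_real_power integral_complex_of_real)
  then show ?thesis
    by (simp add: power2_norm_eq_inner inner_eq_Re_cinner cinner_L2_of assms)
qed

lemma prob_unit_interval: "measure unit_interval (space unit_interval) = 1"
  by (simp add: measure_restrict_space)

lemma square_integrable_const [simp]: "square_integrable (\<lambda>s. c)"
  by (rule square_integrable_bounded[where C = "cmod c"]) auto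

lemma L1_le_norm_L2_of:
  assumes "square_integrable f"
  shows "(LINT s|unit_interval. cmod (f s)) \<le> norm (L2_of f)"
proof -
  let ?h = "\<lambda>s. complex_of_real (cmod (f s))"
  have h: "square_integrable ?h" by (rule square_integrable_norm[OF assms])
  have "(LINT s|unit_interval. cmod (f s)) = Re (cinner (L2_of ?h) (L2_of (\<lambda>s. 1)))"
    by (simp add: cinner_L2_of h integral_complex_of_real)
  also have "\<dots> = inner (L2_of ?h) (L2_of (\<lambda>s. 1))" by (simp add: inner_eq_Re_cinner)
  also have "\<dots> \<le> norm (L2_of ?h) * norm (L2_of (\<lambda>s. 1))" by (rule norm_cauchy_schwarz)
  also have "norm (L2_of (\<lambda>s. 1)) = 1"
  proof -
    have "(norm (L2_of (\<lambda>s. 1)))\<^sup>2 = 1\<^sup>2"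
      by (simp add: norm_L2_of prob_unit_interval[simplified])
    then show ?thesis by (rule power2_eq_imp_eq) auto
  qed
  also have "norm (L2_of ?h) = norm (L2_of f)"
  proof -
    have "(norm (L2_of ?h))\<^sup>2 = (norm (L2_of f))\<^sup>2"
      by (simp add: norm_L2_of h assms)
    then show ?thesis by (rule power2_eq_imp_eq) auto
  qed
  finally show ?thesis by simp
qed

lemma tendsto_L2_of_dominated:
  assumes f[measurable]: "\<And>n. f n \<in> borel_measurable unit_interval"
    and g[measurable]: "g \<in> borel_measurable unit_interval"
    and h: "integrable unit_interval (\<lambda>s. (h s)\<^sup>2)"
    and bound: "\<And>n. AE s in unit_interval. cmod (f n s) \<le> h s"
    and lim: "AE s in unit_interval. (\<lambda>n. f n s) \<longlonglongrightarrow> g s"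
  shows "(\<lambda>n. L2_of (f n)) \<longlonglongrightarrow> L2_of g"
proof -
  have bound_all: "AE s in unit_interval. \<forall>n. cmod (f n s) \<le> h s"
    using bound by (simp add: AE_all_countable)
  have bound_g: "AE s in unit_interval. cmod (g s) \<le> h s"
    using bound_all lim
  proof eventually_elim
    case (elim s)
    show ?case
      by (rule LIMSEQ_le_const2[OF tendsto_norm[OF elim(2)]]) (use elim(1) in auto)
  qed
  have sq: "cmod z \<le> r \<Longrightarrow> (cmod z)\<^sup>2 \<le> r\<^sup>2" for z r by (simp add: power_mono)
  have fs: "square_integrable (f n)" for n
    by (rule square_integrable_dominated[OF f h]) (use bound[of n] in \<open>eventually_elim, simp add: sq\<close>)
  have gs: "square_integrable g"
    by (rule square_integrable_dominated[OF g h]) (use bound_g in \<open>eventually_elim, simp add: sq\<close>)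
  have "(\<lambda>n. LINT s|unit_interval. (cmod (f n s - g s))\<^sup>2) \<longlonglongrightarrow> (LINT s|unit_interval. 0)"
  proof (rule integral_dominated_convergence)
    show "integrable unit_interval (\<lambda>s. 4 * (h s)\<^sup>2)" using h by simp
    show "AE s in unit_interval. (\<lambda>n. (cmod (f n s - g s))\<^sup>2) \<longlonglongrightarrow> 0"
      using lim
    proof eventually_elim
      case (elim s)
      then have "(\<lambda>n. (cmod (f n s - g s))\<^sup>2) \<longlonglongrightarrow> (cmod (g s - g s))\<^sup>2"
        by (intro tendsto_intros)
      then show ?case by simp
    qed
    show "AE s in unit_interval. norm ((cmod (f n s - g s))\<^sup>2) \<le> 4 * (h s)\<^sup>2" for n
      using bound[of n] bound_g
    proof eventually_elim
      case (elim s)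
      have "cmod (f n s - g s) \<le> 2 * h s" using norm_triangle_ineq4[of "f n s" "g s"] elim by linarith
      then show ?case using sq[of "f n s - g s" "2 * h s"] by (simp add: power_mult_distrib)
    qed
  qed measurable
  then have "(\<lambda>n. (norm (L2_of (f n) - L2_of g))\<^sup>2) \<longlonglongrightarrow> 0"
    by (simp add: L2_of_diff[OF fs gs, symmetric] norm_L2_of square_integrable_diff fs gs)
  then have "(\<lambda>n. sqrt ((norm (L2_of (f n) - L2_of g))\<^sup>2)) \<longlonglongrightarrow> sqrt 0"
    by (rule tendsto_real_sqrt)
  then show ?thesis
    by - (rule LIM_zero_cancel, rule tendsto_norm_zero_cancel, simp)
qed

instance L2 :: banach
proof
  fix X :: "nat \<Rightarrow> L2"
  assume X: "Cauchy X"
  define f where "f n = rep_L2 (X n)" for n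
  have fs[simp]: "square_integrable (f n)" for n by (simp add: f_def)
  have fm[measurable]: "f n \<in> borel_measurable unit_interval" for n
    using fs by (rule square_integrable_measurable)
  have Xf: "X n = L2_of (f n)" for n by (simp add: f_def)
  interpret finite_measure unit_interval by (rule finite_measure_unit_interval)
  have int1: "integrable unit_interval (f n)" for n
    using integrable_mult_square_integrable[OF fs square_integrable_const[of 1], of n] by simp
  have diff: "square_integrable (\<lambda>s. f i s - f j s)" for i j by (rule square_integrable_diff) auto
  have CX: "\<exists>N. \<forall>i\<ge>N. \<forall>j\<ge>N. norm (X i - X j) < e" if "e > 0" for e
    using X that unfolding Cauchy_iff by blast
  have "\<exists>N. \<forall>i\<ge>N. \<forall>j\<ge>N. (LINT s|unit_interval. norm (f i s - f j s)) < e" if pos: "e > 0" for e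
  proof -
    obtain N where N: "\<And>i j. i \<ge> N \<Longrightarrow> j \<ge> N \<Longrightarrow> norm (X i - X j) < e"
      using CX[OF pos] by blast
    have "(LINT s|unit_interval. norm (f i s - f j s)) < e" if "i \<ge> N" "j \<ge> N" for i j
      using L1_le_norm_L2_of[OF diff, of i j] N[OF that] by (simp add: Xf L2_of_diff)
    then show ?thesis by blast
  qed
  from cauchy_L1_AE_cauchy_subseq[OF int1 this]
  obtain r where r: "strict_mono r" and Cau: "AE s in unit_interval. Cauchy (\<lambda>i. f (r i) s)"
    by blast
  define g where "g s = lim (\<lambda>i. f (r i) s)" for s
  have g[measurable]: "g \<in> borel_measurable unit_interval"
    unfolding g_def by (rule borel_measurable_lim_metric) simp
  have lim: "AE s in unit_interval. (\<lambda>i. f (r i) s) \<longlonglongrightarrow> g s"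
    using Cau
  proof eventually_elim
    case (elim s)
    then show ?case unfolding g_def using Cauchy_convergent convergent_LIMSEQ_iff by blast
  qed
  have key: "square_integrable (\<lambda>s. f n s - g s) \<and> norm (L2_of (\<lambda>s. f n s - g s)) \<le> e"
    if N: "\<And>j. j \<ge> N \<Longrightarrow> norm (X n - X j) < e" and "e > 0" for e n N
  proof -
    have "(\<integral>\<^sup>+s. ennreal ((cmod (f n s - g s))\<^sup>2) \<partial>unit_interval)
        = (\<integral>\<^sup>+s. liminf (\<lambda>i. ennreal ((cmod (f n s - f (r i) s))\<^sup>2)) \<partial>unit_interval)"
    proof (rule nn_integral_cong_AE)
      show "AE s in unit_interval. ennreal ((cmod (f n s - g s))\<^sup>2)
          = liminf (\<lambda>i. ennreal ((cmod (f n s - f (r i) s))\<^sup>2))"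
        using lim
      proof eventually_elim
        case (elim s)
        then have "(\<lambda>i. ennreal ((cmod (f n s - f (r i) s))\<^sup>2)) \<longlonglongrightarrow> ennreal ((cmod (f n s - g s))\<^sup>2)"
          by (intro tendsto_intros)
        then show ?case by (intro lim_imp_Liminf[symmetric]) simp
      qed
    qed
    also have "\<dots> \<le> liminf (\<lambda>i. \<integral>\<^sup>+s. ennreal ((cmod (f n s - f (r i) s))\<^sup>2) \<partial>unit_interval)"
      by (rule nn_integral_liminf) measurable
    also have "\<dots> \<le> liminf (\<lambda>i. ennreal (e\<^sup>2))"
    proof (rule Liminf_mono)
      have "(\<integral>\<^sup>+s. ennreal ((cmod (f n s - f (r i) s))\<^sup>2) \<partial>unit_interval) \<le> ennreal (e\<^sup>2)"
        if "i \<ge> N" for i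
      proof -
        have "(\<integral>\<^sup>+s. ennreal ((cmod (f n s - f (r i) s))\<^sup>2) \<partial>unit_interval)
            = ennreal ((norm (X n - X (r i)))\<^sup>2)"
          using nn_integral_eq_integral[OF square_integrableD[OF diff[of n "r i"]]]
          by (simp add: norm_L2_of[OF diff, symmetric] Xf L2_of_diff)
        also have "\<dots> \<le> ennreal (e\<^sup>2)"
        proof (rule ennreal_leI, rule power_mono)
          have "r i \<ge> N" using seq_suble[OF r, of i] that by linarith
          then show "norm (X n - X (r i)) \<le> e" using N[of "r i"] by linarith
        qed simp
        finally show ?thesis .
      qed
      then show "\<forall>\<^sub>F i in sequentially. (\<integral>\<^sup>+s. ennreal ((cmod (f n s - f (r i) s))\<^sup>2) \<partial>unit_interval)
          \<le> ennreal (e\<^sup>2)"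
        by (auto simp: eventually_sequentially)
    qed
    also have "\<dots> = ennreal (e\<^sup>2)" by (simp add: Liminf_const)
    finally have le: "(\<integral>\<^sup>+s. ennreal ((cmod (f n s - g s))\<^sup>2) \<partial>unit_interval) \<le> ennreal (e\<^sup>2)" .
    have "integrable unit_interval (\<lambda>s. (cmod (f n s - g s))\<^sup>2)"
    proof (rule integrableI_bounded)
      show "(\<integral>\<^sup>+s. ennreal (norm ((cmod (f n s - g s))\<^sup>2)) \<partial>unit_interval) < \<infinity>"
        using le_less_trans[OF le ennreal_less_top] by simp
    qed measurable
    then have sqi: "square_integrable (\<lambda>s. f n s - g s)" by (simp add: square_integrable_def)
    moreover have "(norm (L2_of (\<lambda>s. f n s - g s)))\<^sup>2 \<le> e\<^sup>2"
      using le nn_integral_eq_integral[OF square_integrableD[OF sqi]]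
      by (simp add: norm_L2_of[OF sqi])
    then have "norm (L2_of (\<lambda>s. f n s - g s)) \<le> e"
      using \<open>e > 0\<close> by - (rule power2_le_imp_le, auto)
    ultimately show ?thesis by blast
  qed
  have gs: "square_integrable g"
  proof -
    obtain N where N: "\<And>i j. i \<ge> N \<Longrightarrow> j \<ge> N \<Longrightarrow> norm (X i - X j) < 1"
      using CX[OF zero_less_one] by blast
    then have "square_integrable (\<lambda>s. f N s - g s)" using key[of N N 1] by simp
    from square_integrable_diff[OF fs this, of N] show ?thesis by simp
  qed
  have "X \<longlonglongrightarrow> L2_of g"
  proof (rule LIMSEQ_I)
    fix e :: real assume "e > 0"
    then obtain N where N: "\<And>i j. i \<ge> N \<Longrightarrow> j \<ge> N \<Longrightarrow> norm (X i - X j) < e / 2"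
      using CX[OF half_gt_zero] by blast
    have "norm (X n - L2_of g) < e" if "n \<ge> N" for n
    proof -
      have "norm (L2_of (\<lambda>s. f n s - g s)) \<le> e / 2"
        using key[of N n "e / 2"] N[OF that] \<open>e > 0\<close> by simp
      then show ?thesis using \<open>e > 0\<close> unfolding Xf L2_of_diff[OF fs gs] by linarith
    qed
    then show "\<exists>N. \<forall>n\<ge>N. norm (X n - L2_of g) < e" by blast
  qed
  then show "convergent X" by (auto simp: convergent_def)
qed

lemma borel_measurable_unit_interval:
  assumes [measurable]: "f \<in> borel_measurable borel"
  shows "f \<in> borel_measurable unit_interval"
proof (rule measurable_restrict_space1)
  have "f \<in> borel_measurable lborel" by simp
  then show "f \<in> borel_measurable lebesgue" by (rule measurable_completion)
qed

lemma AE_unit_intervalI: "AE s in lebesgue. P s \<Longrightarrow> AE s in unit_interval. P s"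
  by (auto simp: AE_restrict_space_iff elim: eventually_mono)

lemma square_integrable_indicator:
  "A \<in> sets lebesgue \<Longrightarrow> square_integrable (indicator A)"
  by (rule square_integrable_bounded[where C = 1])
    (auto intro!: measurable_restrict_space1 simp: indicator_def)

lemma L2_dense_aux:
  fixes V :: "L2 set"
  assumes closed: "closed V"
    and add: "\<And>x y. x \<in> V \<Longrightarrow> y \<in> V \<Longrightarrow> x + y \<in> V"
    and scale: "\<And>c x. x \<in> V \<Longrightarrow> c *\<^sub>C x \<in> V"
    and ind: "\<And>a. L2_of (indicator {..a}) \<in> V"
  shows "x \<in> V"
proof -
  have lim: "L2_of g \<in> V"
    if f: "\<And>n. f n \<in> borel_measurable unit_interval" "\<And>n. L2_of (f n) \<in> V"
      and g: "g \<in> borel_measurable unit_interval" and h: "integrable unit_interval (\<lambda>s. (h s)\<^sup>2)"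
      and b: "\<And>n s. s \<in> {0<..<1} \<Longrightarrow> cmod (f n s) \<le> h s"
      and l: "\<And>s. s \<in> {0<..<1} \<Longrightarrow> (\<lambda>n. f n s) \<longlonglongrightarrow> g s" for f :: "nat \<Rightarrow> real \<Rightarrow> complex" and g h
  proof (rule closed_sequentially[OF closed])
    show "(\<lambda>n. L2_of (f n)) \<longlonglongrightarrow> L2_of g"
      by (rule tendsto_L2_of_dominated[OF f(1) g h]) (use b l in auto)
  qed (use f in simp)
  have one: "integrable unit_interval (\<lambda>s. (1 :: real)\<^sup>2)"
    using square_integrableD[OF square_integrable_const[of 1]] by simp
  have zero: "0 \<in> V" using scale[OF ind[of 0], of 0] by simp
  have univ: "L2_of (\<lambda>s. 1) \<in> V"
  proof -
    have "L2_of (\<lambda>s. 1) = L2_of (indicator {..1})"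
      by (rule L2_of_cong_AE) (auto simp: indicator_def intro!: AE_I2 borel_measurable_unit_interval)
    then show ?thesis using ind by simp
  qed
  have borel: "L2_of (indicator A) \<in> V" if "A \<in> sets borel" for A
  proof -
    have G: "Int_stable (range (\<lambda>a::real. {..a}))" by (auto simp: Int_stable_def)
    have "A \<in> sigma_sets UNIV (range (\<lambda>a::real. {..a}))"
      using that by (simp add: borel_eq_atMost)
    have P: "range (\<lambda>a::real. {..a}) \<subseteq> Pow UNIV" by simp
    from G P \<open>A \<in> sigma_sets UNIV (range (\<lambda>a::real. {..a}))\<close> show ?thesis
    proof (induction rule: sigma_sets_induct_disjoint)
      case (compl A)
      then have A: "A \<in> sets borel" by (simp add: borel_eq_atMost)
      then have sA: "square_integrable (indicator A)" by (intro square_integrable_indicator) auto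
      have "indicator (UNIV - A) = (\<lambda>s. 1 - indicator A s :: complex)" by (auto simp: indicator_def)
      then have "L2_of (indicator (UNIV - A)) = L2_of (\<lambda>s. 1) + (-1) *\<^sub>C L2_of (indicator A)"
        using L2_of_diff[OF square_integrable_const[of 1] sA] scaleR_scaleC[of "-1" "L2_of (indicator A)"]
        by simp
      then show ?case using add[OF univ scale[OF compl(2), of "-1"]] by simp
    next
      case (union A)
      have A: "A i \<in> sets borel" for i using union(2) by (auto simp: borel_eq_atMost)
      have UA: "(\<Union>i. A i) \<in> sets borel" using A by auto
      define B where "B n = (\<Union>i<n. A i)" for n
      have B: "B n \<in> sets borel" for n unfolding B_def using A by auto
      have BV: "L2_of (indicator (B n)) \<in> V" for n
      proof (induction n)
        case 0
        have "indicator (B 0) = (\<lambda>s. 0 :: complex)" by (simp add: B_def fun_eq_iff)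
        then show ?case using zero by simp
      next
        case (Suc n)
        have "B n \<inter> A n = {}"
          using union(1) unfolding B_def disjoint_family_on_def by (auto simp: set_eq_iff) (metis less_irrefl)
        then have "indicator (B (Suc n)) = (\<lambda>s. indicator (B n) s + indicator (A n) s :: complex)"
          by (auto simp: B_def lessThan_Suc indicator_def fun_eq_iff)
        then have "L2_of (indicator (B (Suc n))) = L2_of (indicator (B n)) + L2_of (indicator (A n))"
          using L2_of_add[of "indicator (B n)" "indicator (A n)"] A B
          by (simp add: square_integrable_indicator)
        then show ?case using add[OF Suc union(3)[of n]] by simp
      qed
      show ?case
      proof (rule lim[OF _ BV])
        show "indicator (B n) \<in> borel_measurable unit_interval" for n
          using B by (intro borel_measurable_unit_interval) auto
        show "indicator (\<Union>i. A i) \<in> borel_measurable unit_interval"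
          using UA by (intro borel_measurable_unit_interval) auto
        show "integrable unit_interval (\<lambda>s. (1 :: real)\<^sup>2)" by (rule one)
        show "(\<lambda>n. indicator (B n) s :: complex) \<longlonglongrightarrow> indicator (\<Union>i. A i) s" for s
          using LIMSEQ_indicator_UN[of A s] by (simp add: B_def)
      qed (auto simp: indicator_def)
    qed (auto simp: zero ind)
  qed
  have leb: "L2_of (indicator A) \<in> V" if A: "A \<in> sets lebesgue" for A
  proof -
    obtain S N N' where *: "A = S \<union> N" "N \<subseteq> N'" "N' \<in> null_sets lborel" "S \<in> sets lborel"
      using A by (rule sets_completionE)
    have "AE s in lborel. s \<notin> N'" using *(3) by (rule AE_not_in)
    then have "AE s in lebesgue. s \<notin> N'" by (rule AE_completion)
    then have "AE s in unit_interval. s \<notin> N'" by (rule AE_unit_intervalI)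
    then have "AE s in unit_interval. indicator A s = (indicator S s :: complex)"
      by eventually_elim (use * in \<open>auto simp: indicator_def\<close>)
    then have "L2_of (indicator A) = L2_of (indicator S)"
      by (rule L2_of_cong_AE)
        (use A *(4) in \<open>simp_all add: borel_measurable_unit_interval measurable_restrict_space1\<close>)
    then show ?thesis using borel * by simp
  qed
  have sum: "square_integrable (\<lambda>s. \<Sum>y\<in>Y. y * indicator (A y) s) \<and>
      L2_of (\<lambda>s. \<Sum>y\<in>Y. y * indicator (A y) s) \<in> V"
    if "finite Y" "\<And>y. y \<in> Y \<Longrightarrow> A y \<in> sets lebesgue" for Y :: "complex set" and A
    using that
  proof (induction Y rule: finite_induct)
    case empty
    then show ?case using zero by simp
  next
    case (insert y Y)
    have 1: "square_integrable (\<lambda>s. y * indicator (A y) s)"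
      by (intro square_integrable_mult_const square_integrable_indicator insert)
         simp
    have 2: "L2_of (\<lambda>s. y * indicator (A y) s) \<in> V"
      using insert by (simp add: L2_of_scaleC square_integrable_indicator scale leb)
    have IH: "square_integrable (\<lambda>s. \<Sum>y\<in>Y. y * indicator (A y) s)"
      "L2_of (\<lambda>s. \<Sum>y\<in>Y. y * indicator (A y) s) \<in> V"
      using insert.IH insert.prems by blast+
    show ?case
      unfolding sum.insert[OF insert(1,2)] L2_of_add[OF 1 IH(1)]
      by (intro conjI square_integrable_add 1 IH(1) add 2 IH(2))
  qed
  define f where "f = rep_L2 x"
  have fs: "square_integrable f" and xf: "x = L2_of f" by (simp_all add: f_def)
  have f[measurable]: "f \<in> borel_measurable unit_interval" using fs by (rule square_integrable_measurable)
  from borel_measurable_implies_sequence_metric[OF f, of 0] obtain F where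
    F: "\<And>i. simple_function unit_interval (F i)"
    and lF: "\<And>s. s \<in> {0<..<1} \<Longrightarrow> (\<lambda>i. F i s) \<longlonglongrightarrow> f s"
    and bF: "\<And>i s. s \<in> {0<..<1} \<Longrightarrow> cmod (F i s) \<le> 2 * cmod (f s)"
    by (simp del: greaterThanLessThan_iff) blast
  have FV: "L2_of (F i) \<in> V" for i
  proof -
    let ?Y = "F i ` {0<..<1}" and ?A = "\<lambda>y. F i -` {y} \<inter> {0<..<1}"
    have fin: "finite ?Y" using F[of i] by (simp add: simple_function_def)
    have A: "?A y \<in> sets lebesgue" if "y \<in> ?Y" for y
    proof -
      have "?A y \<in> sets unit_interval" using F[of i] that by (auto simp: simple_function_def)
      then show ?thesis by (subst (asm) sets_restrict_space_iff) auto
    qed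
    have S: "square_integrable (\<lambda>s. \<Sum>y\<in>?Y. y * indicator (?A y) s)"
      and V: "L2_of (\<lambda>s. \<Sum>y\<in>?Y. y * indicator (?A y) s) \<in> V"
      using sum[where Y = ?Y and A = ?A, OF fin A] by blast+
    have eq: "F i s = (\<Sum>y\<in>?Y. y * indicator (?A y) s)" if s: "s \<in> {0<..<1}" for s
    proof -
      have "(\<Sum>y\<in>?Y. y * indicator (?A y) s) = (\<Sum>y\<in>?Y. if y = F i s then y else 0)"
        by (rule sum.cong) (use s in \<open>auto simp: indicator_def\<close>)
      also have "\<dots> = F i s" using fin s by (simp add: sum.delta)
      finally show ?thesis by simp
    qed
    have "L2_of (F i) = L2_of (\<lambda>s. \<Sum>y\<in>?Y. y * indicator (?A y) s)"
    proof (rule L2_of_cong_AE)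
      show "AE s in unit_interval. F i s = (\<Sum>y\<in>?Y. y * indicator (?A y) s)"
        by (rule AE_I2, rule eq) simp
    qed (rule borel_measurable_simple_function[OF F], rule square_integrable_measurable[OF S])
    then show ?thesis using V by simp
  qed
  show ?thesis
    unfolding xf
  proof (rule lim[where f = F, OF _ FV f])
    show "F n \<in> borel_measurable unit_interval" for n by (rule borel_measurable_simple_function[OF F])
    show "integrable unit_interval (\<lambda>s. (2 * cmod (f s))\<^sup>2)"
      using square_integrableD[OF fs] by (simp add: power_mult_distrib)
  qed (use lF bF in auto)
qed

lemma second_countable_metricI:
  fixes D :: "'a::metric_space set"
  assumes "countable D" and dense: "closure D = UNIV"
  shows "\<exists>B::'a set set. countable B \<and> open = generate_topology B"
proof -
  define B where "B = (\<lambda>(d, q). ball d (real_of_rat q)) ` (D \<times> UNIV)"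
  have "countable B" unfolding B_def using assms(1) by auto
  moreover have "topological_basis B"
  proof (rule topological_basisI)
    fix b assume "b \<in> B" then show "open b" by (auto simp: B_def)
  next
    fix U and x :: 'a assume "open U" "x \<in> U"
    then obtain e where e: "e > 0" "ball x e \<subseteq> U" by (meson openE)
    obtain q where q: "0 < real_of_rat q" "real_of_rat q < e / 2" using of_rat_dense[of 0 "e / 2"] e by auto
    have "x \<in> closure D" using dense by simp
    then obtain d where d: "d \<in> D" "dist d x < real_of_rat q" using q by (meson closure_approachable)
    have "x \<in> ball d (real_of_rat q)" using d by simp
    moreover have "ball d (real_of_rat q) \<subseteq> U"
    proof
      fix y assume "y \<in> ball d (real_of_rat q)"
      then have "dist x y < e" using d q dist_triangle[of x y d] by (simp add: dist_commute)
      then show "y \<in> U" using e by auto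
    qed
    ultimately show "\<exists>b\<in>B. x \<in> b \<and> b \<subseteq> U" using d by (auto simp: B_def)
  qed
  ultimately show ?thesis by (auto dest: topological_basis_imp_subbasis)
qed

instance L2 :: second_countable_topology
proof
  define comb where "comb xs = (\<Sum>(p, q, a)\<leftarrow>xs. Complex (real_of_rat p) (real_of_rat q) *\<^sub>C
      L2_of (indicator {..real_of_rat a}))" for xs
  define D where "D = range comb"
  define V where "V = closure D"
  have "countable D" unfolding D_def by simp
  have DD: "x + y \<in> D" if xy: "x \<in> D" "y \<in> D" for x y
  proof -
    obtain xs ys where "x = comb xs" "y = comb ys" using xy unfolding D_def by blast
    then have "x + y = comb (xs @ ys)" by (simp add: comb_def)
    then show ?thesis by (auto simp: D_def)
  qed
  have DV: "x \<in> V" if "x \<in> D" for x using that closure_subset V_def by blast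
  have cV: "closed V" by (simp add: V_def)
  have add: "x + y \<in> V" if xy: "x \<in> V" "y \<in> V" for x y
  proof -
    from xy obtain f g where "\<And>n. f n \<in> D" "f \<longlonglongrightarrow> x" "\<And>n. g n \<in> D" "g \<longlonglongrightarrow> y"
      unfolding V_def closure_sequential by blast
    then have "\<And>n. f n + g n \<in> D" "(\<lambda>n. f n + g n) \<longlonglongrightarrow> x + y" using DD by (auto intro: tendsto_add)
    then show ?thesis unfolding V_def closure_sequential
      by (intro exI[of _ "\<lambda>n. f n + g n"]) simp
  qed
  have lim_scale: "(\<lambda>n. c *\<^sub>C f n) \<longlonglongrightarrow> c *\<^sub>C x" if "f \<longlonglongrightarrow> x" for c and f :: "nat \<Rightarrow> L2" and x
  proof (rule Lim_null_comparison[THEN LIM_zero_cancel])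
    have "(\<lambda>n. cmod c * norm (f n - x)) \<longlonglongrightarrow> cmod c * norm (x - x)" using that by (intro tendsto_intros)
    then show "(\<lambda>n. cmod c * norm (f n - x)) \<longlonglongrightarrow> 0" by simp
  qed (simp add: scaleC_diff_right[symmetric] norm_scaleC)
  have Dscale: "Complex (real_of_rat p) (real_of_rat q) *\<^sub>C x \<in> D" if x: "x \<in> D" for p q x
  proof -
    obtain xs where xs: "x = comb xs" using x unfolding D_def by auto
    have "Complex (real_of_rat p) (real_of_rat q) *\<^sub>C comb xs =
      comb (map (\<lambda>(p', q', a). (p * p' - q * q', p * q' + q * p', a)) xs)"
    proof (induction xs)
      case (Cons z xs)
      obtain p' q' a where z: "z = (p', q', a)" by (cases z)
      have "Complex (real_of_rat p) (real_of_rat q) * Complex (real_of_rat p') (real_of_rat q')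
          = Complex (real_of_rat (p * p' - q * q')) (real_of_rat (p * q' + q * p'))"
        by (simp add: complex_eq_iff of_rat_diff of_rat_mult of_rat_add)
      with Cons show ?case
        by (simp add: comb_def z scaleC_add_right scaleC_scaleC)
    qed (simp add: comb_def)
    then show ?thesis unfolding D_def xs by (rule range_eqI)
  qed
  have rat_seq: "\<exists>q. (\<lambda>n. real_of_rat (q n)) \<longlonglongrightarrow> r \<and> (\<forall>n. r < real_of_rat (q n))" for r :: real
  proof -
    have "\<exists>q. r < real_of_rat q \<and> real_of_rat q < r + 1 / real (Suc n)" for n
      by (rule of_rat_dense) simp
    then have "\<exists>q. \<forall>n. r < real_of_rat (q n) \<and> real_of_rat (q n) < r + 1 / real (Suc n)"
      by (rule choice[OF allI])
    then obtain q where q: "\<And>n. r < real_of_rat (q n)" "\<And>n. real_of_rat (q n) < r + 1 / real (Suc n)"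
      by blast
    have "(\<lambda>n. r + 1 / real (Suc n)) \<longlonglongrightarrow> r"
      using tendsto_add[OF tendsto_const[of r] LIMSEQ_inverse_real_of_nat]
      by (simp add: inverse_eq_divide)
    then have "(\<lambda>n. real_of_rat (q n)) \<longlonglongrightarrow> r"
      by - (rule tendsto_sandwich[where f = "\<lambda>_. r" and h = "\<lambda>n. r + 1 / real (Suc n)"],
          simp_all add: less_imp_le[OF q(1)] less_imp_le[OF q(2)] del: of_nat_Suc)
    then show ?thesis using q(1) by (intro exI[of _ q] conjI allI)
  qed
  have scale: "c *\<^sub>C x \<in> V" if x: "x \<in> V" for c x
  proof -
    have rat: "Complex (real_of_rat p) (real_of_rat q) *\<^sub>C x \<in> V" for p q
    proof -
      from x obtain f where f: "\<And>n. f n \<in> D" "f \<longlonglongrightarrow> x"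
        unfolding V_def closure_sequential by blast
      show ?thesis unfolding V_def closure_sequential
        by (intro exI[of _ "\<lambda>n. Complex (real_of_rat p) (real_of_rat q) *\<^sub>C f n"] conjI allI
            Dscale[OF f(1)] lim_scale[OF f(2)])
    qed
    obtain p where p: "(\<lambda>n. real_of_rat (p n)) \<longlonglongrightarrow> Re c" using rat_seq by blast
    obtain q where q: "(\<lambda>n. real_of_rat (q n)) \<longlonglongrightarrow> Im c" using rat_seq by blast
    have "(\<lambda>n. Complex (real_of_rat (p n)) (real_of_rat (q n))) \<longlonglongrightarrow> Complex (Re c) (Im c)"
      using p q by (rule tendsto_Complex)
    then have l: "(\<lambda>n. Complex (real_of_rat (p n)) (real_of_rat (q n))) \<longlonglongrightarrow> c" by simp
    have "(\<lambda>n. Complex (real_of_rat (p n)) (real_of_rat (q n)) *\<^sub>C x) \<longlonglongrightarrow> c *\<^sub>C x"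
    proof (rule Lim_null_comparison[THEN LIM_zero_cancel])
      have "(\<lambda>n. cmod (Complex (real_of_rat (p n)) (real_of_rat (q n)) - c) * norm x) \<longlonglongrightarrow> cmod (c - c) * norm x"
        using l by (intro tendsto_intros)
      then show "(\<lambda>n. cmod (Complex (real_of_rat (p n)) (real_of_rat (q n)) - c) * norm x) \<longlonglongrightarrow> 0" by simp
    qed (simp add: scaleC_diff_left[symmetric] norm_scaleC)
    then show ?thesis by (rule closed_sequentially[OF cV, rotated]) (rule rat)
  qed
  have ind: "L2_of (indicator {..a}) \<in> V" for a :: real
  proof -
    obtain q where q: "(\<lambda>n. real_of_rat (q n)) \<longlonglongrightarrow> a" "\<And>n. a < real_of_rat (q n)" using rat_seq[of a] by blast
    have "comb [(1, 0, q n)] = L2_of (indicator {..real_of_rat (q n)})" for n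
      unfolding comb_def using one_complex.code by (simp add: scaleC_one)
    then have "L2_of (indicator {..real_of_rat (q n)}) \<in> D" for n
      unfolding D_def by (intro range_eqI[where x = "[(1, 0, q n)]"]) simp
    then have "L2_of (indicator {..real_of_rat (q n)}) \<in> V" for n
      by (rule DV)
    moreover have "(\<lambda>n. L2_of (indicator {..real_of_rat (q n)})) \<longlonglongrightarrow> L2_of (indicator {..a})"
    proof (rule tendsto_L2_of_dominated)
      show "integrable unit_interval (\<lambda>s. (1 :: real)\<^sup>2)"
        using square_integrableD[OF square_integrable_const[of 1]] by simp
      have "(\<lambda>n. indicator {..real_of_rat (q n)} s :: complex) \<longlonglongrightarrow> indicator {..a} s" for s
      proof (cases "s \<le> a")
        case True
        then have "s \<le> real_of_rat (q n)" for n using q(2)[of n] by simp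
        then show ?thesis using True by simp
      next
        case False
        then have "\<forall>\<^sub>F n in sequentially. real_of_rat (q n) < s" using q(1) by (intro order_tendstoD) auto
        then have "\<forall>\<^sub>F n in sequentially. indicator {..real_of_rat (q n)} s = (0 :: complex)"
          by eventually_elim simp
        then show ?thesis using False by (simp add: tendsto_eventually)
      qed
      then show "AE s in unit_interval. (\<lambda>n. indicator {..real_of_rat (q n)} s :: complex) \<longlonglongrightarrow> indicator {..a} s"
        by simp
    qed (auto intro!: borel_measurable_unit_interval simp: indicator_def)
    ultimately show ?thesis by (rule closed_sequentially[OF cV])
  qed
  have "closure D = UNIV" using L2_dense_aux[OF cV add scale ind] by (auto simp: V_def)
  with \<open>countable D\<close> show "\<exists>B::L2 set set. countable B \<and> open = generate_topology B"
    by (rule second_countable_metricI)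
qed

(* C^1 functions whose support is a subset of (0,1), hence compact. *)
definition test_fun :: "(real \<Rightarrow> complex) set"
  where "test_fun = {\<phi>. \<phi> C1_differentiable_on UNIV \<and> closure {s. \<phi> s \<noteq> 0} \<subseteq> {0<..<1}}"

abbreviation deriv_of :: "(real \<Rightarrow> complex) \<Rightarrow> real \<Rightarrow> complex"
  where "deriv_of \<phi> \<equiv> (\<lambda>s. vector_derivative \<phi> (at s))"

lemma test_funD:
  assumes "\<phi> \<in> test_fun"
  shows "(\<phi> has_vector_derivative deriv_of \<phi> s) (at s)" "continuous_on UNIV \<phi>"
    "continuous_on UNIV (deriv_of \<phi>)" "s \<notin> {0<..<1} \<Longrightarrow> \<phi> s = 0"
proof -
  show d: "(\<phi> has_vector_derivative deriv_of \<phi> s) (at s)" for s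
    using assms by (auto simp: test_fun_def C1_differentiable_on_eq vector_derivative_works)
  show "continuous_on UNIV (deriv_of \<phi>)"
    using assms by (auto simp: test_fun_def C1_differentiable_on_eq)
  show "continuous_on UNIV \<phi>"
    by (intro continuous_at_imp_continuous_on ballI has_vector_derivative_continuous[OF d])
  show "s \<notin> {0<..<1} \<Longrightarrow> \<phi> s = 0"
    using assms closure_subset[of "{s. \<phi> s \<noteq> 0}"] unfolding test_fun_def by blast
qed

lemma test_funI:
  assumes "\<And>s. (\<phi> has_vector_derivative D s) (at s)" "continuous_on UNIV D"
    "closed K" "K \<subseteq> {0<..<1}" "\<And>s. s \<notin> K \<Longrightarrow> \<phi> s = 0"
  shows "\<phi> \<in> test_fun"
proof -
  have "closure {s. \<phi> s \<noteq> 0} \<subseteq> K"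
    by (rule closure_minimal) (use assms in auto)
  with assms show ?thesis by (auto simp: test_fun_def C1_differentiable_on_def)
qed

lemma square_integrable_continuous:
  assumes "continuous_on UNIV f"
  shows "square_integrable f"
proof -
  have "compact (f ` {0..1})"
    by (rule compact_continuous_image) (auto intro!: continuous_on_subset[OF assms])
  then have "\<exists>C. \<forall>s\<in>{0..1}. cmod (f s) \<le> C"
    by (auto dest!: compact_imp_bounded simp: bounded_iff simp del: atLeastAtMost_iff)
  then obtain C where "\<forall>s\<in>{0..1}. cmod (f s) \<le> C" ..
  then show ?thesis
    by (intro square_integrable_bounded[where C = C] borel_measurable_unit_interval
        borel_measurable_continuous_onI assms AE_I2) auto
qed

lemma integral_unit_interval_eq:
  fixes f :: "real \<Rightarrow> 'b::euclidean_space"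
  assumes "continuous_on UNIV f"
  shows "(LINT s|unit_interval. f s) = integral {0..1} f"
proof -
  have "f absolutely_integrable_on {0..1}"
    by (rule absolutely_integrable_continuous_real) (auto intro!: continuous_on_subset[OF assms])
  then have "integrable unit_interval f"
    unfolding absolutely_integrable_on_Icc_iff_Ioo by (subst integrable_restrict_space) (auto simp: set_integrable_def)
  then have "(LINT s|unit_interval. f s) = integral {0<..<1} f"
    by (rule lebesgue_integral_eq_integral) auto
  also have "\<dots> = integral {0..1} f"
    using integral_open_interval[of 0 "1::real" f] by simp
  finally show ?thesis .
qed

lemma test_fun_parts:
  assumes \<phi>: "\<phi> \<in> test_fun" and \<psi>: "\<psi> \<in> test_fun"
  shows "(LINT s|unit_interval. \<phi> s * deriv_of \<psi> s) = - (LINT s|unit_interval. deriv_of \<phi> s * \<psi> s)"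
proof -
  have c: "continuous_on UNIV (\<lambda>s. \<phi> s * deriv_of \<psi> s)" "continuous_on UNIV (\<lambda>s. deriv_of \<phi> s * \<psi> s)"
    by (intro continuous_on_mult test_funD(2,3)[OF \<phi>] test_funD(2,3)[OF \<psi>])+
  have "((\<lambda>s. \<phi> s * deriv_of \<psi> s + deriv_of \<phi> s * \<psi> s) has_integral (\<phi> 1 * \<psi> 1 - \<phi> 0 * \<psi> 0)) {0..1}"
    by (rule fundamental_theorem_of_calculus)
      (simp_all add: has_vector_derivative_at_within[OF has_vector_derivative_mult[OF test_funD(1)[OF \<phi>] test_funD(1)[OF \<psi>]]])
  then have "integral {0..1} (\<lambda>s. \<phi> s * deriv_of \<psi> s + deriv_of \<phi> s * \<psi> s) = 0"
    using test_funD(4)[OF \<phi>] by (auto dest: integral_unique)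
  moreover have "(\<lambda>s. \<phi> s * deriv_of \<psi> s) integrable_on {0..1}" "(\<lambda>s. deriv_of \<phi> s * \<psi> s) integrable_on {0..1}"
    by (auto intro!: integrable_continuous_real continuous_on_subset[OF c(1)] continuous_on_subset[OF c(2)])
  ultimately have "integral {0..1} (\<lambda>s. \<phi> s * deriv_of \<psi> s) + integral {0..1} (\<lambda>s. deriv_of \<phi> s * \<psi> s) = 0"
    by (simp add: integral_add)
  then show ?thesis by (simp add: integral_unit_interval_eq c eq_neg_iff_add_eq_0)
qed

lemma test_fun_poincare:
  assumes \<phi>: "\<phi> \<in> test_fun"
  shows "norm (L2_of \<phi>) \<le> norm (L2_of (deriv_of \<phi>))"
proof -
  have si: "square_integrable (deriv_of \<phi>)" "square_integrable \<phi>"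
    by (intro square_integrable_continuous test_funD(2,3)[OF \<phi>])+
  let ?K = "norm (L2_of (deriv_of \<phi>))"
  have cn: "continuous_on UNIV (\<lambda>s. cmod (deriv_of \<phi> s))" by (intro continuous_on_norm test_funD(3)[OF \<phi>])
  have *: "cmod (\<phi> s) \<le> ?K" if s: "s \<in> {0<..<1}" for s
  proof -
    have "(deriv_of \<phi> has_integral (\<phi> s - \<phi> 0)) {0..s}"
      by (rule fundamental_theorem_of_calculus)
        (use s in \<open>simp_all add: has_vector_derivative_at_within[OF test_funD(1)[OF \<phi>]]\<close>)
    then have "\<phi> s = integral {0..s} (deriv_of \<phi>)"
      using test_funD(4)[OF \<phi>, of 0] by (auto dest: integral_unique)
    also have "cmod \<dots> \<le> integral {0..s} (\<lambda>s. cmod (deriv_of \<phi> s))"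
      by (rule integral_norm_bound_integral)
        (auto intro!: integrable_continuous_real continuous_on_norm continuous_on_subset[OF test_funD(3)[OF \<phi>]])
    also have "\<dots> \<le> integral {0..1} (\<lambda>s. cmod (deriv_of \<phi> s))"
      by (rule integral_subset_le)
        (use s in \<open>auto intro!: integrable_continuous_real continuous_on_subset[OF cn]\<close>)
    also have "\<dots> = (LINT s|unit_interval. cmod (deriv_of \<phi> s))"
      by (simp add: integral_unit_interval_eq cn)
    also have "\<dots> \<le> ?K" by (rule L1_le_norm_L2_of[OF si(1)])
    finally show ?thesis .
  qed
  interpret finite_measure unit_interval by (rule finite_measure_unit_interval)
  have "(norm (L2_of \<phi>))\<^sup>2 = (LINT s|unit_interval. (cmod (\<phi> s))\<^sup>2)" by (rule norm_L2_of[OF si(2)])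
  also have "\<dots> \<le> (LINT s|unit_interval. ?K\<^sup>2)"
    by (rule integral_mono) (use * si(2) in \<open>auto simp: square_integrable_def intro!: power_mono\<close>)
  also have "\<dots> = ?K\<^sup>2" using prob_unit_interval by simp
  finally show ?thesis by (rule power2_le_imp_le) simp
qed

definition weak_deriv :: "L2 \<Rightarrow> L2 \<Rightarrow> bool"
  where "weak_deriv f g \<longleftrightarrow> (\<forall>\<phi>\<in>test_fun.
    (LINT s|unit_interval. rep_L2 f s * deriv_of \<phi> s) = - (LINT s|unit_interval. rep_L2 g s * \<phi> s))"

lemma integral_L2_mult:
  assumes "square_integrable \<phi>"
  shows "(LINT s|unit_interval. rep_L2 f s * \<phi> s) = cinner f (L2_of (\<lambda>s. cnj (\<phi> s)))"
  using cinner_L2_of[OF square_integrable_rep[of f] square_integrable_cnj[OF assms]] by simp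

lemma weak_deriv_iff:
  "weak_deriv f g \<longleftrightarrow> (\<forall>\<phi>\<in>test_fun. cinner f (L2_of (\<lambda>s. cnj (deriv_of \<phi> s))) = - cinner g (L2_of (\<lambda>s. cnj (\<phi> s))))"
  unfolding weak_deriv_def
  by (intro ball_cong refl) (simp add: integral_L2_mult square_integrable_continuous test_funD(2,3))

lemma bounded_linear_cinner_left: "bounded_linear (\<lambda>x. cinner x y)" for y :: "'a::complex_inner"
proof (rule bounded_linear_intro)
  show "norm (cinner x y) \<le> norm x * norm y" for x
  proof (cases "cinner x y = 0")
    case False
    define c where "c = cnj (cinner x y) / of_real (cmod (cinner x y))"
    have c1: "cmod c = 1" using False by (simp add: c_def norm_divide)
    have "cinner (c *\<^sub>C x) y = of_real (cmod (cinner x y))"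
      using False complex_norm_square[of "cinner x y"]
      by (simp add: c_def cinner_scaleC_left field_simps power2_eq_square)
    then have "cmod (cinner x y) = inner (c *\<^sub>C x) y" by (simp add: inner_eq_Re_cinner)
    also have "\<dots> \<le> norm (c *\<^sub>C x) * norm y" by (rule norm_cauchy_schwarz)
    finally show ?thesis by (simp add: norm_scaleC c1)
  qed simp
qed (simp_all add: cinner_add_left scaleR_scaleC cinner_scaleC_left scaleR_conv_of_real)

lemma cinner_add_right: "cinner x (y + z) = cinner x y + cinner x z" for x :: "'a::complex_inner"
  using cinner_commute[of x "y + z"] cinner_commute[of x y] cinner_commute[of x z]
  by (simp add: cinner_add_left)

lemma bounded_linear_cinner_right: "bounded_linear (\<lambda>y. cinner x y)" for x :: "'a::complex_inner"
proof -
  have "bounded_linear (\<lambda>y. cnj (cinner y x))"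
    by (rule bounded_linear_compose[OF bounded_linear_cnj bounded_linear_cinner_left])
  then show ?thesis using cinner_commute[of x] by simp
qed

lemma weak_deriv_add: "weak_deriv f g \<Longrightarrow> weak_deriv f' g' \<Longrightarrow> weak_deriv (f + f') (g + g')"
  by (simp add: weak_deriv_iff cinner_add_left)

lemma weak_deriv_scaleC: "weak_deriv f g \<Longrightarrow> weak_deriv (c *\<^sub>C f) (c *\<^sub>C g)"
  by (simp add: weak_deriv_iff cinner_scaleC_left)

lemma weak_deriv_L2_of:
  assumes "\<phi> \<in> test_fun"
  shows "weak_deriv (L2_of \<phi>) (L2_of (deriv_of \<phi>))"
  unfolding weak_deriv_iff
proof
  fix \<psi> assume \<psi>: "\<psi> \<in> test_fun"
  have si: "square_integrable \<phi>" "square_integrable (deriv_of \<phi>)" "square_integrable \<psi>" "square_integrable (deriv_of \<psi>)"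
    by (intro square_integrable_continuous test_funD(2,3)[OF assms] test_funD(2,3)[OF \<psi>])+
  show "cinner (L2_of \<phi>) (L2_of (\<lambda>s. cnj (deriv_of \<psi> s))) = - cinner (L2_of (deriv_of \<phi>)) (L2_of (\<lambda>s. cnj (\<psi> s)))"
    using test_fun_parts[OF assms \<psi>] by (simp add: cinner_L2_of si square_integrable_cnj)
qed

lemma weak_deriv_closed:
  assumes "\<And>n. weak_deriv (f n) (g n)" "f \<longlonglongrightarrow> f'" "g \<longlonglongrightarrow> g'"
  shows "weak_deriv f' g'"
  unfolding weak_deriv_iff
proof
  fix \<phi> assume \<phi>: "\<phi> \<in> test_fun"
  let ?a = "L2_of (\<lambda>s. cnj (deriv_of \<phi> s))" and ?b = "L2_of (\<lambda>s. cnj (\<phi> s))"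
  have "(\<lambda>n. cinner (f n) ?a) \<longlonglongrightarrow> cinner f' ?a"
    by (rule bounded_linear.tendsto[OF bounded_linear_cinner_left assms(2)])
  moreover have "(\<lambda>n. - cinner (g n) ?b) \<longlonglongrightarrow> - cinner g' ?b"
    by (rule tendsto_minus[OF bounded_linear.tendsto[OF bounded_linear_cinner_left assms(3)]])
  moreover have "cinner (f n) ?a = - cinner (g n) ?b" for n
    using assms(1)[of n] \<phi> by (simp add: weak_deriv_iff)
  ultimately show "cinner f' ?a = - cinner g' ?b" by (simp add: LIMSEQ_unique)
qed

lemma DERIV_max_square: "((\<lambda>x::real. (max 0 x)\<^sup>2) has_real_derivative (2 * max 0 x)) (at x)"
proof -
  consider "x > 0" | "x < 0" | "x = 0" by linarith
  then show ?thesis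
  proof cases
    case 1
    have "((\<lambda>x::real. x\<^sup>2) has_real_derivative (2 * max 0 x)) (at x)"
      using 1 by (auto intro!: derivative_eq_intros)
    then show ?thesis
      by (rule has_field_derivative_transform_within_open[where S = "{0<..}"]) (use 1 in auto)
  next
    case 2
    have "((\<lambda>x::real. 0) has_real_derivative (2 * max 0 x)) (at x)"
      using 2 by (auto intro!: derivative_eq_intros)
    then show ?thesis
      by (rule has_field_derivative_transform_within_open[where S = "{..<0}"]) (use 2 in auto)
  next
    case 3
    have "((\<lambda>h::real. (max 0 h)\<^sup>2 / h) \<longlongrightarrow> 0) (at 0)"
    proof (rule Lim_null_comparison)
      show "\<forall>\<^sub>F h in at 0. norm ((max 0 h)\<^sup>2 / h) \<le> \<bar>h\<bar>"
        by (rule always_eventually) (auto simp: max_def power2_eq_square)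
      show "((\<lambda>h::real. \<bar>h\<bar>) \<longlongrightarrow> 0) (at 0)"
        using tendsto_rabs[OF tendsto_ident_at[of "0::real" UNIV]] by simp
    qed
    then show ?thesis using 3 by (simp add: DERIV_def)
  qed
qed

lemma bump_in_test_fun:
  fixes c d :: real
  assumes "0 < c" "d < 1"
  defines "\<psi> \<equiv> \<lambda>s. (max 0 (s - c))\<^sup>2 * (max 0 (d - s))\<^sup>2"
  shows "(\<lambda>s. complex_of_real (real n * \<psi> s / (1 + real n * \<psi> s))) \<in> test_fun"
proof -
  define \<psi>' where "\<psi>' s = 2 * max 0 (s - c) * (max 0 (d - s))\<^sup>2 - (max 0 (s - c))\<^sup>2 * (2 * max 0 (d - s))" for s
  have p: "1 + real n * \<psi> s > 0" for s by (simp add: \<psi>_def add_pos_nonneg)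
  have d1: "((\<lambda>s. (max 0 (s - c))\<^sup>2) has_real_derivative 2 * max 0 (s - c)) (at s)" for s
  proof -
    have "((\<lambda>s. s - c) has_real_derivative 1) (at s)" by (auto intro!: derivative_eq_intros)
    from DERIV_chain2[OF DERIV_max_square[of "s - c"] this] show ?thesis by simp
  qed
  have d2: "((\<lambda>s. (max 0 (d - s))\<^sup>2) has_real_derivative - (2 * max 0 (d - s))) (at s)" for s
  proof -
    have "((\<lambda>s. d - s) has_real_derivative -1) (at s)" by (auto intro!: derivative_eq_intros)
    from DERIV_chain2[OF DERIV_max_square[of "d - s"] this] show ?thesis by simp
  qed
  have d: "(\<psi> has_real_derivative \<psi>' s) (at s)" for s
    using DERIV_mult[OF d1[of s] d2[of s]] unfolding \<psi>_def \<psi>'_def by (simp add: algebra_simps)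
  have q: "((\<lambda>s. real n * \<psi> s / (1 + real n * \<psi> s)) has_real_derivative
      real n * \<psi>' s / (1 + real n * \<psi> s)\<^sup>2) (at s)" for s
  proof -
    have n: "((\<lambda>s. real n * \<psi> s) has_real_derivative real n * \<psi>' s) (at s)"
      by (rule DERIV_cmult[OF d])
    have "((\<lambda>s. 1 + real n * \<psi> s) has_real_derivative 0 + real n * \<psi>' s) (at s)"
      by (rule DERIV_add[OF DERIV_const n])
    from DERIV_divide[OF n this] p[of s] show ?thesis
      by (simp add: power2_eq_square algebra_simps)
  qed
  have c: "continuous_on UNIV \<psi>" "continuous_on UNIV \<psi>'"
    unfolding \<psi>_def \<psi>'_def by (intro continuous_intros)+
  show ?thesis
  proof (rule test_funI)
    show "((\<lambda>s. complex_of_real (real n * \<psi> s / (1 + real n * \<psi> s))) has_vector_derivative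
      complex_of_real (real n * \<psi>' s / (1 + real n * \<psi> s)\<^sup>2)) (at s)" for s
      using q[of s] unfolding has_real_derivative_iff_has_vector_derivative
      by (rule bounded_linear.has_vector_derivative[OF bounded_linear_of_real])
    have "1 + real n * \<psi> s \<noteq> 0" for s using p[of s] by simp
    then show "continuous_on UNIV (\<lambda>s. complex_of_real (real n * \<psi>' s / (1 + real n * \<psi> s)\<^sup>2))"
      by (intro continuous_intros c) auto
    show "closed {c..d}" "{c..d} \<subseteq> {0<..<1}" using assms by auto
    show "complex_of_real (real n * \<psi> s / (1 + real n * \<psi> s)) = 0" if "s \<notin> {c..d}" for s
      using that by (auto simp: \<psi>_def max_def)
  qed
qed

lemma weak_deriv_zero_unique:
  assumes "\<And>\<phi>. \<phi> \<in> test_fun \<Longrightarrow> cinner h (L2_of (\<lambda>s. cnj (\<phi> s))) = 0"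
  shows "h = 0"
proof -
  define V where "V = {y. cinner h y = 0}"
  have cV: "closed V"
  proof -
    have "closed ((\<lambda>y. cinner h y) -` {0})"
      by (rule closed_vimage[OF closed_singleton linear_continuous_on[OF bounded_linear_cinner_right]])
    moreover have "(\<lambda>y. cinner h y) -` {0} = V" by (auto simp: V_def)
    ultimately show ?thesis by simp
  qed
  have one: "integrable unit_interval (\<lambda>s. (1 :: real)\<^sup>2)"
    using square_integrableD[OF square_integrable_const[of 1]] by simp
  have cd: "L2_of (indicator {c<..<d}) \<in> V" if cd: "0 < c" "d < 1" for c d :: real
  proof -
    define \<psi> where "\<psi> s = (max 0 (s - c))\<^sup>2 * (max 0 (d - s))\<^sup>2" for s
    define \<phi> where "\<phi> n s = complex_of_real (real n * \<psi> s / (1 + real n * \<psi> s))" for n s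
    have \<psi>0: "\<psi> s \<ge> 0" for s by (simp add: \<psi>_def)
    have \<phi>: "\<phi> n \<in> test_fun" for n
      using bump_in_test_fun[OF cd, of n] unfolding \<phi>_def \<psi>_def by simp
    have "cnj (\<phi> n s) = \<phi> n s" for n s by (simp add: \<phi>_def)
    then have V: "L2_of (\<phi> n) \<in> V" for n using assms[OF \<phi>, of n] by (simp add: V_def)
    have "(\<lambda>n. L2_of (\<phi> n)) \<longlonglongrightarrow> L2_of (indicator {c<..<d})"
    proof (rule tendsto_L2_of_dominated[OF _ _ one])
      show "\<phi> n \<in> borel_measurable unit_interval" for n
        by (intro square_integrable_measurable square_integrable_continuous test_funD(2)[OF \<phi>])
      show "indicator {c<..<d} \<in> borel_measurable unit_interval"
        by (intro borel_measurable_unit_interval) auto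
      have "cmod (\<phi> n s) \<le> 1" for n s
      proof -
        have "0 \<le> real n * \<psi> s" using \<psi>0[of s] by simp
        then have "\<bar>real n * \<psi> s / (1 + real n * \<psi> s)\<bar> \<le> 1"
          by (simp add: abs_div divide_le_eq_1)
        then show ?thesis unfolding \<phi>_def norm_of_real .
      qed
      then show "AE s in unit_interval. cmod (\<phi> n s) \<le> 1" for n by simp
      have "(\<lambda>n. \<phi> n s) \<longlonglongrightarrow> indicator {c<..<d} s" for s
      proof (cases "s \<in> {c<..<d}")
        case True
        then have p: "\<psi> s > 0" by (simp add: \<psi>_def)
        have "(\<lambda>n. 1 - inverse (1 + real n * \<psi> s)) \<longlonglongrightarrow> 1 - 0"
        proof (intro tendsto_diff tendsto_const tendsto_inverse_0_at_top)
          have "filterlim (\<lambda>n. \<psi> s * real n) at_top sequentially"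
            by (rule filterlim_tendsto_pos_mult_at_top[OF tendsto_const p filterlim_real_sequentially])
          then have "filterlim (\<lambda>n. 1 + \<psi> s * real n) at_top sequentially"
            by (rule filterlim_tendsto_add_at_top[OF tendsto_const])
          then show "filterlim (\<lambda>n. 1 + real n * \<psi> s) at_top sequentially" by (simp add: mult.commute)
        qed
        moreover have "1 - inverse (1 + real n * \<psi> s) = real n * \<psi> s / (1 + real n * \<psi> s)" for n
        proof -
          have "1 + real n * \<psi> s > 0" using p by (simp add: add_pos_nonneg)
          then have "1 + real n * \<psi> s \<noteq> 0" by simp
          then show ?thesis by (metis add_diff_cancel_left' diff_divide_distrib divide_self inverse_eq_divide)
        qed
        ultimately have "(\<lambda>n. real n * \<psi> s / (1 + real n * \<psi> s)) \<longlonglongrightarrow> 1" by simp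
        then have "(\<lambda>n. \<phi> n s) \<longlonglongrightarrow> of_real 1" unfolding \<phi>_def by (rule tendsto_of_real)
        then show ?thesis using True by simp
      next
        case False
        then have "\<psi> s = 0" by (auto simp: \<psi>_def max_def)
        then show ?thesis using False by (simp add: \<phi>_def)
      qed
      then show "AE s in unit_interval. (\<lambda>n. \<phi> n s) \<longlonglongrightarrow> indicator {c<..<d} s" by simp
    qed
    then show ?thesis by (rule closed_sequentially[OF cV V])
  qed
  have ind: "L2_of (indicator {..a}) \<in> V" for a :: real
  proof -
    define m where "m = min a 1"
    define c where "c n = inverse (real (Suc n))" for n
    have c0: "c n > 0" for n by (simp add: c_def)
    have cl: "c \<longlonglongrightarrow> 0" unfolding c_def by (rule LIMSEQ_inverse_real_of_nat)
    have "(\<lambda>n. L2_of (indicator {c n<..<m - c n})) \<longlonglongrightarrow> L2_of (indicator {..a})"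
    proof (rule tendsto_L2_of_dominated[OF _ _ one])
      show "indicator {c n<..<m - c n} \<in> borel_measurable unit_interval" for n
        by (intro borel_measurable_unit_interval) auto
      show "indicator {..a} \<in> borel_measurable unit_interval"
        by (intro borel_measurable_unit_interval) auto
      show "AE s in unit_interval. cmod (indicator {c n<..<m - c n} s) \<le> 1" for n
        by (simp add: indicator_def)
      have pt: "(\<lambda>n. indicator {c n<..<m - c n} s :: complex) \<longlonglongrightarrow> indicator {..a} s"
        if s: "0 < s" "s < 1" "s \<noteq> a" for s
      proof (cases "s < a")
        case True
        then have sm: "s < m" using s by (simp add: m_def)
        have "\<forall>\<^sub>F n in sequentially. c n < s" by (rule order_tendstoD(2)[OF cl s(1)])
        moreover have "\<forall>\<^sub>F n in sequentially. c n < m - s"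
          by (rule order_tendstoD(2)[OF cl]) (use sm in simp)
        ultimately have "\<forall>\<^sub>F n in sequentially. indicator {c n<..<m - c n} s = (1 :: complex)"
          by eventually_elim (simp add: indicator_def)
        then show ?thesis using True by (simp add: tendsto_eventually)
      next
        case False
        have "indicator {c n<..<m - c n} s = (0 :: complex)" for n
          using c0[of n] False by (auto simp: indicator_def m_def min_def split: if_splits)
        then show ?thesis using False s by simp
      qed
      have "AE s in lebesgue. s \<noteq> a"
        by (rule AE_completion[OF AE_lborel_singleton])
      then have "AE s in unit_interval. s \<noteq> a" by (rule AE_unit_intervalI)
      moreover have "AE s in unit_interval. s \<in> {0<..<1}" by (rule AE_I2) simp
      ultimately show "AE s in unit_interval. (\<lambda>n. indicator {c n<..<m - c n} s :: complex) \<longlonglongrightarrow> indicator {..a} s"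
        by eventually_elim (use pt in auto)
    qed
    moreover have "L2_of (indicator {c n<..<m - c n}) \<in> V" for n
    proof (rule cd[OF c0])
      show "m - c n < 1" using c0[of n] by (simp add: m_def)
    qed
    ultimately show ?thesis by (rule closed_sequentially[OF cV, rotated])
  qed
  have "h \<in> V"
  proof (rule L2_dense_aux[OF cV _ _ ind])
    show "x + y \<in> V" if "x \<in> V" "y \<in> V" for x y using that by (simp add: V_def cinner_add_right)
    show "c *\<^sub>C x \<in> V" if "x \<in> V" for c x using that by (simp add: V_def cinner_scaleC_right)
  qed
  then have "inner h h = 0" by (simp add: V_def inner_eq_Re_cinner)
  then show ?thesis by simp
qed

lemma weak_deriv_unique:
  assumes "weak_deriv f g" "weak_deriv f g'"
  shows "g = g'"
proof -
  have "g + (-1) *\<^sub>C g' = 0"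
  proof (rule weak_deriv_zero_unique)
    fix \<phi> assume "\<phi> \<in> test_fun"
    then show "cinner (g + (-1) *\<^sub>C g') (L2_of (\<lambda>s. cnj (\<phi> s))) = 0"
      using assms by (simp add: weak_deriv_iff cinner_add_left cinner_scaleC_left)
  qed
  moreover have "(-1) *\<^sub>C g' = - g'" using scaleR_scaleC[of "-1" g'] by simp
  ultimately show ?thesis by simp
qed

definition sobolev_H1 :: "L2 set"
  where "sobolev_H1 = {f. \<exists>g. weak_deriv f g}"

definition wderiv :: "L2 \<Rightarrow> L2"
  where "wderiv f = (THE g. weak_deriv f g)"

definition sobolev_H1_norm :: "L2 \<Rightarrow> real"
  where "sobolev_H1_norm f = sqrt ((norm f)\<^sup>2 + (norm (wderiv f))\<^sup>2)"

(* The closure of the test functions in the H^1 norm. *)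
definition sobolev_H01 :: "L2 set"
  where "sobolev_H01 = {f \<in> sobolev_H1. \<forall>\<epsilon>>0. \<exists>\<phi>\<in>test_fun. sobolev_H1_norm (f - L2_of \<phi>) < \<epsilon>}"

definition sobolev_H2 :: "L2 set"
  where "sobolev_H2 = {f \<in> sobolev_H1. wderiv f \<in> sobolev_H1}"

lemma wderiv_eq: "weak_deriv f g \<Longrightarrow> wderiv f = g"
  unfolding wderiv_def by (rule the_equality) (auto intro: weak_deriv_unique)

lemma weak_deriv_wderiv: "f \<in> sobolev_H1 \<Longrightarrow> weak_deriv f (wderiv f)"
  by (auto simp: sobolev_H1_def wderiv_eq)

lemma H1_I: "weak_deriv f g \<Longrightarrow> f \<in> sobolev_H1"
  by (auto simp: sobolev_H1_def)

lemma weak_deriv_uminus: "weak_deriv f g \<Longrightarrow> weak_deriv (- f) (- g)"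
  using weak_deriv_scaleC[of f g "-1"] scaleR_scaleC[of "-1" f] scaleR_scaleC[of "-1" g] by simp

lemma weak_deriv_diff: "weak_deriv f g \<Longrightarrow> weak_deriv f' g' \<Longrightarrow> weak_deriv (f - f') (g - g')"
  using weak_deriv_add[of f g "- f'" "- g'"] weak_deriv_uminus[of f' g'] by simp

lemma cinner_zero_left [simp]: "cinner 0 y = 0" for y :: "'a::complex_inner"
  using cinner_scaleC_left[of 0 0 y] by simp

lemma weak_deriv_zero [simp]: "weak_deriv 0 0"
  by (simp add: weak_deriv_iff)

lemma H1_add: "f \<in> sobolev_H1 \<Longrightarrow> g \<in> sobolev_H1 \<Longrightarrow> f + g \<in> sobolev_H1"
  and H1_diff: "f \<in> sobolev_H1 \<Longrightarrow> g \<in> sobolev_H1 \<Longrightarrow> f - g \<in> sobolev_H1"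
  and H1_scaleC: "f \<in> sobolev_H1 \<Longrightarrow> c *\<^sub>C f \<in> sobolev_H1"
  by (rule H1_I, (rule weak_deriv_add weak_deriv_diff weak_deriv_scaleC; rule weak_deriv_wderiv; assumption))+

lemma wderiv_add: "f \<in> sobolev_H1 \<Longrightarrow> g \<in> sobolev_H1 \<Longrightarrow> wderiv (f + g) = wderiv f + wderiv g"
  and wderiv_diff: "f \<in> sobolev_H1 \<Longrightarrow> g \<in> sobolev_H1 \<Longrightarrow> wderiv (f - g) = wderiv f - wderiv g"
  and wderiv_scaleC: "f \<in> sobolev_H1 \<Longrightarrow> wderiv (c *\<^sub>C f) = c *\<^sub>C wderiv f"
  by (rule wderiv_eq, (rule weak_deriv_add weak_deriv_diff weak_deriv_scaleC; rule weak_deriv_wderiv; assumption))+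

lemma H1_zero [simp]: "0 \<in> sobolev_H1" and wderiv_zero [simp]: "wderiv 0 = 0"
  using H1_I[OF weak_deriv_zero] wderiv_eq[OF weak_deriv_zero] by auto

lemma test_fun_H1 [simp]: "\<phi> \<in> test_fun \<Longrightarrow> L2_of \<phi> \<in> sobolev_H1"
  and wderiv_test_fun: "\<phi> \<in> test_fun \<Longrightarrow> wderiv (L2_of \<phi>) = L2_of (deriv_of \<phi>)"
  using weak_deriv_L2_of by (auto intro: H1_I wderiv_eq)

lemma test_fun_add:
  assumes "\<phi> \<in> test_fun" "\<psi> \<in> test_fun"
  shows "(\<lambda>s. \<phi> s + \<psi> s) \<in> test_fun"
proof -
  have "{s. \<phi> s + \<psi> s \<noteq> 0} \<subseteq> {s. \<phi> s \<noteq> 0} \<union> {s. \<psi> s \<noteq> 0}" by auto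
  then have "closure {s. \<phi> s + \<psi> s \<noteq> 0} \<subseteq> closure {s. \<phi> s \<noteq> 0} \<union> closure {s. \<psi> s \<noteq> 0}"
    by (metis closure_Un closure_mono)
  then show ?thesis using assms by (auto simp: test_fun_def)
qed

lemma test_fun_scale:
  assumes "\<phi> \<in> test_fun"
  shows "(\<lambda>s. c * \<phi> s) \<in> test_fun"
proof -
  have "{s. c * \<phi> s \<noteq> 0} \<subseteq> {s. \<phi> s \<noteq> 0}" by auto
  then have "closure {s. c * \<phi> s \<noteq> 0} \<subseteq> closure {s. \<phi> s \<noteq> 0}" by (rule closure_mono)
  then show ?thesis using assms by (auto simp: test_fun_def)
qed

lemma test_fun_zero: "(\<lambda>s. 0) \<in> test_fun"
  by (simp add: test_fun_def)

lemma square_integrable_test_fun: "\<phi> \<in> test_fun \<Longrightarrow> square_integrable \<phi>"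
  by (rule square_integrable_continuous) (rule test_funD)

lemma H1_norm_triangle:
  assumes "f \<in> sobolev_H1" "g \<in> sobolev_H1"
  shows "sobolev_H1_norm (f + g) \<le> sobolev_H1_norm f + sobolev_H1_norm g"
  using norm_triangle_ineq[of "(f, wderiv f)" "(g, wderiv g)"] assms
  by (simp add: sobolev_H1_norm_def norm_Pair wderiv_add)

lemma H1_norm_scaleC:
  assumes "f \<in> sobolev_H1"
  shows "sobolev_H1_norm (c *\<^sub>C f) = cmod c * sobolev_H1_norm f"
  using norm_scaleC[of c "(f, wderiv f)"] assms
  by (simp add: sobolev_H1_norm_def norm_Pair wderiv_scaleC scaleC_prod_def)

lemma norm_le_H1_norm: "norm f \<le> sobolev_H1_norm f" "norm (wderiv f) \<le> sobolev_H1_norm f"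
  by (simp_all add: sobolev_H1_norm_def real_le_rsqrt)

lemma H01_H1: "f \<in> sobolev_H01 \<Longrightarrow> f \<in> sobolev_H1"
  by (simp add: sobolev_H01_def)

lemma test_fun_H01: "\<phi> \<in> test_fun \<Longrightarrow> L2_of \<phi> \<in> sobolev_H01"
  unfolding sobolev_H01_def by (auto intro!: bexI[of _ \<phi>] simp: sobolev_H1_norm_def)

lemma H01_zero: "0 \<in> sobolev_H01"
  using test_fun_H01[OF test_fun_zero] by simp

lemma H01_add:
  assumes "f \<in> sobolev_H01" "g \<in> sobolev_H01"
  shows "f + g \<in> sobolev_H01"
proof -
  have "\<exists>\<phi>\<in>test_fun. sobolev_H1_norm (f + g - L2_of \<phi>) < \<epsilon>" if "\<epsilon> > 0" for \<epsilon>
  proof -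
    have "\<epsilon> / 2 > 0" using \<open>\<epsilon> > 0\<close> by simp
    then obtain \<phi> \<psi> where *: "\<phi> \<in> test_fun" "sobolev_H1_norm (f - L2_of \<phi>) < \<epsilon> / 2" "\<psi> \<in> test_fun" "sobolev_H1_norm (g - L2_of \<psi>) < \<epsilon> / 2"
      using assms unfolding sobolev_H01_def by blast
    have "f + g - L2_of (\<lambda>s. \<phi> s + \<psi> s) = (f - L2_of \<phi>) + (g - L2_of \<psi>)"
      by (simp add: L2_of_add square_integrable_test_fun *)
    also have "sobolev_H1_norm \<dots> \<le> sobolev_H1_norm (f - L2_of \<phi>) + sobolev_H1_norm (g - L2_of \<psi>)"
      by (intro H1_norm_triangle H1_diff test_fun_H1 H01_H1 assms *)
    also have "\<dots> < \<epsilon>" using * by simp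
    finally show ?thesis using test_fun_add[OF *(1,3)] by blast
  qed
  then show ?thesis using assms by (auto simp: sobolev_H01_def H1_add)
qed

lemma H01_scaleC:
  assumes "f \<in> sobolev_H01"
  shows "c *\<^sub>C f \<in> sobolev_H01"
proof -
  have "\<exists>\<phi>\<in>test_fun. sobolev_H1_norm (c *\<^sub>C f - L2_of \<phi>) < \<epsilon>" if "\<epsilon> > 0" for \<epsilon>
  proof -
    have "\<epsilon> / (cmod c + 1) > 0" using \<open>\<epsilon> > 0\<close> by (simp add: add_nonneg_pos)
    then obtain \<phi> where *: "\<phi> \<in> test_fun" "sobolev_H1_norm (f - L2_of \<phi>) < \<epsilon> / (cmod c + 1)"
      using assms unfolding sobolev_H01_def by blast
    have "c *\<^sub>C f - L2_of (\<lambda>s. c * \<phi> s) = c *\<^sub>C (f - L2_of \<phi>)"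
      by (simp add: L2_of_scaleC square_integrable_test_fun * scaleC_diff_right)
    then have "sobolev_H1_norm (c *\<^sub>C f - L2_of (\<lambda>s. c * \<phi> s)) = cmod c * sobolev_H1_norm (f - L2_of \<phi>)"
      using H1_norm_scaleC[OF H1_diff[OF H01_H1[OF assms] test_fun_H1[OF *(1)]], of c] by simp
    also have "\<dots> \<le> (cmod c + 1) * sobolev_H1_norm (f - L2_of \<phi>)"
      by (rule mult_right_mono) (simp_all add: sobolev_H1_norm_def)
    also have "\<dots> < \<epsilon>" using *(2) by (simp add: pos_less_divide_eq add_nonneg_pos mult.commute)
    finally show ?thesis using test_fun_scale[OF *(1)] by blast
  qed
  then show ?thesis using assms by (auto simp: sobolev_H01_def H1_scaleC)
qed

lemma H01_uminus: "f \<in> sobolev_H01 \<Longrightarrow> - f \<in> sobolev_H01"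
  using H01_scaleC[of f "-1"] scaleR_scaleC[of "-1" f] by simp

lemma H01_diff: "f \<in> sobolev_H01 \<Longrightarrow> g \<in> sobolev_H01 \<Longrightarrow> f - g \<in> sobolev_H01"
  using H01_add[of f "- g"] H01_uminus[of g] by simp

lemma H01_poincare:
  assumes "f \<in> sobolev_H01"
  shows "norm f \<le> norm (wderiv f)"
proof (rule field_le_epsilon)
  fix e :: real assume "e > 0"
  then have "e / 2 > 0" by simp
  then obtain \<phi> where \<phi>: "\<phi> \<in> test_fun" and l: "sobolev_H1_norm (f - L2_of \<phi>) < e / 2"
    using assms unfolding sobolev_H01_def by blast
  have "norm f \<le> norm (f - L2_of \<phi>) + norm (L2_of \<phi>)"
    using norm_triangle_ineq[of "f - L2_of \<phi>" "L2_of \<phi>"] by simp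
  also have "\<dots> \<le> norm (f - L2_of \<phi>) + norm (wderiv (L2_of \<phi>))"
    using test_fun_poincare[OF \<phi>] by (simp add: wderiv_test_fun \<phi>)
  also have "norm (wderiv (L2_of \<phi>)) \<le> norm (wderiv f) + norm (wderiv (f - L2_of \<phi>))"
    using norm_triangle_ineq4[of "wderiv f" "wderiv f - wderiv (L2_of \<phi>)"]
    by (simp add: wderiv_diff H01_H1 assms \<phi>)
  finally show "norm f \<le> norm (wderiv f) + e"
    using norm_le_H1_norm[of "f - L2_of \<phi>"] l by linarith
qed

typedef H01 = sobolev_H01
  morphisms H01_embed H01_of
  using H01_zero by blast

setup_lifting type_definition_H01

lemmas H01_embed_H01 [simp] = H01_embed
lemma H01_embed_H1 [simp]: "H01_embed x \<in> sobolev_H1" by (rule H01_H1[OF H01_embed])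

(* H01 carries the norm of the derivative, not the H^1 norm. *)
instantiation H01 :: complex_inner
begin

lift_definition zero_H01 :: H01 is 0 by (rule H01_zero)
lift_definition plus_H01 :: "H01 \<Rightarrow> H01 \<Rightarrow> H01" is "(+)" by (rule H01_add)
lift_definition minus_H01 :: "H01 \<Rightarrow> H01 \<Rightarrow> H01" is "(-)" by (rule H01_diff)
lift_definition uminus_H01 :: "H01 \<Rightarrow> H01" is uminus by (rule H01_uminus)
lift_definition scaleC_H01 :: "complex \<Rightarrow> H01 \<Rightarrow> H01" is scaleC by (rule H01_scaleC)
definition scaleR_H01 :: "real \<Rightarrow> H01 \<Rightarrow> H01" where "r *\<^sub>R f = complex_of_real r *\<^sub>C f" for f :: H01
definition cinner_H01 :: "H01 \<Rightarrow> H01 \<Rightarrow> complex"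
  where "cinner f g = cinner (wderiv (H01_embed f)) (wderiv (H01_embed g))"
definition inner_H01 :: "H01 \<Rightarrow> H01 \<Rightarrow> real" where "inner f g = Re (cinner f g)" for f g :: H01
definition norm_H01 :: "H01 \<Rightarrow> real" where "norm f = sqrt (inner f f)" for f :: H01
definition sgn_H01 :: "H01 \<Rightarrow> H01" where "sgn f = inverse (norm f) *\<^sub>R f" for f :: H01
definition dist_H01 :: "H01 \<Rightarrow> H01 \<Rightarrow> real" where "dist f g = norm (f - g)" for f g :: H01
definition uniformity_H01 :: "(H01 \<times> H01) filter"
  where "uniformity_H01 = (INF e\<in>{0<..}. principal {(f, g). dist f g < e})"
definition open_H01 :: "H01 set \<Rightarrow> bool"
  where "open_H01 U = (\<forall>f\<in>U. eventually (\<lambda>(f', g). f' = f \<longrightarrow> g \<in> U) uniformity)"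

instance
proof
  fix f g h :: H01 and r q :: real and U :: "H01 set"
  show "f + g + h = f + (g + h)" by transfer simp
  show "f + g = g + f" by transfer simp
  show "0 + f = f" by transfer simp
  show "- f + f = 0" by transfer simp
  show "f - g = f + - g" by transfer simp
  show C1: "a *\<^sub>C (f + g) = a *\<^sub>C f + a *\<^sub>C g" for a and f g :: H01 by transfer (rule scaleC_add_right)
  show C2: "(a + b) *\<^sub>C f = a *\<^sub>C f + b *\<^sub>C f" for a b and f :: H01 by transfer (rule scaleC_add_left)
  show C3: "a *\<^sub>C b *\<^sub>C f = (a * b) *\<^sub>C f" for a b and f :: H01 by transfer (rule scaleC_scaleC)
  show C4: "1 *\<^sub>C f = f" for f :: H01 by transfer (rule scaleC_one)
  show C5: "r *\<^sub>R f = complex_of_real r *\<^sub>C f" for r and f :: H01 by (rule scaleR_H01_def)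
  show "r *\<^sub>R (f + g) = r *\<^sub>R f + r *\<^sub>R g" by (simp add: C5 C1)
  show "(r + q) *\<^sub>R f = r *\<^sub>R f + q *\<^sub>R f" by (simp add: C5 C2)
  show "r *\<^sub>R q *\<^sub>R f = (r * q) *\<^sub>R f" by (simp add: C5 C3)
  show "1 *\<^sub>R f = f" by (simp add: C5 C4)
  show I1: "cinner f g = cnj (cinner g f)" for f g :: H01
    unfolding cinner_H01_def by (rule cinner_commute)
  show I2: "cinner (f + g) h = cinner f h + cinner g h" for f g h :: H01
    by (simp add: cinner_H01_def plus_H01.rep_eq wderiv_add cinner_add_left)
  show I3: "cinner (a *\<^sub>C f) g = a * cinner f g" for a and f g :: H01
    by (simp add: cinner_H01_def scaleC_H01.rep_eq wderiv_scaleC cinner_scaleC_left)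
  show "inner f g = Re (cinner f g)" by (simp add: inner_H01_def)
  have n: "inner f f = (norm (wderiv (H01_embed f)))\<^sup>2" for f
    by (simp add: inner_H01_def cinner_H01_def power2_norm_eq_inner inner_eq_Re_cinner)
  show "inner f g = inner g f" using I1[of f g] by (simp add: inner_H01_def)
  show "inner (f + g) h = inner f h + inner g h" by (simp add: inner_H01_def I2)
  show "inner (r *\<^sub>R f) g = r * inner f g" by (simp add: inner_H01_def C5 I3)
  show "0 \<le> inner f f" by (simp add: n)
  show "inner f f = 0 \<longleftrightarrow> f = 0"
  proof
    assume "inner f f = 0"
    then have "norm (H01_embed f) = 0" using H01_poincare[OF H01_embed, of f] by (simp add: n)
    then show "f = 0" by (simp add: H01_embed_inject[symmetric] zero_H01.rep_eq)
  qed (simp add: n zero_H01.rep_eq)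
  show "norm f = sqrt (inner f f)" by (rule norm_H01_def)
  show "dist f g = norm (f - g)" by (rule dist_H01_def)
  show "sgn f = inverse (norm f) *\<^sub>R f" by (rule sgn_H01_def)
  show "uniformity = (INF e\<in>{0<..}. principal {(f :: H01, g). dist f g < e})" by (rule uniformity_H01_def)
  show "open U = (\<forall>f\<in>U. eventually (\<lambda>(f', g). f' = f \<longrightarrow> g \<in> U) uniformity)" by (rule open_H01_def)
qed

end

lemma norm_H01: "norm u = norm (wderiv (H01_embed u))"
  by (simp add: norm_H01_def inner_H01_def cinner_H01_def norm_eq_sqrt_inner[where 'a = L2] inner_eq_Re_cinner)

lemma dist_H01: "dist u v = dist (wderiv (H01_embed u)) (wderiv (H01_embed v))"
  by (simp add: dist_norm norm_H01 minus_H01.rep_eq wderiv_diff)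

lemma norm_H01_embed_le: "norm (H01_embed u) \<le> norm u"
  using H01_poincare[OF H01_embed, of u] by (simp add: norm_H01)

instance H01 :: banach
proof
  fix X :: "nat \<Rightarrow> H01"
  assume X: "Cauchy X"
  let ?f = "\<lambda>n. H01_embed (X n)"
  have "Cauchy (\<lambda>n. wderiv (?f n))" using X by (simp add: Cauchy_def dist_H01)
  then obtain g where g: "(\<lambda>n. wderiv (?f n)) \<longlonglongrightarrow> g" using Cauchy_convergent convergent_def by blast
  have d: "dist (?f m) (?f n) \<le> dist (X m) (X n)" for m n
    using norm_H01_embed_le[of "X m - X n"] by (simp add: dist_norm minus_H01.rep_eq)
  have "Cauchy ?f" unfolding Cauchy_def
  proof (intro allI impI)
    fix e :: real assume "e > 0"
    then obtain M where M: "\<forall>m\<ge>M. \<forall>n\<ge>M. dist (X m) (X n) < e" using X unfolding Cauchy_def by blast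
    have "dist (?f m) (?f n) < e" if "m \<ge> M" "n \<ge> M" for m n
      using d[of m n] M that by (simp add: le_less_trans)
    then show "\<exists>M. \<forall>m\<ge>M. \<forall>n\<ge>M. dist (?f m) (?f n) < e" by blast
  qed
  then obtain f where f: "?f \<longlonglongrightarrow> f" using Cauchy_convergent convergent_def by blast
  have wd: "weak_deriv f g" by (rule weak_deriv_closed[OF _ f g]) (simp add: weak_deriv_wderiv)
  then have fH1: "f \<in> sobolev_H1" and dg: "wderiv f = g" by (auto intro: H1_I wderiv_eq)
  have "f \<in> sobolev_H01"
    unfolding sobolev_H01_def
  proof (intro CollectI conjI fH1 allI impI)
    fix e :: real assume "e > 0"
    have "(\<lambda>n. sobolev_H1_norm (f - ?f n)) \<longlonglongrightarrow> sqrt ((norm (f - f))\<^sup>2 + (norm (g - g))\<^sup>2)"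
      unfolding sobolev_H1_norm_def wderiv_diff[OF fH1 H01_embed_H1] dg
      by (intro tendsto_real_sqrt tendsto_add tendsto_power tendsto_norm tendsto_diff tendsto_const f g)
    then have "\<forall>\<^sub>F n in sequentially. sobolev_H1_norm (f - ?f n) < e / 2"
      by (rule order_tendstoD) (use \<open>e > 0\<close> in simp)
    then obtain n where n: "sobolev_H1_norm (f - ?f n) < e / 2" by (auto simp: eventually_sequentially)
    have "e / 2 > 0" using \<open>e > 0\<close> by simp
    then obtain \<phi> where \<phi>: "\<phi> \<in> test_fun" "sobolev_H1_norm (?f n - L2_of \<phi>) < e / 2"
      using H01_embed[of "X n"] unfolding sobolev_H01_def by blast
    have "sobolev_H1_norm (f - L2_of \<phi>) \<le> sobolev_H1_norm (f - ?f n) + sobolev_H1_norm (?f n - L2_of \<phi>)"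
      using H1_norm_triangle[of "f - ?f n" "?f n - L2_of \<phi>"] by (simp add: H1_diff fH1 \<phi>)
    then show "\<exists>\<phi>\<in>test_fun. sobolev_H1_norm (f - L2_of \<phi>) < e" using n \<phi> by (intro bexI[of _ \<phi>]) auto
  qed
  then have e: "H01_embed (H01_of f) = f" by (rule H01_of_inverse)
  have "(\<lambda>n. dist (X n) (H01_of f)) \<longlonglongrightarrow> 0"
    using iffD1[OF tendsto_dist_iff g] by (simp add: dist_H01 e dg)
  then have "X \<longlonglongrightarrow> H01_of f" by (rule iffD2[OF tendsto_dist_iff])
  then show "convergent X" by (auto simp: convergent_def)
qed

instance H01 :: second_countable_topology
proof
  let ?e = "\<lambda>u. wderiv (H01_embed u)"
  obtain B :: "L2 set set" where B: "countable B" "topological_basis B"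
    using ex_countable_basis by blast
  let ?B = "(\<lambda>b. ?e -` b) ` B"
  have "topological_basis ?B"
  proof (rule topological_basisI)
    have "continuous_on UNIV ?e" unfolding continuous_on_iff by (auto simp: dist_H01)
    moreover fix b assume "b \<in> ?B"
    ultimately show "open b" using B(2) by (auto intro!: open_vimage dest: topological_basis_open)
  next
    fix U :: "H01 set" and u assume "open U" "u \<in> U"
    then obtain e where e: "e > 0" "ball u e \<subseteq> U" by (meson openE)
    obtain b where b: "b \<in> B" "?e u \<in> b" "b \<subseteq> ball (?e u) e"
      using topological_basisE[OF B(2) open_ball, of "?e u" "?e u" e] e by auto
    have "?e -` b \<subseteq> ball u e" using b by (auto simp: dist_H01)
    then show "\<exists>b\<in>?B. u \<in> b \<and> b \<subseteq> U" using b e by blast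
  qed
  moreover have "countable ?B" using B by simp
  ultimately show "\<exists>B::H01 set set. countable B \<and> open = generate_topology B"
    by (blast dest: topological_basis_imp_subbasis)
qed

definition csubspace :: "'a::complex_vector set \<Rightarrow> bool"
  where "csubspace S \<longleftrightarrow> 0 \<in> S \<and> (\<forall>x\<in>S. \<forall>y\<in>S. x + y \<in> S) \<and> (\<forall>c. \<forall>x\<in>S. c *\<^sub>C x \<in> S)"

definition orthocomp :: "'a::complex_inner set \<Rightarrow> 'a set"
  where "orthocomp S = {x. \<forall>y\<in>S. cinner x y = 0}"

definition orthoproj :: "'a::complex_inner set \<Rightarrow> 'a \<Rightarrow> 'a"
  where "orthoproj S x = (THE y. y \<in> S \<and> x - y \<in> orthocomp S)"

definition C0_group :: "(real \<Rightarrow> 'a::complex_inner \<Rightarrow> 'a) \<Rightarrow> bool"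
  where "C0_group T \<longleftrightarrow>
    (\<forall>t. bounded_linear (T t) \<and> (\<forall>c x. T t (c *\<^sub>C x) = c *\<^sub>C T t x)) \<and>
    T 0 = id \<and> (\<forall>s t. T (s + t) = T s \<circ> T t) \<and> (\<forall>x. continuous_on UNIV (\<lambda>t. T t x))"

definition generated_by :: "(real \<Rightarrow> 'a::complex_inner \<Rightarrow> 'a) \<Rightarrow> 'a set \<Rightarrow> ('a \<Rightarrow> 'a) \<Rightarrow> bool"
  where "generated_by T D A \<longleftrightarrow>
    (\<forall>x y. ((\<lambda>h. (T h x - x) /\<^sub>R h) \<longlongrightarrow> y) (at 0) \<longleftrightarrow> x \<in> D \<and> y = A x)"

(* The product norm on this type is the energy norm; see norm_energy_space. *)
type_synonym energy_space = "H01 \<times> L2"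

lemma norm_energy_space:
  fixes x :: energy_space
  shows "(norm x)\<^sup>2 = (norm (wderiv (H01_embed (fst x))))\<^sup>2 + (norm (snd x))\<^sup>2"
  by (simp add: norm_prod_def norm_H01)

definition wave_domain :: "energy_space set"
  where "wave_domain = {(u, v). H01_embed u \<in> sobolev_H2 \<and> v \<in> sobolev_H01}"

(* Total function; its values outside wave_domain are irrelevant. *)
fun wave_operator :: "energy_space \<Rightarrow> energy_space"
  where "wave_operator (u, v) = (H01_of v, wderiv (wderiv (H01_embed u)))"

definition wave_group :: "real \<Rightarrow> energy_space \<Rightarrow> energy_space"
  where "wave_group = (THE T. C0_group T \<and> generated_by T wave_domain wave_operator)"

definition strip :: "(real \<times> real) set"
  where "strip = {0<..<1} \<times> UNIV"

definition period_cell :: "(real \<times> real) set"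
  where "period_cell = {0<..<1} \<times> {0<..<2}"

(* A jointly measurable version of the velocity field: the second component of
   wave_group t x is only an equivalence class for each t, so arbitrary representatives
   need not form a measurable function of (s, t).  The choice is unique up to null sets. *)
definition velocity :: "energy_space \<Rightarrow> real \<times> real \<Rightarrow> complex"
  where "velocity x = (SOME v. v \<in> borel_measurable (lebesgue_on strip) \<and>
    (AE t in lebesgue. square_integrable (\<lambda>s. v (s, t)) \<and>
      L2_of (\<lambda>s. v (s, t)) = snd (wave_group t x)))"

definition observed_energy :: "(real \<times> real \<Rightarrow> real) \<Rightarrow> energy_space \<Rightarrow> real"
  where "observed_energy b x = (LINT p|lebesgue_on period_cell. b p * (cmod (velocity x p))\<^sup>2)"

definition unobserved :: "(real \<times> real \<Rightarrow> real) \<Rightarrow> energy_space set"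
  where "unobserved b = {x. observed_energy b x = 0}"

definition essentially_bounded_on_strip :: "(real \<times> real \<Rightarrow> real) \<Rightarrow> bool"
  where "essentially_bounded_on_strip b \<longleftrightarrow> b \<in> borel_measurable (lebesgue_on strip) \<and>
    (\<exists>C. AE p in lebesgue_on strip. \<bar>b p\<bar> \<le> C)"

(* The operator B(t)B(t)^*.  For almost every t the section of b at t is measurable and
   essentially bounded, so that the product below is square-integrable. *)
fun damping :: "(real \<times> real \<Rightarrow> real) \<Rightarrow> real \<Rightarrow> energy_space \<Rightarrow> energy_space"
  where "damping b t (u, v) = (0, L2_of (\<lambda>s. complex_of_real (b (s, t)) * rep_L2 v s))"

definition mild_solution ::
    "(real \<times> real \<Rightarrow> real) \<Rightarrow> energy_space \<Rightarrow> (real \<Rightarrow> energy_space) \<Rightarrow> bool"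
  where "mild_solution b x z \<longleftrightarrow> continuous_on {0..} z \<and>
    (\<forall>t\<ge>0. z t = wave_group t x -
      (LINT r:{0..t}|lebesgue. wave_group (t - r) (damping b r (z r))))"

(* Functions on the half-line are encoded as extensional functions, which makes the
   mild solution unique as a function on all of the reals. *)
definition damped_solution :: "(real \<times> real \<Rightarrow> real) \<Rightarrow> energy_space \<Rightarrow> real \<Rightarrow> energy_space"
  where "damped_solution b x = (THE z. z \<in> extensional {0..} \<and> mild_solution b x z)"

definition asymptotically_periodic :: "(real \<times> real \<Rightarrow> real) \<Rightarrow> bool"
  where "asymptotically_periodic b \<longleftrightarrow> (\<forall>x. \<exists>z\<^sub>0 :: real \<Rightarrow> energy_space.
    (\<exists>p>0. \<forall>t\<ge>0. z\<^sub>0 (t + p) = z\<^sub>0 t) \<and>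
    ((\<lambda>t. norm (damped_solution b x t - z\<^sub>0 t)) \<longlongrightarrow> 0) at_top)"

definition damped_stable :: "(real \<times> real \<Rightarrow> real) \<Rightarrow> bool"
  where "damped_stable b \<longleftrightarrow> (\<forall>x. ((\<lambda>t. norm (damped_solution b x t)) \<longlongrightarrow> 0) at_top)"

definition translation_invariant :: "real \<Rightarrow> (real \<times> real) set \<Rightarrow> bool"
  where "translation_invariant \<tau> \<omega> \<longleftrightarrow> (\<lambda>p. p + (0, \<tau>)) ` \<omega> = \<omega>"

definition geometric_control :: "real \<Rightarrow> (real \<times> real) set \<Rightarrow> bool"
  where "geometric_control \<tau> \<omega> \<longleftrightarrow> (\<forall>s\<^sub>0. \<exists>t.
    (infdist (s\<^sub>0 + t) (range (\<lambda>k::int. 2 * real_of_int k)), t) \<in> \<omega> \<inter> {0<..<1} \<times> {0<..<\<tau>})"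

end

theory Submission
  imports Defs
begin

text \<open>
  The undamped wave group \<open>T\<close> has period \<open>2\<close>: by d'Alembert's formula it translates the Riemann
  invariant, a function on the circle of length \<open>2\<close> whose even and odd halves are the slope and the
  velocity.  In terms of \<open>w(t) = T(-t) z(t)\<close> the damped equation therefore becomes \<open>w' = - C(t) w\<close>, where
  \<open>C(t) = T(-t) B(t) B(t)\<^sup>* T(t)\<close> is bounded, positive semidefinite and again periodic with period \<open>2\<close>.
  Since \<open>T\<close> is isometric, \<open>z(t) - z\<^sub>0(t)\<close> has the norm of \<open>w(t) - P x\<close>, so everything is a question about
  the monodromy operator \<open>V\<close>, which maps \<open>w(0)\<close> to \<open>w(2)\<close>.

  The energy balance and \<open>C\<^sup>2 \<le> K C\<close> give the inequality
  \<open>(norm (x - V x))\<^sup>2 \<le> K * ((norm x)\<^sup>2 - (norm (V x))\<^sup>2)\<close>.  Summed over the iterates of \<open>V\<close> it shows that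
  \<open>V ^^ n\<close> tends to zero on the range of \<open>1 - V\<close>, at least like \<open>n powr (- 1/2)\<close> (\<open>decay_range\<close>), hence on the
  closure of this range, whose orthogonal complement consists of the fixed vectors of \<open>V\<close>
  (\<open>fixed_decomposition\<close>).  The quadratic form \<open>q x\<close>, the integral of \<open>inner (C t x) x\<close> over a period, is
  the observed energy of \<open>x\<close> (\<open>observed_energy_eq\<close>).  Up to constant factors it is bounded by the energy
  lost along the damped orbit of \<open>x\<close>, and it bounds the squared displacement of this orbit from \<open>x\<close>
  during the first period (\<open>q_le_loss\<close>, \<open>displacement_le_q\<close>).  So the
  unobserved states are the fixed vectors of \<open>V\<close>, which gives the convergence, and exponential
  convergence is equivalent to coercivity of \<open>q\<close> on their complement (\<open>exponential_iff_coercive\<close>).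
  States \<open>y + z\<close> with \<open>y\<close> unobserved and \<open>z\<close> in the ranges of all powers of \<open>1 - V\<close> converge
  faster than any power of time.  They are dense because infinite products of operators \<open>1 - V ^^ N k\<close>
  with rapidly growing \<open>N k\<close> approximate the identity at every point of the closure of the range of \<open>1 - V\<close>
  (\<open>smooth_approximation\<close>).

  If the damping is the indicator of an open set with the geometric control property, every point of
  the circle has a neighbourhood on which the observed energy bounds the oscillation of the Riemann
  invariant: follow the characteristic starting there until it meets the set, and use a small rectangle
  with characteristic sides (\<open>diamond_controlled\<close>).  Such neighbourhoods can be glued along overlaps, and
  the oscillation over the whole circle bounds the norm because the invariant has mean zero
  (\<open>oscillation_period_ge\<close>).

  That the translation group is the group generated by the wave operator follows without solving any
  resolvent equation: its generator is contained in the wave operator (\<open>wave_T_generator\<close>), which is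
  skew-symmetric, and the generator of an isometric group has no proper skew-symmetric extension
  (\<open>generated_by_skew_extension\<close>).
\<close>

section \<open>Orthogonal projections and averaged operators in Hilbert space\<close>

text \<open>The midpoint of two points of the subspace is no closer to \<open>x\<close> than the infimum of the
  distances, so the parallelogram identity makes every minimising sequence a Cauchy sequence.\<close>

lemma orthogonal_projection_exists:
  fixes R :: "'a::{real_inner,banach} set"
  assumes "closed R" "subspace R"
  obtains r where "r \<in> R" "\<And>u. u \<in> R \<Longrightarrow> inner (x - r) u = 0"
proof -
  have ne: "R \<noteq> {}" using subspace_0[OF assms(2)] by auto
  define d where "d = infdist x R"
  have d0: "d \<ge> 0" by (simp add: d_def infdist_nonneg)
  have le: "d \<le> norm (x - y)" if "y \<in> R" for y
    using infdist_le[OF that, of x] by (simp add: d_def dist_norm)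
  have "\<exists>y\<in>R. norm (x - y) < d + inverse (real (Suc n))" for n
  proof (rule ccontr)
    assume "\<not> ?thesis"
    then have "d + inverse (real (Suc n)) \<le> infdist x R"
      using ne by (auto simp: infdist_def dist_norm not_less intro!: cINF_greatest)
    then show False by (simp add: d_def)
  qed
  then obtain y where y: "\<And>n. y n \<in> R" "\<And>n. norm (x - y n) < d + inverse (real (Suc n))" by metis
  have est: "(norm (y m - y n))\<^sup>2 \<le> (8 * d + 4) * inverse (real (Suc N))" if "m \<ge> N" "n \<ge> N" for m n N
  proof -
    define e where "e = inverse (real (Suc N))"
    have e: "0 < e" "e \<le> 1" by (auto simp: e_def inverse_eq_divide)
    have "inverse (real (Suc k)) \<le> e" if "k \<ge> N" for k
      unfolding e_def by (rule le_imp_inverse_le) (use that in auto)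
    then have b: "norm (x - y m) \<le> d + e" "norm (x - y n) \<le> d + e"
      using y(2)[of m] y(2)[of n] that by (meson add_left_mono less_imp_le order_trans)+
    have "(1/2) *\<^sub>R (y m + y n) \<in> R"
      using assms(2) y by (simp add: subspace_add subspace_scale)
    from le[OF this] have "2 * d \<le> norm (2 *\<^sub>R (x - (1/2) *\<^sub>R (y m + y n)))" by simp
    also have "2 *\<^sub>R (x - (1/2) *\<^sub>R (y m + y n)) = (x - y m) + (x - y n)"
      by (simp add: scaleR_2 algebra_simps)
    finally have "(2 * d)\<^sup>2 \<le> (norm ((x - y m) + (x - y n)))\<^sup>2" using d0 by (intro power_mono) auto
    moreover have "(norm (y m - y n))\<^sup>2 + (norm ((x - y m) + (x - y n)))\<^sup>2
        = 2 * (norm (x - y m))\<^sup>2 + 2 * (norm (x - y n))\<^sup>2"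
      by (simp add: power2_norm_eq_inner inner_diff_left inner_diff_right inner_add_left inner_add_right
          inner_commute algebra_simps)
    moreover have "(norm (x - y m))\<^sup>2 \<le> (d + e)\<^sup>2" "(norm (x - y n))\<^sup>2 \<le> (d + e)\<^sup>2"
      using b by (auto intro: power_mono)
    ultimately have "(norm (y m - y n))\<^sup>2 \<le> 4 * (d + e)\<^sup>2 - (2 * d)\<^sup>2" by linarith
    also have "\<dots> = (8 * d + 4 * e) * e" by (simp add: power2_eq_square algebra_simps)
    also have "\<dots> \<le> (8 * d + 4) * e" using e by (intro mult_right_mono) auto
    finally show ?thesis by (simp add: e_def)
  qed
  have "Cauchy y"
    unfolding Cauchy_iff
  proof (intro allI impI)
    fix e :: real assume "e > 0"
    have "(\<lambda>N. (8 * d + 4) * inverse (real (Suc N))) \<longlonglongrightarrow> (8 * d + 4) * 0"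
      by (intro tendsto_mult tendsto_const LIMSEQ_inverse_real_of_nat)
    then have "\<forall>\<^sub>F N in sequentially. (8 * d + 4) * inverse (real (Suc N)) < e\<^sup>2"
      by (rule order_tendstoD) (use \<open>e > 0\<close> in simp)
    then obtain N where N: "(8 * d + 4) * inverse (real (Suc N)) < e\<^sup>2"
      by (auto simp: eventually_sequentially)
    have "norm (y m - y n) < e" if "m \<ge> N" "n \<ge> N" for m n
      using le_less_trans[OF est[OF that] N] \<open>e > 0\<close> by (simp add: power2_less_imp_less)
    then show "\<exists>M. \<forall>m\<ge>M. \<forall>n\<ge>M. norm (y m - y n) < e" by blast
  qed
  then obtain r where r: "y \<longlonglongrightarrow> r" using Cauchy_convergent convergent_def by blast
  have rR: "r \<in> R" by (rule closed_sequentially[OF assms(1) y(1) r])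
  have "norm (x - r) \<le> d"
  proof (rule LIMSEQ_le)
    show "(\<lambda>n. norm (x - y n)) \<longlonglongrightarrow> norm (x - r)" by (intro tendsto_intros r)
    show "(\<lambda>n. d + inverse (real (Suc n))) \<longlonglongrightarrow> d"
      using tendsto_add[OF tendsto_const[of d] LIMSEQ_inverse_real_of_nat] by simp
  qed (use y(2) less_imp_le in blast)
  then have nr: "norm (x - r) = d" using le[OF rR] by simp
  have "inner (x - r) u = 0" if u: "u \<in> R" for u
  proof (cases "u = 0")
    case False
    define s where "s = inner (x - r) u / (norm u)\<^sup>2"
    have "r + s *\<^sub>R u \<in> R" using assms(2) rR u by (simp add: subspace_add subspace_scale)
    from le[OF this] have "d\<^sup>2 \<le> (norm ((x - r) - s *\<^sub>R u))\<^sup>2"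
      using d0 by (intro power_mono) (auto simp: algebra_simps)
    also have "\<dots> = d\<^sup>2 - 2 * s * inner (x - r) u + s\<^sup>2 * (norm u)\<^sup>2"
      unfolding nr[symmetric] power2_norm_eq_inner
      by (simp add: inner_diff_left inner_diff_right inner_commute power2_eq_square algebra_simps)
    also have "\<dots> = d\<^sup>2 - (inner (x - r) u)\<^sup>2 / (norm u)\<^sup>2"
      using False by (simp add: s_def power2_eq_square field_simps)
    finally have "(inner (x - r) u)\<^sup>2 / (norm u)\<^sup>2 \<le> 0" by simp
    then show ?thesis using False by (simp add: divide_le_0_iff)
  qed simp
  with rR that show thesis by blast
qed

lemma subspace_closure:
  fixes S :: "'a::real_normed_vector set"
  assumes "subspace S"
  shows "subspace (closure S)"
proof (rule subspaceI)
  show "0 \<in> closure S" using subspace_0[OF assms] closure_subset by blast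
  show "x + y \<in> closure S" if "x \<in> closure S" "y \<in> closure S" for x y
  proof -
    from that obtain f g where "\<And>n. f n \<in> S" "f \<longlonglongrightarrow> x" "\<And>n. g n \<in> S" "g \<longlonglongrightarrow> y"
      unfolding closure_sequential by blast
    then show ?thesis unfolding closure_sequential
      by (intro exI[of _ "\<lambda>n. f n + g n"]) (auto intro: tendsto_add subspace_add[OF assms])
  qed
  show "c *\<^sub>R x \<in> closure S" if "x \<in> closure S" for c x
  proof -
    from that obtain f where "\<And>n. f n \<in> S" "f \<longlonglongrightarrow> x"
      unfolding closure_sequential by blast
    then show ?thesis unfolding closure_sequential
      by (intro exI[of _ "\<lambda>n. c *\<^sub>R f n"]) (auto intro: tendsto_intros subspace_scale[OF assms])
  qed
qed

text \<open>The displacement is controlled by the loss of energy. For a linear operator this says that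
  \<open>V\<close> is a convex combination of the identity and a contraction, with the weight \<open>K / (K + 1)\<close>
  on the contraction.\<close>

locale averaged_operator =
  fixes V :: "'a::{real_inner,banach} \<Rightarrow> 'a" and K :: real
  assumes linear_V: "linear V"
    and averaged: "(norm (x - V x))\<^sup>2 \<le> K * ((norm x)\<^sup>2 - (norm (V x))\<^sup>2)"
    and K_pos: "K > 0"
begin

lemma contraction: "norm (V x) \<le> norm x"
proof -
  have "0 \<le> K * ((norm x)\<^sup>2 - (norm (V x))\<^sup>2)" using averaged[of x] zero_le_power2 order_trans by blast
  then have "(norm (V x))\<^sup>2 \<le> (norm x)\<^sup>2" using K_pos by (simp add: zero_le_mult_iff)
  then show ?thesis by (rule power2_le_imp_le) simp
qed

lemma linear_pow: "linear (V ^^ n)"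
proof (induction n)
  case (Suc n)
  then show ?case using linear_compose[OF Suc linear_V] by (simp add: comp_def)
qed (simp add: linear_id[unfolded id_def])

lemmas pow_simps = linear_add[OF linear_pow] linear_diff[OF linear_pow] linear_0[OF linear_pow]
  linear_cmul[OF linear_pow] linear_neg[OF linear_pow]

lemma contraction_pow: "norm ((V ^^ n) x) \<le> norm x"
  by (induction n) (auto intro: order_trans[OF contraction])

lemma decreasing_pow: "m \<le> n \<Longrightarrow> norm ((V ^^ n) x) \<le> norm ((V ^^ m) x)"
  using contraction_pow[of "n - m" "(V ^^ m) x"] by (simp flip: funpow_add comp_apply[of "V ^^ (n - m)"])

definition D :: "'a \<Rightarrow> 'a" where "D x = x - V x"

lemma linear_D: "linear D"
  using linear_V by (auto intro!: linearI simp: D_def linear_add linear_cmul algebra_simps)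

lemma D_pow: "D ((V ^^ n) x) = (V ^^ n) (D x)"
  by (simp add: D_def pow_simps funpow_swap1)

lemma Dj_pow: "(D ^^ j) ((V ^^ n) x) = (V ^^ n) ((D ^^ j) x)"
  by (induction j) (auto simp: D_pow)

lemma linear_Dj: "linear (D ^^ j)"
proof (induction j)
  case (Suc j)
  then show ?case using linear_compose[OF Suc linear_D] by (simp add: comp_def)
qed (simp add: linear_id[unfolded id_def])

text \<open>The energy losses of the successive iterates add up to at most the initial energy, and the
  norms of \<open>(V ^^ n) (x - V x)\<close> decrease; so the first \<open>n + 1\<close> of these norms, squared, are all
  at least the last one and have a bounded sum.\<close>

lemma decay_range: "real (Suc n) * (norm ((V ^^ n) (D x)))\<^sup>2 \<le> K * (norm x)\<^sup>2"
proof -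
  have "real (Suc n) * (norm ((V ^^ n) (D x)))\<^sup>2 = (\<Sum>i<Suc n. (norm ((V ^^ n) (D x)))\<^sup>2)" by simp
  also have "\<dots> \<le> (\<Sum>i<Suc n. (norm ((V ^^ i) (D x)))\<^sup>2)"
    by (intro sum_mono power_mono decreasing_pow) auto
  also have "\<dots> \<le> (\<Sum>i<Suc n. K * ((norm ((V ^^ i) x))\<^sup>2 - (norm ((V ^^ Suc i) x))\<^sup>2))"
  proof (rule sum_mono)
    fix i show "(norm ((V ^^ i) (D x)))\<^sup>2 \<le> K * ((norm ((V ^^ i) x))\<^sup>2 - (norm ((V ^^ Suc i) x))\<^sup>2)"
      using averaged[of "(V ^^ i) x"] by (simp add: D_pow[symmetric], simp add: D_def)
  qed
  also have "\<dots> = K * ((norm x)\<^sup>2 - (norm ((V ^^ Suc n) x))\<^sup>2)"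
    unfolding sum_distrib_left[symmetric] sum_lessThan_telescope'[of "\<lambda>i. (norm ((V ^^ i) x))\<^sup>2"] by simp
  also have "\<dots> \<le> K * (norm x)\<^sup>2" using K_pos by simp
  finally show ?thesis .
qed

text \<open>Each of the \<open>j\<close> factors \<open>1 - V\<close> is paired with \<open>n\<close> of the \<open>j * n\<close> iterations and gains a
  factor \<open>K / (n + 1)\<close>.\<close>

lemma decay_iterated_range:
  "real (Suc n) ^ j * (norm ((V ^^ (j * n)) ((D ^^ j) x)))\<^sup>2 \<le> K ^ j * (norm x)\<^sup>2"
proof (induction j)
  case (Suc j)
  have "(V ^^ (Suc j * n)) ((D ^^ Suc j) x) = (V ^^ n) (D ((V ^^ (j * n)) ((D ^^ j) x)))"
    by (simp add: funpow_add D_pow)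
  then have "real (Suc n) ^ Suc j * (norm ((V ^^ (Suc j * n)) ((D ^^ Suc j) x)))\<^sup>2
      = real (Suc n) ^ j * (real (Suc n) * (norm ((V ^^ n) (D ((V ^^ (j * n)) ((D ^^ j) x)))))\<^sup>2)"
    by (simp only: power_Suc ac_simps)
  also have "\<dots> \<le> real (Suc n) ^ j * (K * (norm ((V ^^ (j * n)) ((D ^^ j) x)))\<^sup>2)"
    by (intro mult_left_mono decay_range) auto
  also have "\<dots> = K * (real (Suc n) ^ j * (norm ((V ^^ (j * n)) ((D ^^ j) x)))\<^sup>2)" by simp
  also have "\<dots> \<le> K * (K ^ j * (norm x)\<^sup>2)" using Suc K_pos by (intro mult_left_mono) auto
  finally show ?case by (simp add: ac_simps)
qed simp

lemma pow_range_tendsto: "(\<lambda>n. (V ^^ n) (D x)) \<longlonglongrightarrow> 0"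
proof -
  have b: "(norm ((V ^^ n) (D x)))\<^sup>2 \<le> K * (norm x)\<^sup>2 * inverse (real (Suc n))" for n
    using decay_range[of n x] by (simp add: field_simps)
  have "(\<lambda>n. (norm ((V ^^ n) (D x)))\<^sup>2) \<longlonglongrightarrow> 0"
  proof (rule Lim_null_comparison)
    show "\<forall>\<^sub>F n in sequentially. norm ((norm ((V ^^ n) (D x)))\<^sup>2) \<le> K * (norm x)\<^sup>2 * inverse (real (Suc n))"
      using b by (intro always_eventually) simp
    have "(\<lambda>n. K * (norm x)\<^sup>2 * inverse (real (Suc n))) \<longlonglongrightarrow> K * (norm x)\<^sup>2 * 0"
      by (intro tendsto_mult tendsto_const LIMSEQ_inverse_real_of_nat)
    then show "(\<lambda>n. K * (norm x)\<^sup>2 * inverse (real (Suc n))) \<longlonglongrightarrow> 0" by simp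
  qed
  then have "(\<lambda>n. sqrt ((norm ((V ^^ n) (D x)))\<^sup>2)) \<longlonglongrightarrow> sqrt 0" by (rule tendsto_real_sqrt)
  then show ?thesis by (simp add: tendsto_norm_zero_iff)
qed

lemma pow_closure_range_tendsto:
  assumes "x \<in> closure (range D)"
  shows "(\<lambda>n. (V ^^ n) x) \<longlonglongrightarrow> 0"
proof (rule LIMSEQ_I)
  fix e :: real assume "e > 0"
  then obtain u where u: "dist (D u) x < e / 2"
    using assms unfolding closure_approachable by (metis half_gt_zero imageE)
  from pow_range_tendsto[of u] \<open>e > 0\<close> obtain N where N: "\<And>n. n \<ge> N \<Longrightarrow> norm ((V ^^ n) (D u)) < e / 2"
    using LIMSEQ_D[of _ 0 "e / 2"] by (metis diff_zero half_gt_zero)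
  have "norm ((V ^^ n) x - 0) < e" if "n \<ge> N" for n
  proof -
    have "(V ^^ n) x = (V ^^ n) (D u) - (V ^^ n) (D u - x)" by (simp add: pow_simps)
    then have "norm ((V ^^ n) x) \<le> norm ((V ^^ n) (D u)) + norm ((V ^^ n) (D u - x))"
      by (metis norm_triangle_ineq4)
    then show ?thesis using N[OF that] u contraction_pow[of n "D u - x"] by (simp add: dist_norm)
  qed
  then show "\<exists>N. \<forall>n\<ge>N. norm ((V ^^ n) x - 0) < e" by blast
qed

text \<open>The function \<open>s \<mapsto> (norm (V (y + s u)))\<^sup>2 - (norm (y + s u))\<^sup>2\<close> is nowhere positive and
  vanishes at \<open>0\<close>, so its derivative there, which is twice the difference of the two sides,
  vanishes.\<close>

lemma fixed_inner:
  assumes "V y = y"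
  shows "inner (V u) y = inner u y"
proof -
  define a where "a = inner y (V u - u)"
  \<comment> \<open>The summand \<open>1\<close> keeps the denominator of \<open>s\<close> positive.\<close>
  define k where "k = (norm u)\<^sup>2 + 1"
  have k: "k > 0" by (simp add: k_def add_nonneg_pos)
  define s where "s = a / k"
  have "(norm (V (y + s *\<^sub>R u)))\<^sup>2 \<le> (norm (y + s *\<^sub>R u))\<^sup>2"
    by (intro power_mono contraction) auto
  then have "2 * (s * a) + s\<^sup>2 * (norm (V u))\<^sup>2 \<le> s\<^sup>2 * (norm u)\<^sup>2"
    using assms unfolding power2_norm_eq_inner
    by (simp add: linear_add[OF linear_V] linear_cmul[OF linear_V]
        inner_add_left inner_add_right inner_diff_right a_def inner_commute power2_eq_square algebra_simps)
  moreover have "0 \<le> s\<^sup>2 * (norm (V u))\<^sup>2" by simp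
  moreover have "s\<^sup>2 * (norm u)\<^sup>2 \<le> s\<^sup>2 * k" by (intro mult_left_mono) (auto simp: k_def)
  ultimately have "2 * (s * a) \<le> s\<^sup>2 * k" by linarith
  also have "\<dots> = s * a" using k by (simp add: s_def power2_eq_square)
  finally have "s * a \<le> 0" by (simp add: mult.commute)
  then have "a\<^sup>2 \<le> 0" using k by (simp add: s_def power2_eq_square divide_le_0_iff)
  then show ?thesis by (simp add: a_def inner_diff_right inner_commute)
qed

text \<open>A vector orthogonal to the range of \<open>1 - V\<close> is fixed by \<open>V\<close>, because \<open>V\<close> cannot increase
  its norm; and by the previous lemma every fixed vector is orthogonal to that range.\<close>

lemma fixed_decomposition:
  obtains y where "V y = y" "x - y \<in> closure (range D)"
    "\<And>u. V u = u \<Longrightarrow> inner (x - y) u = 0"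
proof -
  define R where "R = closure (range D)"
  have "subspace (range D)" by (rule linear_subspace_image[OF linear_D subspace_UNIV])
  then have R: "closed R" "subspace R" by (auto simp: R_def intro: subspace_closure)
  obtain r where r: "r \<in> R" "\<And>u. u \<in> R \<Longrightarrow> inner (x - r) u = 0"
    using orthogonal_projection_exists[OF R] by blast
  define y where "y = x - r"
  have "D y \<in> R" unfolding R_def by (rule subsetD[OF closure_subset]) blast
  then have "inner y (D y) = 0" using r(2) by (simp add: y_def)
  then have i: "inner y (V y) = (norm y)\<^sup>2" by (simp add: D_def inner_diff_right power2_norm_eq_inner)
  have "(norm (y - V y))\<^sup>2 = (norm y)\<^sup>2 - 2 * inner y (V y) + (norm (V y))\<^sup>2"
    by (simp add: power2_norm_eq_inner inner_diff_left inner_diff_right inner_commute)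
  also have "\<dots> \<le> 0" using i contraction[of y] power_mono[of "norm (V y)" "norm y" 2] by simp
  finally have Vy: "V y = y" by simp
  have orth: "inner z u = 0" if "V u = u" "z \<in> R" for u z
  proof -
    have "closed {z. inner z u = 0}"
      by (intro closed_Collect_eq continuous_intros)
    moreover have "range D \<subseteq> {z. inner z u = 0}"
      using fixed_inner[OF that(1)] by (auto simp: D_def inner_diff_left)
    ultimately have "R \<subseteq> {z. inner z u = 0}" unfolding R_def by (rule closure_minimal[rotated])
    then show ?thesis using that by auto
  qed
  show thesis
    by (rule that[OF Vy]) (use r orth in \<open>auto simp: y_def R_def\<close>)
qed

text \<open>The approximation is an infinite product of factors \<open>1 - V ^^ N k\<close> applied to \<open>x\<close>. Each of
  them contains a factor \<open>1 - V\<close>, and it changes \<open>x\<close> little when \<open>N k\<close> is large, because the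
  powers of \<open>V\<close> tend to zero at \<open>x\<close>.\<close>

lemma smooth_approximation:
  assumes lim: "(\<lambda>n. (V ^^ n) x) \<longlonglongrightarrow> 0" and "e > 0"
  obtains y where "norm (y - x) < e" "\<And>j. y \<in> range (D ^^ j)"
proof -
  have "\<exists>N. norm ((V ^^ N) x) < e / 4 ^ Suc k" for k
    using LIMSEQ_D[OF lim, of "e / 4 ^ Suc k"] \<open>e > 0\<close> by auto
  then obtain N where N: "\<And>k. norm ((V ^^ N k) x) < e / 4 ^ Suc k" by metis
  define F where "F k z = z - (V ^^ N k) z" for k z
  have Flin: "F k (a - b) = F k a - F k b" for k a b by (simp add: F_def pow_simps)
  have Fn: "norm (F k z) \<le> 2 * norm z" for k z
    using norm_triangle_ineq4[of z "(V ^^ N k) z"] contraction_pow[of "N k" z] by (simp add: F_def)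
  \<comment> \<open>\<open>a m j\<close> is the product of the factors \<open>F j\<close> up to \<open>F (j + m - 1)\<close> applied to \<open>x\<close>.  Each factor
    may double the norm, which the powers of \<open>4\<close> in the choice of \<open>N\<close> compensate.\<close>
  define a where "a = rec_nat (\<lambda>j. x) (\<lambda>m r j. F j (r (Suc j)))"
  have a0: "a 0 j = x" and aS: "a (Suc m) j = F j (a m (Suc j))" for m j by (simp_all add: a_def)
  have step: "norm (a (Suc m) j - a m j) \<le> 2 ^ m * norm ((V ^^ N (j + m)) x)" for m j
  proof (induction m arbitrary: j)
    case 0 then show ?case by (simp add: aS a0 F_def)
  next
    case (Suc m)
    have "norm (a (Suc (Suc m)) j - a (Suc m) j) \<le> 2 * norm (a (Suc m) (Suc j) - a m (Suc j))"
      unfolding aS[of "Suc m" j] aS[of m j] Flin[symmetric] by (rule Fn)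
    also have "\<dots> \<le> 2 * (2 ^ m * norm ((V ^^ N (Suc j + m)) x))" by (intro mult_left_mono Suc) simp
    finally show ?case by simp
  qed
  have step': "norm (a (Suc m) j - a m j) \<le> e / 4 * (1 / 2) ^ m" for m j
  proof -
    have "norm (a (Suc m) j - a m j) \<le> 2 ^ m * (e / 4 ^ Suc (j + m))"
      using step[of m j] N[of "j + m"] by (meson less_imp_le mult_left_mono order_trans zero_le_numeral zero_le_power)
    also have "\<dots> \<le> 2 ^ m * (e / 4 ^ Suc m)"
      using \<open>e > 0\<close> by (intro mult_left_mono divide_left_mono power_increasing) auto
    also have "\<dots> = e / 4 * (1 / 2) ^ m"
      by (simp add: power_divide field_simps flip: power_mult_distrib)
    finally show ?thesis .
  qed
  have sm: "summable (\<lambda>m. a (Suc m) j - a m j)" for j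
    by (rule summable_comparison_test'[where g = "\<lambda>m. e / 4 * (1 / 2) ^ m" and N = 0])
      (auto intro!: summable_mult summable_geometric simp del: times_divide_eq_left simp: step')
  define y where "y j = x + (\<Sum>m. a (Suc m) j - a m j)" for j
  have conv: "(\<lambda>m. a m j) \<longlonglongrightarrow> y j" for j
  proof -
    have "(\<lambda>n. x + (\<Sum>m<n. a (Suc m) j - a m j)) \<longlonglongrightarrow> y j"
      unfolding y_def by (intro tendsto_add tendsto_const summable_LIMSEQ sm)
    then show ?thesis unfolding sum_lessThan_telescope[of "\<lambda>m. a m j"] by (simp add: a0)
  qed
  have "norm (y 0 - x) \<le> (\<Sum>m. e / 4 * (1 / 2) ^ m)"
  proof -
    have "norm (\<Sum>m. a (Suc m) 0 - a m 0) \<le> (\<Sum>m. e / 4 * (1 / 2) ^ m)"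
      by (rule norm_suminf_le[OF step']) (auto intro!: summable_mult summable_geometric)
    then show ?thesis by (simp add: y_def)
  qed
  also have "\<dots> = e / 2" by (subst suminf_mult) (auto simp: suminf_geometric summable_geometric)
  finally have near: "norm (y 0 - x) < e" using \<open>e > 0\<close> by simp
  have yF: "y j = F j (y (Suc j))" for j
  proof (rule LIMSEQ_unique)
    show "(\<lambda>m. a (Suc m) j) \<longlonglongrightarrow> y j" using conv[of j] by (rule LIMSEQ_Suc)
    have "bounded_linear (F j)"
      by (rule bounded_linear_intro[where K = 2])
        (use Fn[of j] in \<open>auto simp: F_def pow_simps algebra_simps\<close>)
    from bounded_linear.tendsto[OF this conv[of "Suc j"]]
    show "(\<lambda>m. a (Suc m) j) \<longlonglongrightarrow> F j (y (Suc j))" by (simp add: aS)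
  qed
  have FD: "F k z = D (\<Sum>i<N k. (V ^^ i) z)" for k z
  proof -
    have "D (\<Sum>i<n. (V ^^ i) z) = z - (V ^^ n) z" for n
      by (induction n) (simp_all only: lessThan_Suc sum.insert finite_lessThan lessThan_iff
          less_irrefl not_False_eq_True linear_add[OF linear_D] lessThan_0 sum.empty linear_0[OF linear_D],
          simp_all add: D_def)
    then show ?thesis by (simp add: F_def)
  qed
  have "y k \<in> range (D ^^ j)" for j k
  proof (induction j arbitrary: k)
    case (Suc j)
    then obtain u where u: "y (Suc k) = (D ^^ j) u" by blast
    have "y k = (D ^^ Suc j) (\<Sum>i<N k. (V ^^ i) u)"
      by (simp add: yF[of k] FD u linear_sum[OF linear_Dj] Dj_pow)
    then show ?case by blast
  qed simp
  with near that show thesis by blast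
qed

end

section \<open>A dissipative evolution equation with bounded coefficients\<close>

lemma set_integrable_bounded:
  fixes h :: "real \<Rightarrow> 'a::{banach, second_countable_topology}"
  assumes "h \<in> borel_measurable borel" "\<And>r. r \<in> {a..b} \<Longrightarrow> norm (h r) \<le> K"
  shows "set_integrable lborel {a..b} h"
  unfolding set_integrable_def
proof (rule Bochner_Integration.integrable_bound[where f = "\<lambda>r. K * indicator {a..b} r"])
  show "integrable lborel (\<lambda>r. K * indicator {a..b} r)"
    by (intro integrable_mult_right integrable_real_indicator) (auto simp: emeasure_lborel_Icc_eq)
  show "(\<lambda>r. indicator {a..b} r *\<^sub>R h r) \<in> borel_measurable lborel" using assms(1) by measurable
  show "AE r in lborel. norm (indicator {a..b} r *\<^sub>R h r) \<le> norm (K * indicator {a..b} r)"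
    using assms(2) by (intro AE_I2) (auto simp: indicator_def intro: order_trans[OF _ abs_ge_self])
qed

lemma norm_set_integral_le:
  fixes h :: "real \<Rightarrow> 'a::{banach, second_countable_topology}"
  assumes "h \<in> borel_measurable borel" "\<And>r. r \<in> {a..b} \<Longrightarrow> norm (h r) \<le> K" "a \<le> b"
  shows "norm (LINT r:{a..b}|lborel. h r) \<le> K * (b - a)"
proof -
  have "norm (LINT r:{a..b}|lborel. h r) \<le> (LINT r:{a..b}|lborel. norm (h r))"
    by (rule set_integral_norm_bound[OF set_integrable_bounded[OF assms(1,2)]])
  also have "\<dots> \<le> (LINT r:{a..b}|lborel. K)"
    by (rule set_integral_mono)
      (use assms in \<open>auto intro!: set_integrable_bounded[where K = "\<bar>K\<bar>"] intro: order_trans[OF _ abs_ge_self]\<close>)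
  also have "\<dots> = K * (b - a)" using assms(3) by (simp add: set_lebesgue_integral_def)
  finally show ?thesis .
qed

lemma set_integral_point [simp]: "(LINT r:{a::real}|lborel. h r) = 0"
proof -
  have "AE r in lborel. r \<noteq> a" by (rule AE_lborel_singleton)
  then have "AE r in lborel. indicator {a} r *\<^sub>R h r = 0" by eventually_elim auto
  then show ?thesis unfolding set_lebesgue_integral_def by (rule integral_eq_zero_AE)
qed

lemma set_integral_inner:
  fixes h :: "'b \<Rightarrow> 'a::{real_inner, banach, second_countable_topology}"
  assumes "set_integrable M A h"
  shows "set_integrable M A (\<lambda>r. inner (h r) m)"
    and "(LINT r:A|M. inner (h r) m) = inner (LINT r:A|M. h r) m"
proof -
  have *: "indicator A r *\<^sub>R inner (h r) m = inner (indicator A r *\<^sub>R h r) m" for r by simp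
  show "set_integrable M A (\<lambda>r. inner (h r) m)"
    using assms unfolding set_integrable_def * by (intro integrable_inner_left)
  show "(LINT r:A|M. inner (h r) m) = inner (LINT r:A|M. h r) m"
    using assms unfolding set_integrable_def set_lebesgue_integral_def * by (intro integral_inner_left)
qed

lemma set_integral_nonneg:
  fixes f :: "'b \<Rightarrow> real"
  assumes "\<And>r. r \<in> A \<Longrightarrow> 0 \<le> f r"
  shows "0 \<le> (LINT r:A|M. f r)"
  unfolding set_lebesgue_integral_def using assms
  by (intro Bochner_Integration.integral_nonneg) (auto simp: indicator_def)

lemma set_integral_split:
  fixes h :: "real \<Rightarrow> 'a::{banach, second_countable_topology}"
  assumes "set_integrable lborel {a..c} h" "a \<le> b" "b \<le> c"
  shows "(LINT r:{a..c}|lborel. h r) = (LINT r:{a..b}|lborel. h r) + (LINT r:{b..c}|lborel. h r)"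
proof -
  have eq: "{a..c} = {a..b} \<union> {b<..c}" using assms by auto
  have i: "set_integrable lborel {a..b} h" "set_integrable lborel {b<..c} h"
    by (rule set_integrable_subset[OF assms(1)]; use assms in auto)+
  have i': "set_integrable lborel {b..c} h"
    by (rule set_integrable_subset[OF assms(1)]) (use assms in auto)
  have "AE r in lborel. r \<noteq> b" by (rule AE_lborel_singleton)
  then have "AE r in lborel. indicator {b<..c} r *\<^sub>R h r = indicator {b..c} r *\<^sub>R h r"
    by eventually_elim (auto simp: indicator_def)
  then have "(LINT r:{b<..c}|lborel. h r) = (LINT r:{b..c}|lborel. h r)"
    unfolding set_lebesgue_integral_def
    using i(2) i' by (intro integral_cong_AE) (auto simp: set_integrable_def)
  moreover have "{a..b} \<inter> {b<..c} = {}" by (auto simp: set_eq_iff)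
  ultimately show ?thesis unfolding eq using set_integral_Un[OF _ i] by simp
qed

text \<open>Over an interval the difference of both sides changes by at most a constant times the
  square of the length, so its derivative vanishes everywhere. In this way the chain rule holds
  although \<open>h\<close> is merely measurable and \<open>f\<close> need not be differentiable at any given time.\<close>

lemma square_norm_primitive:
  fixes h f :: "real \<Rightarrow> 'a::{real_inner, banach, second_countable_topology}"
  assumes h[measurable]: "h \<in> borel_measurable borel" and bound: "\<And>r. r \<in> {0..T} \<Longrightarrow> norm (h r) \<le> K"
    and f: "\<And>t. t \<in> {0..T} \<Longrightarrow> f t = x - (LINT r:{0..t}|lborel. h r)"
    and meas[measurable]: "f \<in> borel_measurable borel"
    and t: "t \<in> {0..T}"
  shows "(norm (f t))\<^sup>2 = (norm x)\<^sup>2 - 2 * (LINT r:{0..t}|lborel. inner (h r) (f r))"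
proof -
  have T: "0 \<le> T" using t by simp
  have K: "0 \<le> K" using bound[of 0] T order_trans[OF norm_ge_zero[of "h 0"]] by simp
  have hi: "set_integrable lborel {a..b} h" if "0 \<le> a" "b \<le> T" for a b
    by (rule set_integrable_bounded[OF h, where K = K]) (use bound that in auto)
  have fd: "f b = f a - (LINT r:{a..b}|lborel. h r)" if "0 \<le> a" "a \<le> b" "b \<le> T" for a b
    using f[of a] f[of b] set_integral_split[OF hi, of 0 b a] that by simp
  have fl: "norm (f b - f a) \<le> K * (b - a)" if "0 \<le> a" "a \<le> b" "b \<le> T" for a b
    using norm_set_integral_le[OF h, of a b K] bound that fd[of a b] by simp
  have fb: "norm (f r) \<le> norm x + K * T" if "r \<in> {0..T}" for r
  proof -
    have "norm (f r) \<le> norm (f 0) + norm (f r - f 0)" by (metis add.commute diff_add_cancel norm_triangle_ineq)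
    moreover have "f 0 = x" using f[of 0] T by (simp add: set_integral_point)
    moreover have "K * (r - 0) \<le> K * T" using that K by (intro mult_left_mono) auto
    ultimately show ?thesis using fl[of 0 r] that by auto
  qed
  have gm: "(\<lambda>r. inner (h r) (f r)) \<in> borel_measurable borel" by measurable
  have gi: "set_integrable lborel {a..b} (\<lambda>r. inner (h r) (f r))" if "0 \<le> a" "b \<le> T" for a b
  proof (rule set_integrable_bounded[OF gm, where K = "K * (norm x + K * T)"])
    fix r assume "r \<in> {a..b}"
    then have r: "r \<in> {0..T}" using that by auto
    have "norm (inner (h r) (f r)) \<le> norm (h r) * norm (f r)" by (simp add: Cauchy_Schwarz_ineq2)
    also have "\<dots> \<le> K * (norm x + K * T)" using bound[OF r] fb[OF r] K by (intro mult_mono) auto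
    finally show "norm (inner (h r) (f r)) \<le> K * (norm x + K * T)" .
  qed
  define \<Phi> where "\<Phi> t = (norm (f t))\<^sup>2 + 2 * (LINT r:{0..t}|lborel. inner (h r) (f r))" for t
  have \<Phi>: "\<bar>\<Phi> b - \<Phi> a\<bar> \<le> 3 * K\<^sup>2 * (b - a)\<^sup>2" if ab: "0 \<le> a" "a \<le> b" "b \<le> T" for a b
  proof -
    define H where "H = (LINT r:{a..b}|lborel. h r)"
    have hai: "set_integrable lborel {a..b} (\<lambda>r. inner (h r) (f a))"
      using hi[of a b] ab by (intro set_integral_inner) auto
    have H: "inner H (f a) = (LINT r:{a..b}|lborel. inner (h r) (f a))"
      unfolding H_def using hi[of a b] ab by (intro set_integral_inner(2)[symmetric]) auto
    have "\<Phi> b - \<Phi> a = ((norm (f b))\<^sup>2 - (norm (f a))\<^sup>2) + 2 * (LINT r:{a..b}|lborel. inner (h r) (f r))"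
      using set_integral_split[OF gi, of 0 b a] ab by (simp add: \<Phi>_def)
    also have "(norm (f b))\<^sup>2 - (norm (f a))\<^sup>2 = (norm H)\<^sup>2 - 2 * inner H (f a)"
      using fd[OF ab] unfolding H_def[symmetric] power2_norm_eq_inner
      by (simp add: inner_diff_left inner_diff_right inner_commute)
    also have "\<dots> + 2 * (LINT r:{a..b}|lborel. inner (h r) (f r))
        = (norm H)\<^sup>2 + 2 * (LINT r:{a..b}|lborel. inner (h r) (f r - f a))"
      using set_integral_diff(2)[OF gi hai] ab by (simp add: H inner_diff_right)
    finally have "\<bar>\<Phi> b - \<Phi> a\<bar> \<le> (norm H)\<^sup>2 + 2 * \<bar>LINT r:{a..b}|lborel. inner (h r) (f r - f a)\<bar>"
      using zero_le_power2[of "norm H"] by linarith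
    moreover have "norm (LINT r:{a..b}|lborel. inner (h r) (f r - f a)) \<le> K * (K * (b - a)) * (b - a)"
    proof (rule norm_set_integral_le)
      fix r assume r: "r \<in> {a..b}"
      have "norm (inner (h r) (f r - f a)) \<le> norm (h r) * norm (f r - f a)" by (simp add: Cauchy_Schwarz_ineq2)
      also have "\<dots> \<le> K * (K * (r - a))" using bound[of r] fl[of a r] K r ab by (intro mult_mono) auto
      also have "\<dots> \<le> K * (K * (b - a))" using K r by (intro mult_left_mono) auto
      finally show "norm (inner (h r) (f r - f a)) \<le> K * (K * (b - a))" .
    qed (use ab in measurable)
    moreover have "(norm H)\<^sup>2 \<le> (K * (b - a))\<^sup>2"
      unfolding H_def using bound ab by (intro power_mono norm_set_integral_le) auto
    ultimately show ?thesis by (simp add: power2_eq_square algebra_simps)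
  qed
  have "\<Phi> t = \<Phi> 0"
  proof (rule has_field_derivative_zero_constant[THEN exE])
    show "convex {0..T}" by simp
    fix r assume r: "r \<in> {0..T}"
    have "((\<lambda>y. (\<Phi> y - \<Phi> r) / (y - r)) \<longlongrightarrow> 0) (at r within {0..T})"
    proof (rule Lim_null_comparison)
      show "\<forall>\<^sub>F y in at r within {0..T}. norm ((\<Phi> y - \<Phi> r) / (y - r)) \<le> 3 * K\<^sup>2 * \<bar>y - r\<bar>"
      proof (simp add: eventually_at_filter, rule always_eventually, intro allI impI)
        fix y assume y: "y \<noteq> r" "0 \<le> y \<and> y \<le> T"
        have "\<bar>\<Phi> y - \<Phi> r\<bar> \<le> 3 * K\<^sup>2 * (y - r)\<^sup>2"
          using \<Phi>[of y r] \<Phi>[of r y] y r by (cases "y \<le> r") (auto simp: abs_minus_commute power2_commute)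
        also have "\<dots> = (3 * K\<^sup>2 * \<bar>y - r\<bar>) * \<bar>y - r\<bar>" by (simp add: power2_eq_square abs_mult_self_eq)
        finally show "\<bar>\<Phi> y - \<Phi> r\<bar> / \<bar>y - r\<bar> \<le> 3 * K\<^sup>2 * \<bar>y - r\<bar>" using y(1) by (simp add: divide_le_eq)
      qed
      show "((\<lambda>y. 3 * K\<^sup>2 * \<bar>y - r\<bar>) \<longlongrightarrow> 0) (at r within {0..T})"
        by (rule tendsto_eq_intros refl tendsto_mult_right_zero | simp)+
    qed
    then show "(\<Phi> has_field_derivative 0) (at r within {0..T})" by (simp add: has_field_derivative_iff)
  next
    fix c assume "\<forall>x\<in>{0..T}. \<Phi> x = c"
    then show "\<Phi> t = \<Phi> 0" using t T by simp
  qed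
  moreover have "\<Phi> 0 = (norm x)\<^sup>2"
    using f[of 0] T by (simp add: \<Phi>_def set_integral_point)
  ultimately show ?thesis by (simp add: \<Phi>_def)
qed

text \<open>The variance of \<open>h\<close> about its mean value \<open>m\<close> is nonnegative.\<close>

lemma square_norm_integral_le:
  fixes h :: "real \<Rightarrow> 'a::{real_inner, banach, second_countable_topology}"
  assumes h[measurable]: "h \<in> borel_measurable borel" and bound: "\<And>r. r \<in> {0..t} \<Longrightarrow> norm (h r) \<le> K"
    and t: "0 \<le> t"
  shows "(norm (LINT r:{0..t}|lborel. h r))\<^sup>2 \<le> t * (LINT r:{0..t}|lborel. (norm (h r))\<^sup>2)"
proof (cases "t = 0")
  case False
  then have t: "t > 0" using t by simp
  define H where "H = (LINT r:{0..t}|lborel. h r)"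
  define m where "m = (1 / t) *\<^sub>R H"
  have K: "0 \<le> K" using bound[of 0] t order_trans[OF norm_ge_zero[of "h 0"]] by simp
  have i: "set_integrable lborel {0..t} h" by (rule set_integrable_bounded[OF h bound])
  have i1: "set_integrable lborel {0..t} (\<lambda>r. (norm (h r))\<^sup>2)"
    by (rule set_integrable_bounded[where K = "K\<^sup>2"]) (auto intro!: power_mono bound)
  have i2: "set_integrable lborel {0..t} (\<lambda>r. inner (h r) m)"
    using i by (rule set_integral_inner)
  have i3: "set_integrable lborel {0..t} (\<lambda>r. (norm m)\<^sup>2)"
    by (rule set_integrable_bounded[where K = "(norm m)\<^sup>2"]) auto
  have "0 \<le> (LINT r:{0..t}|lborel. (norm (h r - m))\<^sup>2)"
    by (rule set_integral_nonneg) auto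
  also have "\<dots> = (LINT r:{0..t}|lborel. ((norm (h r))\<^sup>2 - 2 * inner (h r) m) + (norm m)\<^sup>2)"
    by (intro set_lebesgue_integral_cong)
      (auto simp: power2_norm_eq_inner inner_diff_left inner_diff_right inner_commute)
  also have "\<dots> = (LINT r:{0..t}|lborel. (norm (h r))\<^sup>2) - 2 * (LINT r:{0..t}|lborel. inner (h r) m)
      + (LINT r:{0..t}|lborel. (norm m)\<^sup>2)"
    using i1 i2 i3 by simp
  also have "(LINT r:{0..t}|lborel. inner (h r) m) = inner H m"
    unfolding H_def using i by (rule set_integral_inner)
  also have "(LINT r:{0..t}|lborel. (norm m)\<^sup>2) = t * (norm m)\<^sup>2"
    using t by (simp add: set_lebesgue_integral_def)
  finally have "t * 0 \<le> t * ((LINT r:{0..t}|lborel. (norm (h r))\<^sup>2) - 2 * inner H m + t * (norm m)\<^sup>2)"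
    using t by (intro mult_left_mono) auto
  also have "\<dots> = t * (LINT r:{0..t}|lborel. (norm (h r))\<^sup>2) - (norm H)\<^sup>2"
    using t by (simp add: m_def power2_norm_eq_inner[of H] power_mult_distrib power2_eq_square[of t] field_simps)
  finally show ?thesis by (simp add: H_def)
qed (simp add: set_integral_point)

text \<open>When \<open>w\<close> is replaced by a step function with steps of length \<open>1 / (n + 1)\<close>, the
  composition involves only countably many sections of \<open>F\<close>; these approximations converge
  pointwise.\<close>

lemma caratheodory_measurable:
  fixes F :: "real \<Rightarrow> 'a::metric_space \<Rightarrow> 'b::{metric_space, second_countable_topology}"
  assumes meas: "\<And>y. (\<lambda>r. F r y) \<in> borel_measurable borel"
    and cont: "\<And>r. continuous_on UNIV (F r)" and w: "continuous_on UNIV w"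
  shows "(\<lambda>r. F r (w r)) \<in> borel_measurable borel"
proof (rule borel_measurable_LIMSEQ_metric)
  fix n :: nat
  show "(\<lambda>r. F r (w (real_of_int \<lfloor>real (Suc n) * r\<rfloor> / real (Suc n)))) \<in> borel_measurable borel"
    by (rule measurable_compose_countable[where f = "\<lambda>i r. F r (w (real_of_int i / real (Suc n)))"])
      (auto intro: meas)
next
  fix r :: real
  have "(\<lambda>n. real_of_int \<lfloor>real (Suc n) * r\<rfloor> / real (Suc n)) \<longlonglongrightarrow> r"
  proof (rule LIMSEQ_I)
    fix e :: real assume "e > 0"
    then obtain N where N: "\<And>n. n \<ge> N \<Longrightarrow> inverse (real (Suc n)) < e"
      using LIMSEQ_D[OF LIMSEQ_inverse_real_of_nat \<open>e > 0\<close>] by auto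
    have "norm (real_of_int \<lfloor>real (Suc n) * r\<rfloor> / real (Suc n) - r) \<le> inverse (real (Suc n))" for n
    proof -
      have "\<bar>real_of_int \<lfloor>real (Suc n) * r\<rfloor> - real (Suc n) * r\<bar> \<le> 1" by linarith
      then have "\<bar>real_of_int \<lfloor>real (Suc n) * r\<rfloor> - real (Suc n) * r\<bar> / real (Suc n) \<le> 1 / real (Suc n)"
        by (intro divide_right_mono) auto
      moreover have "real_of_int \<lfloor>real (Suc n) * r\<rfloor> / real (Suc n) - r
          = (real_of_int \<lfloor>real (Suc n) * r\<rfloor> - real (Suc n) * r) / real (Suc n)"
        by (simp add: diff_divide_distrib del: of_nat_Suc)
      ultimately show ?thesis by (simp add: inverse_eq_divide del: of_nat_Suc)
    qed
    then show "\<exists>N. \<forall>n\<ge>N. norm (real_of_int \<lfloor>real (Suc n) * r\<rfloor> / real (Suc n) - r) < e"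
      using N by (meson le_less_trans)
  qed
  moreover have "isCont w r" "isCont (F r) (w r)"
    using w cont by (auto simp: continuous_on_eq_continuous_at)
  ultimately show "(\<lambda>n. F r (w (real_of_int \<lfloor>real (Suc n) * r\<rfloor> / real (Suc n)))) \<longlonglongrightarrow> F r (w r)"
    by (intro isCont_tendsto_compose[of _ "F r"] isCont_tendsto_compose[of _ w])
qed

text \<open>The equation \<open>w' = - C(t) w\<close> for a bounded measurable family of symmetric
  operators with \<open>0 \<le> C(t) \<le> c\<close>. The two-sided bound is stated as
  \<open>C(t)\<^sup>2 \<le> c C(t)\<close>, the form in which it turns dissipated energy into an
  estimate of the speed \<open>C(t) w\<close>.\<close>

locale dissipative_equation =
  fixes C :: "real \<Rightarrow> 'a \<Rightarrow> 'a::{real_inner, banach, second_countable_topology}" and c :: real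
  assumes linear_C: "linear (C r)"
    and coercive_C: "(norm (C r x))\<^sup>2 \<le> c * inner (C r x) x"
    and sym_C: "inner (C r x) y = inner x (C r y)"
    and meas_C: "(\<lambda>r. C r x) \<in> borel_measurable borel"
    and periodic_C: "C (r + 2) x = C r x"
    and c_pos: "c > 0"
begin

lemma C_nonneg: "0 \<le> inner (C r x) x"
proof -
  have "0 \<le> c * inner (C r x) x" by (rule order_trans[OF zero_le_power2 coercive_C])
  then show ?thesis using c_pos by (simp add: zero_le_mult_iff)
qed

lemma C_bound: "norm (C r x) \<le> c * norm x"
proof (cases "C r x = 0")
  case False
  have "norm (C r x) * norm (C r x) \<le> c * (norm (C r x) * norm x)"
    using coercive_C[of r x] c_pos
    by (meson norm_cauchy_schwarz mult_left_mono less_imp_le order_trans power2_eq_square[THEN eq_refl, THEN order_trans, rotated] power2_eq_square[symmetric, THEN eq_refl])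
  then show ?thesis using False by (simp add: mult.left_commute)
qed (use c_pos in simp)

lemmas C_simps = linear_add[OF linear_C] linear_diff[OF linear_C] linear_0[OF linear_C] linear_cmul[OF linear_C]

lemma C_cont: "continuous_on UNIV (C r)"
proof -
  have "bounded_linear (C r)"
    by (rule bounded_linear_intro[where K = c]) (use C_bound[of r] in \<open>auto simp: C_simps mult.commute\<close>)
  then show ?thesis by (rule linear_continuous_on)
qed

lemma C_quadratic_le: "inner (C r x) x \<le> c * (norm x)\<^sup>2"
proof -
  have "inner (C r x) x \<le> norm (C r x) * norm x" by (rule norm_cauchy_schwarz)
  also have "\<dots> \<le> (c * norm x) * norm x" by (intro mult_right_mono C_bound) auto
  finally show ?thesis by (simp add: power2_eq_square)
qed

lemma meas_C_comp: "continuous_on UNIV w \<Longrightarrow> (\<lambda>r. C r (w r)) \<in> borel_measurable borel"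
  by (rule caratheodory_measurable[OF meas_C C_cont])

definition solution :: "'a \<Rightarrow> (real \<Rightarrow> 'a) \<Rightarrow> bool"
  where "solution x w \<longleftrightarrow> continuous_on {0..} w \<and> (\<forall>t\<ge>0. w t = x - (LINT r:{0..t}|lborel. C r (w r)))"

lemma solution_eq: "solution x w \<Longrightarrow> t \<ge> 0 \<Longrightarrow> w t = x - (LINT r:{0..t}|lborel. C r (w r))"
  unfolding solution_def by (elim conjE allE impE)

lemma solution_continuous: "solution x w \<Longrightarrow> continuous_on {0..} w"
  unfolding solution_def by (elim conjE)

lemma continuous_max: "continuous_on {0..} w \<Longrightarrow> continuous_on UNIV (\<lambda>t::real. w (max 0 t))"
  by (rule continuous_on_compose2[where t = "{0..}" and f = "\<lambda>t. max 0 t"]) (auto intro!: continuous_intros)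

lemma continuous_bounded:
  fixes w :: "real \<Rightarrow> 'a"
  assumes "continuous_on {0..} w"
  obtains B where "\<And>r. r \<in> {0..T} \<Longrightarrow> norm (w r) \<le> B"
proof -
  have "compact (w ` {0..T})"
    by (rule compact_continuous_image) (auto intro: continuous_on_subset[OF assms])
  then have "bounded (w ` {0..T})" by (rule compact_imp_bounded)
  then obtain B where "\<forall>r\<in>{0..T}. norm (w r) \<le> B" by (auto simp: bounded_iff)
  then show thesis using that by blast
qed

lemma set_integrable_C:
  assumes "continuous_on {0..} w" "0 \<le> a"
  shows "set_integrable lborel {a..b} (\<lambda>r. C r (w r))"
proof -
  obtain B where B: "\<And>r. r \<in> {0..b} \<Longrightarrow> norm (w r) \<le> B" by (rule continuous_bounded[OF assms(1)]) blast
  have "set_integrable lborel {a..b} (\<lambda>r. C r (w (max 0 r)))"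
  proof (rule set_integrable_bounded[where K = "c * B"])
    show "(\<lambda>r. C r (w (max 0 r))) \<in> borel_measurable borel" by (rule meas_C_comp[OF continuous_max[OF assms(1)]])
    show "norm (C r (w (max 0 r))) \<le> c * B" if "r \<in> {a..b}" for r
      using that assms(2) B[of r] C_bound[of r "w r"] c_pos by (auto intro: order_trans)
  qed
  also have "?this \<longleftrightarrow> ?thesis"
    using assms(2) by (intro set_integrable_cong) auto
  finally show ?thesis .
qed

lemma set_integrable_C_inner:
  assumes w: "continuous_on {0..} w" and v: "continuous_on {0..} v" and "0 \<le> a"
  shows "set_integrable lborel {a..b} (\<lambda>r. inner (C r (w r)) (v r))"
proof -
  obtain B where B: "\<And>r. r \<in> {0..b} \<Longrightarrow> norm (w r) \<le> B" by (rule continuous_bounded[OF w]) blast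
  obtain B' where B': "\<And>r. r \<in> {0..b} \<Longrightarrow> norm (v r) \<le> B'" by (rule continuous_bounded[OF v]) blast
  have [measurable]: "(\<lambda>r. C r (w (max 0 r))) \<in> borel_measurable borel"
    "(\<lambda>r. v (max 0 r)) \<in> borel_measurable borel"
    using continuous_max[OF w] continuous_max[OF v] by (auto intro: meas_C_comp borel_measurable_continuous_onI)
  have "set_integrable lborel {a..b} (\<lambda>r. inner (C r (w (max 0 r))) (v (max 0 r)))"
  proof (rule set_integrable_bounded[where K = "c * B * B'"])
    fix r assume "r \<in> {a..b}"
    then have r: "r \<in> {0..b}" "max 0 r = r" using \<open>0 \<le> a\<close> by auto
    have "norm (inner (C r (w r)) (v r)) \<le> norm (C r (w r)) * norm (v r)" by (simp add: Cauchy_Schwarz_ineq2)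
    also have "\<dots> \<le> (c * B) * B'"
    proof (intro mult_mono)
      show "norm (C r (w r)) \<le> c * B" by (rule order_trans[OF C_bound]) (use B[OF r(1)] c_pos in auto)
      show "0 \<le> c * B" using order_trans[OF norm_ge_zero B[OF r(1)]] c_pos by simp
    qed (use B'[OF r(1)] in auto)
    finally show "norm (inner (C r (w (max 0 r))) (v (max 0 r))) \<le> c * B * B'" using r by simp
  qed measurable
  also have "?this \<longleftrightarrow> ?thesis"
    using assms(3) by (intro set_integrable_cong) auto
  finally show ?thesis .
qed

lemma primitive_continuous:
  fixes h :: "real \<Rightarrow> 'a"
  assumes h: "h \<in> borel_measurable borel" "\<And>T. \<exists>K. \<forall>r\<in>{0..T}. norm (h r) \<le> K"
  shows "continuous_on {0..} (\<lambda>t. LINT r:{0..t}|lborel. h r)"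
  unfolding continuous_on_eq_continuous_within
proof
  fix t :: real assume t: "t \<in> {0..}"
  obtain K where K: "\<And>r. r \<in> {0..t + 1} \<Longrightarrow> norm (h r) \<le> K" using h(2)[of "t + 1"] by blast
  let ?I = "\<lambda>t. LINT r:{0..t}|lborel. h r"
  have L: "norm (?I b - ?I a) \<le> K * (b - a)" if "0 \<le> a" "a \<le> b" "b \<le> t + 1" for a b
  proof -
    have "set_integrable lborel {0..b} h" by (rule set_integrable_bounded[OF h(1), where K = K]) (use K that in auto)
    then have "?I b - ?I a = (LINT r:{a..b}|lborel. h r)" using set_integral_split[of 0 b h a] that by simp
    then show ?thesis using norm_set_integral_le[OF h(1), of a b K] K that by simp
  qed
  have "(?I \<longlongrightarrow> ?I t) (at t within {0..})"
  proof (rule LIM_zero_cancel, rule Lim_null_comparison)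
    have "\<forall>\<^sub>F s in at t within {0..}. dist s t < 1" by (auto simp: eventually_at intro: exI[of _ 1])
    moreover have "\<forall>\<^sub>F s in at t within {0..}. s \<in> {0..}" by (simp add: eventually_at_filter)
    ultimately show "\<forall>\<^sub>F s in at t within {0..}. norm (?I s - ?I t) \<le> K * \<bar>s - t\<bar>"
    proof eventually_elim
      case (elim s)
      then show ?case using L[of s t] L[of t s] t
        by (cases "s \<le> t") (auto simp: dist_real_def norm_minus_commute)
    qed
    show "((\<lambda>s. K * \<bar>s - t\<bar>) \<longlongrightarrow> 0) (at t within {0..})"
      by (rule tendsto_eq_intros refl | simp)+
  qed
  then show "continuous (at t within {0..}) ?I" by (simp add: continuous_within)
qed

text \<open>Picard iteration: the successive differences are at most \<open>norm x * (c t)\<^sup>n / n!\<close>, so they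
  are summable locally uniformly in \<open>t\<close>.\<close>

lemma solution_exists: "\<exists>w. solution x w"
proof -
  define s where "s = rec_nat (\<lambda>t. x) (\<lambda>n w t. x - (LINT r:{0..t}|lborel. C r (w r)))"
  have s0: "s 0 t = x" and sS: "s (Suc n) t = x - (LINT r:{0..t}|lborel. C r (s n r))" for n t
    by (simp_all add: s_def)
  have prim: "continuous_on {0..} (\<lambda>t. LINT r:{0..t}|lborel. C r (w r))" if w: "continuous_on {0..} w" for w
  proof -
    have "continuous_on {0..} (\<lambda>t. LINT r:{0..t}|lborel. C r (w (max 0 r)))"
    proof (rule primitive_continuous)
      show "(\<lambda>r. C r (w (max 0 r))) \<in> borel_measurable borel" by (rule meas_C_comp[OF continuous_max[OF w]])
      fix T
      obtain B where B: "\<And>r. r \<in> {0..T} \<Longrightarrow> norm (w r) \<le> B" by (rule continuous_bounded[OF w]) blast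
      have "norm (C r (w (max 0 r))) \<le> c * B" if "r \<in> {0..T}" for r
        using B[OF that] C_bound[of r "w r"] c_pos that by (auto intro: order_trans)
      then show "\<exists>K. \<forall>r\<in>{0..T}. norm (C r (w (max 0 r))) \<le> K" by blast
    qed
    also have "(\<lambda>t. LINT r:{0..t}|lborel. C r (w (max 0 r))) = (\<lambda>t. LINT r:{0..t}|lborel. C r (w r))"
      by (intro ext set_lebesgue_integral_cong) auto
    finally show ?thesis .
  qed
  have sc: "continuous_on {0..} (s n)" for n
  proof (induction n)
    case 0
    have "s 0 = (\<lambda>t. x)" by (simp add: s0 fun_eq_iff)
    then show ?case by simp
  next
    case (Suc n)
    have "s (Suc n) = (\<lambda>t. x - (LINT r:{0..t}|lborel. C r (s n r)))" by (simp add: sS fun_eq_iff)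
    then show ?case using prim[OF Suc] by (auto intro: continuous_intros)
  qed
  have step: "norm (s (Suc n) t - s n t) \<le> norm x * (c * t) ^ Suc n / fact (Suc n)" if "t \<ge> 0" for n t
    using that
  proof (induction n arbitrary: t)
    case 0
    have "norm (LINT r:{0..t}|lborel. C r x) \<le> c * norm x * (t - 0)"
      by (rule norm_set_integral_le) (use meas_C C_bound 0 in auto)
    then show ?case by (simp add: sS s0 mult_ac)
  next
    case (Suc n)
    have i: "set_integrable lborel {0..t} (\<lambda>r. C r (s m r))" for m by (rule set_integrable_C[OF sc]) simp
    have i': "set_integrable lborel {0..t} (\<lambda>r. C r (s (Suc n) r - s n r))"
      using set_integral_diff(1)[OF i i] by (simp add: C_simps)
    have "s (Suc (Suc n)) t - s (Suc n) t = - (LINT r:{0..t}|lborel. C r (s (Suc n) r - s n r))"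
      using set_integral_diff(2)[OF i i, of "Suc n" n] unfolding sS[of "Suc n"] sS[of n t] by (simp add: C_simps)
    then have "norm (s (Suc (Suc n)) t - s (Suc n) t) \<le> (LINT r:{0..t}|lborel. norm (C r (s (Suc n) r - s n r)))"
      using set_integral_norm_bound[OF i'] by simp
    also have "\<dots> \<le> (LINT r:{0..t}|lborel. norm x * c ^ Suc (Suc n) / fact (Suc n) * r ^ Suc n)"
    proof (rule set_integral_mono)
      show "set_integrable lborel {0..t} (\<lambda>r. norm x * c ^ Suc (Suc n) / fact (Suc n) * r ^ Suc n)"
        by (intro borel_integrable_atLeastAtMost' continuous_intros)
      fix r assume r: "r \<in> {0..t}"
      have "norm (C r (s (Suc n) r - s n r)) \<le> c * norm (s (Suc n) r - s n r)" by (rule C_bound)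
      also have "\<dots> \<le> c * (norm x * (c * r) ^ Suc n / fact (Suc n))"
        using Suc.IH[of r] r c_pos by (intro mult_left_mono) auto
      finally show "norm (C r (s (Suc n) r - s n r)) \<le> norm x * c ^ Suc (Suc n) / fact (Suc n) * r ^ Suc n"
        by (simp add: power_mult_distrib mult_ac)
    qed (use i' in \<open>rule set_integrable_norm\<close>)
    also have "\<dots> = norm x * c ^ Suc (Suc n) / fact (Suc n) * (LINT r:{0..t}|lborel. r ^ Suc n)" by simp
    also have "(LINT r:{0..t}|lborel. r ^ Suc n) = t ^ Suc (Suc n) / real (Suc (Suc n))"
      using integral_power[of 0 t "Suc n"] Suc.prems unfolding set_lebesgue_integral_def by (simp add: mult.commute)
    also have "norm x * c ^ Suc (Suc n) / fact (Suc n) * (t ^ Suc (Suc n) / real (Suc (Suc n)))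
       = norm x * (c * t) ^ Suc (Suc n) / fact (Suc (Suc n))"
      unfolding fact_Suc[of "Suc n"] of_nat_mult by (simp only: times_divide_times_eq power_mult_distrib mult_ac times_divide_eq_left times_divide_eq_right divide_divide_eq_left)
    finally show ?case .
  qed
  define w where "w t = x + (\<Sum>n. s (Suc n) t - s n t)" for t
  have unif: "uniform_limit {0..T} s w sequentially" if T: "0 \<le> T" for T
  proof -
    have "uniform_limit {0..T} (\<lambda>n t. \<Sum>i<n. s (Suc i) t - s i t) (\<lambda>t. \<Sum>n. s (Suc n) t - s n t) sequentially"
    proof (rule Weierstrass_m_test)
      have "summable (\<lambda>n. norm x * (inverse (fact (Suc n)) * (c * T) ^ Suc n))"
        using summable_exp[of "c * T"] by (intro summable_mult) (subst summable_Suc_iff)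
      then show "summable (\<lambda>n. norm x * (c * T) ^ Suc n / fact (Suc n))" by (simp add: field_simps)
      show "norm (s (Suc n) t - s n t) \<le> norm x * (c * T) ^ Suc n / fact (Suc n)" if "t \<in> {0..T}" for n t
        using that c_pos by (intro order_trans[OF step] divide_right_mono mult_left_mono power_mono) auto
    qed
    then have "uniform_limit {0..T} (\<lambda>n t. x + (\<Sum>i<n. s (Suc i) t - s i t)) w sequentially"
      unfolding w_def by (intro uniform_limit_intros)
    moreover have "x + (\<Sum>i<n. s (Suc i) t - s i t) = s n t" for n t
      using sum_lessThan_telescope[of "\<lambda>i. s i t" n] by (simp add: s0)
    ultimately show ?thesis by simp
  qed
  have wc: "continuous_on {0..} w"
    unfolding continuous_on_eq_continuous_within
  proof
    fix t :: real assume t: "t \<in> {0..}"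
    have "continuous_on {0..t + 1} w"
      by (rule uniform_limit_theorem[OF _ unif]) (use t in \<open>auto intro!: always_eventually continuous_on_subset[OF sc]\<close>)
    then have "continuous (at t within {0..t + 1}) w" using t by (auto simp: continuous_on_eq_continuous_within)
    moreover have "at t within {0..t + 1} = at t within {0..}"
      by (rule at_within_nhd[where S = "{..<t + 1}"]) auto
    ultimately show "continuous (at t within {0..}) w" by (simp add: continuous_within)
  qed
  have "w t = x - (LINT r:{0..t}|lborel. C r (w r))" if t: "t \<ge> 0" for t
  proof (rule LIMSEQ_unique)
    have lim: "(\<lambda>n. s n r) \<longlonglongrightarrow> w r" if "r \<in> {0..t}" for r
      by (rule tendsto_uniform_limitI[OF unif[OF t] that])
    show "(\<lambda>n. s (Suc n) t) \<longlonglongrightarrow> w t" by (rule LIMSEQ_Suc, rule lim) (use t in simp)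
    obtain B where B: "\<And>r. r \<in> {0..t} \<Longrightarrow> norm (w r) \<le> B" by (rule continuous_bounded[OF wc]) blast
    have "\<forall>\<^sub>F n in sequentially. \<forall>r\<in>{0..t}. dist (s n r) (w r) < 1"
      using uniform_limitD[OF unif[OF t], of 1] by simp
    then obtain N where N: "\<And>n r. n \<ge> N \<Longrightarrow> r \<in> {0..t} \<Longrightarrow> dist (s n r) (w r) < 1"
      unfolding eventually_sequentially by blast
    have "(\<lambda>n. LINT r:{0..t}|lborel. C r (s (n + N) r)) \<longlonglongrightarrow> (LINT r:{0..t}|lborel. C r (w r))"
      unfolding set_lebesgue_integral_def
    proof (rule integral_dominated_convergence[where w = "\<lambda>r. c * (B + 1) * indicator {0..t} r"])
      show "(\<lambda>r. indicat_real {0..t} r *\<^sub>R C r (w r)) \<in> borel_measurable lborel"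
        using set_integrable_C[OF wc, of 0 t] by (auto simp: set_integrable_def)
      show "(\<lambda>r. indicat_real {0..t} r *\<^sub>R C r (s (n + N) r)) \<in> borel_measurable lborel" for n
        using set_integrable_C[OF sc, of 0 t] by (auto simp: set_integrable_def)
      show "integrable lborel (\<lambda>r. c * (B + 1) * indicator {0..t} r)"
        by (intro integrable_mult_right integrable_real_indicator) (auto simp: emeasure_lborel_Icc_eq)
      show "AE r in lborel. (\<lambda>n. indicat_real {0..t} r *\<^sub>R C r (s (n + N) r)) \<longlonglongrightarrow> indicat_real {0..t} r *\<^sub>R C r (w r)"
      proof (rule AE_I2)
        fix r show "(\<lambda>n. indicat_real {0..t} r *\<^sub>R C r (s (n + N) r)) \<longlonglongrightarrow> indicat_real {0..t} r *\<^sub>R C r (w r)"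
        proof (cases "r \<in> {0..t}")
          case True
          have "(\<lambda>n. s (n + N) r) \<longlonglongrightarrow> w r" using lim[OF True] by (rule LIMSEQ_ignore_initial_segment)
          moreover have "isCont (C r) (w r)" using C_cont[of r] by (simp add: continuous_on_eq_continuous_at)
          ultimately have "(\<lambda>n. C r (s (n + N) r)) \<longlonglongrightarrow> C r (w r)" by (rule isCont_tendsto_compose[rotated])
          then show ?thesis using True by simp
        qed simp
      qed
      show "AE r in lborel. norm (indicat_real {0..t} r *\<^sub>R C r (s (n + N) r)) \<le> c * (B + 1) * indicat_real {0..t} r" for n
      proof (rule AE_I2)
        fix r show "norm (indicat_real {0..t} r *\<^sub>R C r (s (n + N) r)) \<le> c * (B + 1) * indicat_real {0..t} r"
        proof (cases "r \<in> {0..t}")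
          case True
          have "norm (s (n + N) r) \<le> norm (w r) + dist (s (n + N) r) (w r)"
            using norm_triangle_sub[of "s (n + N) r" "w r"] by (simp add: dist_norm)
          also have "\<dots> \<le> B + 1" using B[OF True] N[of "n + N" r] True by simp
          finally have "norm (C r (s (n + N) r)) \<le> c * (B + 1)"
            using C_bound[of r "s (n + N) r"] c_pos by (meson less_imp_le mult_left_mono order_trans)
          then show ?thesis using True by simp
        qed simp
      qed
    qed
    then have "(\<lambda>n. s (Suc (n + N)) t) \<longlonglongrightarrow> x - (LINT r:{0..t}|lborel. C r (w r))"
      unfolding sS by (intro tendsto_diff tendsto_const)
    then show "(\<lambda>n. s (Suc n) t) \<longlonglongrightarrow> x - (LINT r:{0..t}|lborel. C r (w r))"
      using LIMSEQ_offset[of "\<lambda>n. s (Suc n) t" N] by simp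
  qed
  with wc show ?thesis by (auto simp: solution_def)
qed

text \<open>For \<open>y = 0\<close> this is the energy balance; for \<open>y = x\<close> it measures how far the solution has
  moved from its initial value.\<close>

lemma square_norm_solution_diff:
  assumes w: "solution x w" and t: "t \<ge> 0"
  shows "(norm (w t - y))\<^sup>2 = (norm (x - y))\<^sup>2 - 2 * (LINT r:{0..t}|lborel. inner (C r (w r)) (w r - y))"
proof -
  have wc: "continuous_on {0..} w" using w by (simp add: solution_def)
  obtain B where B: "\<And>r. r \<in> {0..t} \<Longrightarrow> norm (w r) \<le> B" by (rule continuous_bounded[OF wc]) blast
  let ?h = "\<lambda>r. C r (w (max 0 r))" and ?f = "\<lambda>r. w (max 0 r) - y"
  have "(norm (?f t))\<^sup>2 = (norm (x - y))\<^sup>2 - 2 * (LINT r:{0..t}|lborel. inner (?h r) (?f r))"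
  proof (rule square_norm_primitive[where T = t])
    show "?h \<in> borel_measurable borel" by (rule meas_C_comp[OF continuous_max[OF wc]])
    show "norm (?h r) \<le> c * B" if "r \<in> {0..t}" for r
      using B[OF that] C_bound[of r "w r"] c_pos that by (auto intro: order_trans)
    show "?f t' = x - y - (LINT r:{0..t'}|lborel. ?h r)" if t': "t' \<in> {0..t}" for t'
    proof -
      have "(LINT r:{0..t'}|lborel. C r (w r)) = (LINT r:{0..t'}|lborel. ?h r)"
        by (intro set_lebesgue_integral_cong) auto
      moreover have "w t' = x - (LINT r:{0..t'}|lborel. C r (w r))"
        using solution_eq[OF w] t' by simp
      moreover have "max 0 t' = t'" using t' by simp
      ultimately show ?thesis by simp
    qed
    show "?f \<in> borel_measurable borel"
      by (intro borel_measurable_continuous_onI continuous_intros continuous_max[OF wc])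
  qed (use t in simp)
  also have "(LINT r:{0..t}|lborel. inner (?h r) (?f r)) = (LINT r:{0..t}|lborel. inner (C r (w r)) (w r - y))"
    by (intro set_lebesgue_integral_cong) auto
  finally show ?thesis using t by simp
qed

lemma solution_add:
  assumes "solution x w" "solution y v"
  shows "solution (x + a *\<^sub>R y) (\<lambda>t. w t + a *\<^sub>R v t)"
  unfolding solution_def
proof (intro conjI allI impI)
  have wv: "continuous_on {0..} w" "continuous_on {0..} v" using assms by (auto simp: solution_def)
  then show "continuous_on {0..} (\<lambda>t. w t + a *\<^sub>R v t)" by (intro continuous_intros)
  fix t :: real assume t: "t \<ge> 0"
  have i: "set_integrable lborel {0..t} (\<lambda>r. C r (w r))" "set_integrable lborel {0..t} (\<lambda>r. C r (v r))"
    using wv by (auto intro: set_integrable_C)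
  then have "(LINT r:{0..t}|lborel. C r (w r + a *\<^sub>R v r)) =
      (LINT r:{0..t}|lborel. C r (w r)) + a *\<^sub>R (LINT r:{0..t}|lborel. C r (v r))"
    by (simp add: C_simps)
  moreover have "w t = x - (LINT r:{0..t}|lborel. C r (w r))" "v t = y - (LINT r:{0..t}|lborel. C r (v r))"
    using solution_eq[OF assms(1) t] solution_eq[OF assms(2) t] by simp_all
  ultimately show "w t + a *\<^sub>R v t = x + a *\<^sub>R y - (LINT r:{0..t}|lborel. C r (w r + a *\<^sub>R v r))"
    by (simp add: scaleR_diff_right)
qed

lemma solution_unique:
  assumes "solution x w" "solution x v" "t \<ge> 0"
  shows "w t = v t"
proof -
  have d: "solution 0 (\<lambda>t. w t - v t)" using solution_add[OF assms(1,2), of "-1"] by simp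
  have "(norm (w t - v t))\<^sup>2 = - 2 * (LINT r:{0..t}|lborel. inner (C r (w r - v r)) (w r - v r))"
    using square_norm_solution_diff[OF d assms(3), of 0] by simp
  also have "\<dots> \<le> 0" using set_integral_nonneg[of "{0..t}"  "\<lambda>r. inner (C r (w r - v r)) (w r - v r)"] C_nonneg by simp
  finally show ?thesis by simp
qed

definition sol :: "'a \<Rightarrow> real \<Rightarrow> 'a" where "sol x = (SOME w. solution x w)"

lemma solution_sol: "solution x (sol x)"
  unfolding sol_def by (rule someI_ex[OF solution_exists])

lemma sol_eqI: "solution x w \<Longrightarrow> t \<ge> 0 \<Longrightarrow> sol x t = w t"
  by (rule solution_unique[OF solution_sol])

lemmas sol_cont = solution_continuous[OF solution_sol]
lemmas sol_eq = solution_eq[OF solution_sol]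

lemma sol_linear: "t \<ge> 0 \<Longrightarrow> linear (\<lambda>x. sol x t)"
proof (rule linearI)
  assume t: "t \<ge> 0"
  have *: "sol (x + a *\<^sub>R y) t = sol x t + a *\<^sub>R sol y t" for x a y
    by (rule sol_eqI[OF solution_add[OF solution_sol solution_sol] t])
  show "sol (x + y) t = sol x t + sol y t" for x y using *[of x 1 y] by simp
  have "sol 0 t = 0" using *[of 0 "-1" 0] by simp
  then show "sol (a *\<^sub>R x) t = a *\<^sub>R sol x t" for a x using *[of 0 a x] by simp
qed

lemma sol_energy:
  assumes "t \<ge> 0"
  shows "(norm (sol x t))\<^sup>2 = (norm x)\<^sup>2 - 2 * (LINT r:{0..t}|lborel. inner (C r (sol x r)) (sol x r))"
  using square_norm_solution_diff[OF solution_sol assms, of x 0] by simp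

lemma C_integral_mono:
  assumes "0 \<le> s" "s \<le> t" "continuous_on {0..} w"
  shows "(LINT r:{0..s}|lborel. inner (C r (w r)) (w r)) \<le> (LINT r:{0..t}|lborel. inner (C r (w r)) (w r))"
  using set_integral_split[OF set_integrable_C_inner[OF assms(3,3)], of 0 s t]
    set_integral_nonneg[of "{s..t}" "\<lambda>r. inner (C r (w r)) (w r)" lborel] C_nonneg assms by simp

lemma sol_decreasing: "0 \<le> s \<Longrightarrow> s \<le> t \<Longrightarrow> norm (sol x t) \<le> norm (sol x s)"
  using C_integral_mono[of s t "sol x"] sol_energy[of t x] sol_energy[of s x] sol_cont[of x]
  by - (rule power2_le_imp_le, auto)

text \<open>The monodromy operator of the periodic equation.\<close>

definition V :: "'a \<Rightarrow> 'a" where "V x = sol x 2"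

text \<open>By the Cauchy-Schwarz inequality the squared displacement is at most \<open>t\<close> times the
  integral of \<open>(norm (C r w))\<^sup>2 \<le> c * inner (C r w) w\<close>, and twice the integral of
  \<open>inner (C r w) w\<close> is the energy lost.\<close>

lemma sol_near:
  assumes t: "0 \<le> t" "t \<le> 2"
  shows "(norm (x - sol x t))\<^sup>2 \<le> c * ((norm x)\<^sup>2 - (norm (V x))\<^sup>2)"
proof -
  let ?h = "\<lambda>r. C r (sol x (max 0 r))" and ?E = "\<lambda>t. LINT r:{0..t}|lborel. inner (C r (sol x r)) (sol x r)"
  obtain B where B: "\<And>r. r \<in> {0..t} \<Longrightarrow> norm (sol x r) \<le> B" by (rule continuous_bounded[OF sol_cont]) blast
  have hm: "?h \<in> borel_measurable borel" by (rule meas_C_comp[OF continuous_max[OF sol_cont]])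
  have hb: "norm (?h r) \<le> c * B" if "r \<in> {0..t}" for r
  proof -
    have "norm (C r (sol x r)) \<le> c * B"
      by (rule order_trans[OF C_bound]) (use B[OF that] c_pos in simp)
    then show ?thesis using that by simp
  qed
  have hb': "norm (C r (sol x r)) \<le> c * B" if "0 \<le> r" "r \<le> t" for r using hb[of r] that by simp
  have "x - sol x t = (LINT r:{0..t}|lborel. C r (sol x r))" using sol_eq[of t x] t by simp
  also have "\<dots> = (LINT r:{0..t}|lborel. ?h r)" by (intro set_lebesgue_integral_cong) auto
  finally have "(norm (x - sol x t))\<^sup>2 \<le> t * (LINT r:{0..t}|lborel. (norm (?h r))\<^sup>2)"
    using square_norm_integral_le[OF hm hb] t by simp
  also have "(LINT r:{0..t}|lborel. (norm (?h r))\<^sup>2) \<le> (LINT r:{0..t}|lborel. c * inner (C r (sol x r)) (sol x r))"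
  proof (rule set_integral_mono)
    show "set_integrable lborel {0..t} (\<lambda>r. (norm (?h r))\<^sup>2)"
      using hm by (intro set_integrable_bounded[where K = "(c * B)\<^sup>2"]) (auto intro!: power_mono hb')
    show "set_integrable lborel {0..t} (\<lambda>r. c * inner (C r (sol x r)) (sol x r))"
      using set_integrable_C_inner[OF sol_cont sol_cont, of 0 t] by simp
  qed (use coercive_C in auto)
  also have "\<dots> = c * ?E t" by simp
  also have "t * (c * ?E t) \<le> 2 * (c * ?E 2)"
    using t C_integral_mono[OF t sol_cont, of x] c_pos C_nonneg
    by (intro mult_mono mult_left_mono mult_nonneg_nonneg set_integral_nonneg) auto
  also have "\<dots> = c * ((norm x)\<^sup>2 - (norm (V x))\<^sup>2)" using sol_energy[of 2 x] by (simp add: V_def)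
  finally show ?thesis using t by (simp add: mult_left_mono)
qed

sublocale averaged_operator V c
proof (rule averaged_operator.intro)
  show "linear V" using sol_linear[of 2] by (simp add: V_def[abs_def])
qed (use sol_near[of 2] c_pos in \<open>auto simp: V_def\<close>)

lemma sol_shift: "t \<ge> 0 \<Longrightarrow> sol x (t + 2) = sol (V x) t"
proof (rule sol_eqI[symmetric])
  show "solution (V x) (\<lambda>t. sol x (t + 2))"
    unfolding solution_def
  proof (intro conjI allI impI)
    show "continuous_on {0..} (\<lambda>t. sol x (t + 2))"
      by (rule continuous_on_compose2[OF sol_cont]) (auto intro!: continuous_intros)
    fix t :: real assume t: "t \<ge> 0"
    have "(LINT r:{0..t + 2}|lborel. C r (sol x r)) = (LINT r:{0..2}|lborel. C r (sol x r)) + (LINT r:{2..t + 2}|lborel. C r (sol x r))"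
      by (rule set_integral_split[OF set_integrable_C[OF sol_cont]]) (use t in auto)
    also have "(LINT r:{2..t + 2}|lborel. C r (sol x r)) = (LINT r:{0..t}|lborel. C r (sol x (r + 2)))"
      unfolding set_lebesgue_integral_def
      by (subst lborel_integral_real_affine[where t = 2 and c = 1])
        (auto simp: indicator_def add.commute periodic_C intro!: Bochner_Integration.integral_cong)
    finally show "sol x (t + 2) = V x - (LINT r:{0..t}|lborel. C r (sol x (r + 2)))"
      using sol_eq[of "t + 2" x] sol_eq[of 2 x] t by (simp add: V_def)
  qed
qed

lemma sol_shifts: "t \<ge> 0 \<Longrightarrow> sol x (t + 2 * real n) = sol ((V ^^ n) x) t"
proof (induction n arbitrary: x)
  case (Suc n)
  have "sol x (t + 2 * real (Suc n)) = sol x ((t + 2 * real n) + 2)" by (simp add: algebra_simps)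
  also have "\<dots> = sol ((V ^^ n) (V x)) t" using Suc by (simp add: sol_shift)
  finally show ?case by (simp add: funpow_swap1)
qed simp

lemma nat_floor_half:
  fixes t :: real
  assumes "t \<ge> 0"
  shows "0 \<le> t - 2 * real (nat \<lfloor>t / 2\<rfloor>)" "t - 2 * real (nat \<lfloor>t / 2\<rfloor>) \<le> 2"
proof -
  have "real (nat \<lfloor>t / 2\<rfloor>) = of_int \<lfloor>t / 2\<rfloor>" using assms by simp
  moreover have "of_int \<lfloor>t / 2\<rfloor> \<le> t / 2" "t / 2 < of_int \<lfloor>t / 2\<rfloor> + 1"
    by (rule of_int_floor_le, rule floor_correct[THEN conjunct2, simplified])
  ultimately show "0 \<le> t - 2 * real (nat \<lfloor>t / 2\<rfloor>)" "t - 2 * real (nat \<lfloor>t / 2\<rfloor>) \<le> 2"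
    by linarith+
qed

lemma sol_le_pow:
  assumes "t \<ge> 0"
  shows "norm (sol x t) \<le> norm ((V ^^ nat \<lfloor>t / 2\<rfloor>) x)"
proof -
  define n where "n = nat \<lfloor>t / 2\<rfloor>"
  have n: "0 \<le> t - 2 * real n" using nat_floor_half(1)[OF assms] by (simp add: n_def)
  have "sol x t = sol ((V ^^ n) x) (t - 2 * real n)" using sol_shifts[OF n, of x n] by simp
  also have "norm \<dots> \<le> norm (sol ((V ^^ n) x) 0)" by (rule sol_decreasing) (use n in auto)
  also have "sol ((V ^^ n) x) 0 = (V ^^ n) x" using sol_eq[of 0] by simp
  finally show ?thesis by (simp add: n_def)
qed

text \<open>The energy that would be dissipated, up to a factor \<open>2\<close>, if the state stayed at \<open>x\<close>.\<close>

definition q :: "'a \<Rightarrow> real" where "q x = (LINT r:{0..2}|lborel. inner (C r x) x)"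

lemma q_integrable: "set_integrable lborel {0..t} (\<lambda>r. inner (C r x) x)"
  using set_integrable_C_inner[of "\<lambda>r. x" "\<lambda>r. x" 0 t] by simp

lemma q_nonneg: "0 \<le> q x"
  unfolding q_def by (intro set_integral_nonneg C_nonneg)

text \<open>The solution stays near its initial value over a period in which little energy is lost, so
  the form evaluated at that value and along the solution differ little.\<close>

lemma q_le_loss: "q x \<le> (1 + 4 * c\<^sup>2) * ((norm x)\<^sup>2 - (norm (V x))\<^sup>2)"
proof -
  define L where "L = (norm x)\<^sup>2 - (norm (V x))\<^sup>2"
  let ?w = "sol x"
  have i: "set_integrable lborel {0..2} (\<lambda>r. inner (C r (?w r)) (?w r))"
    by (rule set_integrable_C_inner[OF sol_cont sol_cont]) simp
  have i2: "set_integrable lborel {0..2::real} (\<lambda>r. 2 * c * (c * L))"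
    by (rule set_integrable_bounded[where K = "\<bar>2 * c * (c * L)\<bar>"]) auto
  have "q x \<le> (LINT r:{0..2}|lborel. 2 * inner (C r (?w r)) (?w r) + 2 * c * (c * L))"
    unfolding q_def
  proof (rule set_integral_mono)
    show "set_integrable lborel {0..2} (\<lambda>r. 2 * inner (C r (?w r)) (?w r) + 2 * c * (c * L))"
      using i i2 by simp
    fix r :: real assume r: "r \<in> {0..2}"
    define d where "d = x - ?w r"
    have "0 \<le> inner (C r (?w r - d)) (?w r - d)" by (rule C_nonneg)
    then have "inner (C r (?w r + d)) (?w r + d) \<le> 2 * inner (C r (?w r)) (?w r) + 2 * inner (C r d) d"
      by (simp add: C_simps inner_add_left inner_add_right inner_diff_left inner_diff_right)
    then have "inner (C r x) x \<le> 2 * inner (C r (?w r)) (?w r) + 2 * inner (C r d) d" by (simp add: d_def)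
    moreover have "inner (C r d) d \<le> c * (c * L)"
      using C_quadratic_le[of r d] sol_near[of r x] r c_pos
      by (simp add: d_def L_def) (meson less_imp_le mult_left_mono order_trans)
    ultimately show "inner (C r x) x \<le> 2 * inner (C r (?w r)) (?w r) + 2 * c * (c * L)" by simp
  qed (rule q_integrable)
  also have "\<dots> = 2 * (LINT r:{0..2}|lborel. inner (C r (?w r)) (?w r)) + 4 * c * (c * L)"
    using i i2 by (subst set_integral_add(2)) (simp_all, simp add: set_lebesgue_integral_def)
  also have "2 * (LINT r:{0..2}|lborel. inner (C r (?w r)) (?w r)) = L"
    using sol_energy[of 2 x] by (simp add: L_def V_def)
  finally show ?thesis by (simp add: L_def power2_eq_square algebra_simps)
qed

text \<open>With \<open>d = w - x\<close>, completing the square gives \<open>inner (C (x + d)) d \<ge> - inner (C x) x / 4\<close>,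
  which bounds the rate at which the distance from \<open>x\<close> can grow.\<close>

lemma displacement_le_q:
  assumes t: "0 \<le> t" "t \<le> 2"
  shows "(norm (sol x t - x))\<^sup>2 \<le> q x / 2"
proof -
  let ?w = "sol x"
  have i: "set_integrable lborel {0..t} (\<lambda>r. inner (C r (?w r)) (?w r - x))"
    by (rule set_integrable_C_inner[OF sol_cont]) (auto intro!: continuous_intros sol_cont)
  have j: "set_integrable lborel {0..t} (\<lambda>r. - (1/4) * inner (C r x) x)" by (intro set_integrable_mult_right q_integrable)
  have "- (1/4) * inner (C r x) x \<le> inner (C r (?w r)) (?w r - x)" for r
  proof -
    define d where "d = ?w r - x"
    have w: "?w r = x + d" by (simp add: d_def)
    have "0 \<le> inner (C r (d + (1/2) *\<^sub>R x)) (d + (1/2) *\<^sub>R x)" by (rule C_nonneg)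
    also have "inner (C r (d + (1/2) *\<^sub>R x)) (d + (1/2) *\<^sub>R x) = inner (C r d) d + inner (C r x) d + inner (C r x) x / 4"
      using sym_C[of r d x] inner_commute[of d "C r x"]
      by (simp add: C_simps inner_add_left inner_add_right field_simps)
    finally have "0 \<le> inner (C r d) d + inner (C r x) d + inner (C r x) x / 4" .
    then show ?thesis by (simp add: w C_simps inner_add_left)
  qed
  then have "- (1/4) * (LINT r:{0..t}|lborel. inner (C r x) x) \<le> (LINT r:{0..t}|lborel. inner (C r (?w r)) (?w r - x))"
    using set_integral_mono[OF j i] unfolding set_integral_mult_right by simp
  moreover have "(norm (?w t - x))\<^sup>2 = - 2 * (LINT r:{0..t}|lborel. inner (C r (?w r)) (?w r - x))"
    using square_norm_solution_diff[OF solution_sol t(1), of x x] by simp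
  moreover have "(LINT r:{0..t}|lborel. inner (C r x) x) \<le> q x"
    unfolding q_def by (rule C_integral_mono[OF t]) simp
  ultimately show ?thesis by linarith
qed

lemma fixed_iff_q: "V y = y \<longleftrightarrow> q y = 0"
proof
  assume "V y = y"
  then show "q y = 0" using q_le_loss[of y] q_nonneg[of y] by simp
next
  assume "q y = 0"
  then show "V y = y" using displacement_le_q[of 2 y] by (simp add: V_def)
qed

lemma sol_fixed:
  assumes "q y = 0" "t \<ge> 0"
  shows "sol y t = y"
proof -
  define n where "n = nat \<lfloor>t / 2\<rfloor>"
  have n: "0 \<le> t - 2 * real n" "t - 2 * real n \<le> 2"
    using nat_floor_half[OF assms(2)] by (simp_all only: n_def)
  have "(V ^^ n) y = y" using assms(1) by (induction n) (auto simp: fixed_iff_q)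
  then have "sol y t = sol y (t - 2 * real n)" using sol_shifts[OF n(1), of y n] by simp
  then show ?thesis using displacement_le_q[OF n, of y] assms(1) by simp
qed

lemma sol_diff_fixed:
  assumes "q y = 0" "t \<ge> 0"
  shows "sol x t - y = sol (x - y) t"
  using linear_diff[OF sol_linear[OF assms(2)]] sol_fixed[OF assms] by simp

lemma q_decomposition:
  obtains y where "q y = 0" "\<And>u. q u = 0 \<Longrightarrow> inner (x - y) u = 0"
proof -
  obtain y where "V y = y" "\<And>u. V u = u \<Longrightarrow> inner (x - y) u = 0"
    by (rule fixed_decomposition) blast
  then show thesis using that[of y] by (simp add: fixed_iff_q)
qed

lemma q_projection_unique:
  assumes "q y = 0" "\<And>u. q u = 0 \<Longrightarrow> inner (x - y) u = 0"
    and "q y' = 0" "\<And>u. q u = 0 \<Longrightarrow> inner (x - y') u = 0"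
  shows "y = y'"
proof -
  have "V (y - y') = y - y'" using assms(1,3) by (simp add: linear_diff[OF linear_V] flip: fixed_iff_q)
  then have "q (y - y') = 0" by (simp add: fixed_iff_q)
  then have "inner (x - y') (y - y') - inner (x - y) (y - y') = 0" using assms by simp
  then show ?thesis by (simp flip: inner_diff_left)
qed

text \<open>Between multiples of the period the norm decreases, so the powers of \<open>V\<close> decide; and they
  tend to zero at \<open>x - y\<close>, which lies in the closure of the range of \<open>1 - V\<close>.\<close>

theorem sol_tendsto:
  assumes y: "q y = 0" "\<And>u. q u = 0 \<Longrightarrow> inner (x - y) u = 0"
  shows "((\<lambda>t. norm (sol x t - y)) \<longlongrightarrow> 0) at_top"
proof (rule Lim_null_comparison)
  show "\<forall>\<^sub>F t in at_top. norm (norm (sol x t - y)) \<le> norm ((V ^^ nat \<lfloor>t / 2\<rfloor>) (x - y))"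
    using eventually_ge_at_top[of 0]
    by eventually_elim (simp add: sol_diff_fixed[OF y(1)] sol_le_pow)
  obtain y' where y': "V y' = y'" "x - y' \<in> closure (range D)" "\<And>u. V u = u \<Longrightarrow> inner (x - y') u = 0"
    by (rule fixed_decomposition) blast
  have "y = y'" by (rule q_projection_unique[OF y]) (use y' in \<open>auto simp: fixed_iff_q\<close>)
  then have "(\<lambda>n. (V ^^ n) (x - y)) \<longlonglongrightarrow> 0" using pow_closure_range_tendsto y'(2) by simp
  moreover have "filterlim (\<lambda>t::real. nat \<lfloor>t / 2\<rfloor>) sequentially at_top"
  proof (intro filterlim_compose[OF filterlim_nat_sequentially] filterlim_compose[OF filterlim_floor_sequentially])
    show "filterlim (\<lambda>t::real. t / 2) at_top at_top"
      using filterlim_tendsto_pos_mult_at_top[OF tendsto_const _ filterlim_ident, of "1/2 :: real"] by simp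
  qed
  ultimately have "((\<lambda>t::real. (V ^^ nat \<lfloor>t / 2\<rfloor>) (x - y)) \<longlongrightarrow> 0) at_top"
    by (rule filterlim_compose)
  then show "((\<lambda>t::real. norm ((V ^^ nat \<lfloor>t / 2\<rfloor>) (x - y))) \<longlongrightarrow> 0) at_top" by (rule tendsto_norm_zero)
qed

text \<open>Coercivity makes \<open>V\<close> a strict contraction on the orthogonal complement of its fixed
  vectors. Conversely, if some power \<open>V ^^ n\<close> at least halves all norms there, then \<open>V\<close> must
  move each \<open>x\<close> in this complement by at least \<open>norm x / (2 n)\<close>, and displacements are bounded
  by \<open>q\<close>.\<close>

theorem exponential_iff_coercive:
  assumes P: "\<And>x. q (P x) = 0" "\<And>x u. q u = 0 \<Longrightarrow> inner (x - P x) u = 0"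
  shows "(\<exists>M \<beta>. M > 0 \<and> \<beta> > 0 \<and> (\<forall>x. \<forall>t\<ge>0. norm (sol x t - P x) \<le> M * exp (- \<beta> * t) * norm x)) \<longleftrightarrow>
    (\<exists>\<kappa>>0. \<forall>x. (\<forall>u. q u = 0 \<longrightarrow> inner x u = 0) \<longrightarrow> q x \<ge> \<kappa>\<^sup>2 * (norm x)\<^sup>2)" (is "?L \<longleftrightarrow> ?R")
proof
  assume ?L
  then obtain M \<beta> where M: "M > 0" "\<beta> > 0" "\<And>x t. t \<ge> 0 \<Longrightarrow> norm (sol x t - P x) \<le> M * exp (- \<beta> * t) * norm x"
    by blast
  have "((\<lambda>n. M * exp (- \<beta> * (2 * real n))) \<longlongrightarrow> 0) sequentially"
  proof -
    have "filterlim (\<lambda>n. \<beta> * 2 * real n) at_top sequentially"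
      using M(2) by (intro filterlim_tendsto_pos_mult_at_top[OF tendsto_const] filterlim_real_sequentially) auto
    then have "filterlim (\<lambda>n. - (\<beta> * 2 * real n)) at_bot sequentially" by (simp add: filterlim_uminus_at_bot)
    then have "((\<lambda>n. exp (- (\<beta> * 2 * real n))) \<longlongrightarrow> 0) sequentially"
      by (rule filterlim_compose[OF exp_at_bot])
    then show ?thesis using tendsto_mult_right_zero[of _ sequentially M] by (simp add: mult.assoc)
  qed
  then have "\<forall>\<^sub>F n in sequentially. M * exp (- \<beta> * (2 * real n)) < 1/2" by (rule order_tendstoD) simp
  with eventually_ge_at_top[of 1] have "\<forall>\<^sub>F n in sequentially. n \<ge> 1 \<and> M * exp (- \<beta> * (2 * real n)) < 1/2"
    by (rule eventually_conj)
  then obtain n where n: "n \<ge> 1" "M * exp (- \<beta> * (2 * real n)) < 1/2"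
    unfolding eventually_sequentially by blast
  show ?R
  proof (intro exI[of _ "1 / (2 * real n)"] conjI allI impI)
    show "1 / (2 * real n) > 0" using n by simp
    fix x assume x: "\<forall>u. q u = 0 \<longrightarrow> inner x u = 0"
    have "P x = 0"
      by (rule q_projection_unique[OF P]) (use x in \<open>auto simp: q_def linear_0[OF linear_C]\<close>)
    then have "norm (sol x (0 + 2 * real n)) \<le> M * exp (- \<beta> * (2 * real n)) * norm x" using M(3)[of "2 * real n" x] by simp
    also have "\<dots> \<le> (1/2) * norm x" using n by (intro mult_right_mono) auto
    also have "sol x (0 + 2 * real n) = (V ^^ n) x" using sol_shifts[of 0 x n] sol_eq[of 0 "(V ^^ n) x"] by simp
    finally have half: "norm ((V ^^ n) x) \<le> norm x / 2" by simp
    have "norm (x - (V ^^ m) x) \<le> real m * norm (x - V x)" for m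
    proof (induction m)
      case (Suc m)
      have "x - (V ^^ Suc m) x = (x - (V ^^ m) x) + (V ^^ m) (x - V x)" by (simp add: pow_simps funpow_swap1)
      then have "norm (x - (V ^^ Suc m) x) \<le> norm (x - (V ^^ m) x) + norm ((V ^^ m) (x - V x))"
        by (metis norm_triangle_ineq)
      then show ?case using Suc contraction_pow[of m "x - V x"] by (simp add: algebra_simps)
    qed simp
    from this[of n] have "norm x / 2 \<le> real n * norm (V x - x)"
      using half norm_triangle_ineq2[of x "(V ^^ n) x"] by (simp add: norm_minus_commute)
    then have "(norm x / 2)\<^sup>2 \<le> (real n * norm (V x - x))\<^sup>2" by (intro power_mono) auto
    also have "\<dots> = (real n)\<^sup>2 * (norm (V x - x))\<^sup>2" by (simp add: power_mult_distrib)
    also have "\<dots> \<le> (real n)\<^sup>2 * q x"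
      using displacement_le_q[of 2 x] q_nonneg[of x] by (intro mult_left_mono) (auto simp: V_def)
    finally show "(1 / (2 * real n))\<^sup>2 * (norm x)\<^sup>2 \<le> q x" using n by (simp add: power2_eq_square field_simps)
  qed
next
  assume ?R
  then obtain \<kappa> where \<kappa>: "\<kappa> > 0" "\<And>x. (\<And>u. q u = 0 \<Longrightarrow> inner x u = 0) \<Longrightarrow> q x \<ge> \<kappa>\<^sup>2 * (norm x)\<^sup>2" by blast
  define L where "L = 1 + 4 * c\<^sup>2"
  have L: "L > 0" by (simp add: L_def add_pos_nonneg)
  \<comment> \<open>The lower bound \<open>1/4\<close> only ensures that the rate \<open>\<rho>\<close> is positive and has a logarithm.\<close>
  define \<rho> where "\<rho> = sqrt (max (1/4) (1 - \<kappa>\<^sup>2 / L))"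
  have \<rho>: "\<rho> < 1" "\<rho> > 0" using \<kappa>(1) L by (auto simp: \<rho>_def less_max_iff_disj)
  have \<rho>2: "1 - \<kappa>\<^sup>2 / L \<le> \<rho>\<^sup>2" by (simp add: \<rho>_def le_max_iff_disj)
  have step: "norm (V x) \<le> \<rho> * norm x" if x: "\<And>u. q u = 0 \<Longrightarrow> inner x u = 0" for x
  proof (rule power2_le_imp_le)
    have "\<kappa>\<^sup>2 * (norm x)\<^sup>2 \<le> L * ((norm x)\<^sup>2 - (norm (V x))\<^sup>2)"
      using \<kappa>(2)[OF x] q_le_loss[of x] by (simp add: L_def)
    then have "(norm (V x))\<^sup>2 \<le> (1 - \<kappa>\<^sup>2 / L) * (norm x)\<^sup>2" using L by (simp add: field_simps)
    also have "\<dots> \<le> \<rho>\<^sup>2 * (norm x)\<^sup>2" by (intro mult_right_mono \<rho>2) auto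
    finally show "(norm (V x))\<^sup>2 \<le> (\<rho> * norm x)\<^sup>2" by (simp add: power_mult_distrib)
  qed (use \<rho> in auto)
  have orth: "inner ((V ^^ n) x) u = 0" if "\<And>u. q u = 0 \<Longrightarrow> inner x u = 0" "q u = 0" for n x u
    using that by (induction n) (auto simp: fixed_inner fixed_iff_q)
  have pow: "norm ((V ^^ n) x) \<le> \<rho> ^ n * norm x" if x: "\<And>u. q u = 0 \<Longrightarrow> inner x u = 0" for x n
  proof (induction n)
    case (Suc n)
    have "norm ((V ^^ Suc n) x) \<le> \<rho> * norm ((V ^^ n) x)" using step[OF orth[OF x]] by simp
    also have "\<dots> \<le> \<rho> * (\<rho> ^ n * norm x)" using Suc \<rho> by (intro mult_left_mono) auto
    finally show ?case by simp
  qed simp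
  define \<beta> where "\<beta> = - ln \<rho> / 2"
  show ?L
  proof (rule exI[of _ "1 / \<rho>"], rule exI[of _ \<beta>], intro conjI allI impI)
    show "1 / \<rho> > 0" "\<beta> > 0" using \<rho> by (auto simp: \<beta>_def)
    fix x and t :: real assume t: "t \<ge> 0"
    define n where "n = nat \<lfloor>t / 2\<rfloor>"
    have "t - 2 * real n \<le> 2" unfolding n_def by (rule nat_floor_half(2)[OF t])
    then have n: "t / 2 - 1 \<le> real n" by simp
    have "inner (P x) (x - P x) = 0" using P(2)[OF P(1), of x x] by (simp add: inner_commute)
    then have "(norm x)\<^sup>2 = (norm (P x))\<^sup>2 + (norm (x - P x))\<^sup>2"
      by (simp add: power2_norm_eq_inner inner_diff_left inner_diff_right inner_commute algebra_simps)
    then have xP: "norm (x - P x) \<le> norm x" by - (rule power2_le_imp_le, auto)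
    have "norm (sol x t - P x) = norm (sol (x - P x) t)" by (simp add: sol_diff_fixed[OF P(1) t])
    also have "\<dots> \<le> norm ((V ^^ n) (x - P x))" unfolding n_def by (rule sol_le_pow[OF t])
    also have "\<dots> \<le> \<rho> ^ n * norm (x - P x)" by (rule pow) (rule P(2))
    also have "\<dots> \<le> \<rho> ^ n * norm x" using xP \<rho> by (intro mult_left_mono) auto
    also have "\<rho> ^ n \<le> 1 / \<rho> * exp (- \<beta> * t)"
    proof -
      have "\<rho> ^ n = exp (real n * ln \<rho>)" using \<rho> by (simp add: exp_of_nat_mult)
      also have "\<dots> \<le> exp ((t / 2 - 1) * ln \<rho>)" using n \<rho> by (simp add: mult_right_mono_neg)
      also have "\<dots> = exp (- \<beta> * t) / exp (ln \<rho>)" by (simp add: \<beta>_def exp_diff[symmetric] algebra_simps)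
      finally show ?thesis using \<rho> by simp
    qed
    finally show "norm (sol x t - P x) \<le> 1 / \<rho> * exp (- \<beta> * t) * norm x" by (simp add: mult_right_mono)
  qed
qed

text \<open>Membership in the range of \<open>(1 - V) ^^ j\<close> gives decay of order \<open>t powr (- j / 2)\<close>.\<close>

lemma superpolynomial_decay:
  assumes y: "\<And>j. y \<in> range (D ^^ j)"
  shows "(\<lambda>t. norm (sol y t)) \<in> o[at_top](\<lambda>t. t powr (- \<gamma>))"
proof -
  obtain j :: nat where j: "real j > 2 * \<gamma>" "j \<ge> 1"
    by (metis le_add2 less_le_trans of_nat_le_iff le_add1 reals_Archimedean2)
  obtain u where u: "y = (D ^^ j) u" using y[of j] by blast
  \<comment> \<open>At time \<open>t\<close> each of the \<open>j\<close> factors \<open>1 - V\<close> is given about \<open>t / (2 j)\<close> of the \<open>t / 2\<close> periods.\<close>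
  define B where "B = sqrt ((2 * real j * c) ^ j) * norm u"
  have bound: "norm (sol y t) \<le> B * t powr (- (real j / 2))" if t: "t > 0" for t
  proof -
    define n where "n = nat \<lfloor>t / 2\<rfloor>"
    define m where "m = n div j"
    have jm: "j * m \<le> n" by (simp add: m_def)
    have "n < j * Suc m" using j(2) by (simp add: m_def dividend_less_times_div mult.commute)
    then have "n + 1 \<le> j * Suc m" by simp
    then have "real n + 1 \<le> real j * real (Suc m)" by (metis of_nat_1 of_nat_add of_nat_le_iff of_nat_mult)
    moreover have "t / 2 \<le> real n + 1" using nat_floor_half(2)[of t] t unfolding n_def by linarith
    ultimately have le: "t / (2 * real j) \<le> real (Suc m)" using j(2) by (simp add: field_simps)
    have "norm (sol y t) \<le> norm ((V ^^ n) y)" unfolding n_def by (rule sol_le_pow) (use t in simp)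
    also have "\<dots> \<le> norm ((V ^^ (j * m)) y)" by (rule decreasing_pow[OF jm])
    finally have "(norm (sol y t))\<^sup>2 \<le> (norm ((V ^^ (j * m)) y))\<^sup>2" by (intro power_mono) auto
    then have "(t / (2 * real j)) ^ j * (norm (sol y t))\<^sup>2 \<le> real (Suc m) ^ j * (norm ((V ^^ (j * m)) ((D ^^ j) u)))\<^sup>2"
      unfolding u using t le by (intro mult_mono power_mono) auto
    also have "\<dots> \<le> c ^ j * (norm u)\<^sup>2" by (rule decay_iterated_range)
    finally have "(norm (sol y t))\<^sup>2 \<le> (2 * real j * c) ^ j * (norm u)\<^sup>2 * (1 / t ^ j)"
      using t j(2) by (simp add: power_divide power_mult_distrib field_simps)
    also have "1 / t ^ j = (t powr (- (real j / 2)))\<^sup>2"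
    proof -
      have "(t powr (- (real j / 2)))\<^sup>2 = t powr (- (real j / 2) + - (real j / 2))"
        unfolding power2_eq_square powr_add ..
      also have "- (real j / 2) + - (real j / 2) = - real j" by simp
      also have "t powr (- real j) = 1 / t ^ j" using t by (simp add: powr_minus_divide powr_realpow)
      finally show ?thesis by simp
    qed
    finally have "(norm (sol y t))\<^sup>2 \<le> (B * t powr (- (real j / 2)))\<^sup>2"
      using c_pos by (simp add: B_def power_mult_distrib)
    then show ?thesis by (rule power2_le_imp_le) (use c_pos in \<open>simp add: B_def\<close>)
  qed
  have "(\<lambda>t. norm (sol y t)) \<in> O[at_top](\<lambda>t. t powr (- (real j / 2)))"
    by (rule bigoI[where c = B]) (use bound in \<open>auto intro!: eventually_mono[OF eventually_gt_at_top[of 0]]\<close>)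
  also have "(\<lambda>t. t powr (- (real j / 2))) \<in> o[at_top](\<lambda>t::real. t powr (- \<gamma>))"
    using j(1) by (subst powr_smallo_iff) (auto simp: filterlim_ident)
  finally show ?thesis .
qed

text \<open>The part of \<open>x\<close> orthogonal to the fixed vectors is approximated by vectors in the ranges
  of all powers of \<open>1 - V\<close>; the fixed part is left unchanged.\<close>

theorem superpolynomial_dense:
  assumes P: "q y = 0" "\<And>u. q u = 0 \<Longrightarrow> inner (x - y) u = 0" and "e > 0"
  obtains x' where "norm (x' - x) < e" "\<And>u. q u = 0 \<Longrightarrow> inner (x' - y) u = 0"
    "\<And>\<gamma>. (\<lambda>t. norm (sol x' t - y)) \<in> o[at_top](\<lambda>t. t powr (- \<gamma>))"
proof -
  obtain y' where y': "V y' = y'" "x - y' \<in> closure (range D)" "\<And>u. V u = u \<Longrightarrow> inner (x - y') u = 0"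
    by (rule fixed_decomposition) blast
  have "y = y'" by (rule q_projection_unique[OF P(1,2)]) (use y' in \<open>auto simp: fixed_iff_q\<close>)
  then have "(\<lambda>n. (V ^^ n) (x - y)) \<longlonglongrightarrow> 0" using pow_closure_range_tendsto y'(2) by simp
  from smooth_approximation[OF this \<open>e > 0\<close>] obtain z
    where z: "norm (z - (x - y)) < e" "\<And>j. z \<in> range (D ^^ j)" by blast
  show thesis
  proof (rule that[of "y + z"])
    show "norm (y + z - x) < e" using z(1) by (simp add: algebra_simps)
    show "inner (y + z - y) u = 0" if u: "q u = 0" for u
    proof -
      obtain v where "z = D v" using z(2)[of 1] by auto
      then show ?thesis using fixed_inner[of u v] u by (simp add: D_def inner_diff_left fixed_iff_q)
    qed
    have "\<forall>\<^sub>F t in at_top. norm (sol z t) = norm (sol (y + z) t - y)"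
      using eventually_ge_at_top[of 0] by eventually_elim (simp add: sol_diff_fixed[OF P(1)])
    then show "(\<lambda>t. norm (sol (y + z) t - y)) \<in> o[at_top](\<lambda>t. t powr (- \<gamma>))" for \<gamma>
      using superpolynomial_decay[OF z(2), of \<gamma>] by (subst (asm) landau_o.small.in_cong)
  qed
qed

end

section \<open>Square-integrable functions on the circle\<close>

lemma borel_representative:
  fixes f :: "'a::euclidean_space \<Rightarrow> complex"
  assumes f: "f \<in> borel_measurable (lebesgue_on S)" and S: "S \<in> sets borel"
  obtains f' where "f' \<in> borel_measurable borel" "\<And>s. s \<notin> S \<Longrightarrow> f' s = 0"
    "AE s in lebesgue_on S. f s = f' s" "AE s in lebesgue. s \<in> S \<longrightarrow> f s = f' s"
proof -
  define F where "F s = (if s \<in> S then f s else 0)" for s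
  have F: "F \<in> borel_measurable lebesgue"
    unfolding F_def by (rule borel_measurable_if_I[OF f]) (use S in auto)
  have re: "(\<lambda>s. Re (F s)) \<in> borel_measurable (completion lborel)" and im: "(\<lambda>s. Im (F s)) \<in> borel_measurable (completion lborel)"
    using F by auto
  obtain a where a: "a \<in> borel_measurable lborel" "AE s in lborel. Re (F s) = a s"
    using completion_ex_borel_measurable_real[OF re] by blast
  obtain b where b: "b \<in> borel_measurable lborel" "AE s in lborel. Im (F s) = b s"
    using completion_ex_borel_measurable_real[OF im] by blast
  define f' where "f' s = (if s \<in> S then Complex (a s) (b s) else 0)" for s
  have "(\<lambda>s. Complex (a s) (b s)) = (\<lambda>s. of_real (a s) + \<i> * of_real (b s))" by (simp add: fun_eq_iff complex_eq_iff)
  moreover have "(\<lambda>s. complex_of_real (a s) + \<i> * of_real (b s)) \<in> borel_measurable borel"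
    using a(1) b(1) by measurable
  ultimately have "(\<lambda>s. Complex (a s) (b s)) \<in> borel_measurable borel" by simp
  then have 1: "f' \<in> borel_measurable borel" unfolding f'_def using S by measurable
  have "AE s in lborel. s \<in> S \<longrightarrow> f s = f' s"
    using a(2) b(2) by eventually_elim (auto simp: F_def f'_def complex_eq_iff)
  then have 2: "AE s in lebesgue. s \<in> S \<longrightarrow> f s = f' s" by (rule AE_completion)
  then have "AE s in lebesgue_on S. f s = f' s"
    using S by (subst AE_restrict_space_iff) auto
  with 1 2 show thesis using that[of f'] by (simp add: f'_def)
qed

lemma nn_integral_unit_interval:
  "(\<integral>\<^sup>+s. f s \<partial>unit_interval) = (\<integral>\<^sup>+s. f s * indicator {0<..<1} s \<partial>lborel)"
  by (simp add: nn_integral_restrict_space nn_integral_completion)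

lemma periodic_int:
  fixes g :: "real \<Rightarrow> 'a"
  assumes "\<And>\<xi>. g (\<xi> + 2) = g \<xi>"
  shows "g (\<xi> + 2 * of_int n) = g \<xi>"
proof -
  have nat: "g (\<xi> + 2 * real k) = g \<xi>" for k \<xi>
  proof (induction k)
    case (Suc k)
    have "g (\<xi> + 2 * real (Suc k)) = g ((\<xi> + 2 * real k) + 2)" by (simp add: algebra_simps)
    also have "\<dots> = g (\<xi> + 2 * real k)" by (rule assms)
    finally show ?case using Suc by simp
  qed simp
  show ?thesis
  proof (cases "n \<ge> 0")
    case True
    then show ?thesis using nat[of \<xi> "nat n"] by simp
  next
    case False
    then show ?thesis using nat[of "\<xi> + 2 * of_int n" "nat (- n)"] by simp
  qed
qed

lemma nn_integral_shift:
  fixes F :: "real \<Rightarrow> ennreal"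
  assumes [measurable]: "F \<in> borel_measurable borel"
  shows "(\<integral>\<^sup>+\<xi>. F \<xi> \<partial>lborel) = (\<integral>\<^sup>+\<xi>. F (\<xi> + t) \<partial>lborel)"
  using nn_integral_real_affine[of F 1 t] by (simp add: add.commute)

text \<open>Cut the interval at the even integer in it and move the two pieces by even integers so
  that they fill \<open>[0, 2)\<close>.\<close>

lemma nn_integral_period:
  fixes F :: "real \<Rightarrow> ennreal"
  assumes F[measurable]: "F \<in> borel_measurable borel" and per: "\<And>\<xi>. F (\<xi> + 2) = F \<xi>"
  shows "(\<integral>\<^sup>+\<xi>. F \<xi> * indicator {a..<a + 2} \<xi> \<partial>lborel) = (\<integral>\<^sup>+\<xi>. F \<xi> * indicator {0..<2} \<xi> \<partial>lborel)"
proof -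
  define k where "k = \<lceil>a / 2\<rceil>"
  define d where "d = 2 * of_int k - a"
  have d: "0 \<le> d" "d < 2" unfolding d_def k_def by linarith+
  have shift: "(\<integral>\<^sup>+\<xi>. F \<xi> * indicator {u..<v} \<xi> \<partial>lborel) = (\<integral>\<^sup>+\<xi>. F \<xi> * indicator {u + 2 * of_int n..<v + 2 * of_int n} \<xi> \<partial>lborel)"
    for u v and n :: int
  proof -
    have "(\<integral>\<^sup>+\<xi>. F \<xi> * indicator {u + 2 * of_int n..<v + 2 * of_int n} \<xi> \<partial>lborel)
      = (\<integral>\<^sup>+\<xi>. F (\<xi> + 2 * of_int n) * indicator {u + 2 * of_int n..<v + 2 * of_int n} (\<xi> + 2 * of_int n) \<partial>lborel)"
      by (rule nn_integral_shift) measurable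
    also have "\<dots> = (\<integral>\<^sup>+\<xi>. F \<xi> * indicator {u..<v} \<xi> \<partial>lborel)"
      by (intro nn_integral_cong) (auto simp: periodic_int[of F, OF per] indicator_def)
    finally show ?thesis by simp
  qed
  have split: "(\<integral>\<^sup>+\<xi>. F \<xi> * indicator {u..<w} \<xi> \<partial>lborel)
      = (\<integral>\<^sup>+\<xi>. F \<xi> * indicator {u..<v} \<xi> \<partial>lborel) + (\<integral>\<^sup>+\<xi>. F \<xi> * indicator {v..<w} \<xi> \<partial>lborel)"
    if "u \<le> v" "v \<le> w" for u v w :: real
  proof -
    have "(\<integral>\<^sup>+\<xi>. F \<xi> * indicator {u..<w} \<xi> \<partial>lborel) = (\<integral>\<^sup>+\<xi>. F \<xi> * indicator {u..<v} \<xi> + F \<xi> * indicator {v..<w} \<xi> \<partial>lborel)"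
      using that by (intro nn_integral_cong) (auto simp: indicator_def)
    also have "\<dots> = (\<integral>\<^sup>+\<xi>. F \<xi> * indicator {u..<v} \<xi> \<partial>lborel) + (\<integral>\<^sup>+\<xi>. F \<xi> * indicator {v..<w} \<xi> \<partial>lborel)"
      by (rule nn_integral_add) measurable
    finally show ?thesis .
  qed
  have "(\<integral>\<^sup>+\<xi>. F \<xi> * indicator {a..<a + 2} \<xi> \<partial>lborel)
      = (\<integral>\<^sup>+\<xi>. F \<xi> * indicator {a..<2 * of_int k} \<xi> \<partial>lborel) + (\<integral>\<^sup>+\<xi>. F \<xi> * indicator {2 * of_int k..<a + 2} \<xi> \<partial>lborel)"
    by (rule split) (use d in \<open>auto simp: d_def\<close>)
  also have "(\<integral>\<^sup>+\<xi>. F \<xi> * indicator {a..<2 * of_int k} \<xi> \<partial>lborel) = (\<integral>\<^sup>+\<xi>. F \<xi> * indicator {2 - d..<2} \<xi> \<partial>lborel)"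
    by (subst shift[where n = "1 - k"]) (simp add: d_def algebra_simps)
  also have "(\<integral>\<^sup>+\<xi>. F \<xi> * indicator {2 * of_int k..<a + 2} \<xi> \<partial>lborel) = (\<integral>\<^sup>+\<xi>. F \<xi> * indicator {0..<2 - d} \<xi> \<partial>lborel)"
    by (subst shift[where n = "- k"]) (simp add: d_def algebra_simps)
  also have "(\<integral>\<^sup>+\<xi>. F \<xi> * indicator {2 - d..<2} \<xi> \<partial>lborel) + (\<integral>\<^sup>+\<xi>. F \<xi> * indicator {0..<2 - d} \<xi> \<partial>lborel)
      = (\<integral>\<^sup>+\<xi>. F \<xi> * indicator {0..<2} \<xi> \<partial>lborel)"
    using split[of 0 "2 - d" 2] d by (simp add: add.commute)
  finally show ?thesis .
qed

text \<open>The squared norm in the space of square-integrable functions on the circle of length \<open>2\<close>.\<close>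

definition mass :: "(real \<Rightarrow> complex) \<Rightarrow> ennreal"
  where "mass g = (\<integral>\<^sup>+\<xi>. ennreal ((cmod (g \<xi>))\<^sup>2) * indicator {0..<2} \<xi> \<partial>lborel)"

definition circle_fun :: "(real \<Rightarrow> complex) \<Rightarrow> bool"
  where "circle_fun g \<longleftrightarrow> g \<in> borel_measurable borel \<and> (\<forall>\<xi>. g (\<xi> + 2) = g \<xi>) \<and> mass g < \<infinity>"

lemma circle_funD:
  assumes "circle_fun g"
  shows "g \<in> borel_measurable borel" "g (\<xi> + 2) = g \<xi>" "mass g < \<infinity>"
  using assms by (auto simp: circle_fun_def)

lemma mass_period:
  assumes "g \<in> borel_measurable borel" "\<And>\<xi>. g (\<xi> + 2) = g \<xi>"
  shows "(\<integral>\<^sup>+\<xi>. ennreal ((cmod (g \<xi>))\<^sup>2) * indicator {a..<a + 2} \<xi> \<partial>lborel) = mass g"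
  unfolding mass_def
proof (rule nn_integral_period)
  show "(\<lambda>\<xi>. ennreal ((cmod (g \<xi>))\<^sup>2)) \<in> borel_measurable borel" using assms(1) by measurable
qed (simp add: assms(2))

lemma mass_shift:
  assumes [measurable]: "g \<in> borel_measurable borel" and "\<And>\<xi>. g (\<xi> + 2) = g \<xi>"
  shows "mass (\<lambda>\<xi>. g (\<xi> + t)) = mass g"
proof -
  have "mass g = (\<integral>\<^sup>+\<xi>. ennreal ((cmod (g \<xi>))\<^sup>2) * indicator {t..<t + 2} \<xi> \<partial>lborel)"
    by (rule mass_period[OF assms, symmetric])
  also have "\<dots> = (\<integral>\<^sup>+\<xi>. ennreal ((cmod (g (\<xi> + t)))\<^sup>2) * indicator {t..<t + 2} (\<xi> + t) \<partial>lborel)"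
    by (rule nn_integral_shift) measurable
  also have "\<dots> = mass (\<lambda>\<xi>. g (\<xi> + t))"
    unfolding mass_def by (intro nn_integral_cong) (auto simp: indicator_def)
  finally show ?thesis ..
qed

lemma mass_eq_unit_interval:
  assumes [measurable]: "g \<in> borel_measurable borel" and "\<And>\<xi>. g (\<xi> + 2) = g \<xi>"
  shows "mass g = (\<integral>\<^sup>+s. ennreal ((cmod (g s))\<^sup>2 + (cmod (g (- s)))\<^sup>2) \<partial>unit_interval)"
proof -
  let ?f = "\<lambda>\<xi>. ennreal ((cmod (g \<xi>))\<^sup>2)"
  have "AE \<xi> in lborel. \<xi> \<noteq> (-1::real)" "AE \<xi> in lborel. \<xi> \<noteq> (0::real)" by (rule AE_lborel_singleton)+
  then have ae: "AE \<xi> in lborel. ?f \<xi> * indicator {-1..<1} \<xi> = ?f \<xi> * indicator {0<..<1} \<xi> + ?f \<xi> * indicator {-1<..<0} \<xi>"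
    by eventually_elim (auto simp: indicator_def)
  have "mass g = (\<integral>\<^sup>+\<xi>. ?f \<xi> * indicator {-1..<1} \<xi> \<partial>lborel)"
    using mass_period[OF assms, of "-1"] by simp
  also have "\<dots> = (\<integral>\<^sup>+\<xi>. ?f \<xi> * indicator {0<..<1} \<xi> + ?f \<xi> * indicator {-1<..<0} \<xi> \<partial>lborel)"
    by (rule nn_integral_cong_AE[OF ae])
  also have "\<dots> = (\<integral>\<^sup>+\<xi>. ?f \<xi> * indicator {0<..<1} \<xi> \<partial>lborel) + (\<integral>\<^sup>+\<xi>. ?f \<xi> * indicator {-1<..<0} \<xi> \<partial>lborel)"
    by (rule nn_integral_add) measurable
  also have "(\<integral>\<^sup>+\<xi>. ?f \<xi> * indicator {-1<..<0} \<xi> \<partial>lborel) = (\<integral>\<^sup>+\<xi>. ?f (- \<xi>) * indicator {-1<..<0} (- \<xi>) \<partial>lborel)"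
    by (subst nn_integral_real_affine[where c = "-1" and t = 0]) auto
  also have "\<dots> = (\<integral>\<^sup>+\<xi>. ?f (- \<xi>) * indicator {0<..<1} \<xi> \<partial>lborel)"
    by (intro nn_integral_cong) (auto simp: indicator_def)
  also have "(\<integral>\<^sup>+\<xi>. ?f \<xi> * indicator {0<..<1} \<xi> \<partial>lborel) + \<dots>
      = (\<integral>\<^sup>+\<xi>. ?f \<xi> * indicator {0<..<1} \<xi> + ?f (- \<xi>) * indicator {0<..<1} \<xi> \<partial>lborel)"
    by (rule nn_integral_add[symmetric]) measurable
  also have "\<dots> = (\<integral>\<^sup>+s. ennreal ((cmod (g s))\<^sup>2 + (cmod (g (- s)))\<^sup>2) \<partial>unit_interval)"
    unfolding nn_integral_unit_interval by (intro nn_integral_cong) (auto simp: indicator_def)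
  finally show ?thesis .
qed

lemma circle_fun_square_integrable:
  assumes g: "circle_fun g"
  shows "square_integrable g" "square_integrable (\<lambda>s. g (- s))"
proof -
  note [measurable] = circle_funD(1)[OF g]
  have fin: "(\<integral>\<^sup>+s. ennreal ((cmod (g s))\<^sup>2 + (cmod (g (- s)))\<^sup>2) \<partial>unit_interval) < \<infinity>"
    using mass_eq_unit_interval[OF circle_funD(1,2)[OF g]] circle_funD(3)[OF g] by simp
  have le: "(\<integral>\<^sup>+s. ennreal (norm ((cmod (f s))\<^sup>2)) \<partial>unit_interval) < \<infinity>"
    if "\<And>s. (cmod (f s))\<^sup>2 \<le> (cmod (g s))\<^sup>2 + (cmod (g (- s)))\<^sup>2" for f
    by (rule le_less_trans[OF nn_integral_mono fin]) (auto intro!: ennreal_leI that simp del: ennreal_plus)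
  show "square_integrable g" "square_integrable (\<lambda>s. g (- s))"
    unfolding square_integrable_def
    by (auto intro!: integrableI_bounded le borel_measurable_unit_interval)
qed

text \<open>The even and the odd part of a function on the circle, as functions on a half circle. When
  \<open>g\<close> is the Riemann invariant of a string with fixed ends, these are the slope and the
  velocity.\<close>

definition halves :: "(real \<Rightarrow> complex) \<Rightarrow> L2 \<times> L2"
  where "halves g = (L2_of (\<lambda>s. (g s + g (- s)) / 2), L2_of (\<lambda>s. (g s - g (- s)) / 2))"

lemma square_integrable_halves:
  assumes "circle_fun g"
  shows "square_integrable (\<lambda>s. (g s + g (- s)) / 2)" "square_integrable (\<lambda>s. (g s - g (- s)) / 2)"
proof -
  have "(\<lambda>s. (g s + g (- s)) / 2) = (\<lambda>s. (1/2) * (g s + g (- s)))"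
    "(\<lambda>s. (g s - g (- s)) / 2) = (\<lambda>s. (1/2) * (g s - g (- s)))" by auto
  then show "square_integrable (\<lambda>s. (g s + g (- s)) / 2)" "square_integrable (\<lambda>s. (g s - g (- s)) / 2)"
    using circle_fun_square_integrable[OF assms]
    by (simp_all only: square_integrable_mult_const square_integrable_add square_integrable_diff)
qed

lemma norm_halves:
  assumes g: "circle_fun g"
  shows "mass g = ennreal (2 * (norm (halves g))\<^sup>2)"
proof -
  note si = square_integrable_halves[OF g] circle_fun_square_integrable[OF g]
  have par: "(cmod ((a + b) / 2))\<^sup>2 + (cmod ((a - b) / 2))\<^sup>2 = ((cmod a)\<^sup>2 + (cmod b)\<^sup>2) / 2" for a b
    unfolding cmod_power2 by (simp add: power2_eq_square field_simps)
  have "(norm (halves g))\<^sup>2 = (LINT s|unit_interval. (cmod ((g s + g (- s)) / 2))\<^sup>2) + (LINT s|unit_interval. (cmod ((g s - g (- s)) / 2))\<^sup>2)"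
    unfolding halves_def norm_Pair using si by (simp add: norm_L2_of)
  also have "\<dots> = (LINT s|unit_interval. (cmod ((g s + g (- s)) / 2))\<^sup>2 + (cmod ((g s - g (- s)) / 2))\<^sup>2)"
    by (rule Bochner_Integration.integral_add[symmetric]) (use si in \<open>auto dest: square_integrableD\<close>)
  also have "\<dots> = (LINT s|unit_interval. ((cmod (g s))\<^sup>2 + (cmod (g (- s)))\<^sup>2) / 2)" by (simp only: par)
  finally have "2 * (norm (halves g))\<^sup>2 = (LINT s|unit_interval. (cmod (g s))\<^sup>2 + (cmod (g (- s)))\<^sup>2)" by simp
  also have "ennreal \<dots> = (\<integral>\<^sup>+s. ennreal ((cmod (g s))\<^sup>2 + (cmod (g (- s)))\<^sup>2) \<partial>unit_interval)"
    by (rule nn_integral_eq_integral[symmetric]) (use si in \<open>auto dest: square_integrableD\<close>)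
  also have "\<dots> = mass g" by (rule mass_eq_unit_interval[OF circle_funD(1,2)[OF g], symmetric])
  finally show ?thesis ..
qed

lemma ennreal_lincomb:
  "0 \<le> k \<Longrightarrow> 0 \<le> l \<Longrightarrow> 0 \<le> x \<Longrightarrow> 0 \<le> y \<Longrightarrow>
    ennreal (k * x + l * y) = ennreal k * ennreal x + ennreal l * ennreal y"
  by (simp add: ennreal_mult)

lemma scaleC_minus_one: "(- 1) *\<^sub>C x = - x" for x :: "'a::complex_vector"
  using scaleR_scaleC[of "- 1" x] by simp

lemma circle_fun_add:
  assumes f: "circle_fun f" and g: "circle_fun g"
  shows "circle_fun (\<lambda>\<xi>. f \<xi> + c * g \<xi>)"
proof -
  note [measurable] = circle_funD(1)[OF f] circle_funD(1)[OF g]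
  have *: "(cmod (a + c * b))\<^sup>2 \<le> 2 * (cmod a)\<^sup>2 + 2 * (cmod c)\<^sup>2 * (cmod b)\<^sup>2" for a b
  proof -
    have "(cmod (a + c * b))\<^sup>2 \<le> (cmod a + cmod c * cmod b)\<^sup>2"
      by (intro power_mono order_trans[OF norm_triangle_ineq]) (auto simp: norm_mult)
    also have "\<dots> \<le> 2 * (cmod a)\<^sup>2 + 2 * (cmod c * cmod b)\<^sup>2"
      using sum_squares_bound[of "cmod a" "cmod c * cmod b"] by (simp add: power2_sum)
    finally show ?thesis by (simp add: power_mult_distrib)
  qed
  have "mass (\<lambda>\<xi>. f \<xi> + c * g \<xi>) \<le> (\<integral>\<^sup>+\<xi>. ennreal 2 * (ennreal ((cmod (f \<xi>))\<^sup>2) * indicator {0..<2} \<xi>)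
      + ennreal (2 * (cmod c)\<^sup>2) * (ennreal ((cmod (g \<xi>))\<^sup>2) * indicator {0..<2} \<xi>) \<partial>lborel)"
    unfolding mass_def
  proof (rule nn_integral_mono)
    fix \<xi>
    have "ennreal ((cmod (f \<xi> + c * g \<xi>))\<^sup>2) \<le> ennreal 2 * ennreal ((cmod (f \<xi>))\<^sup>2) + ennreal (2 * (cmod c)\<^sup>2) * ennreal ((cmod (g \<xi>))\<^sup>2)"
      using ennreal_leI[OF *] by (subst ennreal_lincomb[symmetric]) auto
    then show "ennreal ((cmod (f \<xi> + c * g \<xi>))\<^sup>2) * indicator {0..<2} \<xi> \<le> ennreal 2 * (ennreal ((cmod (f \<xi>))\<^sup>2) * indicator {0..<2} \<xi>)
      + ennreal (2 * (cmod c)\<^sup>2) * (ennreal ((cmod (g \<xi>))\<^sup>2) * indicator {0..<2} \<xi>)"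
      by (simp add: indicator_def)
  qed
  also have "\<dots> = ennreal 2 * mass f + ennreal (2 * (cmod c)\<^sup>2) * mass g"
    unfolding mass_def by (subst nn_integral_add) (auto simp: nn_integral_cmult)
  also have "\<dots> < \<infinity>" using circle_funD(3)[OF f] circle_funD(3)[OF g]
    by (simp add: ennreal_mult_less_top ennreal_add_eq_top less_top[symmetric] ennreal_mult_eq_top_iff)
  finally show ?thesis using circle_funD(2)[OF f] circle_funD(2)[OF g] by (simp add: circle_fun_def)
qed

lemma circle_fun_shift:
  assumes g: "circle_fun g"
  shows "circle_fun (\<lambda>\<xi>. g (\<xi> + t))"
proof -
  note [measurable] = circle_funD(1)[OF g]
  have "g (\<xi> + 2 + t) = g (\<xi> + t)" for \<xi> using circle_funD(2)[OF g, of "\<xi> + t"] by (simp add: ac_simps)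
  moreover have "(\<lambda>\<xi>. g (\<xi> + t)) \<in> borel_measurable borel" by measurable
  ultimately show ?thesis using mass_shift[OF circle_funD(1,2)[OF g]] circle_funD(3)[OF g]
    by (simp add: circle_fun_def)
qed

lemma halves_add:
  assumes f: "circle_fun f" and g: "circle_fun g"
  shows "halves (\<lambda>\<xi>. f \<xi> + c * g \<xi>) = halves f + c *\<^sub>C halves g"
proof -
  note s = square_integrable_halves[OF f] square_integrable_halves[OF g]
  have lin: "L2_of (\<lambda>s. a s + c * b s) = L2_of a + c *\<^sub>C L2_of b" if "square_integrable a" "square_integrable b" for a b
    using that by (simp add: L2_of_add L2_of_scaleC square_integrable_mult_const)
  have 1: "(\<lambda>s. (f s + c * g s + (f (- s) + c * g (- s))) / 2) = (\<lambda>s. (f s + f (- s)) / 2 + c * ((g s + g (- s)) / 2))"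
    and 2: "(\<lambda>s. (f s + c * g s - (f (- s) + c * g (- s))) / 2) = (\<lambda>s. (f s - f (- s)) / 2 + c * ((g s - g (- s)) / 2))"
    by (auto simp: field_simps)
  show ?thesis
    unfolding halves_def 1 2 lin[OF s(1,3)] lin[OF s(2,4)] by (simp add: scaleC_prod_def)
qed

lemma norm_halves_shift:
  assumes g: "circle_fun g"
  shows "norm (halves (\<lambda>\<xi>. g (\<xi> + t))) = norm (halves g)"
proof -
  have "ennreal (2 * (norm (halves (\<lambda>\<xi>. g (\<xi> + t))))\<^sup>2) = ennreal (2 * (norm (halves g))\<^sup>2)"
    using norm_halves[OF g] norm_halves[OF circle_fun_shift[OF g, of t]] mass_shift[OF circle_funD(1,2)[OF g], of t] by simp
  then show ?thesis by simp
qed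

text \<open>The representative in \<open>[-1, 1)\<close> modulo \<open>2\<close>.\<close>

definition fold2 :: "real \<Rightarrow> real" where "fold2 \<xi> = \<xi> - 2 * of_int \<lfloor>(\<xi> + 1) / 2\<rfloor>"

lemma fold2: "-1 \<le> fold2 \<xi>" "fold2 \<xi> < 1" "fold2 (\<xi> + 2) = fold2 \<xi>"
proof -
  have "(\<xi> + 2 + 1) / 2 = (\<xi> + 1) / 2 + 1" by simp
  then show "fold2 (\<xi> + 2) = fold2 \<xi>" unfolding fold2_def by (simp only: one_add_floor[symmetric]) simp
  define k where "k = \<lfloor>(\<xi> + 1) / 2\<rfloor>"
  have "of_int k \<le> (\<xi> + 1) / 2" "(\<xi> + 1) / 2 < of_int k + 1"
    unfolding k_def by (rule of_int_floor_le, rule real_of_int_floor_add_one_gt)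
  then show "-1 \<le> fold2 \<xi>" "fold2 \<xi> < 1" unfolding fold2_def k_def[symmetric] by (simp_all add: field_simps)
qed

lemma fold2_id: "-1 \<le> \<xi> \<Longrightarrow> \<xi> < 1 \<Longrightarrow> fold2 \<xi> = \<xi>"
  unfolding fold2_def by (simp add: floor_eq_iff)

lemma fold2_measurable [measurable]: "fold2 \<in> borel_measurable borel"
  unfolding fold2_def[abs_def] by measurable

lemma halves_surj: "\<exists>g. circle_fun g \<and> halves g = x"
proof -
  obtain p q where x: "x = (p, q)" by (cases x)
  obtain P where P[measurable]: "P \<in> borel_measurable borel" "\<And>s. s \<notin> {0<..<1} \<Longrightarrow> P s = 0" "AE s in unit_interval. rep_L2 p s = P s"
    by (rule borel_representative[OF square_integrable_measurable[OF square_integrable_rep[of p]]]) auto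
  obtain Q where Q[measurable]: "Q \<in> borel_measurable borel" "\<And>s. s \<notin> {0<..<1} \<Longrightarrow> Q s = 0" "AE s in unit_interval. rep_L2 q s = Q s"
    by (rule borel_representative[OF square_integrable_measurable[OF square_integrable_rep[of q]]]) auto
  have Pp: "L2_of P = p" using L2_of_cong_AE[OF P(3)] by (simp add: borel_measurable_unit_interval P(1) square_integrable_measurable)
  have Qq: "L2_of Q = q" using L2_of_cong_AE[OF Q(3)] by (simp add: borel_measurable_unit_interval Q(1) square_integrable_measurable)
  have sP: "square_integrable P"
    by (rule square_integrable_dominated[where g = "\<lambda>s. (cmod (rep_L2 p s))\<^sup>2"])
      (use P(3) in \<open>auto intro: borel_measurable_unit_interval square_integrableD\<close>)
  have sQ: "square_integrable Q"
    by (rule square_integrable_dominated[where g = "\<lambda>s. (cmod (rep_L2 q s))\<^sup>2"])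
      (use Q(3) in \<open>auto intro: borel_measurable_unit_interval square_integrableD\<close>)
  define g where "g \<xi> = P (fold2 \<xi>) + Q (fold2 \<xi>) + P (- fold2 \<xi>) - Q (- fold2 \<xi>)" for \<xi>
  have gm[measurable]: "g \<in> borel_measurable borel" unfolding g_def by measurable
  have gp: "g (\<xi> + 2) = g \<xi>" for \<xi> by (simp add: g_def fold2)
  have gs: "g s = P s + Q s" "g (- s) = P s - Q s" if "s \<in> {0<..<1}" for s
    using that by (auto simp: g_def fold2_id P(2) Q(2))
  have sg: "square_integrable (\<lambda>s. P s + Q s)" "square_integrable (\<lambda>s. P s - Q s)"
    using sP sQ by (auto intro: square_integrable_add square_integrable_diff)
  have "mass g = (\<integral>\<^sup>+s. ennreal ((cmod (P s + Q s))\<^sup>2 + (cmod (P s - Q s))\<^sup>2) \<partial>unit_interval)"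
    unfolding mass_eq_unit_interval[OF gm gp] by (intro nn_integral_cong) (auto simp: gs)
  also have "\<dots> = ennreal (LINT s|unit_interval. (cmod (P s + Q s))\<^sup>2 + (cmod (P s - Q s))\<^sup>2)"
    by (rule nn_integral_eq_integral) (use sg in \<open>auto dest: square_integrableD\<close>)
  finally have g: "circle_fun g" using gp by (simp add: circle_fun_def)
  have "L2_of (\<lambda>s. (g s + g (- s)) / 2) = L2_of P" "L2_of (\<lambda>s. (g s - g (- s)) / 2) = L2_of Q"
    by (rule L2_of_cong_AE, rule AE_I2, simp add: gs, simp_all add: borel_measurable_unit_interval)+
  then have "halves g = x" by (simp add: halves_def x Pp Qq)
  with g show ?thesis by blast
qed

text \<open>The Riemann invariant as a function on the line, one of its versions that agree almost
  everywhere.\<close>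

definition profile :: "L2 \<times> L2 \<Rightarrow> real \<Rightarrow> complex"
  where "profile x = (SOME g. circle_fun g \<and> halves g = x)"

lemma circle_fun_profile: "circle_fun (profile x)" and halves_profile: "halves (profile x) = x"
  using someI_ex[OF halves_surj[of x]] by (auto simp: profile_def)

definition translate :: "real \<Rightarrow> L2 \<times> L2 \<Rightarrow> L2 \<times> L2"
  where "translate t x = halves (\<lambda>\<xi>. profile x (\<xi> + t))"

text \<open>Translations preserve \<open>mass\<close>, so translates of two functions with the same halves have the
  same halves.\<close>

lemma translate_halves:
  assumes g: "circle_fun g"
  shows "translate t (halves g) = halves (\<lambda>\<xi>. g (\<xi> + t))"
proof -
  let ?f = "profile (halves g)"
  note f = circle_fun_profile[of "halves g"]
  have "translate t (halves g) + (-1) *\<^sub>C halves (\<lambda>\<xi>. g (\<xi> + t)) = halves (\<lambda>\<xi>. ?f (\<xi> + t) + (-1) * g (\<xi> + t))"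
    unfolding translate_def by (rule halves_add[OF circle_fun_shift[OF f] circle_fun_shift[OF g], symmetric])
  also have "norm \<dots> = norm (halves (\<lambda>\<xi>. ?f \<xi> + (-1) * g \<xi>))"
    by (rule norm_halves_shift[OF circle_fun_add[OF f g]])
  also have "halves (\<lambda>\<xi>. ?f \<xi> + (-1) * g \<xi>) = 0"
    unfolding halves_add[OF f g] halves_profile by (simp add: scaleC_minus_one)
  finally show ?thesis by (simp add: scaleC_minus_one)
qed

lemma translate_linear: "translate t (x + c *\<^sub>C y) = translate t x + c *\<^sub>C translate t y"
proof -
  note f = circle_fun_profile[of x] and g = circle_fun_profile[of y]
  have "x + c *\<^sub>C y = halves (\<lambda>\<xi>. profile x \<xi> + c * profile y \<xi>)"
    by (simp add: halves_add[OF f g] halves_profile)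
  then have "translate t (x + c *\<^sub>C y) = halves (\<lambda>\<xi>. profile x (\<xi> + t) + c * profile y (\<xi> + t))"
    by (simp add: translate_halves[OF circle_fun_add[OF f g]])
  also have "\<dots> = translate t x + c *\<^sub>C translate t y"
    unfolding translate_def by (rule halves_add[OF circle_fun_shift[OF f] circle_fun_shift[OF g]])
  finally show ?thesis .
qed

lemma norm_translate: "norm (translate t x) = norm x"
  unfolding translate_def using norm_halves_shift[OF circle_fun_profile] by (simp add: halves_profile)

lemma translate_translate: "translate s (translate t x) = translate (s + t) x"
  unfolding translate_def[of t]
  by (subst translate_halves[OF circle_fun_shift[OF circle_fun_profile]]) (simp add: translate_def add.assoc)

lemma translate_0: "translate 0 x = x"
  by (simp add: translate_def halves_profile)

lemma translate_2: "translate 2 x = x"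
  by (simp add: translate_def halves_profile circle_funD(2)[OF circle_fun_profile])

lemma norm_halves_le:
  assumes g: "circle_fun g" and b: "\<And>\<xi>. cmod (g \<xi>) \<le> e"
  shows "norm (halves g) \<le> e"
proof -
  have e: "0 \<le> e" using order_trans[OF norm_ge_zero b] .
  have "mass g \<le> (\<integral>\<^sup>+\<xi>. ennreal (e\<^sup>2) * indicator {0..<2::real} \<xi> \<partial>lborel)"
    unfolding mass_def using b by (intro nn_integral_mono) (auto simp: indicator_def intro!: ennreal_leI power_mono)
  also have "\<dots> = ennreal (2 * e\<^sup>2)" by (simp add: nn_integral_cmult_indicator ennreal_mult' mult.commute)
  finally have "(norm (halves g))\<^sup>2 \<le> e\<^sup>2" using norm_halves[OF g] by (simp add: ennreal_le_iff)
  then show ?thesis by (rule power2_le_imp_le[OF _ e])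
qed

lemma circle_fun_continuous:
  assumes "continuous_on UNIV g" "\<And>\<xi>. g (\<xi> + 2) = g \<xi>"
  shows "circle_fun g"
proof -
  have "bounded (g ` {0..2})" by (intro compact_imp_bounded compact_continuous_image continuous_on_subset[OF assms(1)]) auto
  then have "\<exists>B. \<forall>\<xi>\<in>{0..2}. cmod (g \<xi>) \<le> B" by (simp add: bounded_iff)
  then obtain B where B: "\<And>\<xi>. \<xi> \<in> {0..2} \<Longrightarrow> cmod (g \<xi>) \<le> B" by blast
  have "mass g \<le> (\<integral>\<^sup>+\<xi>. ennreal (B\<^sup>2) * indicator {0..<2::real} \<xi> \<partial>lborel)"
    unfolding mass_def using B by (intro nn_integral_mono) (auto simp: indicator_def intro!: ennreal_leI power_mono)
  also have "\<dots> < \<infinity>" by (simp add: nn_integral_cmult_indicator ennreal_mult_less_top)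
  finally show ?thesis using assms by (simp add: circle_fun_def borel_measurable_continuous_onI)
qed

lemma periodic_uniformly_continuous:
  fixes g :: "real \<Rightarrow> complex"
  assumes c: "continuous_on UNIV g" and p: "\<And>\<xi>. g (\<xi> + 2) = g \<xi>" and "e > 0"
  obtains d where "d > 0" "\<And>x y. \<bar>x - y\<bar> < d \<Longrightarrow> cmod (g x - g y) < e"
proof -
  have "uniformly_continuous_on {-3..3} g"
    by (rule compact_uniformly_continuous) (auto intro: continuous_on_subset[OF c])
  then obtain d where d: "d > 0" "\<And>x y. x \<in> {-3..3} \<Longrightarrow> y \<in> {-3..3} \<Longrightarrow> dist y x < d \<Longrightarrow> dist (g y) (g x) < e"
    unfolding uniformly_continuous_on_def using \<open>e > 0\<close> by (elim allE[of _ e]) blast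
  show thesis
  proof (rule that[of "min d 1"])
    show "min d 1 > 0" using d by simp
    fix x y :: real assume xy: "\<bar>x - y\<bar> < min d 1"
    define n where "n = - \<lfloor>(x + 1) / 2\<rfloor>"
    have x: "x + 2 * of_int n = fold2 x" by (simp add: fold2_def n_def)
    have "dist (g (x + 2 * of_int n)) (g (y + 2 * of_int n)) < e"
      by (rule d(2)) (use fold2(1,2)[of x] xy x in \<open>auto simp: dist_real_def\<close>)
    then show "cmod (g x - g y) < e" by (simp add: periodic_int[of g, OF p] dist_norm)
  qed
qed

text \<open>Since \<open>g'\<close> is uniformly continuous, the difference quotients converge uniformly, hence in
  norm.\<close>

lemma translate_derivative:
  assumes d: "\<And>\<xi>. (g has_vector_derivative g' \<xi>) (at \<xi>)" and c: "continuous_on UNIV g'"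
    and p: "\<And>\<xi>. g (\<xi> + 2) = g \<xi>" and p': "\<And>\<xi>. g' (\<xi> + 2) = g' \<xi>"
  shows "((\<lambda>h. (translate h (halves g) - halves g) /\<^sub>R h) \<longlongrightarrow> halves g') (at 0)"
proof (rule LIM_I)
  fix e :: real assume "e > 0"
  then have "e / 2 > 0" by simp
  obtain \<delta> where \<delta>: "\<delta> > 0" "\<And>x y. \<bar>x - y\<bar> < \<delta> \<Longrightarrow> cmod (g' x - g' y) < e / 2"
    by (rule periodic_uniformly_continuous[OF c p' \<open>e / 2 > 0\<close>]) blast
  have gc: "circle_fun g" "circle_fun g'"
    by (intro circle_fun_continuous p p' c continuous_at_imp_continuous_on ballI has_vector_derivative_continuous[OF d])+
  show "\<exists>s>0. \<forall>h. h \<noteq> 0 \<and> norm (h - 0) < s \<longrightarrow> norm ((translate h (halves g) - halves g) /\<^sub>R h - halves g') < e"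
  proof (intro exI[of _ \<delta>] conjI allI impI \<delta>(1))
    fix h :: real assume h: "h \<noteq> 0 \<and> norm (h - 0) < \<delta>"
    let ?k = "\<lambda>\<xi>. (g (\<xi> + h) + (-1) * g \<xi>) + of_real h * (- g' \<xi>)"
    let ?f = "\<lambda>\<xi>. (-1) * g' \<xi> + of_real (1 / h) * (g (\<xi> + h) + (-1) * g \<xi>)"
    have f0: "circle_fun (\<lambda>\<xi>. g (\<xi> + h) + (-1) * g \<xi>)" by (rule circle_fun_add[OF circle_fun_shift[OF gc(1)] gc(1)])
    have z: "circle_fun (\<lambda>\<xi>. 0)" by (rule circle_fun_continuous) auto
    have zh: "halves (\<lambda>\<xi>. 0) = 0" by (simp add: halves_def zero_prod_def)
    have f1: "circle_fun (\<lambda>\<xi>. (-1) * g' \<xi>)" using circle_fun_add[OF z gc(2), of "-1"] by simp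
    have f: "circle_fun ?f" by (rule circle_fun_add[OF f1 f0])
    have "halves ?f = (translate h (halves g) - halves g) /\<^sub>R h - halves g'"
    proof -
      have "halves ?f = halves (\<lambda>\<xi>. (-1) * g' \<xi>) + of_real (1 / h) *\<^sub>C (translate h (halves g) + (-1) *\<^sub>C halves g)"
        unfolding halves_add[OF f1 f0] halves_add[OF circle_fun_shift[OF gc(1)] gc(1)] translate_halves[OF gc(1)] ..
      also have "halves (\<lambda>\<xi>. (-1) * g' \<xi>) = - halves g'"
        using halves_add[OF z gc(2), of "-1"] by (simp add: zh scaleC_minus_one)
      finally show ?thesis unfolding scaleR_scaleC[symmetric] by (simp add: scaleC_minus_one inverse_eq_divide)
    qed
    moreover have "norm (halves ?f) \<le> e / 2"
    proof (rule norm_halves_le[OF f])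
      fix \<xi>
      have seg: "\<bar>r - \<xi>\<bar> < \<delta>" if "r \<in> closed_segment \<xi> (\<xi> + h)" for r
        using that h by (auto simp: closed_segment_eq_real_ivl split: if_splits)
      have "norm (g (\<xi> + h) - g \<xi> - ((\<xi> + h) - \<xi>) *\<^sub>R g' \<xi>) \<le> norm ((\<xi> + h) - \<xi>) * (e / 2)"
      proof (rule vector_differentiable_bound_linearization[where S = "closed_segment \<xi> (\<xi> + h)"])
        show "(g has_vector_derivative g' r) (at r within closed_segment \<xi> (\<xi> + h))" for r
          by (rule has_vector_derivative_at_within[OF d])
        show "norm (g' r - g' \<xi>) \<le> e / 2" if "r \<in> closed_segment \<xi> (\<xi> + h)" for r
          using \<delta>(2)[OF seg[OF that]] by simp
      qed auto
      then have "cmod (of_real (1 / h) * (g (\<xi> + h) - g \<xi> - h *\<^sub>R g' \<xi>)) \<le> \<bar>1 / h\<bar> * (\<bar>h\<bar> * (e / 2))"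
        unfolding norm_mult norm_of_real by (intro mult_left_mono) auto
      also have "of_real (1 / h) * (g (\<xi> + h) - g \<xi> - h *\<^sub>R g' \<xi>) = ?f \<xi>"
        using h by (simp add: scaleR_conv_of_real field_simps)
      finally show "cmod (?f \<xi>) \<le> e / 2" using h by (simp add: abs_div)
    qed
    ultimately show "norm ((translate h (halves g) - halves g) /\<^sub>R h - halves g') < e" using \<open>e > 0\<close> by simp
  qed
qed

section \<open>Isometric groups and their generators\<close>

lemma cinner_inner: "cinner x y = Complex (inner x y) (inner x (\<i> *\<^sub>C y))" for x y :: "'a::complex_inner"
  by (simp add: complex_eq_iff inner_eq_Re_cinner cinner_scaleC_right)

lemma isometry_inner:
  fixes f :: "'a::real_inner \<Rightarrow> 'b::real_inner"
  assumes "linear f" "\<And>x. norm (f x) = norm x"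
  shows "inner (f x) (f y) = inner x y"
proof -
  have "(norm (f x + f y))\<^sup>2 = (norm (x + y))\<^sup>2" using assms by (simp flip: linear_add)
  then have "(norm (f x))\<^sup>2 + 2 * inner (f x) (f y) + (norm (f y))\<^sup>2 = (norm x)\<^sup>2 + 2 * inner x y + (norm y)\<^sup>2"
    unfolding power2_norm_eq_inner by (simp add: inner_add_left inner_add_right inner_commute)
  then show ?thesis by (simp add: assms(2))
qed

lemma inner_bound_dense:
  fixes v :: "'a::real_inner"
  assumes "closure S = UNIV" "\<And>\<eta>. \<eta> \<in> S \<Longrightarrow> inner v \<eta> \<le> C * norm \<eta>" "0 \<le> C"
  shows "norm v \<le> C"
proof -
  have "closed {\<eta>. inner v \<eta> \<le> C * norm \<eta>}" by (intro closed_Collect_le continuous_intros)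
  moreover have "S \<subseteq> {\<eta>. inner v \<eta> \<le> C * norm \<eta>}" using assms(2) by blast
  ultimately have "closure S \<subseteq> {\<eta>. inner v \<eta> \<le> C * norm \<eta>}" by (rule closure_minimal[rotated])
  then have "inner v v \<le> C * norm v" using assms(1) by auto
  then have le: "norm v * norm v \<le> C * norm v" by (simp add: power2_norm_eq_inner[symmetric] power2_eq_square)
  show ?thesis by (cases "v = 0") (use le assms(3) in simp_all)
qed

lemma has_vector_derivative_quotient:
  "(f has_vector_derivative d) (at t) \<longleftrightarrow> ((\<lambda>h. (f (t + h) - f t) /\<^sub>R h) \<longlongrightarrow> d) (at 0)"
proof -
  have "\<forall>\<^sub>F h in at 0. norm (f (t + h) - f t - h *\<^sub>R d) / norm h = norm ((f (t + h) - f t) /\<^sub>R h - d)"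
    unfolding eventually_at_filter
  proof (intro always_eventually allI impI)
    fix h :: real assume "h \<noteq> 0"
    then have "(f (t + h) - f t) /\<^sub>R h - d = (f (t + h) - f t - h *\<^sub>R d) /\<^sub>R h" by (simp add: scaleR_diff_right)
    then show "norm (f (t + h) - f t - h *\<^sub>R d) / norm h = norm ((f (t + h) - f t) /\<^sub>R h - d)"
      by (simp add: divide_inverse mult.commute)
  qed
  then show ?thesis
    unfolding has_vector_derivative_def has_derivative_at
    using bounded_linear_scaleR_left[of d]
    by (simp add: tendsto_cong tendsto_norm_zero_iff LIM_zero_iff)
qed

lemma antiderivative_exists:
  fixes f :: "real \<Rightarrow> 'a::banach"
  assumes c: "continuous_on UNIV f"
  obtains F where "\<And>x. (F has_vector_derivative f x) (at x)" "F 0 = 0"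
proof -
  define F where "F x = (if 0 \<le> x then integral {0..x} f else - integral {x..0} f)" for x
  have "(F has_vector_derivative f x) (at x)" for x
  proof -
    define a where "a = \<bar>x\<bar> + 1"
    have i: "f integrable_on {u..v}" for u v by (rule integrable_continuous_real) (rule continuous_on_subset[OF c], simp)
    have "((\<lambda>u. integral {-a..u} f) has_vector_derivative f x) (at x within {-a..a})"
      by (rule integral_has_vector_derivative) (auto simp: a_def intro: continuous_on_subset[OF c])
    then have "((\<lambda>u. integral {-a..u} f) has_vector_derivative f x) (at x)"
      by (subst (asm) at_within_Icc_at) (auto simp: a_def)
    from has_vector_derivative_diff[OF this has_vector_derivative_const]
    have "((\<lambda>u. integral {-a..u} f - integral {-a..0} f) has_vector_derivative f x) (at x)" by simp
    then show ?thesis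
    proof (rule has_vector_derivative_transform_within_open[where S = "{-a<..<a}"])
      fix y assume y: "y \<in> {-a<..<a}"
      show "integral {-a..y} f - integral {-a..0} f = F y"
      proof (cases "0 \<le> y")
        case True
        then have "integral {-a..0} f + integral {0..y} f = integral {-a..y} f"
          using y by (intro Henstock_Kurzweil_Integration.integral_combine i) auto
        then show ?thesis using True by (simp add: F_def algebra_simps)
      next
        case False
        then have "integral {-a..y} f + integral {y..0} f = integral {-a..0} f"
          using y by (intro Henstock_Kurzweil_Integration.integral_combine i) auto
        then show ?thesis using False by (simp add: F_def algebra_simps)
      qed
    qed (auto simp: a_def)
  qed
  then show thesis by (rule that) (simp add: F_def)
qed

lemma zero_derivative_constant:
  fixes f :: "real \<Rightarrow> 'a::real_normed_vector"
  assumes "convex S" "\<And>x. x \<in> S \<Longrightarrow> (f has_vector_derivative 0) (at x)" "a \<in> S" "b \<in> S"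
  shows "f a = f b"
proof -
  have "\<exists>c. \<forall>x\<in>S. f x = c"
    by (rule has_derivative_zero_constant[OF assms(1)])
      (use assms(2) in \<open>auto simp: has_vector_derivative_def intro: has_derivative_at_withinI\<close>)
  then show ?thesis using assms(3,4) by auto
qed

locale isometric_group =
  fixes T :: "real \<Rightarrow> 'a::{complex_inner,banach} \<Rightarrow> 'a"
  assumes C0: "C0_group T" and isometric: "norm (T t x) = norm x"
begin

lemma group: "T s (T t x) = T (s + t) x"
  using C0 unfolding C0_group_def by (metis comp_apply)

lemma zero: "T 0 x = x"
  using C0 unfolding C0_group_def by simp

lemma inverse1: "T (- t) (T t x) = x" and inverse2: "T t (T (- t) x) = x"
  by (simp_all add: group zero)

lemma blin: "bounded_linear (T t)" and scaleC: "T t (c *\<^sub>C x) = c *\<^sub>C T t x"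
  using C0 unfolding C0_group_def by auto

lemmas lin = bounded_linear.linear[OF blin]
lemmas simps = linear_add[OF lin] linear_diff[OF lin] linear_0[OF lin] linear_cmul[OF lin] linear_neg[OF lin]

lemma cont: "continuous_on UNIV (\<lambda>t. T t x)"
  using C0 unfolding C0_group_def by auto

lemma inner_T: "inner (T t x) (T t y) = inner x y"
  by (rule isometry_inner[OF lin isometric])

lemma inner_T_left: "inner (T t x) y = inner x (T (- t) y)"
  using inner_T[of "- t" "T t x" y] by (simp add: inverse1)

text \<open>The graph of the infinitesimal generator.\<close>

definition gen :: "'a \<Rightarrow> 'a \<Rightarrow> bool"
  where "gen x y \<longleftrightarrow> ((\<lambda>h. (T h x - x) /\<^sub>R h) \<longlongrightarrow> y) (at 0)"

lemma gen_T: "gen x y \<Longrightarrow> gen (T t x) (T t y)"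
proof -
  assume "gen x y"
  then have "((\<lambda>h. T t ((T h x - x) /\<^sub>R h)) \<longlongrightarrow> T t y) (at 0)"
    unfolding gen_def by (rule bounded_linear.tendsto[OF blin])
  moreover have "T t ((T h x - x) /\<^sub>R h) = (T h (T t x) - T t x) /\<^sub>R h" for h
    by (simp add: simps group add.commute)
  ultimately show ?thesis by (simp add: gen_def)
qed

lemma gen_derivative:
  assumes "gen x y"
  shows "((\<lambda>t. T t x) has_vector_derivative T t y) (at t)"
proof -
  have "((\<lambda>h. (T (t + h) x - T t x) /\<^sub>R h) \<longlongrightarrow> T t y) (at 0)"
    using gen_T[OF assms, of t] by (simp add: gen_def group add.commute)
  then show ?thesis
    by (simp add: has_vector_derivative_quotient)
qed

text \<open>The time averages of an orbit lie in the domain of the generator and converge to its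
  initial value.\<close>

lemma gen_dense: "closure {x. \<exists>y. gen x y} = UNIV"
proof (intro equalityI subset_UNIV subsetI)
  fix x
  obtain F where F: "\<And>t. (F has_vector_derivative T t x) (at t)" "F 0 = 0"
    by (rule antiderivative_exists[OF cont[of x]]) blast
  have shift: "T h (F d) = F (h + d) - F h" for h d
  proof -
    have "(\<lambda>d. T h (F d) - (F (h + d) - F h)) d = (\<lambda>d. T h (F d) - (F (h + d) - F h)) 0"
    proof (rule zero_derivative_constant[of UNIV])
      fix d
      have "((\<lambda>d. T h (F d)) has_vector_derivative T h (T d x)) (at d)"
        by (rule bounded_linear.has_vector_derivative[OF blin F(1)])
      moreover have "((\<lambda>d. F (h + d)) has_vector_derivative T (h + d) x) (at d)"
        using vector_diff_chain_at[of "\<lambda>d. h + d" 1 d F "T (h + d) x"] F(1)[of "h + d"]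
        by (simp add: comp_def has_vector_derivative_add_const has_vector_derivative_id[unfolded id_def] add.commute[of h])
      ultimately have "((\<lambda>d. T h (F d) - (F (h + d) - F h)) has_vector_derivative (T h (T d x) - (T (h + d) x - 0))) (at d)"
        by (intro has_vector_derivative_diff has_vector_derivative_const)
      then show "((\<lambda>d. T h (F d) - (F (h + d) - F h)) has_vector_derivative 0) (at d)" by (simp add: group)
    qed auto
    then show ?thesis by (simp add: F(2) simps)
  qed
  have der: "((\<lambda>h. (F (t + h) - F t) /\<^sub>R h) \<longlongrightarrow> T t x) (at 0)" for t
    using F(1)[of t] by (simp add: has_vector_derivative_quotient)
  have dom: "F d /\<^sub>R d \<in> {x. \<exists>y. gen x y}" for d
  proof -
    have "((\<lambda>h. ((F (d + h) - F d) /\<^sub>R h - (F (0 + h) - F 0) /\<^sub>R h) /\<^sub>R d) \<longlongrightarrow> (T d x - T 0 x) /\<^sub>R d) (at 0)"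
      by (intro tendsto_intros der)
    moreover have "((F (d + h) - F d) /\<^sub>R h - (F (0 + h) - F 0) /\<^sub>R h) /\<^sub>R d = (T h (F d /\<^sub>R d) - F d /\<^sub>R d) /\<^sub>R h" for h
      by (simp add: simps shift F(2) add.commute[of h] scaleR_diff_right algebra_simps)
    ultimately show ?thesis unfolding gen_def by auto
  qed
  have "((\<lambda>h. F h /\<^sub>R h) \<longlongrightarrow> x) (at 0)" using der[of 0] by (simp add: F(2) zero)
  then show "x \<in> closure {x. \<exists>y. gen x y}"
    by (rule Lim_in_closed_set[OF closed_closure _ trivial_limit_at, rotated])
      (auto intro!: always_eventually subsetD[OF closure_subset dom])
qed

lemma gen_skew: "gen x y \<Longrightarrow> inner y x = 0"
proof -
  assume g: "gen x y"
  have d: "((\<lambda>t. T t x) has_vector_derivative y) (at 0)" using gen_derivative[OF g, of 0] by (simp add: zero)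
  have "((\<lambda>t. inner (T t x) (T t x)) has_real_derivative (inner (T 0 x) y + inner y (T 0 x))) (at 0)"
    using bounded_bilinear.has_vector_derivative[OF bounded_bilinear_inner d d]
    by (simp add: has_real_derivative_iff_has_vector_derivative)
  moreover have "((\<lambda>t. inner (T t x) (T t x)) has_real_derivative 0) (at 0)" by (simp add: inner_T)
  ultimately have "inner (T 0 x) y + inner y (T 0 x) = 0" by (rule DERIV_unique)
  then show ?thesis by (simp add: zero inner_commute)
qed

text \<open>The generator of an isometric group has no proper skew-symmetric extension. Tested against
  a vector \<open>\<eta>\<close> in the domain of the generator, the orbit of \<open>x \<in> D\<close> has the derivative
  \<open>inner (T t (A x)) \<eta>\<close>. Hence \<open>inner (T h x - x - h A x) \<eta>\<close> is \<open>o(h)\<close>, uniformly for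
  \<open>norm \<eta> \<le> 1\<close>, and such \<open>\<eta>\<close> are dense in the unit ball.\<close>

lemma generated_by_skew_extension:
  assumes ext: "\<And>x y. gen x y \<Longrightarrow> x \<in> D \<and> y = A x"
    and skew: "\<And>x \<xi>. x \<in> D \<Longrightarrow> \<xi> \<in> D \<Longrightarrow> inner (A x) \<xi> = - inner x (A \<xi>)"
  shows "generated_by T D A"
proof -
  have "gen x (A x)" if x: "x \<in> D" for x
    unfolding gen_def
  proof (rule LIM_I)
    fix e :: real assume "e > 0"
    have "isCont (\<lambda>t. T t (A x)) 0" using cont by (simp add: continuous_on_eq_continuous_at)
    then have "\<exists>d>0. \<forall>t. dist t 0 < d \<longrightarrow> dist (T t (A x)) (T 0 (A x)) < e / 2"
      unfolding continuous_at_eps_delta using \<open>e > 0\<close> by (metis half_gt_zero)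
    then obtain d where d: "d > 0" "\<And>t. \<bar>t\<bar> < d \<Longrightarrow> norm (T t (A x) - A x) < e / 2"
      by (auto simp: zero dist_norm)
    show "\<exists>s>0. \<forall>h. h \<noteq> 0 \<and> norm (h - 0) < s \<longrightarrow> norm ((T h x - x) /\<^sub>R h - A x) < e"
    proof (intro exI[of _ d] conjI allI impI d(1))
      fix h :: real assume h: "h \<noteq> 0 \<and> norm (h - 0) < d"
      have "norm (T h x - x - h *\<^sub>R A x) \<le> \<bar>h\<bar> * (e / 2)"
      proof (rule inner_bound_dense[OF gen_dense])
        fix \<eta> assume "\<eta> \<in> {x. \<exists>y. gen x y}"
        then obtain y where y: "gen \<eta> y" by blast
        let ?\<phi> = "\<lambda>t. inner (T t x) \<eta> - t * inner (A x) \<eta>"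
        have der: "(?\<phi> has_vector_derivative inner (T t (A x) - A x) \<eta>) (at t)" for t
        proof -
          have "((\<lambda>t. T (- t) \<eta>) has_vector_derivative - T (- t) y) (at t)"
            using vector_diff_chain_at[of "\<lambda>t. - t" "- 1" t "\<lambda>t. T t \<eta>" "T (- t) y"] gen_derivative[OF y, of "- t"]
              has_vector_derivative_minus[OF has_vector_derivative_id, of "at t"]
            by (simp add: comp_def)
          then have "((\<lambda>t. inner x (T (- t) \<eta>)) has_vector_derivative inner x (- T (- t) y)) (at t)"
            by (rule bounded_linear.has_vector_derivative[OF bounded_linear_inner_right])
          also have "(\<lambda>t. inner x (T (- t) \<eta>)) = (\<lambda>t. inner (T t x) \<eta>)" by (simp add: inner_T_left)
          also have "inner x (- T (- t) y) = inner (T t (A x)) \<eta>"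
          proof -
            have "gen (T (- t) \<eta>) (T (- t) y)" by (rule gen_T[OF y])
            then have "T (- t) \<eta> \<in> D" "T (- t) y = A (T (- t) \<eta>)" using ext by blast+
            then show ?thesis using skew[OF x, of "T (- t) \<eta>"] by (simp add: inner_T_left)
          qed
          finally have 1: "((\<lambda>t. inner (T t x) \<eta>) has_vector_derivative inner (T t (A x)) \<eta>) (at t)" .
          have 2: "((\<lambda>t. t * inner (A x) \<eta>) has_vector_derivative inner (A x) \<eta>) (at t)"
            by (auto intro!: derivative_eq_intros simp flip: has_real_derivative_iff_has_vector_derivative)
          show ?thesis using has_vector_derivative_diff[OF 1 2] by (simp add: inner_diff_left)
        qed
        have "norm (?\<phi> h - ?\<phi> 0) \<le> (e / 2 * norm \<eta>) * norm (h - 0)"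
        proof (rule field_differentiable_bound[where S = "closed_segment 0 h"])
          show "(?\<phi> has_field_derivative inner (T t (A x) - A x) \<eta>) (at t within closed_segment 0 h)" for t
            using has_vector_derivative_at_within[OF der] by (simp add: has_real_derivative_iff_has_vector_derivative)
          fix t assume "t \<in> closed_segment 0 h"
          then have "\<bar>t\<bar> < d" using h by (auto simp: closed_segment_eq_real_ivl split: if_splits)
          then have "norm (T t (A x) - A x) \<le> e / 2" using d(2) by fastforce
          then have "norm (T t (A x) - A x) * norm \<eta> \<le> e / 2 * norm \<eta>" by (intro mult_right_mono) auto
          then show "norm (inner (T t (A x) - A x) \<eta>) \<le> e / 2 * norm \<eta>"
            using Cauchy_Schwarz_ineq2[of "T t (A x) - A x" \<eta>] by simp
        qed auto
        moreover have "inner (T h x - x - h *\<^sub>R A x) \<eta> = ?\<phi> h - ?\<phi> 0" by (simp add: inner_diff_left zero)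
        ultimately have "inner (T h x - x - h *\<^sub>R A x) \<eta> \<le> (e / 2 * norm \<eta>) * norm (h - 0)"
          by (metis order_trans real_norm_def abs_ge_self)
        then show "inner (T h x - x - h *\<^sub>R A x) \<eta> \<le> \<bar>h\<bar> * (e / 2) * norm \<eta>"
          by (simp add: mult_ac)
      qed (use \<open>e > 0\<close> in simp)
      then have "norm ((T h x - x - h *\<^sub>R A x) /\<^sub>R h) \<le> e / 2"
        using h by (simp add: divide_simps mult_ac)
      also have "(T h x - x - h *\<^sub>R A x) /\<^sub>R h = (T h x - x) /\<^sub>R h - A x" using h by (simp add: scaleR_diff_right)
      finally show "norm ((T h x - x) /\<^sub>R h - A x) < e" using \<open>e > 0\<close> by simp
    qed
  qed
  then show ?thesis unfolding generated_by_def using ext by (auto simp: gen_def)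
qed

text \<open>The difference of two orbits with the same initial value in \<open>D\<close> is differentiated by \<open>A\<close>,
  which is skew-symmetric, so its norm stays zero; and \<open>D\<close> is dense.\<close>

lemma generator_determines_group:
  assumes T: "generated_by T D A" and S: "C0_group S" "generated_by S D A"
  shows "S = T"
proof -
  have Slin: "bounded_linear (S t)" and Sgrp: "S (s + t) x = S s (S t x)" and S0: "S 0 x = x"
    for s t x
    using S(1) by (auto simp: C0_group_def)
  have gD: "gen x y \<longleftrightarrow> x \<in> D \<and> y = A x" for x y using T by (auto simp: generated_by_def gen_def)
  have sD: "((\<lambda>h. (S h x - x) /\<^sub>R h) \<longlongrightarrow> y) (at 0) \<longleftrightarrow> x \<in> D \<and> y = A x" for x y
    using S(2) by (auto simp: generated_by_def)
  have sT: "((\<lambda>h. (S h (S t x) - S t x) /\<^sub>R h) \<longlongrightarrow> S t (A x)) (at 0)" if "x \<in> D" for x t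
  proof -
    have "((\<lambda>h. S t ((S h x - x) /\<^sub>R h)) \<longlongrightarrow> S t (A x)) (at 0)"
      by (rule bounded_linear.tendsto[OF Slin]) (use sD that in blast)
    moreover have "S t ((S h x - x) /\<^sub>R h) = (S h (S t x) - S t x) /\<^sub>R h" for h
      using Sgrp[of t h x] Sgrp[of h t x] bounded_linear.linear[OF Slin[of t]]
      by (simp add: linear_cmul linear_diff add.commute)
    ultimately show ?thesis by simp
  qed
  have on_D: "S t x = T t x" if x: "x \<in> D" for t x
  proof -
    define E where "E t = S t x - T t x" for t
    have gE: "gen (E t) (S t (A x) - T t (A x))" for t
    proof -
      have "S t x \<in> D" "S t (A x) = A (S t x)" using sT[OF x, of t] sD by blast+
      then have "gen (S t x) (S t (A x))" by (simp add: gD)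
      moreover have "gen (T t x) (T t (A x))" by (rule gen_T) (simp add: gD x)
      ultimately have "((\<lambda>h. (T h (S t x) - S t x) /\<^sub>R h - (T h (T t x) - T t x) /\<^sub>R h) \<longlongrightarrow> S t (A x) - T t (A x)) (at 0)"
        unfolding gen_def by (rule tendsto_diff)
      then show ?thesis unfolding gen_def E_def by (simp add: simps algebra_simps)
    qed
    have dS: "((\<lambda>t. S t x) has_vector_derivative S t (A x)) (at t)" for t
    proof -
      have "((\<lambda>h. (S (t + h) x - S t x) /\<^sub>R h) \<longlongrightarrow> S t (A x)) (at 0)"
        using sT[OF x, of t] by (simp add: Sgrp[symmetric] add.commute)
      then show ?thesis
        by (simp add: has_vector_derivative_quotient)
    qed
    have dE: "(E has_vector_derivative S t (A x) - T t (A x)) (at t)" for t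
      unfolding E_def by (intro has_vector_derivative_diff dS gen_derivative) (simp add: gD x)
    have "((\<lambda>t. inner (E t) (E t)) has_vector_derivative 0) (at t)" for t
      using bounded_bilinear.has_vector_derivative[OF bounded_bilinear_inner dE dE, of t] gen_skew[OF gE, of t]
      by (simp add: inner_commute)
    then have "inner (E t) (E t) = inner (E 0) (E 0)" by (intro zero_derivative_constant[of UNIV]) auto
    then show ?thesis by (simp add: E_def S0 zero)
  qed
  have "S t x = T t x" for t x
  proof -
    have "closed {x. S t x = T t x}"
      by (intro closed_Collect_eq linear_continuous_on Slin blin)
    moreover have "D \<subseteq> {x. S t x = T t x}" using on_D by blast
    ultimately have "closure D \<subseteq> {x. S t x = T t x}" by (rule closure_minimal[rotated])
    moreover have "D = {x. \<exists>y. gen x y}" by (auto simp: gD)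
    ultimately show ?thesis using gen_dense by auto
  qed
  then show ?thesis by blast
qed

end

section \<open>The wave group\<close>

lemma translate_add: "translate t (x + y) = translate t x + translate t y"
  using translate_linear[of t x 1 y] by (simp add: scaleC_one)

lemma translate_scaleC: "translate t (c *\<^sub>C y) = c *\<^sub>C translate t y"
proof -
  have "translate t 0 = 0" using norm_translate[of t 0] by simp
  then show ?thesis using translate_linear[of t 0 c y] by simp
qed

lemma translate_bounded_linear: "bounded_linear (translate t)"
  by (rule bounded_linear_intro[where K = 1])
    (simp_all add: translate_add translate_scaleC scaleR_scaleC norm_translate)

lemma translate_inner: "inner (translate t x) (translate t y) = inner x y"
  by (rule isometry_inner[OF bounded_linear.linear[OF translate_bounded_linear] norm_translate])

lemma translate_cinner: "cinner (translate t x) (translate t y) = cinner x y"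
  unfolding cinner_inner[of "translate t x"] cinner_inner[of x] translate_scaleC[symmetric] translate_inner ..

text \<open>Functions that vanish outside \<open>(-1, 1)\<close> together with their derivatives, so that their
  periodic extensions are continuously differentiable also at the odd integers.\<close>

definition bump :: "(real \<Rightarrow> complex) \<Rightarrow> (real \<Rightarrow> complex) \<Rightarrow> bool"
  where "bump h h' \<longleftrightarrow> (\<forall>r. (h has_vector_derivative h' r) (at r)) \<and> continuous_on UNIV h' \<and>
    (\<forall>r. 1 \<le> \<bar>r\<bar> \<longrightarrow> h r = 0 \<and> h' r = 0)"

text \<open>Around every point of the line the periodic extension is a sum of two translates of \<open>h\<close>,
  in spite of the discontinuities of \<open>fold2\<close>.\<close>

lemma fold2_local:
  assumes z: "\<And>r. 1 \<le> \<bar>r\<bar> \<Longrightarrow> h r = (0::complex)" and \<xi>: "2 * of_int n - 2 < \<xi>" "\<xi> < 2 * of_int n + 1"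
  shows "h (fold2 \<xi>) = h (\<xi> - 2 * of_int n) + h (\<xi> - 2 * of_int n + 2)"
proof (cases "2 * of_int n - 1 \<le> \<xi>")
  case True
  then have "\<lfloor>(\<xi> + 1) / 2\<rfloor> = n" using \<xi> by (simp add: floor_eq_iff)
  then show ?thesis using True by (simp add: fold2_def z)
next
  case False
  show ?thesis
  proof (cases "2 * of_int n - 3 \<le> \<xi>")
    case True
    then have e: "\<lfloor>(\<xi> + 1) / 2\<rfloor> = n - 1" using False by (simp add: floor_eq_iff)
    have "h (fold2 \<xi>) = h (\<xi> - 2 * of_int n + 2)" unfolding fold2_def e by (simp add: algebra_simps)
    then show ?thesis using False by (simp add: z)
  qed (use \<xi> in simp)
qed

lemma bump_fold2:
  assumes b: "bump h h'"
  shows "((\<lambda>\<xi>. h (fold2 \<xi>)) has_vector_derivative h' (fold2 \<xi>)) (at \<xi>)" "continuous_on UNIV (\<lambda>\<xi>. h' (fold2 \<xi>))"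
proof -
  have d: "(h has_vector_derivative h' r) (at r)" and c: "continuous_on UNIV h'"
    and z: "1 \<le> \<bar>r\<bar> \<Longrightarrow> h r = 0" "1 \<le> \<bar>r\<bar> \<Longrightarrow> h' r = 0" for r
    using b by (auto simp: bump_def)
  have n: "\<exists>n::int. 2 * of_int n - 2 < \<xi> \<and> \<xi> < 2 * of_int n + 1" for \<xi> :: real
  proof -
    define k where "k = \<lfloor>(\<xi> + 1) / 2\<rfloor>"
    have "of_int k \<le> (\<xi> + 1) / 2" "(\<xi> + 1) / 2 < of_int k + 1"
      unfolding k_def by (rule of_int_floor_le, rule real_of_int_floor_add_one_gt)
    then show ?thesis by (intro exI[of _ k]) (simp add: field_simps)
  qed
  show "((\<lambda>\<xi>. h (fold2 \<xi>)) has_vector_derivative h' (fold2 \<xi>)) (at \<xi>)"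
  proof -
    obtain n :: int where \<xi>: "2 * of_int n - 2 < \<xi>" "\<xi> < 2 * of_int n + 1" using n by blast
    have sh: "((\<lambda>\<xi>. h (\<xi> + a)) has_vector_derivative h' (\<xi> + a)) (at \<xi>)" for a
      using vector_diff_chain_at[of "\<lambda>\<xi>. \<xi> + a" 1 \<xi> h "h' (\<xi> + a)"] d[of "\<xi> + a"]
      by (simp add: comp_def has_vector_derivative_add_const)
    have "((\<lambda>\<xi>. h (\<xi> + (- 2 * of_int n)) + h (\<xi> + (- 2 * of_int n + 2))) has_vector_derivative
        h' (\<xi> + (- 2 * of_int n)) + h' (\<xi> + (- 2 * of_int n + 2))) (at \<xi>)"
      by (intro has_vector_derivative_add sh)
    then have "((\<lambda>\<xi>. h (\<xi> - 2 * of_int n) + h (\<xi> - 2 * of_int n + 2)) has_vector_derivative h' (fold2 \<xi>)) (at \<xi>)"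
      by (simp add: fold2_local[of h', OF z(2) \<xi>] algebra_simps)
    then show ?thesis
      by (rule has_vector_derivative_transform_within_open[where S = "{2 * of_int n - 2<..<2 * of_int n + 1}"])
        (use \<xi> in \<open>auto simp: fold2_local[of h, OF z(1)]\<close>)
  qed
  show "continuous_on UNIV (\<lambda>\<xi>. h' (fold2 \<xi>))"
  proof (rule continuous_at_imp_continuous_on, rule ballI)
    fix \<xi> :: real
    obtain n :: int where \<xi>: "2 * of_int n - 2 < \<xi>" "\<xi> < 2 * of_int n + 1" using n by blast
    let ?S = "{2 * of_int n - 2<..<2 * of_int n + 1} :: real set"
    have "continuous_on ?S (\<lambda>\<xi>. h' (\<xi> - 2 * of_int n) + h' (\<xi> - 2 * of_int n + 2))"
      by (intro continuous_intros continuous_on_compose2[OF c]) auto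
    also have "?this \<longleftrightarrow> continuous_on ?S (\<lambda>\<xi>. h' (fold2 \<xi>))"
      by (rule continuous_on_cong) (auto simp: fold2_local[of h', OF z(2)])
    finally show "isCont (\<lambda>\<xi>. h' (fold2 \<xi>)) \<xi>" using \<xi> by (simp add: continuous_on_eq_continuous_at)
  qed
qed

lemma bump_translate:
  assumes b: "bump h h'"
  shows "((\<lambda>t. (translate t (halves (\<lambda>\<xi>. h (fold2 \<xi>))) - halves (\<lambda>\<xi>. h (fold2 \<xi>))) /\<^sub>R t) \<longlongrightarrow> halves (\<lambda>\<xi>. h' (fold2 \<xi>))) (at 0)"
  by (rule translate_derivative[OF bump_fold2[OF b]]) (simp_all add: fold2)

lemma halves_fold2:
  assumes "h \<in> borel_measurable borel"
  shows "halves (\<lambda>\<xi>. h (fold2 \<xi>)) = (L2_of (\<lambda>s. (h s + h (- s)) / 2), L2_of (\<lambda>s. (h s - h (- s)) / 2))"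
  unfolding halves_def prod.inject
  using assms by (intro conjI L2_of_cong_AE AE_I2) (auto simp: fold2_id intro!: borel_measurable_unit_interval)

lemma test_fun_reflect: "\<phi> \<in> test_fun \<Longrightarrow> ((\<lambda>s. \<phi> (- s)) has_vector_derivative - deriv_of \<phi> (- s)) (at s)"
  using vector_diff_chain_at[of "\<lambda>s. - s" "- 1" s \<phi> "deriv_of \<phi> (- s)"] test_funD(1)[of \<phi> "- s"]
    has_vector_derivative_minus[OF has_vector_derivative_id, of "at s"] by (simp add: comp_def)

lemma test_fun_support:
  assumes "\<phi> \<in> test_fun"
  obtains a b where "0 < a" "a \<le> b" "b < 1" "\<And>s. s \<le> a \<or> b \<le> s \<Longrightarrow> \<phi> s = 0"
proof -
  define K where "K = closure {s. \<phi> s \<noteq> 0}"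
  have K: "K \<subseteq> {0<..<1}" "closed K" using assms by (auto simp: test_fun_def K_def)
  have "bounded K" by (rule bounded_subset[OF _ K(1)]) simp
  then have comp: "compact K" using K(2) by (simp add: compact_eq_bounded_closed)
  have sub: "s \<in> K" if "\<phi> s \<noteq> 0" for s using that closure_subset[of "{s. \<phi> s \<noteq> 0}"] by (auto simp: K_def)
  show thesis
  proof (cases "K = {}")
    case True
    have "\<phi> s = 0" for s using sub[of s] True by auto
    then show thesis using that[of "1/2" "1/2"] by simp
  next
    case False
    obtain a where a: "a \<in> K" "\<And>s. s \<in> K \<Longrightarrow> a \<le> s" using compact_attains_inf[OF comp False] by blast
    obtain b where b: "b \<in> K" "\<And>s. s \<in> K \<Longrightarrow> s \<le> b" using compact_attains_sup[OF comp False] by blast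
    have ab: "0 < a" "a \<le> b" "b < 1" using a b K(1) by auto
    show thesis
    proof (rule that[of "a / 2" "(b + 1) / 2"])
      show "\<phi> s = 0" if "s \<le> a / 2 \<or> (b + 1) / 2 \<le> s" for s
        using sub[of s] a(2)[of s] b(2)[of s] that ab by fastforce
    qed (use ab in auto)
  qed
qed

lemma deriv_test_fun_outside:
  assumes "\<phi> \<in> test_fun" "s \<notin> {0<..<1}"
  shows "deriv_of \<phi> s = 0"
proof -
  obtain a b where ab: "0 < a" "a \<le> b" "b < 1" "\<And>s. s \<le> a \<or> b \<le> s \<Longrightarrow> \<phi> s = 0"
    by (rule test_fun_support[OF assms(1)]) blast
  have "((\<lambda>s. 0) has_vector_derivative 0) (at s)" by simp
  then have "(\<phi> has_vector_derivative 0) (at s)"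
    by (rule has_vector_derivative_transform_within_open[where S = "- {a..b}"]) (use ab assms(2) in auto)
  then show ?thesis by (rule vector_derivative_at)
qed

lemma bump_even:
  assumes "\<phi> \<in> test_fun"
  shows "bump (\<lambda>s. \<phi> s + \<phi> (- s)) (\<lambda>s. deriv_of \<phi> s - deriv_of \<phi> (- s))"
  unfolding bump_def
proof (intro conjI allI impI)
  fix r :: real
  show "((\<lambda>s. \<phi> s + \<phi> (- s)) has_vector_derivative deriv_of \<phi> r - deriv_of \<phi> (- r)) (at r)"
    using has_vector_derivative_add[OF test_funD(1)[OF assms] test_fun_reflect[OF assms]] by simp
  assume "1 \<le> \<bar>r\<bar>"
  then have r: "r \<notin> {0<..<1}" "- r \<notin> {0<..<1}" by auto
  show "\<phi> r + \<phi> (- r) = 0" "deriv_of \<phi> r - deriv_of \<phi> (- r) = 0"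
    using r[THEN test_funD(4)[OF assms]] r[THEN deriv_test_fun_outside[OF assms]] by simp_all
qed (intro continuous_intros continuous_on_compose2[OF test_funD(3)[OF assms]] test_funD(3)[OF assms], auto)

lemma bump_odd:
  assumes "\<phi> \<in> test_fun"
  shows "bump (\<lambda>s. \<phi> s - \<phi> (- s)) (\<lambda>s. deriv_of \<phi> s + deriv_of \<phi> (- s))"
  unfolding bump_def
proof (intro conjI allI impI)
  fix r :: real
  show "((\<lambda>s. \<phi> s - \<phi> (- s)) has_vector_derivative deriv_of \<phi> r + deriv_of \<phi> (- r)) (at r)"
    using has_vector_derivative_diff[OF test_funD(1)[OF assms] test_fun_reflect[OF assms]] by simp
  assume "1 \<le> \<bar>r\<bar>"
  then have r: "r \<notin> {0<..<1}" "- r \<notin> {0<..<1}" by auto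
  show "\<phi> r - \<phi> (- r) = 0" "deriv_of \<phi> r + deriv_of \<phi> (- r) = 0"
    using r[THEN test_funD(4)[OF assms]] r[THEN deriv_test_fun_outside[OF assms]] by simp_all
qed (intro continuous_intros continuous_on_compose2[OF test_funD(3)[OF assms]] test_funD(3)[OF assms], auto)

lemma continuous_test_fun_measurable [measurable]:
  assumes "\<phi> \<in> test_fun"
  shows "\<phi> \<in> borel_measurable borel" "deriv_of \<phi> \<in> borel_measurable borel"
  using test_funD(2,3)[OF assms] by (auto intro: borel_measurable_continuous_onI)

text \<open>The derivative of the odd extension of \<open>\<phi>\<close> is the even extension of its derivative.\<close>

lemma halves_bump_odd:
  assumes \<phi>: "\<phi> \<in> test_fun"
  shows "halves (\<lambda>\<xi>. \<phi> (fold2 \<xi>) - \<phi> (- fold2 \<xi>)) = (0, L2_of \<phi>)"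
    and "halves (\<lambda>\<xi>. deriv_of \<phi> (fold2 \<xi>) + deriv_of \<phi> (- fold2 \<xi>)) = (L2_of (deriv_of \<phi>), 0)"
proof -
  note [measurable] = continuous_test_fun_measurable[OF \<phi>]
  have *: "L2_of (\<lambda>s. ((\<phi> s - \<phi> (- s)) - (\<phi> (- s) - \<phi> s)) / 2) = L2_of \<phi>"
    "L2_of (\<lambda>s. ((deriv_of \<phi> s + deriv_of \<phi> (- s)) + (deriv_of \<phi> (- s) + deriv_of \<phi> s)) / 2) = L2_of (deriv_of \<phi>)"
    by (intro L2_of_cong_AE AE_I2 borel_measurable_unit_interval;
        simp add: test_funD(4)[OF \<phi>] deriv_test_fun_outside[OF \<phi>])+
  show "halves (\<lambda>\<xi>. \<phi> (fold2 \<xi>) - \<phi> (- fold2 \<xi>)) = (0, L2_of \<phi>)"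
    using halves_fold2[of "\<lambda>s. \<phi> s - \<phi> (- s)"] * by (simp add: algebra_simps)
  show "halves (\<lambda>\<xi>. deriv_of \<phi> (fold2 \<xi>) + deriv_of \<phi> (- fold2 \<xi>)) = (L2_of (deriv_of \<phi>), 0)"
    using halves_fold2[of "\<lambda>s. deriv_of \<phi> s + deriv_of \<phi> (- s)"] * by (simp add: algebra_simps)
qed

lemma halves_bump_even:
  assumes \<phi>: "\<phi> \<in> test_fun"
  shows "halves (\<lambda>\<xi>. \<phi> (fold2 \<xi>) + \<phi> (- fold2 \<xi>)) = (L2_of \<phi>, 0)"
proof -
  note [measurable] = continuous_test_fun_measurable[OF \<phi>]
  have *: "L2_of (\<lambda>s. ((\<phi> s + \<phi> (- s)) + (\<phi> (- s) + \<phi> s)) / 2) = L2_of \<phi>"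
    by (intro L2_of_cong_AE AE_I2 borel_measurable_unit_interval; simp add: test_funD(4)[OF \<phi>])
  show ?thesis
    using halves_fold2[of "\<lambda>s. \<phi> s + \<phi> (- s)"] * by (simp add: algebra_simps)
qed

lemma test_fun_cnj: "\<phi> \<in> test_fun \<Longrightarrow> (\<lambda>s. cnj (\<phi> s)) \<in> test_fun"
  and deriv_test_fun_cnj: "\<phi> \<in> test_fun \<Longrightarrow> deriv_of (\<lambda>s. cnj (\<phi> s)) s = cnj (deriv_of \<phi> s)"
proof -
  assume \<phi>: "\<phi> \<in> test_fun"
  have d: "((\<lambda>s. cnj (\<phi> s)) has_vector_derivative cnj (deriv_of \<phi> s)) (at s)" for s
    by (rule bounded_linear.has_vector_derivative[OF bounded_linear_cnj test_funD(1)[OF \<phi>]])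
  show "deriv_of (\<lambda>s. cnj (\<phi> s)) s = cnj (deriv_of \<phi> s)" by (rule vector_derivative_at[OF d])
  obtain a b where ab: "0 < a" "a \<le> b" "b < 1" "\<And>s. s \<le> a \<or> b \<le> s \<Longrightarrow> \<phi> s = 0" by (rule test_fun_support[OF \<phi>]) blast
  show "(\<lambda>s. cnj (\<phi> s)) \<in> test_fun"
    by (rule test_funI[OF d, where K = "{a..b}"]) (use ab in \<open>auto intro!: continuous_intros test_funD(3)[OF \<phi>]\<close>)
qed

lemma weak_deriv_iff_test: "weak_deriv f g \<longleftrightarrow> (\<forall>\<phi>\<in>test_fun. cinner f (L2_of (deriv_of \<phi>)) = - cinner g (L2_of \<phi>))"
proof
  assume w: "weak_deriv f g"
  show "\<forall>\<phi>\<in>test_fun. cinner f (L2_of (deriv_of \<phi>)) = - cinner g (L2_of \<phi>)"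
  proof
    fix \<phi> assume \<phi>: "\<phi> \<in> test_fun"
    show "cinner f (L2_of (deriv_of \<phi>)) = - cinner g (L2_of \<phi>)"
      using w[unfolded weak_deriv_iff, rule_format, OF test_fun_cnj[OF \<phi>]] by (simp add: deriv_test_fun_cnj[OF \<phi>])
  qed
next
  assume r: "\<forall>\<phi>\<in>test_fun. cinner f (L2_of (deriv_of \<phi>)) = - cinner g (L2_of \<phi>)"
  show "weak_deriv f g"
    unfolding weak_deriv_iff
  proof
    fix \<phi> assume \<phi>: "\<phi> \<in> test_fun"
    show "cinner f (L2_of (\<lambda>s. cnj (deriv_of \<phi> s))) = - cinner g (L2_of (\<lambda>s. cnj (\<phi> s)))"
      using r[rule_format, OF test_fun_cnj[OF \<phi>]] by (simp add: deriv_test_fun_cnj[OF \<phi>])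
  qed
qed

lemma test_fun_orthogonal_zero:
  assumes "\<And>\<phi>. \<phi> \<in> test_fun \<Longrightarrow> cinner h (L2_of \<phi>) = 0"
  shows "h = 0"
  by (rule weak_deriv_zero_unique) (rule assms[OF test_fun_cnj])

text \<open>Orthogonality for the real inner product already gives complex orthogonality to a set that
  is invariant under multiplication by \<open>\<i>\<close>.\<close>

lemma inner_zero_cinner_zero:
  assumes "\<And>y. y \<in> S \<Longrightarrow> inner x y = 0" "\<And>y. y \<in> S \<Longrightarrow> \<i> *\<^sub>C y \<in> S" "y \<in> S"
  shows "cinner x y = 0"
  unfolding cinner_inner using assms by (simp add: complex_eq_iff)

lemma closure_test_fun: "closure (L2_of ` test_fun) = UNIV"
proof -
  have lin: "L2_of \<phi> + c *\<^sub>C L2_of \<psi> \<in> L2_of ` test_fun" if "\<phi> \<in> test_fun" "\<psi> \<in> test_fun" for \<phi> \<psi> c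
  proof -
    have "L2_of \<phi> + c *\<^sub>C L2_of \<psi> = L2_of (\<lambda>s. \<phi> s + c * \<psi> s)"
      using that by (simp add: L2_of_add L2_of_scaleC square_integrable_test_fun square_integrable_mult_const)
    then show ?thesis using that by (auto intro!: test_fun_add test_fun_scale)
  qed
  have z: "0 \<in> L2_of ` test_fun" using test_fun_zero by (intro image_eqI[of _ _ "\<lambda>s. 0"]) auto
  have sub: "subspace (L2_of ` test_fun)"
  proof (rule subspaceI[OF z])
    show "x + y \<in> L2_of ` test_fun" if "x \<in> L2_of ` test_fun" "y \<in> L2_of ` test_fun" for x y
      using that lin[where c = 1] by (auto simp: scaleC_one)
    show "c *\<^sub>R x \<in> L2_of ` test_fun" if "x \<in> L2_of ` test_fun" for c x
      using that lin[OF test_fun_zero, where c = "of_real c"] by (auto simp: scaleR_scaleC)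
  qed
  have "x \<in> closure (L2_of ` test_fun)" for x
  proof -
    obtain r where r: "r \<in> closure (L2_of ` test_fun)" "\<And>u. u \<in> closure (L2_of ` test_fun) \<Longrightarrow> inner (x - r) u = 0"
      by (rule orthogonal_projection_exists[OF closed_closure subspace_closure[OF sub]]) blast
    have "x - r = 0"
    proof (rule test_fun_orthogonal_zero)
      fix \<phi> assume "\<phi> \<in> test_fun"
      then show "cinner (x - r) (L2_of \<phi>) = 0"
        by (intro inner_zero_cinner_zero[of "L2_of ` test_fun"])
          (use r(2)[OF subsetD[OF closure_subset]] lin[OF test_fun_zero, where c = \<i>] in auto)
    qed
    then show ?thesis using r(1) by simp
  qed
  then show ?thesis by blast
qed

text \<open>The vectors with a continuous orbit form a closed set because translations are isometric,
  and this set contains the periodic extensions of test functions, which are dense.\<close>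

lemma translate_tendsto: "((\<lambda>h. translate h x) \<longlongrightarrow> x) (at 0)"
proof -
  define S where "S = {x. ((\<lambda>h. translate h x) \<longlongrightarrow> x) (at 0)}"
  have add: "x + y \<in> S" if "x \<in> S" "y \<in> S" for x y
    using that by (auto simp: S_def translate_add intro: tendsto_add)
  have bump: "halves (\<lambda>\<xi>. h (fold2 \<xi>)) \<in> S" if b: "bump h h'" for h h'
  proof -
    have "((\<lambda>t. t *\<^sub>R ((translate t (halves (\<lambda>\<xi>. h (fold2 \<xi>))) - halves (\<lambda>\<xi>. h (fold2 \<xi>))) /\<^sub>R t) + halves (\<lambda>\<xi>. h (fold2 \<xi>)))
        \<longlongrightarrow> 0 *\<^sub>R halves (\<lambda>\<xi>. h' (fold2 \<xi>)) + halves (\<lambda>\<xi>. h (fold2 \<xi>))) (at 0)"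
      by (intro tendsto_intros bump_translate[OF b])
    moreover have "\<forall>\<^sub>F t in at 0. t *\<^sub>R ((translate t (halves (\<lambda>\<xi>. h (fold2 \<xi>))) - halves (\<lambda>\<xi>. h (fold2 \<xi>))) /\<^sub>R t) + halves (\<lambda>\<xi>. h (fold2 \<xi>))
        = translate t (halves (\<lambda>\<xi>. h (fold2 \<xi>)))"
      by (auto simp: eventually_at_filter)
    ultimately show ?thesis unfolding S_def by (simp add: tendsto_cong)
  qed
  have test: "(L2_of \<phi>, L2_of \<psi>) \<in> S" if "\<phi> \<in> test_fun" "\<psi> \<in> test_fun" for \<phi> \<psi>
    using add[OF bump[OF bump_even[OF that(1)]] bump[OF bump_odd[OF that(2)]]]
    by (simp add: halves_bump_even[OF that(1)] halves_bump_odd(1)[OF that(2)])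
  have "closed S"
    unfolding closed_sequential_limits
  proof (intro allI impI, elim conjE)
    fix y x assume y: "\<forall>n. y n \<in> S" "y \<longlonglongrightarrow> x"
    show "x \<in> S"
      unfolding S_def mem_Collect_eq
    proof (rule tendstoI)
      fix e :: real assume "e > 0"
      obtain n where n: "dist (y n) x < e / 3" using metric_LIMSEQ_D[OF y(2), of "e / 3"] \<open>e > 0\<close> by auto
      have "((\<lambda>h. translate h (y n)) \<longlongrightarrow> y n) (at 0)" using y(1) by (simp add: S_def)
      then have "\<forall>\<^sub>F h in at 0. dist (translate h (y n)) (y n) < e / 3" by (rule tendstoD) (use \<open>e > 0\<close> in simp)
      then show "\<forall>\<^sub>F h in at 0. dist (translate h x) x < e"
      proof eventually_elim
        case (elim h)
        have "dist (translate h x) (translate h (y n)) = dist x (y n)"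
          using norm_translate[of h "x - y n"] linear_diff[OF bounded_linear.linear[OF translate_bounded_linear], of h x "y n"]
          by (simp add: dist_norm)
        then show ?case using elim n dist_triangle[of "translate h x" x "translate h (y n)"]
            dist_triangle[of "translate h (y n)" x "y n"] by (simp add: dist_commute)
      qed
    qed
  qed
  moreover have "L2_of ` test_fun \<times> L2_of ` test_fun \<subseteq> S" using test by auto
  ultimately have "closure (L2_of ` test_fun \<times> L2_of ` test_fun) \<subseteq> S" by (rule closure_minimal[rotated])
  then show ?thesis by (auto simp: closure_Times closure_test_fun S_def)
qed

lemma translate_continuous: "continuous_on UNIV (\<lambda>t. translate t x)"
proof (rule continuous_at_imp_continuous_on, rule ballI)
  fix t
  have "((\<lambda>h. translate t (translate h x)) \<longlongrightarrow> translate t x) (at 0)"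
    by (rule bounded_linear.tendsto[OF translate_bounded_linear translate_tendsto])
  then have "((\<lambda>h. translate (t + h) x) \<longlongrightarrow> translate t x) (at 0)" by (simp add: translate_translate)
  then show "isCont (\<lambda>t. translate t x) t" by (simp add: isCont_iff)
qed

abbreviation one_L2 :: L2 where "one_L2 \<equiv> L2_of (\<lambda>s. 1)"

lemma cinner_bound: "cmod (cinner x y) \<le> norm x * norm y" for x y :: "'a::complex_inner"
proof (cases "cinner x y = 0")
  case False
  define c where "c = cnj (cinner x y) / of_real (cmod (cinner x y))"
  have c1: "cmod c = 1" using False by (simp add: c_def norm_divide)
  have "cinner (c *\<^sub>C x) y = of_real (cmod (cinner x y))"
    using False complex_norm_square[of "cinner x y"]
    by (simp add: c_def cinner_scaleC_left field_simps power2_eq_square)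
  then have "cmod (cinner x y) = inner (c *\<^sub>C x) y" by (simp add: inner_eq_Re_cinner)
  also have "\<dots> \<le> norm (c *\<^sub>C x) * norm y" by (rule norm_cauchy_schwarz)
  finally show ?thesis by (simp add: norm_scaleC c1)
qed simp

lemma primitive_of_compact_support:
  fixes \<psi> :: "real \<Rightarrow> complex"
  assumes c: "continuous_on UNIV \<psi>" and z: "\<And>s. s \<le> a \<or> b \<le> s \<Longrightarrow> \<psi> s = 0"
  obtains F where "\<And>s. (F has_vector_derivative \<psi> s) (at s)" "\<And>s. s \<le> a \<Longrightarrow> F s = 0" "\<And>s t. b \<le> s \<Longrightarrow> b \<le> t \<Longrightarrow> F s = F t"
proof -
  obtain G where G: "\<And>s. (G has_vector_derivative \<psi> s) (at s)"
    by (rule antiderivative_exists[OF c]) blast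
  have G0: "(G has_vector_derivative 0) (at s)" if "s \<le> a \<or> b \<le> s" for s using G[of s] z[OF that] by simp
  show thesis
  proof (rule that[of "\<lambda>s. G s - G a"])
    show "((\<lambda>s. G s - G a) has_vector_derivative \<psi> s) (at s)" for s
      using has_vector_derivative_diff[OF G[of s] has_vector_derivative_const[of "G a"]] by simp
    show "G s - G a = 0" if "s \<le> a" for s
      using zero_derivative_constant[of "{..a}" G s a] G0 that by auto
    show "G s - G a = G t - G a" if "b \<le> s" "b \<le> t" for s t
      using zero_derivative_constant[of "{b..}" G s t] G0 that by auto
  qed
qed

lemma integral_derivative_unit_interval:
  assumes "\<And>s. (F has_vector_derivative f s) (at s)" "continuous_on UNIV f"
  shows "(LINT s|unit_interval. f s) = F 1 - (F 0 :: complex)"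
  using fundamental_theorem_of_calculus[of 0 1 F f] assms
  by (simp add: integral_unit_interval_eq has_vector_derivative_at_within integral_unique)

lemma cinner_one: "square_integrable f \<Longrightarrow> cinner (L2_of f) one_L2 = (LINT s|unit_interval. f s)"
  by (simp add: cinner_L2_of)

lemma weak_deriv_smooth:
  assumes F: "\<And>s. (F has_vector_derivative f s) (at s)" "continuous_on UNIV f"
  shows "weak_deriv (L2_of F) (L2_of f)"
  unfolding weak_deriv_iff_test
proof
  fix \<phi> assume \<phi>: "\<phi> \<in> test_fun"
  have Fc: "continuous_on UNIV F" by (intro continuous_at_imp_continuous_on ballI has_vector_derivative_continuous[OF F(1)])
  note c = Fc F(2) test_funD(2,3)[OF \<phi>]
  have si: "square_integrable F" "square_integrable f" "square_integrable \<phi>" "square_integrable (deriv_of \<phi>)"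
    by (intro square_integrable_continuous c)+
  have d: "((\<lambda>s. F s * cnj (\<phi> s)) has_vector_derivative (F s * cnj (deriv_of \<phi> s) + f s * cnj (\<phi> s))) (at s)" for s
    by (rule has_vector_derivative_mult[OF F(1) bounded_linear.has_vector_derivative[OF bounded_linear_cnj test_funD(1)[OF \<phi>]]])
  have "(LINT s|unit_interval. F s * cnj (deriv_of \<phi> s) + f s * cnj (\<phi> s)) = F 1 * cnj (\<phi> 1) - F 0 * cnj (\<phi> 0)"
    by (rule integral_derivative_unit_interval[OF d]) (intro continuous_intros c)
  also have "\<dots> = 0" by (simp add: test_funD(4)[OF \<phi>])
  finally show "cinner (L2_of F) (L2_of (deriv_of \<phi>)) = - cinner (L2_of f) (L2_of \<phi>)"
    using si by (simp add: cinner_L2_of integrable_cinner_square_integrable eq_neg_iff_add_eq_0)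
qed

text \<open>By definition of the weak derivative this holds for test functions, and \<open>u\<close> is a limit of
  these in the Sobolev norm.\<close>

lemma H01_parts:
  assumes u: "u \<in> sobolev_H01" and e: "weak_deriv e e'"
  shows "cinner (wderiv u) e = - cinner u e'"
proof -
  have "cmod (cinner (wderiv u) e + cinner u e') \<le> 0 + \<epsilon>" if "\<epsilon> > 0" for \<epsilon>
  proof -
    define \<delta> where "\<delta> = \<epsilon> / (norm e + norm e' + 1)"
    have pos: "norm e + norm e' + 1 > 0" by (simp add: add_nonneg_pos)
    then have "\<delta> > 0" using that by (simp add: \<delta>_def)
    then obtain \<phi> where \<phi>: "\<phi> \<in> test_fun" "sobolev_H1_norm (u - L2_of \<phi>) < \<delta>"
      using u unfolding sobolev_H01_def by blast
    define w where "w = u - L2_of \<phi>"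
    have u': "u = w + L2_of \<phi>" "wderiv u = wderiv w + L2_of (deriv_of \<phi>)"
      using wderiv_diff[OF H01_H1[OF u] test_fun_H1[OF \<phi>(1)]] by (auto simp: w_def wderiv_test_fun \<phi>)
    have "cinner e (L2_of (deriv_of \<phi>)) = - cinner e' (L2_of \<phi>)" using e \<phi>(1) by (simp add: weak_deriv_iff_test)
    then have "cinner (L2_of (deriv_of \<phi>)) e = - cinner (L2_of \<phi>) e'"
      using cinner_commute[of "L2_of (deriv_of \<phi>)" e] cinner_commute[of "L2_of \<phi>" e'] by simp
    then have "cinner (wderiv u) e + cinner u e' = cinner (wderiv w) e + cinner w e'"
      unfolding u'(2) by (subst u'(1)) (simp add: cinner_add_left)
    also have "cmod \<dots> \<le> norm (wderiv w) * norm e + norm w * norm e'"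
      by (rule order_trans[OF norm_triangle_ineq]) (intro add_mono cinner_bound)
    also have "\<dots> \<le> \<delta> * norm e + \<delta> * norm e'"
      using norm_le_H1_norm[of w] \<phi>(2) unfolding w_def by (intro add_mono mult_right_mono) auto
    also have "\<dots> \<le> \<delta> * (norm e + norm e' + 1)" using \<open>\<delta> > 0\<close> by (simp add: algebra_simps)
    also have "\<dots> = \<epsilon>" using pos by (simp add: \<delta>_def)
    finally show ?thesis by simp
  qed
  then have "cmod (cinner (wderiv u) e + cinner u e') \<le> 0" by (rule field_le_epsilon)
  then show ?thesis by (simp add: eq_neg_iff_add_eq_0)
qed

lemma weak_deriv_one: "weak_deriv one_L2 0"
  using weak_deriv_smooth[of "\<lambda>s. 1" "\<lambda>s. 0"] by simp

lemma H01_wderiv_one: "u \<in> sobolev_H01 \<Longrightarrow> cinner (wderiv u) one_L2 = 0"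
  using H01_parts[OF _ weak_deriv_one] cinner_scaleC_right[of u 0 0] by simp

text \<open>Every test function of mean zero is the derivative of a test function, so only constants
  are orthogonal to all these derivatives.\<close>

lemma orthogonal_to_derivatives:
  assumes h: "\<And>\<phi>. \<phi> \<in> test_fun \<Longrightarrow> cinner h (L2_of (deriv_of \<phi>)) = 0"
  obtains m where "h = m *\<^sub>C one_L2"
proof -
  have "one_L2 \<noteq> 0"
  proof
    assume "one_L2 = 0"
    then have "(norm one_L2)\<^sup>2 = 0" by simp
    then show False by (simp add: norm_L2_of prob_unit_interval[simplified])
  qed
  then obtain \<eta> where \<eta>: "\<eta> \<in> test_fun" "cinner one_L2 (L2_of \<eta>) \<noteq> 0" using test_fun_orthogonal_zero by blast
  define k where "k = cinner one_L2 (L2_of \<eta>)"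
  define m where "m = cinner h (L2_of \<eta>) / k"
  have "h + (- m) *\<^sub>C one_L2 = 0"
  proof (rule test_fun_orthogonal_zero)
    fix \<psi> assume \<psi>: "\<psi> \<in> test_fun"
    define a where "a = cnj (cinner one_L2 (L2_of \<psi>) / k)"
    define \<theta> where "\<theta> s = \<psi> s + (- a) * \<eta> s" for s
    have \<theta>: "\<theta> \<in> test_fun" unfolding \<theta>_def by (intro test_fun_add test_fun_scale \<psi> \<eta>)
    have L\<theta>: "L2_of \<theta> = L2_of \<psi> + (- a) *\<^sub>C L2_of \<eta>"
      unfolding \<theta>_def using \<psi> \<eta> by (simp only: L2_of_add L2_of_scaleC square_integrable_test_fun square_integrable_mult_const)
    have "cinner one_L2 (L2_of \<theta>) = 0"
      using \<eta>(2) by (simp add: L\<theta> cinner_add_right cinner_scaleC_right a_def k_def)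
    then have "cinner (L2_of \<theta>) one_L2 = 0" using cinner_commute[of "L2_of \<theta>" one_L2] by simp
    then have i0: "(LINT s|unit_interval. \<theta> s) = 0" by (simp add: cinner_one square_integrable_test_fun \<theta>)
    obtain c d where cd: "0 < c" "c \<le> d" "d < 1" "\<And>s. s \<le> c \<or> d \<le> s \<Longrightarrow> \<theta> s = 0" by (rule test_fun_support[OF \<theta>]) blast
    obtain F where F: "\<And>s. (F has_vector_derivative \<theta> s) (at s)" "\<And>s. s \<le> c \<Longrightarrow> F s = 0" "\<And>s t. d \<le> s \<Longrightarrow> d \<le> t \<Longrightarrow> F s = F t"
      by (rule primitive_of_compact_support[OF test_funD(2)[OF \<theta>] cd(4)]) blast+
    have "F 1 = 0" using integral_derivative_unit_interval[OF F(1) test_funD(2)[OF \<theta>]] i0 F(2)[of 0] cd(1) by simp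
    then have "F s = 0" if "d \<le> s" for s using F(3)[of s 1] that cd by simp
    then have "F \<in> test_fun"
      by (intro test_funI[OF F(1) test_funD(2)[OF \<theta>], where K = "{c..d}"]) (use cd F(2) in auto)
    then have "cinner h (L2_of (deriv_of F)) = 0" by (rule h)
    moreover have "deriv_of F = \<theta>" using vector_derivative_at[OF F(1)] by blast
    ultimately have "cinner h (L2_of \<psi>) = cnj a * cinner h (L2_of \<eta>)"
      by (simp add: L\<theta> cinner_add_right cinner_scaleC_right)
    then show "cinner (h + (- m) *\<^sub>C one_L2) (L2_of \<psi>) = 0"
      by (simp add: cinner_add_left cinner_scaleC_left m_def a_def)
  qed
  then have "h = m *\<^sub>C one_L2" using scaleC_diff_left[of 0 m one_L2] by (simp add: add_eq_0_iff)
  then show thesis by (rule that)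
qed

text \<open>Weak differentiation is isometric on the Sobolev space with the energy norm, so its range
  is closed; and what is orthogonal to the range is constant.\<close>

lemma wderiv_surj:
  assumes p: "cinner p one_L2 = 0"
  shows "\<exists>u. wderiv (H01_embed u) = p"
proof -
  define R where "R = range (\<lambda>u. wderiv (H01_embed u))"
  have lin: "wderiv (H01_embed (u + c *\<^sub>C v)) = wderiv (H01_embed u) + c *\<^sub>C wderiv (H01_embed v)" for u v c
    by (simp add: plus_H01.rep_eq scaleC_H01.rep_eq wderiv_add wderiv_scaleC H1_scaleC)
  have scR: "c *\<^sub>C x \<in> R" if x: "x \<in> R" for c x
  proof -
    obtain u where "x = wderiv (H01_embed u)" using x by (auto simp: R_def)
    then have "c *\<^sub>C x = wderiv (H01_embed (0 + c *\<^sub>C u))" unfolding lin by (simp add: zero_H01.rep_eq)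
    then show ?thesis unfolding R_def by (rule range_eqI)
  qed
  have sub: "subspace R"
  proof (rule subspaceI)
    show "0 \<in> R" unfolding R_def by (rule range_eqI[of _ _ 0]) (simp add: zero_H01.rep_eq)
    show "x + y \<in> R" if xy: "x \<in> R" "y \<in> R" for x y
    proof -
      obtain u v where "x = wderiv (H01_embed u)" "y = wderiv (H01_embed v)" using xy by (auto simp: R_def)
      then have "x + y = wderiv (H01_embed (u + 1 *\<^sub>C v))" unfolding lin by (simp add: scaleC_one)
      then show ?thesis unfolding R_def by (rule range_eqI)
    qed
    show "c *\<^sub>R x \<in> R" if "x \<in> R" for c x
      using scR[OF that] by (simp add: scaleR_scaleC)
  qed
  have "complete R"
    unfolding complete_def
  proof (intro allI impI, elim conjE)
    fix x assume x: "\<forall>n. x n \<in> R" "Cauchy x"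
    have "\<forall>n. \<exists>u. x n = wderiv (H01_embed u)" using x(1) by (auto simp: R_def)
    then obtain u where u: "\<And>n. x n = wderiv (H01_embed (u n))" by metis
    then have "Cauchy u" using x(2) by (simp add: Cauchy_def dist_H01)
    then obtain v where "u \<longlonglongrightarrow> v" using Cauchy_convergent convergent_def by blast
    then have "x \<longlonglongrightarrow> wderiv (H01_embed v)" using u by (simp add: tendsto_dist_iff[of u] tendsto_dist_iff[of x] dist_H01)
    then show "\<exists>l\<in>R. x \<longlonglongrightarrow> l" by (auto simp: R_def)
  qed
  then have "closed R" by (rule complete_imp_closed)
  then obtain r where r: "r \<in> R" "\<And>y. y \<in> R \<Longrightarrow> inner (p - r) y = 0"
    using orthogonal_projection_exists[OF _ sub] by blast
  have "cinner (p - r) (L2_of (deriv_of \<phi>)) = 0" if "\<phi> \<in> test_fun" for \<phi>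
  proof (rule inner_zero_cinner_zero[OF r(2) scR])
    have "H01_embed (H01_of (L2_of \<phi>)) = L2_of \<phi>" by (rule H01_of_inverse[OF test_fun_H01[OF that]])
    then have "wderiv (H01_embed (H01_of (L2_of \<phi>))) = L2_of (deriv_of \<phi>)" using that by (simp add: wderiv_test_fun)
    then show "L2_of (deriv_of \<phi>) \<in> R" unfolding R_def by (metis rangeI)
  qed
  then obtain m where m: "p - r = m *\<^sub>C one_L2" by (rule orthogonal_to_derivatives) blast+
  have "cinner r one_L2 = 0" using r(1) H01_wderiv_one by (auto simp: R_def)
  then have "cinner (p - r) one_L2 = 0"
    using p cinner_add_left[of "p - r" r one_L2] by simp
  then have "cinner (p - r) (p - r) = 0" unfolding m cinner_scaleC_right by simp
  then have "inner (p - r) (p - r) = 0" by (simp add: inner_eq_Re_cinner)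
  then show ?thesis using r(1) by (auto simp: R_def)
qed

text \<open>The halves of the Riemann invariant: slope and velocity.\<close>

definition riemann :: "energy_space \<Rightarrow> L2 \<times> L2"
  where "riemann x = (wderiv (H01_embed (fst x)), snd x)"

lemma riemann_add: "riemann (x + y) = riemann x + riemann y"
  by (simp add: riemann_def plus_H01.rep_eq wderiv_add)

lemma riemann_scaleC: "riemann (c *\<^sub>C x) = c *\<^sub>C riemann x"
  by (simp add: riemann_def scaleC_prod_def scaleC_H01.rep_eq wderiv_scaleC)

lemma riemann_diff: "riemann (x - y) = riemann x - riemann y"
  using riemann_add[of "x - y" y] by simp

lemma norm_riemann: "norm (riemann x) = norm x"
  by (simp add: riemann_def norm_prod_def norm_H01)

lemma riemann_bounded_linear: "bounded_linear riemann"
  by (rule bounded_linear_intro[where K = 1])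
    (simp_all add: riemann_add riemann_scaleC scaleR_scaleC norm_riemann)

lemma riemann_inject: "riemann x = riemann y \<longleftrightarrow> x = y"
  using norm_riemann[of "x - y"] by (auto simp: riemann_diff)

lemma riemann_mean: "cinner (riemann x) (one_L2, 0) = 0"
  using H01_wderiv_one[OF H01_embed] cinner_scaleC_right[of "snd x" 0 0] by (simp add: riemann_def cinner_prod_def)

lemma riemann_surj:
  assumes "cinner z (one_L2, 0) = 0"
  obtains x where "riemann x = z"
proof -
  have "cinner (fst z) one_L2 = 0" using assms cinner_scaleC_right[of "snd z" 0 0] by (simp add: cinner_prod_def)
  then obtain u where "wderiv (H01_embed u) = fst z" using wderiv_surj by blast
  then have "riemann (u, snd z) = z" by (simp add: riemann_def)
  then show thesis by (rule that)
qed

lemma translate_constant: "translate t (one_L2, 0) = (one_L2, 0)"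
proof -
  have c: "circle_fun (\<lambda>\<xi>. 1)" by (rule circle_fun_continuous) auto
  have "halves (\<lambda>\<xi>. 1) = (one_L2, 0)" by (simp add: halves_def)
  then show ?thesis using translate_halves[OF c, of t] by simp
qed

text \<open>D'Alembert's solution: the Riemann invariant moves with unit speed. Its mean value remains
  zero, which by \<open>riemann_surj\<close> makes the translated invariant that of another state.\<close>

definition wave_T :: "real \<Rightarrow> energy_space \<Rightarrow> energy_space"
  where "wave_T t x = (THE y. riemann y = translate t (riemann x))"

lemma riemann_wave_T: "riemann (wave_T t x) = translate t (riemann x)"
proof -
  have "cinner (translate t (riemann x)) (one_L2, 0) = 0"
    using translate_cinner[of t "riemann x" "(one_L2, 0)"] by (simp add: translate_constant riemann_mean)
  then obtain y where y: "riemann y = translate t (riemann x)" by (rule riemann_surj)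
  show ?thesis unfolding wave_T_def by (rule theI[of _ y]) (use y in \<open>auto simp flip: riemann_inject\<close>)
qed

lemma wave_T_eqI: "riemann y = translate t (riemann x) \<Longrightarrow> wave_T t x = y"
  by (simp flip: riemann_inject add: riemann_wave_T)

lemma wave_T_add: "wave_T t (x + y) = wave_T t x + wave_T t y"
  by (rule wave_T_eqI) (simp add: riemann_add riemann_wave_T translate_add)

lemma wave_T_scaleC: "wave_T t (c *\<^sub>C x) = c *\<^sub>C wave_T t x"
  by (rule wave_T_eqI) (simp add: riemann_scaleC riemann_wave_T translate_scaleC)

lemma norm_wave_T: "norm (wave_T t x) = norm x"
  using norm_riemann[of "wave_T t x"] by (simp add: riemann_wave_T norm_translate norm_riemann)

lemma wave_T_2: "wave_T 2 x = x"
  by (rule wave_T_eqI) (simp add: translate_2)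

interpretation wave: isometric_group wave_T
proof
  have "bounded_linear (wave_T t)" for t
    by (rule bounded_linear_intro[where K = 1]) (simp_all add: wave_T_add wave_T_scaleC scaleR_scaleC norm_wave_T)
  moreover have "wave_T 0 = id"
    by (rule ext, rule wave_T_eqI) (simp add: translate_0)
  moreover have "wave_T (s + t) = wave_T s \<circ> wave_T t" for s t
    by (rule ext, rule wave_T_eqI) (simp add: riemann_wave_T translate_translate)
  moreover have "continuous_on UNIV (\<lambda>t. wave_T t x)" for x
  proof -
    have "dist (wave_T s x) (wave_T t x) = dist (translate s (riemann x)) (translate t (riemann x))" for s t
      using norm_riemann[of "wave_T s x - wave_T t x"] by (simp add: dist_norm riemann_diff riemann_wave_T)
    then show ?thesis using translate_continuous[of "riemann x"] unfolding continuous_on_iff by simp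
  qed
  ultimately show "C0_group wave_T" by (simp add: C0_group_def wave_T_scaleC)
qed (rule norm_wave_T)

lemma cinner_scaleR_left: "cinner (r *\<^sub>R x) y = of_real r * cinner x y" for x y :: "'a::complex_inner"
  by (simp add: scaleR_scaleC cinner_scaleC_left)

lemma cinner_scaleR_right: "cinner x (r *\<^sub>R y) = of_real r * cinner x y" for x y :: "'a::complex_inner"
  by (simp add: scaleR_scaleC cinner_scaleC_right)

lemma cinner_minus_right: "cinner x (- y) = - cinner x y" for x y :: "'a::complex_inner"
  using cinner_scaleR_right[of x "- 1" y] by simp

lemma cinner_diff_left: "cinner (x - y) z = cinner x z - cinner y z" for x y z :: "'a::complex_inner"
  using cinner_add_left[of "x - y" y z] by simp

lemma cinner_diff_right: "cinner x (y - z) = cinner x y - cinner x z" for x y z :: "'a::complex_inner"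
  using cinner_add_right[of x "y - z" z] by simp

text \<open>Because translations are isometric, a difference quotient of \<open>z\<close> can be moved to the
  differentiable factor, at the cost of a sign and a reversed direction of time.\<close>

lemma translate_pairing:
  assumes lim: "((\<lambda>t. (translate t z - z) /\<^sub>R t) \<longlongrightarrow> k) (at 0)" and b: "bump h h'"
  shows "cinner k (halves (\<lambda>\<xi>. h (fold2 \<xi>))) = - cinner z (halves (\<lambda>\<xi>. h' (fold2 \<xi>)))"
proof (rule tendsto_unique[OF trivial_limit_at])
  let ?e = "halves (\<lambda>\<xi>. h (fold2 \<xi>))"
  show "((\<lambda>t. cinner ((translate t z - z) /\<^sub>R t) ?e) \<longlongrightarrow> cinner k ?e) (at 0)"
    by (rule bounded_linear.tendsto[OF bounded_linear_cinner_left lim])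
  have neg: "filterlim uminus (at 0) (at (0::real))"
    unfolding filterlim_at by (auto intro!: tendsto_eq_intros simp: eventually_at_filter)
  have "((\<lambda>t. - cinner z ((translate t ?e - ?e) /\<^sub>R t)) \<longlongrightarrow> - cinner z (halves (\<lambda>\<xi>. h' (fold2 \<xi>)))) (at 0)"
    by (intro tendsto_minus bounded_linear.tendsto[OF bounded_linear_cinner_right bump_translate[OF b]])
  then have "((\<lambda>t. - cinner z ((translate (- t) ?e - ?e) /\<^sub>R (- t))) \<longlongrightarrow> - cinner z (halves (\<lambda>\<xi>. h' (fold2 \<xi>)))) (at 0)"
    by (rule filterlim_compose[OF _ neg])
  moreover have "- cinner z ((translate (- t) ?e - ?e) /\<^sub>R (- t)) = cinner ((translate t z - z) /\<^sub>R t) ?e" for t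
  proof -
    have "cinner (translate t z) ?e = cinner (translate (- t) (translate t z)) (translate (- t) ?e)"
      by (rule translate_cinner[symmetric])
    also have "\<dots> = cinner z (translate (- t) ?e)" by (simp add: translate_translate translate_0)
    finally show ?thesis
      by (simp add: cinner_scaleR_left cinner_scaleR_right cinner_diff_left cinner_diff_right cinner_minus_right)
  qed
  ultimately show "((\<lambda>t. cinner ((translate t z - z) /\<^sub>R t) ?e) \<longlongrightarrow> - cinner z (halves (\<lambda>\<xi>. h' (fold2 \<xi>)))) (at 0)" by simp
qed

text \<open>Pairing with the odd extensions of test functions shows that the slope has the second
  component of \<open>y\<close> as its weak derivative. Pairing with their primitives, which are even bumps,
  shows that the first component of \<open>y\<close> is the velocity.\<close>

lemma wave_T_generator:
  assumes g: "wave.gen x y"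
  shows "x \<in> wave_domain \<and> y = wave_operator x"
proof -
  obtain u q where x: "x = (u, q)" by (cases x)
  obtain y1 y2 where y: "y = (y1, y2)" by (cases y)
  let ?p = "wderiv (H01_embed u)"
  have "((\<lambda>t. riemann ((wave_T t x - x) /\<^sub>R t)) \<longlongrightarrow> riemann y) (at 0)"
    using g unfolding wave.gen_def by (rule bounded_linear.tendsto[OF riemann_bounded_linear])
  then have lim: "((\<lambda>t. (translate t (riemann x) - riemann x) /\<^sub>R t) \<longlongrightarrow> riemann y) (at 0)"
    by (simp add: scaleR_scaleC riemann_scaleC riemann_diff riemann_wave_T)
  have z: "cinner a 0 = 0" for a :: L2 using cinner_scaleC_right[of a 0 0] by simp
  have "cinner ?p (L2_of (deriv_of \<phi>)) = - cinner y2 (L2_of \<phi>)" if \<phi>: "\<phi> \<in> test_fun" for \<phi>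
    using translate_pairing[OF lim bump_odd[OF \<phi>]] unfolding halves_bump_odd[OF \<phi>]
    by (simp add: x y riemann_def cinner_prod_def z)
  then have w: "weak_deriv ?p y2" by (simp add: weak_deriv_iff_test)
  have "cinner (H01_embed y1 - q) (L2_of \<psi>) = 0" if \<psi>: "\<psi> \<in> test_fun" for \<psi>
  proof -
    define k where "k s = \<psi> s - \<psi> (- s)" for s
    have kc: "continuous_on UNIV k"
      unfolding k_def by (intro continuous_intros continuous_on_compose2[OF test_funD(2)[OF \<psi>]] test_funD(2)[OF \<psi>]) auto
    have kz: "k s = 0" if "s \<le> -1 \<or> 1 \<le> s" for s
      using that test_funD(4)[OF \<psi>, of s] test_funD(4)[OF \<psi>, of "- s"] by (auto simp: k_def)
    obtain F where F: "\<And>s. (F has_vector_derivative k s) (at s)" "\<And>s. s \<le> -1 \<Longrightarrow> F s = 0" "\<And>s t. 1 \<le> s \<Longrightarrow> 1 \<le> t \<Longrightarrow> F s = F t"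
      by (rule primitive_of_compact_support[OF kc kz]) blast+
    have even: "F (- s) = F s" for s
    proof -
      have "F s - F (- s) = F 0 - F (- 0)"
      proof (rule zero_derivative_constant[of UNIV "\<lambda>s. F s - F (- s)"])
        fix s :: real
        have "((\<lambda>s. F (- s)) has_vector_derivative - k (- s)) (at s)"
          using vector_diff_chain_at[of "\<lambda>s. - s" "- 1" s F "k (- s)"] F(1)[of "- s"]
            has_vector_derivative_minus[OF has_vector_derivative_id, of "at s"] by (simp add: comp_def)
        from has_vector_derivative_diff[OF F(1)[of s] this]
        show "((\<lambda>s. F s - F (- s)) has_vector_derivative 0) (at s)" by (simp add: k_def)
      qed auto
      then show ?thesis by simp
    qed
    have F1: "F s = 0" if "1 \<le> s" for s using even[of s] F(2)[of "- s"] that by simp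
    have b: "bump F k" unfolding bump_def using F kc kz F1 by (auto simp: abs_if split: if_splits)
    have Fc: "continuous_on UNIV F" by (intro continuous_at_imp_continuous_on ballI has_vector_derivative_continuous[OF F(1)])
    have k\<psi>: "L2_of k = L2_of \<psi>"
    proof (rule L2_of_cong_AE)
      show "AE s in unit_interval. k s = \<psi> s" by (rule AE_I2) (simp add: k_def test_funD(4)[OF \<psi>])
    qed (intro square_integrable_measurable square_integrable_continuous kc test_funD(2)[OF \<psi>])+
    have "(\<lambda>s. (k s - k (- s)) / 2) = k" by (auto simp: k_def)
    then have hk: "halves (\<lambda>\<xi>. k (fold2 \<xi>)) = (0, L2_of \<psi>)"
      using halves_fold2[of k] kc k\<psi> by (simp add: borel_measurable_continuous_onI k_def)
    have hF: "halves (\<lambda>\<xi>. F (fold2 \<xi>)) = (L2_of F, 0)"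
      using halves_fold2[of F] Fc by (simp add: borel_measurable_continuous_onI even)
    have "cinner (wderiv (H01_embed y1)) (L2_of F) = - cinner q (L2_of \<psi>)"
      using translate_pairing[OF lim b] unfolding hk hF by (simp add: x y riemann_def cinner_prod_def z)
    moreover have "cinner (wderiv (H01_embed y1)) (L2_of F) = - cinner (H01_embed y1) (L2_of \<psi>)"
      using H01_parts[OF H01_embed weak_deriv_smooth[OF F(1) kc]] by (simp add: k\<psi>)
    ultimately show ?thesis by (simp add: cinner_diff_left)
  qed
  then have "H01_embed y1 - q = 0" by (rule test_fun_orthogonal_zero)
  then have q: "q = H01_embed y1" by simp
  show ?thesis
    using H1_I[OF w] wderiv_eq[OF w] by (simp add: x y q wave_domain_def sobolev_H2_def H01_embed_inverse)
qed

lemma wave_operator_skew: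
  assumes x: "x \<in> wave_domain" and \<xi>: "\<xi> \<in> wave_domain"
  shows "inner (wave_operator x) \<xi> = - inner x (wave_operator \<xi>)"
proof -
  obtain u v where x': "x = (u, v)" by (cases x)
  obtain e f where \<xi>': "\<xi> = (e, f)" by (cases \<xi>)
  have uv: "wderiv (H01_embed u) \<in> sobolev_H1" "v \<in> sobolev_H01"
    using x by (auto simp: x' wave_domain_def sobolev_H2_def)
  have ef: "wderiv (H01_embed e) \<in> sobolev_H1" "f \<in> sobolev_H01"
    using \<xi> by (auto simp: \<xi>' wave_domain_def sobolev_H2_def)
  have 1: "cinner (wderiv v) (wderiv (H01_embed e)) = - cinner v (wderiv (wderiv (H01_embed e)))"
    by (rule H01_parts[OF uv(2) weak_deriv_wderiv[OF ef(1)]])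
  have "cinner (wderiv f) (wderiv (H01_embed u)) = - cinner f (wderiv (wderiv (H01_embed u)))"
    by (rule H01_parts[OF ef(2) weak_deriv_wderiv[OF uv(1)]])
  then have 2: "cinner (wderiv (H01_embed u)) (wderiv f) = - cinner (wderiv (wderiv (H01_embed u))) f"
    using cinner_commute[of "wderiv (H01_embed u)" "wderiv f"] cinner_commute[of "wderiv (wderiv (H01_embed u))" f] by simp
  have "cinner (wave_operator x) \<xi> = - cinner x (wave_operator \<xi>)"
    using 1 2 by (simp add: x' \<xi>' cinner_prod_def cinner_H01_def H01_of_inverse uv(2) ef(2))
  then show ?thesis by (simp add: inner_eq_Re_cinner)
qed

theorem wave_group_eq: "wave_group = wave_T"
  unfolding wave_group_def
proof (rule the_equality)
  have g: "generated_by wave_T wave_domain wave_operator"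
    by (rule wave.generated_by_skew_extension) (use wave_T_generator wave_operator_skew in auto)
  then show "C0_group wave_T \<and> generated_by wave_T wave_domain wave_operator" using wave.C0 by simp
  show "T = wave_T" if "C0_group T \<and> generated_by T wave_domain wave_operator" for T
    using wave.generator_determines_group[OF g] that by blast
qed

lemma snd_wave_T: "snd (wave_T t x) = L2_of (\<lambda>s. (profile (riemann x) (t + s) - profile (riemann x) (t - s)) / 2)"
proof -
  have "snd (wave_T t x) = snd (riemann (wave_T t x))" by (simp add: riemann_def)
  then show ?thesis by (simp add: riemann_wave_T translate_def halves_def add.commute)
qed

section \<open>The damping operators\<close>

lemma measurable_completion_AE:
  fixes f g :: "'a \<Rightarrow> 'b::topological_space"
  assumes g: "g \<in> borel_measurable M" and ae: "AE x in M. f x = g x"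
  shows "f \<in> borel_measurable (completion M)"
proof (rule measurableI)
  fix A :: "'b set" assume A: "A \<in> sets borel"
  have "AE x in completion M. (x \<in> g -` A \<inter> space M) \<longleftrightarrow> (x \<in> f -` A \<inter> space M)"
    using AE_completion[OF ae] by eventually_elim auto
  moreover have "g -` A \<inter> space M \<in> sets (completion M)" using measurable_sets[OF g A] by simp
  ultimately show "f -` A \<inter> space (completion M) \<in> sets (completion M)"
    by (simp add: completion.in_sets_AE[of "g -` A \<inter> space M" "f -` A \<inter> space M"])
qed simp

lemma integral_completion_AE:
  fixes f g :: "'a \<Rightarrow> 'b::{banach, second_countable_topology}"
  assumes g: "g \<in> borel_measurable M" and ae: "AE x in M. f x = g x"
  shows "integral\<^sup>L (completion M) f = integral\<^sup>L M g"
proof -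
  have "integral\<^sup>L (completion M) f = integral\<^sup>L (completion M) g"
    by (rule integral_cong_AE[OF measurable_completion_AE[OF g ae] measurable_completion[OF g] AE_completion[OF ae]])
  then show ?thesis by (simp add: integral_completion[OF g])
qed

lemma L2_of_cong_AE_borel:
  assumes g: "g \<in> borel_measurable borel" and ae: "AE s in lborel. s \<in> {0<..<1} \<longrightarrow> f s = g s"
  shows "L2_of f = L2_of g"
proof (rule L2_of_cong_AE)
  have ae': "AE s in lborel. (if s \<in> {0<..<1} then f s else 0) = (if s \<in> {0<..<1} then g s else 0)"
    using ae by eventually_elim auto
  have "(\<lambda>s. if s \<in> {0<..<1} then g s else 0) \<in> borel_measurable lborel" using g by measurable
  from measurable_completion_AE[OF this ae'] show "f \<in> borel_measurable unit_interval"
    by (rule borel_measurable_if_D)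
  show "g \<in> borel_measurable unit_interval" by (rule borel_measurable_unit_interval[OF g])
  show "AE s in unit_interval. f s = g s"
    using AE_completion[OF ae] by (simp add: AE_restrict_space_iff)
qed

lemma borel_imp_measurable_unit_interval:
  fixes f :: "real \<Rightarrow> 'a::topological_space"
  assumes "f \<in> borel_measurable borel"
  shows "f \<in> borel_measurable unit_interval"
proof (rule measurable_restrict_space1)
  have "f \<in> borel_measurable lborel" using assms by simp
  then show "f \<in> borel_measurable lebesgue" by (rule measurable_completion)
qed

text \<open>In a separable metric space every open set is a countable union of balls.\<close>

lemma borel_measurable_if_dist:
  fixes f :: "'a \<Rightarrow> 'b::{metric_space, second_countable_topology}"
  assumes "\<And>y. (\<lambda>t. dist (f t) y) \<in> borel_measurable M"
  shows "f \<in> borel_measurable M"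
proof (rule borel_measurableI)
  fix U :: "'b set" assume U: "open U"
  define B where "B = {ball y e | y e. ball y e \<subseteq> U}"
  obtain B' where B': "B' \<subseteq> B" "countable B'" "\<Union>B' = \<Union>B"
    by (rule Lindelof[of B]) (auto simp: B_def)
  have "\<Union>B = U"
  proof
    show "U \<subseteq> \<Union>B"
    proof
      fix y assume "y \<in> U"
      then obtain e where "e > 0" "ball y e \<subseteq> U" using U openE by blast
      then have "ball y e \<in> B" "y \<in> ball y e" by (auto simp: B_def)
      then show "y \<in> \<Union>B" by blast
    qed
  qed (auto simp: B_def)
  then have U': "U = \<Union>B'" using B'(3) by simp
  have "f -` U \<inter> space M = (\<Union>b\<in>B'. f -` b \<inter> space M)" unfolding U' by blast
  also have "\<dots> \<in> sets M"
  proof (rule sets.countable_UN''[OF B'(2)])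
    fix b assume "b \<in> B'"
    then obtain y e where b: "b = ball y e" using B'(1) by (auto simp: B_def)
    have "{t \<in> space M. dist (f t) y < e} \<in> sets M" using assms[of y] by measurable
    also have "{t \<in> space M. dist (f t) y < e} = f -` b \<inter> space M" by (auto simp: b dist_commute)
    finally show "f -` b \<inter> space M \<in> sets M" .
  qed
  finally show "f -` U \<inter> space M \<in> sets M" .
qed

lemma lborel2: "(lborel :: (real \<times> real) measure) = lborel \<Otimes>\<^sub>M lborel"
  by (rule lborel_prod[symmetric])

lemma AE_lborel_translate:
  fixes a :: "'a::euclidean_space"
  assumes "AE p in lborel. P p"
  shows "AE p in lborel. P (a + p)"
proof (rule AE_distrD[of "(+) a" lborel borel])
  show "AE p in distr lborel borel ((+) a). P p" unfolding lborel_distr_plus by (rule assms)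
qed simp

lemma AE_lborel_sections:
  assumes "AE p in lborel. P (p :: real \<times> real)"
  shows "AE t in lborel. AE s in lborel. P (s, t)"
proof -
  have "AE p in lborel \<Otimes>\<^sub>M lborel. P p" using assms by (simp only: lborel2)
  then have "AE p in distr (lborel \<Otimes>\<^sub>M lborel) (lborel \<Otimes>\<^sub>M lborel) (\<lambda>(x::real, y::real). (y, x)). P p"
    unfolding lborel_pair.distr_pair_swap[symmetric] .
  then have "AE p in lborel \<Otimes>\<^sub>M lborel. P (case p of (x, y) \<Rightarrow> (y, x))"
    by (rule AE_distrD[rotated]) simp
  from lborel_pair.AE_pair[OF this] show ?thesis by simp
qed

lemma AE_lborel_of_sections:
  assumes P: "{p. P p} \<in> sets (borel :: (real \<times> real) measure)" and ae: "AE t in lborel. AE s in lborel. P (s, t)"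
  shows "AE p in lborel. P p"
proof -
  have P': "{p \<in> space (lborel \<Otimes>\<^sub>M lborel). P p} \<in> sets (lborel \<Otimes>\<^sub>M lborel :: (real \<times> real) measure)"
  proof -
    have "sets (lborel \<Otimes>\<^sub>M lborel :: (real \<times> real) measure) = sets borel" unfolding lborel_prod by simp
    then show ?thesis using P by (simp add: space_pair_measure)
  qed
  have "(AE s in lborel. AE t in lborel. P (s, t)) \<longleftrightarrow> (AE t in lborel. AE s in lborel. P (s, t))"
    by (rule lborel_pair.AE_commute) (use P' in simp)
  then show ?thesis using lborel_pair.AE_pair_measure[OF P'] ae by (simp only: lborel2)
qed

lemma wave_T_jointly_continuous: "continuous_on UNIV (\<lambda>x. wave_T (fst x) (snd x))"
proof (rule continuous_at_imp_continuous_on, rule ballI, unfold isCont_def, rule tendstoI)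
  fix x :: "real \<times> energy_space" and e :: real assume "e > 0"
  have "isCont (\<lambda>t. wave_T t (snd x)) (fst x)" using wave.cont by (simp add: continuous_on_eq_continuous_at)
  then have "((\<lambda>z. wave_T (fst z) (snd x)) \<longlongrightarrow> wave_T (fst x) (snd x)) (at x)"
    by (rule isCont_tendsto_compose) (intro tendsto_intros)
  then have "\<forall>\<^sub>F z in at x. dist (wave_T (fst z) (snd x)) (wave_T (fst x) (snd x)) < e / 2"
    by (rule tendstoD) (use \<open>e > 0\<close> in simp)
  moreover have "(snd \<longlongrightarrow> snd x) (at x)" by (intro tendsto_intros)
  then have "\<forall>\<^sub>F z in at x. dist (snd z) (snd x) < e / 2" by (rule tendstoD) (use \<open>e > 0\<close> in simp)
  ultimately show "\<forall>\<^sub>F z in at x. dist (wave_T (fst z) (snd z)) (wave_T (fst x) (snd x)) < e"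
  proof eventually_elim
    case (elim z)
    have "dist (wave_T (fst z) (snd z)) (wave_T (fst z) (snd x)) = dist (snd z) (snd x)"
      by (simp add: dist_norm norm_wave_T flip: wave.simps)
    then show ?case using elim dist_triangle[of "wave_T (fst z) (snd z)" "wave_T (fst x) (snd x)" "wave_T (fst z) (snd x)"] by simp
  qed
qed

lemma wave_T_continuous:
  assumes "continuous_on S f" "continuous_on S z"
  shows "continuous_on S (\<lambda>t. wave_T (f t) (z t))"
  using continuous_on_compose2[OF wave_T_jointly_continuous continuous_on_Pair[OF assms]] by simp

text \<open>A Borel version of the damping coefficient that is bounded, nonnegative and periodic
  everywhere instead of almost everywhere.\<close>

locale periodic_damping =
  fixes \<beta> :: "real \<times> real \<Rightarrow> real" and K :: real
  assumes \<beta>_borel [measurable]: "\<beta> \<in> borel_measurable borel"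
    and \<beta>_nonneg: "0 \<le> \<beta> p" and \<beta>_le: "\<beta> p \<le> K" and \<beta>_periodic: "\<beta> (s, t + 2) = \<beta> (s, t)"
    and K_pos: "K > 0"
begin

lemma \<beta>_section [measurable]: "(\<lambda>s. \<beta> (s, t)) \<in> borel_measurable borel"
  by measurable

lemma \<beta>_section_unit: "(\<lambda>s. \<beta> (s, t)) \<in> borel_measurable unit_interval"
  by (rule borel_imp_measurable_unit_interval[OF \<beta>_section])

definition mult :: "real \<Rightarrow> L2 \<Rightarrow> L2"
  where "mult t v = L2_of (\<lambda>s. complex_of_real (\<beta> (s, t)) * rep_L2 v s)"

lemma square_integrable_\<beta>_mult:
  assumes f: "square_integrable f"
  shows "square_integrable (\<lambda>s. complex_of_real (\<beta> (s, t)) * f s)"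
proof (rule square_integrable_dominated[where g = "\<lambda>s. K\<^sup>2 * (cmod (f s))\<^sup>2"])
  note [measurable] = square_integrable_measurable[OF f] \<beta>_section_unit
  show "(\<lambda>s. complex_of_real (\<beta> (s, t)) * f s) \<in> borel_measurable unit_interval" by measurable
  show "integrable unit_interval (\<lambda>s. K\<^sup>2 * (cmod (f s))\<^sup>2)" using square_integrableD[OF f] by simp
  show "AE s in unit_interval. (cmod (complex_of_real (\<beta> (s, t)) * f s))\<^sup>2 \<le> K\<^sup>2 * (cmod (f s))\<^sup>2"
    using \<beta>_nonneg \<beta>_le by (intro AE_I2) (auto simp: norm_mult power_mult_distrib intro!: mult_right_mono power_mono)
qed

lemma mult_L2_of:
  assumes f: "square_integrable f"
  shows "mult t (L2_of f) = L2_of (\<lambda>s. complex_of_real (\<beta> (s, t)) * f s)"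
  unfolding mult_def
proof (rule L2_of_cong_AE)
  show "AE s in unit_interval. complex_of_real (\<beta> (s, t)) * rep_L2 (L2_of f) s = complex_of_real (\<beta> (s, t)) * f s"
    using rep_L2_of[OF f] by eventually_elim simp
qed (intro square_integrable_measurable square_integrable_\<beta>_mult f square_integrable_rep)+

lemma mult_lin: "mult t (v + c *\<^sub>C w) = mult t v + c *\<^sub>C mult t w"
proof -
  note s = square_integrable_\<beta>_mult[OF square_integrable_rep]
  have "v + c *\<^sub>C w = L2_of (\<lambda>s. rep_L2 v s + c * rep_L2 w s)"
    by (simp add: L2_of_add L2_of_scaleC square_integrable_mult_const)
  then have "mult t (v + c *\<^sub>C w) = L2_of (\<lambda>s. complex_of_real (\<beta> (s, t)) * (rep_L2 v s + c * rep_L2 w s))"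
    by (simp add: mult_L2_of square_integrable_add square_integrable_mult_const)
  also have "(\<lambda>s. complex_of_real (\<beta> (s, t)) * (rep_L2 v s + c * rep_L2 w s))
      = (\<lambda>s. complex_of_real (\<beta> (s, t)) * rep_L2 v s + c * (complex_of_real (\<beta> (s, t)) * rep_L2 w s))"
    by (auto simp: algebra_simps)
  also have "L2_of \<dots> = mult t v + c *\<^sub>C mult t w"
    using s by (simp only: L2_of_add L2_of_scaleC square_integrable_mult_const mult_def)
  finally show ?thesis .
qed

lemma mult_add: "mult t (v + w) = mult t v + mult t w"
  using mult_lin[of t v 1 w] by (simp add: scaleC_one)

lemma mult_0: "mult t 0 = 0"
  by (simp add: mult_L2_of[of "\<lambda>s. 0", simplified])

lemma mult_scaleC: "mult t (c *\<^sub>C w) = c *\<^sub>C mult t w"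
  using mult_lin[of t 0 c w] by (simp add: mult_0)

lemma mult_scaleR: "mult t (c *\<^sub>R w) = c *\<^sub>R mult t w"
  by (simp add: scaleR_scaleC mult_scaleC)

lemma mult_cinner:
  "cinner (mult t v) w = (LINT s|unit_interval. complex_of_real (\<beta> (s, t)) * (rep_L2 v s * cnj (rep_L2 w s)))"
  using cinner_L2_of[OF square_integrable_\<beta>_mult[OF square_integrable_rep[of v]] square_integrable_rep[of w]]
  by (simp add: mult_def mult.assoc)

lemma mult_inner_L2_of:
  assumes f: "square_integrable f"
  shows "inner (mult t (L2_of f)) (L2_of f) = (LINT s|unit_interval. \<beta> (s, t) * (cmod (f s))\<^sup>2)"
    and "integrable unit_interval (\<lambda>s. \<beta> (s, t) * (cmod (f s))\<^sup>2)"
proof -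
  have "cinner (mult t (L2_of f)) (L2_of f) = (LINT s|unit_interval. complex_of_real (\<beta> (s, t)) * f s * cnj (f s))"
    unfolding mult_L2_of[OF f] by (rule cinner_L2_of[OF square_integrable_\<beta>_mult[OF f] f])
  also have "\<dots> = (LINT s|unit_interval. complex_of_real (\<beta> (s, t) * (cmod (f s))\<^sup>2))"
    by (intro Bochner_Integration.integral_cong refl) (simp only: of_real_mult complex_norm_square mult.assoc)
  also have "\<dots> = of_real (LINT s|unit_interval. \<beta> (s, t) * (cmod (f s))\<^sup>2)" by (rule integral_complex_of_real)
  finally show "inner (mult t (L2_of f)) (L2_of f) = (LINT s|unit_interval. \<beta> (s, t) * (cmod (f s))\<^sup>2)"
    by (simp add: inner_eq_Re_cinner)
  show "integrable unit_interval (\<lambda>s. \<beta> (s, t) * (cmod (f s))\<^sup>2)"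
  proof (rule Bochner_Integration.integrable_bound[where f = "\<lambda>s. K * (cmod (f s))\<^sup>2"])
    note [measurable] = square_integrable_measurable[OF f] \<beta>_section_unit
    show "integrable unit_interval (\<lambda>s. K * (cmod (f s))\<^sup>2)" using square_integrableD[OF f] by simp
    show "(\<lambda>s. \<beta> (s, t) * (cmod (f s))\<^sup>2) \<in> borel_measurable unit_interval" by measurable
    show "AE s in unit_interval. norm (\<beta> (s, t) * (cmod (f s))\<^sup>2) \<le> norm (K * (cmod (f s))\<^sup>2)"
      using \<beta>_nonneg \<beta>_le K_pos by (intro AE_I2) (auto simp: abs_mult intro!: mult_right_mono)
  qed
qed

lemma mult_sym: "inner (mult t v) w = inner v (mult t w)"
proof -
  have "cinner (mult t v) w = cnj (cinner (mult t w) v)"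
    unfolding mult_cinner by (simp flip: Bochner_Integration.integral_cnj add: mult.commute mult.left_commute)
  then show ?thesis using cinner_commute[of v "mult t w"] by (simp add: inner_eq_Re_cinner)
qed

lemma mult_coercive: "(norm (mult t v))\<^sup>2 \<le> K * inner (mult t v) v"
proof -
  let ?f = "rep_L2 v"
  have "(norm (mult t v))\<^sup>2 = (LINT s|unit_interval. (cmod (complex_of_real (\<beta> (s, t)) * ?f s))\<^sup>2)"
    unfolding mult_def by (rule norm_L2_of[OF square_integrable_\<beta>_mult[OF square_integrable_rep]])
  also have "\<dots> \<le> (LINT s|unit_interval. K * (\<beta> (s, t) * (cmod (?f s))\<^sup>2))"
  proof (rule integral_mono)
    show "integrable unit_interval (\<lambda>s. (cmod (complex_of_real (\<beta> (s, t)) * ?f s))\<^sup>2)"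
      by (rule square_integrableD[OF square_integrable_\<beta>_mult[OF square_integrable_rep]])
    show "integrable unit_interval (\<lambda>s. K * (\<beta> (s, t) * (cmod (?f s))\<^sup>2))"
      using mult_inner_L2_of(2)[OF square_integrable_rep[of v], of t] by simp
    fix s
    have "\<beta> (s, t) * \<beta> (s, t) * (cmod (?f s))\<^sup>2 \<le> K * \<beta> (s, t) * (cmod (?f s))\<^sup>2"
      by (intro mult_right_mono \<beta>_le \<beta>_nonneg) simp
    then show "(cmod (complex_of_real (\<beta> (s, t)) * ?f s))\<^sup>2 \<le> K * (\<beta> (s, t) * (cmod (?f s))\<^sup>2)"
      by (simp add: norm_mult power_mult_distrib power2_eq_square[of "\<beta> (s, t)"] mult.assoc)
  qed
  also have "\<dots> = K * inner (mult t v) v" using mult_inner_L2_of(1)[OF square_integrable_rep[of v], of t] by simp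
  finally show ?thesis .
qed

lemma mult_bound: "norm (mult t v) \<le> K * norm v"
proof (cases "mult t v = 0")
  case False
  have "norm (mult t v) * norm (mult t v) \<le> K * (norm (mult t v) * norm v)"
    using mult_coercive[of t v] K_pos norm_cauchy_schwarz[of "mult t v" v]
    by (smt (verit) mult_left_mono power2_eq_square)
  then show ?thesis using False by (simp add: mult.left_commute)
qed (use K_pos in simp)

lemma mult_continuous: "continuous_on UNIV (mult t)"
proof -
  have "bounded_linear (mult t)"
    by (rule bounded_linear_intro[where K = K]) (use mult_bound[of t] in \<open>auto simp: mult_add mult_scaleR mult.commute\<close>)
  then show ?thesis by (rule linear_continuous_on)
qed

text \<open>The distance from a fixed function is the root of a parameter integral over a jointly
  measurable integrand.\<close>

lemma mult_measurable: "(\<lambda>t. mult t v) \<in> borel_measurable borel"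
proof (rule borel_measurable_if_dist)
  fix y
  interpret finite_measure unit_interval by (rule finite_measure_unit_interval)
  let ?f = "\<lambda>t s. complex_of_real (\<beta> (s, t)) * rep_L2 v s - rep_L2 y s"
  have "(dist (mult t v) y)\<^sup>2 = (LINT s|unit_interval. (cmod (?f t s))\<^sup>2)" for t
  proof -
    note s = square_integrable_\<beta>_mult[OF square_integrable_rep[of v]]
    have "mult t v - y = L2_of (?f t)"
      using L2_of_diff[OF s square_integrable_rep[of y]] by (simp add: mult_def)
    then show ?thesis using norm_L2_of[OF square_integrable_diff[OF s square_integrable_rep[of y]], of t] by (simp add: dist_norm)
  qed
  then have eq: "(\<lambda>t. dist (mult t v) y) = (\<lambda>t. sqrt (LINT s|unit_interval. (cmod (?f t s))\<^sup>2))"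
    by (metis real_sqrt_abs abs_of_nonneg zero_le_dist)
  have rep: "rep_L2 x \<in> borel_measurable unit_interval" for x by (rule square_integrable_measurable) simp
  have id: "(\<lambda>s. s) \<in> unit_interval \<rightarrow>\<^sub>M borel" by (rule borel_imp_measurable_unit_interval) simp
  have [measurable]: "(\<lambda>p. \<beta> (snd p, fst p)) \<in> borel_measurable (borel \<Otimes>\<^sub>M unit_interval)"
    by (rule measurable_compose[OF _ \<beta>_borel], simp only: borel_prod[symmetric])
      (intro measurable_Pair measurable_fst'' measurable_compose[OF measurable_snd id] measurable_fst)
  have [measurable]: "(\<lambda>p. rep_L2 x (snd p)) \<in> borel_measurable (borel \<Otimes>\<^sub>M unit_interval)" for x
    by (rule measurable_compose[OF measurable_snd rep])
  have "(\<lambda>t. LINT s|unit_interval. (cmod (?f t s))\<^sup>2) \<in> borel_measurable borel"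
    by (rule borel_measurable_lebesgue_integral) (simp add: split_beta')
  then show "(\<lambda>t. dist (mult t v) y) \<in> borel_measurable borel" unfolding eq by measurable
qed

text \<open>The damping seen from the undamped motion.\<close>

definition C :: "real \<Rightarrow> energy_space \<Rightarrow> energy_space"
  where "C r x = wave_T (- r) (0, mult r (snd (wave_T r x)))"

lemma wave_T_jointly_measurable:
  assumes f: "f \<in> borel_measurable borel"
  shows "(\<lambda>r. wave_T (- r) (f r)) \<in> borel_measurable borel"
proof (rule borel_measurable_continuous_Pair[where H = wave_T, OF _ f])
  show "uminus \<in> borel_measurable (borel :: real measure)" by simp
  show "continuous_on UNIV (\<lambda>x. wave_T (fst x) (snd x))" by (rule wave_T_jointly_continuous)
qed

lemma inner_C: "inner (C r x) y = inner (mult r (snd (wave_T r x))) (snd (wave_T r y))"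
  unfolding C_def wave.inner_T_left by (simp add: inner_prod_def)

lemma wave_T_period: "wave_T (r + 2) x = wave_T r x"
  using wave.group[of r 2 x] by (simp add: wave_T_2)

lemma wave_T_period': "wave_T (r - 2) x = wave_T r x"
  using wave_T_period[of "r - 2" x] by simp

sublocale dissipative_equation C K
proof
  fix r x y and c :: real
  show "C r (x + y) = C r x + C r y"
    unfolding C_def wave.simps(1)[symmetric] by (simp add: wave.simps mult_add)
  show "C r (c *\<^sub>R x) = c *\<^sub>R C r x"
    unfolding C_def wave.simps(4)[symmetric] by (simp add: wave.simps mult_scaleR)
  show "(norm (C r x))\<^sup>2 \<le> K * inner (C r x) x"
    unfolding inner_C using mult_coercive[of r "snd (wave_T r x)"] by (simp add: C_def norm_wave_T norm_Pair)
  show "inner (C r x) y = inner x (C r y)"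
    using inner_C[of r x y] inner_C[of r y x] mult_sym[of r "snd (wave_T r x)" "snd (wave_T r y)"] by (simp add: inner_commute)
  show "C (r + 2) x = C r x"
  proof -
    have "mult (r + 2) v = mult r v" for v by (simp add: mult_def \<beta>_periodic)
    then show ?thesis using wave_T_period'[of "- r"] by (simp add: C_def wave_T_period)
  qed
  show "(\<lambda>r. C r x) \<in> borel_measurable borel"
  proof -
    have "(\<lambda>r. mult r (snd (wave_T r x))) \<in> borel_measurable borel"
      by (rule caratheodory_measurable[OF mult_measurable mult_continuous]) (intro continuous_intros wave.cont)
    then have "(\<lambda>r. (0 :: H01, mult r (snd (wave_T r x)))) \<in> borel_measurable borel" by (intro borel_measurable_Pair) auto
    then show ?thesis unfolding C_def by (rule wave_T_jointly_measurable)
  qed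
qed (rule K_pos)

text \<open>Apply \<open>wave_T (- t)\<close> to the formula for mild solutions. At almost every time the sections
  of \<open>b\<close> and \<open>\<beta>\<close> define the same multiplication operator, simultaneously for all arguments; this
  matters because the integrand depends on the unknown \<open>z\<close>.\<close>

lemma mild_solution_iff:
  assumes b: "AE p in lborel. p \<in> strip \<longrightarrow> b p = \<beta> p"
    and z: "continuous_on {0..} z"
  shows "mild_solution b x z \<longleftrightarrow> solution x (\<lambda>t. wave_T (- t) (z t))"
proof -
  define w where "w t = wave_T (- t) (z t)" for t
  have zw: "z t = wave_T t (w t)" for t by (simp add: w_def wave.inverse2)
  have wc: "continuous_on {0..} w" unfolding w_def by (intro wave_T_continuous continuous_intros z)
  have "AE t in lborel. AE s in lborel. (s, t) \<in> strip \<longrightarrow> b (s, t) = \<beta> (s, t)"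
    by (rule AE_lborel_sections[OF b])
  then have ae: "AE t in lborel. \<forall>y. damping b t y = (0, mult t (snd y))"
  proof eventually_elim
    case (elim t)
    have "L2_of (\<lambda>s. complex_of_real (b (s, t)) * rep_L2 v s) = mult t v" for v
    proof -
      obtain f where f: "f \<in> borel_measurable borel" "AE s in lebesgue. s \<in> {0<..<1} \<longrightarrow> rep_L2 v s = f s"
        by (rule borel_representative[OF square_integrable_measurable[OF square_integrable_rep[of v]]]) auto
      have f2: "AE s in lborel. s \<in> {0<..<1} \<longrightarrow> rep_L2 v s = f s" using f(2) by (simp add: AE_completion_iff)
      have m: "(\<lambda>s. complex_of_real (\<beta> (s, t)) * f s) \<in> borel_measurable borel" using f(1) by measurable
      have "L2_of (\<lambda>s. complex_of_real (b (s, t)) * rep_L2 v s) = L2_of (\<lambda>s. complex_of_real (\<beta> (s, t)) * f s)"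
        by (rule L2_of_cong_AE_borel[OF m]) (use elim f2 in \<open>eventually_elim, auto simp: strip_def\<close>)
      also have "\<dots> = mult t v"
        unfolding mult_def by (rule L2_of_cong_AE_borel[OF m, symmetric]) (use f2 in \<open>eventually_elim, auto\<close>)
      finally show ?thesis .
    qed
    then show ?case by (auto simp: split_paired_all)
  qed
  have int: "(LINT r:{0..t}|lebesgue. wave_group (t - r) (damping b r (z r))) = wave_T t (LINT r:{0..t}|lborel. C r (w r))" for t
  proof -
    have i: "set_integrable lborel {0..t} (\<lambda>r. C r (w r))" by (rule set_integrable_C[OF wc]) simp
    have TC: "wave_T (t - r) (0, mult r (snd (z r))) = wave_T t (C r (w r))" for r
      by (simp add: C_def zw wave.group)
    have "(LINT r:{0..t}|lebesgue. wave_group (t - r) (damping b r (z r))) = (LINT r:{0..t}|lborel. wave_T t (C r (w r)))"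
      unfolding set_lebesgue_integral_def
    proof (rule integral_completion_AE)
      show "AE r in lborel. indicat_real {0..t} r *\<^sub>R wave_group (t - r) (damping b r (z r)) = indicat_real {0..t} r *\<^sub>R wave_T t (C r (w r))"
        using ae
      proof eventually_elim
        case (elim r)
        then have "damping b r (z r) = (0, mult r (snd (z r)))" by blast
        then show ?case by (simp add: wave_group_eq TC)
      qed
      have "integrable lborel (\<lambda>r. wave_T t (indicat_real {0..t} r *\<^sub>R C r (w r)))"
        by (rule integrable_bounded_linear[OF wave.blin]) (use i in \<open>simp add: set_integrable_def\<close>)
      then show "(\<lambda>r. indicat_real {0..t} r *\<^sub>R wave_T t (C r (w r))) \<in> borel_measurable lborel"
        by (simp add: wave.simps borel_measurable_integrable)
    qed
    also have "\<dots> = wave_T t (LINT r:{0..t}|lborel. C r (w r))"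
      unfolding set_lebesgue_integral_def wave.simps(4)[symmetric]
      by (rule integral_bounded_linear[OF wave.blin]) (use i in \<open>simp add: set_integrable_def\<close>)
    finally show ?thesis .
  qed
  have eq: "z t = wave_T t x - wave_T t I \<longleftrightarrow> w t = x - I" for t I
  proof -
    have "z t = wave_T t x - wave_T t I \<longleftrightarrow> wave_T t (w t) = wave_T t (x - I)" by (simp add: zw wave.simps)
    also have "\<dots> \<longleftrightarrow> w t = x - I" by (metis wave.inverse1)
    finally show ?thesis .
  qed
  show ?thesis
    unfolding mild_solution_def solution_def w_def[symmetric] int using z wc by (simp add: wave_group_eq eq)
qed

lemma solution_cong:
  assumes "solution x w" "\<And>t. t \<ge> 0 \<Longrightarrow> w' t = w t"
  shows "solution x w'"
  unfolding solution_def
proof (intro conjI allI impI)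
  show "continuous_on {0..} w'"
    using solution_continuous[OF assms(1)] by (rule continuous_on_eq) (simp add: assms(2))
  fix t :: real assume t: "t \<ge> 0"
  have "(LINT r:{0..t}|lborel. C r (w' r)) = (LINT r:{0..t}|lborel. C r (w r))"
    by (intro set_lebesgue_integral_cong) (auto simp: assms(2))
  then show "w' t = x - (LINT r:{0..t}|lborel. C r (w' r))"
    using solution_eq[OF assms(1) t] assms(2)[OF t] by simp
qed

lemma damped_solution_eq:
  assumes b: "AE p in lborel. p \<in> strip \<longrightarrow> b p = \<beta> p" and t: "t \<ge> 0"
  shows "damped_solution b x t = wave_T t (sol x t)"
proof -
  define Z where "Z t = (if t \<in> {0..} then wave_T t (sol x t) else undefined)" for t
  have Zc: "continuous_on {0..} Z"
  proof (rule continuous_on_eq)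
    show "continuous_on {0..} (\<lambda>t. wave_T t (sol x t))" by (intro wave_T_continuous continuous_intros sol_cont)
  qed (simp add: Z_def)
  have "mild_solution b x Z"
    unfolding mild_solution_iff[OF b Zc]
    by (rule solution_cong[OF solution_sol]) (simp add: Z_def wave.inverse1)
  moreover have "Z \<in> extensional {0..}" by (simp add: Z_def extensional_def)
  moreover have "z = Z" if z: "z \<in> extensional {0..}" "mild_solution b x z" for z
  proof
    fix t
    have "continuous_on {0..} z" using z(2) by (simp add: mild_solution_def)
    then have s: "solution x (\<lambda>t. wave_T (- t) (z t))" using z(2) mild_solution_iff[OF b] by blast
    show "z t = Z t"
    proof (cases "t \<ge> 0")
      case True
      then show ?thesis using sol_eqI[OF s True] by (simp add: Z_def wave.inverse2)
    next
      case False
      then show ?thesis using z(1) by (simp add: Z_def extensional_def)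
    qed
  qed
  ultimately have "damped_solution b x = Z" unfolding damped_solution_def by (intro the_equality) blast+
  then show ?thesis using t by (simp add: Z_def)
qed

end

section \<open>The velocity field and the observed energy\<close>

text \<open>D'Alembert's formula, which provides a jointly measurable version of the velocity.\<close>

definition velocity_field :: "energy_space \<Rightarrow> real \<times> real \<Rightarrow> complex"
  where "velocity_field x p = (profile (riemann x) (snd p + fst p) - profile (riemann x) (snd p - fst p)) / 2"

lemma velocity_field_measurable [measurable]: "velocity_field x \<in> borel_measurable borel"
proof -
  note g = circle_funD(1)[OF circle_fun_profile[of "riemann x"]]
  have "(\<lambda>p::real \<times> real. snd p + fst p) \<in> borel_measurable borel" "(\<lambda>p::real \<times> real. snd p - fst p) \<in> borel_measurable borel"
    by (intro borel_measurable_continuous_onI continuous_intros)+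
  note [measurable] = measurable_compose[OF this(1) g] measurable_compose[OF this(2) g]
  show ?thesis unfolding velocity_field_def[abs_def] by measurable
qed

lemma velocity_field_section:
  "square_integrable (\<lambda>s. velocity_field x (s, t))" "L2_of (\<lambda>s. velocity_field x (s, t)) = snd (wave_T t x)"
  using square_integrable_halves(2)[OF circle_fun_shift[OF circle_fun_profile[of "riemann x"], of t]]
  by (simp_all add: velocity_field_def snd_wave_T add.commute)

lemma strip_borel: "strip \<in> sets borel"
  unfolding strip_def by (intro borel_open open_Times) auto

text \<open>On almost every time slice the two functions represent the same element of \<open>L2\<close>; by
  Fubini's theorem, applied to a Borel version, they agree almost everywhere.\<close>

lemma velocity_eq: "AE p in lborel. p \<in> strip \<longrightarrow> velocity x p = velocity_field x p"
proof -
  have "velocity_field x \<in> borel_measurable (lebesgue_on strip)"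
  proof (rule measurable_restrict_space1)
    have "velocity_field x \<in> borel_measurable lborel" by simp
    then show "velocity_field x \<in> borel_measurable lebesgue" by (rule measurable_completion)
  qed
  then have "\<exists>v. v \<in> borel_measurable (lebesgue_on strip) \<and>
    (AE t in lebesgue. square_integrable (\<lambda>s. v (s, t)) \<and> L2_of (\<lambda>s. v (s, t)) = snd (wave_group t x))"
    by (intro exI[of _ "velocity_field x"]) (simp add: velocity_field_section wave_group_eq)
  from someI_ex[OF this] have v: "velocity x \<in> borel_measurable (lebesgue_on strip)"
    "AE t in lebesgue. square_integrable (\<lambda>s. velocity x (s, t)) \<and> L2_of (\<lambda>s. velocity x (s, t)) = snd (wave_T t x)"
    unfolding velocity_def[symmetric] by (auto simp: wave_group_eq)
  obtain v' where v': "v' \<in> borel_measurable borel" "AE p in lebesgue. p \<in> strip \<longrightarrow> velocity x p = v' p"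
    by (rule borel_representative[OF v(1) strip_borel]) blast
  have ae': "AE p in lborel. p \<in> strip \<longrightarrow> velocity x p = v' p" using v'(2) by (simp add: AE_completion_iff)
  have "AE t in lborel. square_integrable (\<lambda>s. velocity x (s, t)) \<and> L2_of (\<lambda>s. velocity x (s, t)) = snd (wave_T t x)"
    using v(2) by (simp add: AE_completion_iff)
  then have "AE t in lborel. AE s in lborel. (s, t) \<in> strip \<longrightarrow> v' (s, t) = velocity_field x (s, t)"
    using AE_lborel_sections[OF ae']
  proof eventually_elim
    case (elim t)
    then have "AE s in unit_interval. velocity x (s, t) = velocity_field x (s, t)"
      using L2_of_eq_iff[of "\<lambda>s. velocity x (s, t)" "\<lambda>s. velocity_field x (s, t)"] by (simp add: velocity_field_section)
    then have "AE s in lborel. s \<in> {0<..<1} \<longrightarrow> velocity x (s, t) = velocity_field x (s, t)"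
      by (simp add: AE_restrict_space_iff AE_completion_iff)
    with elim(2) show ?case by eventually_elim (auto simp: strip_def)
  qed
  then have "AE p in lborel. p \<in> strip \<longrightarrow> v' p = velocity_field x p"
  proof (rule AE_lborel_of_sections[rotated])
    have "{p \<in> space borel. v' p = velocity_field x p} \<in> sets borel" using v'(1) by measurable
    moreover have "{p. p \<in> strip \<longrightarrow> v' p = velocity_field x p} = (- strip) \<union> {p \<in> space borel. v' p = velocity_field x p}" by auto
    ultimately show "{p. p \<in> strip \<longrightarrow> v' p = velocity_field x p} \<in> sets borel" using strip_borel by auto
  qed
  then show ?thesis using ae' by eventually_elim auto
qed

context periodic_damping begin

lemma observed_energy_eq:
  assumes b: "AE p in lborel. p \<in> strip \<longrightarrow> b p = \<beta> p"
  shows "observed_energy b x = q x"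
    and "(\<integral>\<^sup>+p. ennreal (indicator period_cell p * (\<beta> p * (cmod (velocity_field x p))\<^sup>2)) \<partial>lborel) = ennreal (q x)"
proof -
  let ?v = "velocity_field x"
  let ?G = "\<lambda>p. indicator period_cell p * (\<beta> p * (cmod (?v p))\<^sup>2)"
  have cell: "period_cell \<in> sets borel" unfolding period_cell_def by (intro borel_open open_Times) auto
  have cs: "p \<in> strip" if "p \<in> period_cell" for p using that by (auto simp: strip_def period_cell_def)
  have Gm[measurable]: "?G \<in> borel_measurable borel" using cell by measurable
  have G0: "0 \<le> ?G p" for p by (intro mult_nonneg_nonneg \<beta>_nonneg) auto
  have "observed_energy b x = (LINT p|lebesgue. indicator period_cell p *\<^sub>R (b p * (cmod (velocity x p))\<^sup>2))"
    unfolding observed_energy_def by (rule integral_restrict_space) (use cell in simp)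
  also have "\<dots> = (LINT p|lborel. ?G p)"
  proof (rule integral_completion_AE)
    show "AE p in lborel. indicator period_cell p *\<^sub>R (b p * (cmod (velocity x p))\<^sup>2) = ?G p"
      using b velocity_eq[of x] by eventually_elim (use cs in \<open>auto simp: indicator_def\<close>)
  qed simp
  also have "\<dots> = enn2real (\<integral>\<^sup>+p. ennreal (?G p) \<partial>lborel)"
    by (rule integral_eq_nn_integral) (use G0 in auto)
  finally have 1: "observed_energy b x = enn2real (\<integral>\<^sup>+p. ennreal (?G p) \<partial>lborel)" .
  have \<phi>: "ennreal (inner (C t x) x) = (\<integral>\<^sup>+s. ennreal (\<beta> (s, t) * (cmod (?v (s, t)))\<^sup>2) * indicator {0<..<1} s \<partial>lborel)" for t
  proof -
    have "inner (C t x) x = (LINT s|unit_interval. \<beta> (s, t) * (cmod (?v (s, t)))\<^sup>2)"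
      unfolding inner_C velocity_field_section(2)[symmetric] by (rule mult_inner_L2_of(1)[OF velocity_field_section(1)])
    also have "ennreal \<dots> = (\<integral>\<^sup>+s. ennreal (\<beta> (s, t) * (cmod (?v (s, t)))\<^sup>2) \<partial>unit_interval)"
      by (rule nn_integral_eq_integral[symmetric, OF mult_inner_L2_of(2)[OF velocity_field_section(1)]]) (simp add: \<beta>_nonneg)
    finally show ?thesis by (simp add: nn_integral_unit_interval)
  qed
  have "(\<integral>\<^sup>+p. ennreal (?G p) \<partial>lborel) = (\<integral>\<^sup>+t. \<integral>\<^sup>+s. ennreal (?G (s, t)) \<partial>lborel \<partial>lborel)"
  proof -
    have "(\<lambda>p. ennreal (?G p)) \<in> borel_measurable (lborel \<Otimes>\<^sub>M lborel)" unfolding lborel_prod by simp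
    from lborel_pair.nn_integral_snd[OF this] show ?thesis by (simp add: lborel_prod)
  qed
  also have "\<dots> = (\<integral>\<^sup>+t. ennreal (inner (C t x) x) * indicator {0<..<2} t \<partial>lborel)"
  proof (rule nn_integral_cong)
    fix t :: real
    have "(\<integral>\<^sup>+s. ennreal (?G (s, t)) \<partial>lborel) = (\<integral>\<^sup>+s. (ennreal (\<beta> (s, t) * (cmod (?v (s, t)))\<^sup>2) * indicator {0<..<1} s) * indicator {0<..<2} t \<partial>lborel)"
      by (intro nn_integral_cong) (auto simp: indicator_def period_cell_def)
    also have "\<dots> = ennreal (inner (C t x) x) * indicator {0<..<2} t"
      unfolding \<phi>
    proof (rule nn_integral_multc)
      have "(\<lambda>s. (s, t)) \<in> borel_measurable borel" by (intro borel_measurable_continuous_onI continuous_intros)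
      then have [measurable]: "(\<lambda>s. ?v (s, t)) \<in> borel_measurable borel" by (rule measurable_compose) simp
      show "(\<lambda>s. ennreal (\<beta> (s, t) * (cmod (?v (s, t)))\<^sup>2) * indicator {0<..<1} s) \<in> borel_measurable lborel" by measurable
    qed
    finally show "(\<integral>\<^sup>+s. ennreal (?G (s, t)) \<partial>lborel) = ennreal (inner (C t x) x) * indicator {0<..<2} t" .
  qed
  also have "\<dots> = (\<integral>\<^sup>+t. ennreal (indicator {0..2} t *\<^sub>R inner (C t x) x) \<partial>lborel)"
  proof (rule nn_integral_cong_AE)
    have "AE t in lborel. t \<noteq> (0::real)" "AE t in lborel. t \<noteq> (2::real)" by (rule AE_lborel_singleton)+
    then show "AE t in lborel. ennreal (inner (C t x) x) * indicator {0<..<2} t = ennreal (indicator {0..2} t *\<^sub>R inner (C t x) x)"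
      by eventually_elim (auto simp: indicator_def)
  qed
  also have "\<dots> = ennreal (LINT t|lborel. indicator {0..2} t *\<^sub>R inner (C t x) x)"
    by (rule nn_integral_eq_integral) (use q_integrable[of 2 x] C_nonneg in \<open>auto simp: set_integrable_def\<close>)
  finally show 2: "(\<integral>\<^sup>+p. ennreal (?G p) \<partial>lborel) = ennreal (q x)" by (simp add: q_def set_lebesgue_integral_def)
  show "observed_energy b x = q x" unfolding 1 2 using q_nonneg[of x] by simp
qed

end

text \<open>Evaluate a Borel version of \<open>b\<close> at the translate of each point into the first period. The
  exceptional points form a countable union of null sets, one for each translation by an even
  integer.\<close>

lemma periodic_damping_exists:
  assumes bounded: "essentially_bounded_on_strip b"
    and nonneg: "AE p in lebesgue_on strip. 0 \<le> b p"
    and periodic: "AE (s, t) in lebesgue_on strip. b (s, t + 2) = b (s, t)"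
  obtains \<beta> K where "periodic_damping \<beta> K" "AE p in lborel. p \<in> strip \<longrightarrow> b p = \<beta> p"
proof -
  have S: "strip \<in> sets lebesgue" using strip_borel by simp
  have lift: "AE p in lborel. p \<in> strip \<longrightarrow> Q p" if "AE p in lebesgue_on strip. Q p" for Q
    using that S by (simp add: AE_restrict_space_iff AE_completion_iff)
  obtain M where M: "AE p in lborel. p \<in> strip \<longrightarrow> \<bar>b p\<bar> \<le> M"
    using bounded lift unfolding essentially_bounded_on_strip_def by blast
  define K where "K = max M 1"
  have "(\<lambda>p. if p \<in> strip then b p else 0) \<in> borel_measurable lebesgue"
    by (rule borel_measurable_if_I[OF _ S]) (use bounded in \<open>simp add: essentially_bounded_on_strip_def\<close>)
  then obtain b1 where b1: "b1 \<in> borel_measurable lborel" "AE p in lborel. (if p \<in> strip then b p else 0) = b1 p"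
    using completion_ex_borel_measurable_real by blast
  define \<tau> where "\<tau> p = (fst p, snd p + 2 * of_int (- \<lfloor>snd p / 2\<rfloor>))" for p :: "real \<times> real"
  define \<beta> where "\<beta> p = max 0 (min K (b1 (\<tau> p)))" for p
  have "\<tau> \<in> borel_measurable borel"
  proof -
    have [measurable]: "fst \<in> borel_measurable (borel :: (real \<times> real) measure)" "snd \<in> borel_measurable (borel :: (real \<times> real) measure)"
      by (intro borel_measurable_continuous_onI continuous_intros)+
    show ?thesis unfolding \<tau>_def[abs_def] by (intro borel_measurable_Pair) measurable
  qed
  then have \<beta>m: "\<beta> \<in> borel_measurable borel"
    unfolding \<beta>_def using measurable_compose[of \<tau> borel borel b1] b1(1) by (intro borel_measurable_max borel_measurable_min) auto
  have "periodic_damping \<beta> K"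
  proof
    show "\<beta> (s, t + 2) = \<beta> (s, t)" for s t
    proof -
      have "\<lfloor>(t + 2) / 2\<rfloor> = \<lfloor>t / 2\<rfloor> + 1" by (simp add: add_divide_distrib)
      then show ?thesis by (simp add: \<beta>_def \<tau>_def)
    qed
  qed (auto simp: \<beta>m \<beta>_def K_def)
  moreover have "AE p in lborel. p \<in> strip \<longrightarrow> b p = \<beta> p"
  proof -
    have "AE p in lborel. p \<in> strip \<longrightarrow> b (fst p, snd p + 2) = b p" using lift[OF periodic] by (simp add: split_beta')
    then have "AE p in lborel. (0, 2 * of_int n) + p \<in> strip \<longrightarrow> b (fst ((0, 2 * of_int n) + p), snd ((0, 2 * of_int n) + p) + 2) = b ((0, 2 * of_int n) + p)" for n :: int
      by (rule AE_lborel_translate)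
    note tr = this
    have "AE p in lborel. p \<in> strip \<longrightarrow> b (fst p, snd p + 2 * of_int n + 2) = b (fst p, snd p + 2 * of_int n)" for n :: int
      using tr[of n] by eventually_elim (auto simp: strip_def algebra_simps)
    then have per: "AE p in lborel. \<forall>n::int. p \<in> strip \<longrightarrow> b (fst p, snd p + 2 * of_int n + 2) = b (fst p, snd p + 2 * of_int n)"
      unfolding AE_all_countable AE_conj_iff by (intro allI)
    have "AE p in lborel. (if (0, 2 * of_int n) + p \<in> strip then b ((0, 2 * of_int n) + p) else 0) = b1 ((0, 2 * of_int n) + p)" for n :: int
      by (rule AE_lborel_translate[OF b1(2)])
    note tr = this
    have "AE p in lborel. p \<in> strip \<longrightarrow> b (fst p, snd p + 2 * of_int n) = b1 (fst p, snd p + 2 * of_int n)" for n :: int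
      using tr[of n] by eventually_elim (auto simp: strip_def algebra_simps)
    then have rep: "AE p in lborel. \<forall>n::int. p \<in> strip \<longrightarrow> b (fst p, snd p + 2 * of_int n) = b1 (fst p, snd p + 2 * of_int n)"
      unfolding AE_all_countable AE_conj_iff by (intro allI)
    show ?thesis using per rep M lift[OF nonneg]
    proof eventually_elim
      case (elim p)
      show ?case
      proof
        assume p: "p \<in> strip"
        have step: "b (fst p, snd p + 2 * of_int n + 2) = b (fst p, snd p + 2 * of_int n)" for n :: int using elim(1) p by blast
        have nat: "b (fst p, snd p + 2 * of_int (n + int k)) = b (fst p, snd p + 2 * of_int n)" for n :: int and k
        proof (induction k)
          case (Suc k)
          then show ?case using step[of "n + int k"] by (simp add: algebra_simps)
        qed simp
        have all: "b (fst p, snd p + 2 * of_int n) = b p" for n :: int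
        proof (cases "n \<ge> 0")
          case True
          then show ?thesis using nat[of 0 "nat n"] by simp
        next
          case False
          then show ?thesis using nat[of n "nat (- n)"] by simp
        qed
        have "b p = b1 (\<tau> p)" using elim(2) p all[of "- \<lfloor>snd p / 2\<rfloor>"] unfolding \<tau>_def by (metis of_int_minus)
        then show "b p = \<beta> p" using elim(3,4) p by (auto simp: \<beta>_def K_def)
      qed
    qed
  qed
  ultimately show thesis by (rule that)
qed

section \<open>Observability under the geometric control condition\<close>

text \<open>Observation of a velocity sees only differences of two values of the Riemann invariant,
  hence the invariant up to a constant.\<close>

definition oscillation :: "(real \<Rightarrow> complex) \<Rightarrow> real set \<Rightarrow> real set \<Rightarrow> ennreal"
  where "oscillation g A B = (\<integral>\<^sup>+\<xi>. \<integral>\<^sup>+\<eta>. ennreal ((cmod (g \<xi> - g \<eta>))\<^sup>2) * indicator A \<xi> * indicator B \<eta> \<partial>lborel \<partial>lborel)"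

lemma oscillation_mono: "A \<subseteq> A' \<Longrightarrow> B \<subseteq> B' \<Longrightarrow> oscillation g A B \<le> oscillation g A' B'"
  unfolding oscillation_def by (intro nn_integral_mono mult_mono) (auto simp: indicator_def)

lemma oscillation_sym:
  assumes [measurable]: "g \<in> borel_measurable borel" "A \<in> sets borel" "B \<in> sets borel"
  shows "oscillation g A B = oscillation g B A"
proof -
  have "oscillation g A B = (\<integral>\<^sup>+\<eta>. \<integral>\<^sup>+\<xi>. ennreal ((cmod (g \<xi> - g \<eta>))\<^sup>2) * indicator A \<xi> * indicator B \<eta> \<partial>lborel \<partial>lborel)"
    unfolding oscillation_def by (rule lborel_pair.Fubini'[symmetric]) measurable
  also have "\<dots> = oscillation g B A"
    unfolding oscillation_def by (intro nn_integral_cong) (auto simp: norm_minus_commute indicator_def)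
  finally show ?thesis .
qed

text \<open>Compare the values of \<open>g\<close> at two points through its value at a third one, and average over
  the third point.\<close>

lemma oscillation_triangle:
  assumes [measurable]: "g \<in> borel_measurable borel" "A \<in> sets borel" "B \<in> sets borel" "J \<in> sets borel"
  shows "emeasure lborel J * oscillation g A B \<le> 2 * emeasure lborel B * oscillation g A J + 2 * emeasure lborel A * oscillation g B J"
proof -
  let ?N = "\<lambda>x y. ennreal ((cmod (g x - g y))\<^sup>2)"
  have tri: "?N x y \<le> 2 * ?N x z + 2 * ?N y z" for x y z
  proof -
    have "cmod (g x - g y) \<le> cmod (g x - g z) + cmod (g y - g z)"
      using norm_triangle_ineq4[of "g x - g z" "g y - g z"] by simp
    then have "(cmod (g x - g y))\<^sup>2 \<le> (cmod (g x - g z) + cmod (g y - g z))\<^sup>2" by (intro power_mono) auto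
    also have "\<dots> \<le> 2 * (cmod (g x - g z))\<^sup>2 + 2 * (cmod (g y - g z))\<^sup>2"
      using sum_squares_bound[of "cmod (g x - g z)" "cmod (g y - g z)"] by (simp add: power2_sum)
    finally have "?N x y \<le> ennreal (2 * (cmod (g x - g z))\<^sup>2 + 2 * (cmod (g y - g z))\<^sup>2)" by (rule ennreal_leI)
    also have "\<dots> = 2 * ?N x z + 2 * ?N y z" using ennreal_lincomb[of 2 2] by simp
    finally show ?thesis .
  qed
  have "emeasure lborel J * oscillation g A B
      = (\<integral>\<^sup>+x. \<integral>\<^sup>+y. \<integral>\<^sup>+z. ?N x y * indicator A x * indicator B y * indicator J z \<partial>lborel \<partial>lborel \<partial>lborel)"
    unfolding oscillation_def by (simp add: nn_integral_cmult nn_integral_multc mult.commute[of "emeasure lborel J"])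
  also have "\<dots> \<le> (\<integral>\<^sup>+x. \<integral>\<^sup>+y. \<integral>\<^sup>+z. 2 * (?N x z * indicator A x * indicator J z) * indicator B y
      + 2 * (?N y z * indicator B y * indicator J z) * indicator A x \<partial>lborel \<partial>lborel \<partial>lborel)"
    using tri by (intro nn_integral_mono) (auto simp: indicator_def)
  also have "\<dots> = (\<integral>\<^sup>+x. \<integral>\<^sup>+y. 2 * (\<integral>\<^sup>+z. ?N x z * indicator A x * indicator J z \<partial>lborel) * indicator B y
      + 2 * (\<integral>\<^sup>+z. ?N y z * indicator B y * indicator J z \<partial>lborel) * indicator A x \<partial>lborel \<partial>lborel)"
    by (simp add: nn_integral_add nn_integral_cmult nn_integral_multc)
  also have "\<dots> = (\<integral>\<^sup>+x. 2 * (\<integral>\<^sup>+z. ?N x z * indicator A x * indicator J z \<partial>lborel) * emeasure lborel B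
      + 2 * oscillation g B J * indicator A x \<partial>lborel)"
    unfolding oscillation_def by (simp add: nn_integral_add nn_integral_cmult nn_integral_multc)
  also have "\<dots> = 2 * oscillation g A J * emeasure lborel B + 2 * oscillation g B J * emeasure lborel A"
    unfolding oscillation_def by (simp add: nn_integral_add nn_integral_cmult nn_integral_multc)
  finally show ?thesis by (simp add: mult_ac)
qed

lemma oscillation_Un:
  assumes [measurable]: "g \<in> borel_measurable borel" "A \<in> sets borel" "B \<in> sets borel"
  shows "oscillation g (A \<union> B) (A \<union> B) \<le> oscillation g A A + 2 * oscillation g A B + oscillation g B B"
proof -
  let ?N = "\<lambda>x y. ennreal ((cmod (g x - g y))\<^sup>2)"
  have "oscillation g (A \<union> B) (A \<union> B) \<le> (\<integral>\<^sup>+x. \<integral>\<^sup>+y. (?N x y * indicator A x * indicator A y + ?N x y * indicator A x * indicator B y)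
      + (?N x y * indicator B x * indicator A y + ?N x y * indicator B x * indicator B y) \<partial>lborel \<partial>lborel)"
    unfolding oscillation_def by (intro nn_integral_mono) (auto simp: indicator_def)
  also have "\<dots> = (oscillation g A A + oscillation g A B) + (oscillation g B A + oscillation g B B)"
    unfolding oscillation_def by (simp add: nn_integral_add)
  also have "oscillation g B A = oscillation g A B" by (rule oscillation_sym) measurable
  finally show ?thesis by (simp add: mult_2 add_ac)
qed

text \<open>The characteristic coordinates \<open>t + s\<close> and \<open>t - s\<close> turn a space-time integral into an
  integral over a product.\<close>

lemma nn_integral_characteristic:
  fixes f :: "real \<Rightarrow> real \<Rightarrow> ennreal"
  assumes [measurable]: "case_prod f \<in> borel_measurable (borel \<Otimes>\<^sub>M borel)"
  shows "(\<integral>\<^sup>+t. \<integral>\<^sup>+s. f (t + s) (t - s) \<partial>lborel \<partial>lborel) = ennreal (1/2) * (\<integral>\<^sup>+\<xi>. \<integral>\<^sup>+\<eta>. f \<xi> \<eta> \<partial>lborel \<partial>lborel)"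
proof -
  have "(\<integral>\<^sup>+s. f (t + s) (t - s) \<partial>lborel) = (\<integral>\<^sup>+\<xi>. f \<xi> (2 * t - \<xi>) \<partial>lborel)" for t
    using nn_integral_shift[of "\<lambda>\<xi>. f \<xi> (2 * t - \<xi>)" t] by (simp add: add.commute algebra_simps)
  then have "(\<integral>\<^sup>+t. \<integral>\<^sup>+s. f (t + s) (t - s) \<partial>lborel \<partial>lborel) = (\<integral>\<^sup>+t. \<integral>\<^sup>+\<xi>. f \<xi> (2 * t - \<xi>) \<partial>lborel \<partial>lborel)" by simp
  also have "\<dots> = (\<integral>\<^sup>+\<xi>. \<integral>\<^sup>+t. f \<xi> (2 * t - \<xi>) \<partial>lborel \<partial>lborel)"
    by (rule lborel_pair.Fubini') measurable
  also have "\<dots> = (\<integral>\<^sup>+\<xi>. ennreal (1/2) * (\<integral>\<^sup>+\<eta>. f \<xi> \<eta> \<partial>lborel) \<partial>lborel)"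
  proof (rule nn_integral_cong)
    fix \<xi>
    have "(\<integral>\<^sup>+t. f \<xi> (2 * t - \<xi>) \<partial>lborel) = ennreal \<bar>1/2\<bar> * (\<integral>\<^sup>+\<eta>. f \<xi> (2 * (\<xi> / 2 + 1/2 * \<eta>) - \<xi>) \<partial>lborel)"
    proof (rule nn_integral_real_affine[where f = "\<lambda>t. f \<xi> (2 * t - \<xi>)"])
      show "(\<lambda>t. f \<xi> (2 * t - \<xi>)) \<in> borel_measurable borel" by measurable
    qed simp
    also have "(\<lambda>\<eta>. f \<xi> (2 * (\<xi> / 2 + 1/2 * \<eta>) - \<xi>)) = f \<xi>" by (simp add: fun_eq_iff algebra_simps)
    finally show "(\<integral>\<^sup>+t. f \<xi> (2 * t - \<xi>) \<partial>lborel) = ennreal (1/2) * (\<integral>\<^sup>+\<eta>. f \<xi> \<eta> \<partial>lborel)" by simp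
  qed
  also have "\<dots> = ennreal (1/2) * (\<integral>\<^sup>+\<xi>. \<integral>\<^sup>+\<eta>. f \<xi> \<eta> \<partial>lborel \<partial>lborel)"
    by (rule nn_integral_cmult) measurable
  finally show ?thesis .
qed

lemma oscillation_shift:
  assumes g[measurable]: "g \<in> borel_measurable borel" and p: "\<And>\<xi>. g (\<xi> + 2) = g \<xi>"
  shows "oscillation g {a + 2 * of_int n<..<b + 2 * of_int n} {a + 2 * of_int n<..<b + 2 * of_int n} = oscillation g {a<..<b} {a<..<b}"
proof -
  let ?c = "2 * of_int n :: real"
  let ?f = "\<lambda>\<xi> \<eta>. ennreal ((cmod (g \<xi> - g \<eta>))\<^sup>2) * indicator {a + ?c<..<b + ?c} \<xi> * indicator {a + ?c<..<b + ?c} \<eta>"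
  have "oscillation g {a + ?c<..<b + ?c} {a + ?c<..<b + ?c} = (\<integral>\<^sup>+\<xi>. \<integral>\<^sup>+\<eta>. ?f (\<xi> + ?c) \<eta> \<partial>lborel \<partial>lborel)"
    unfolding oscillation_def by (rule nn_integral_shift) measurable
  also have "\<dots> = (\<integral>\<^sup>+\<xi>. \<integral>\<^sup>+\<eta>. ?f (\<xi> + ?c) (\<eta> + ?c) \<partial>lborel \<partial>lborel)"
    by (intro nn_integral_cong nn_integral_shift) measurable
  also have "\<dots> = oscillation g {a<..<b} {a<..<b}"
    unfolding oscillation_def by (intro nn_integral_cong) (auto simp: periodic_int[of g, OF p] indicator_def)
  finally show ?thesis .
qed

text \<open>The Riemann invariant has mean zero, so it is orthogonal to constants and subtracting one
  of its values cannot decrease its mass \<open>2 * (norm x)\<^sup>2\<close>. Averaging over that value contributes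
  the length \<open>2\<close> of the circle.\<close>

lemma oscillation_period_ge:
  "ennreal (4 * (norm x)\<^sup>2) \<le> oscillation (profile (riemann x)) {0<..<2} {0<..<2}"
proof -
  let ?g = "profile (riemann x)"
  note g = circle_fun_profile[of "riemann x"]
  note [measurable] = circle_funD(1)[OF g]
  have one: "circle_fun (\<lambda>\<xi>. 1)" by (rule circle_fun_continuous) auto
  have lower: "ennreal (2 * (norm x)\<^sup>2) \<le> (\<integral>\<^sup>+\<eta>. ennreal ((cmod (c - ?g \<eta>))\<^sup>2) * indicator {0<..<2} \<eta> \<partial>lborel)" for c
  proof -
    let ?h = "\<lambda>\<xi>. ?g \<xi> + (- c) * 1"
    have h: "circle_fun ?h" by (rule circle_fun_add[OF g one])
    have "halves ?h = riemann x + (- c) *\<^sub>C (one_L2, 0)"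
      unfolding halves_add[OF g one] halves_profile by (simp add: halves_def)
    then have "(norm (halves ?h))\<^sup>2 = (norm (riemann x))\<^sup>2 + 2 * inner (riemann x) ((- c) *\<^sub>C (one_L2, 0)) + (norm ((- c) *\<^sub>C (one_L2, 0 :: L2)))\<^sup>2"
      unfolding power2_norm_eq_inner by (simp add: inner_add_left inner_add_right inner_commute)
    also have "inner (riemann x) ((- c) *\<^sub>C (one_L2, 0)) = 0"
      unfolding inner_eq_Re_cinner cinner_scaleC_right riemann_mean by simp
    finally have "(norm x)\<^sup>2 \<le> (norm (halves ?h))\<^sup>2" by (simp add: norm_riemann)
    then have "ennreal (2 * (norm x)\<^sup>2) \<le> mass ?h" unfolding norm_halves[OF h] by (intro ennreal_leI) simp
    also have "mass ?h = (\<integral>\<^sup>+\<eta>. ennreal ((cmod (c - ?g \<eta>))\<^sup>2) * indicator {0<..<2} \<eta> \<partial>lborel)"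
      unfolding mass_def
    proof (rule nn_integral_cong_AE)
      have "AE \<eta> in lborel. \<eta> \<noteq> (0::real)" by (rule AE_lborel_singleton)
      then show "AE \<eta> in lborel. ennreal ((cmod (?h \<eta>))\<^sup>2) * indicator {0..<2} \<eta> = ennreal ((cmod (c - ?g \<eta>))\<^sup>2) * indicator {0<..<2} \<eta>"
        by eventually_elim (auto simp: indicator_def norm_minus_commute)
    qed
    finally show ?thesis .
  qed
  have "ennreal (4 * (norm x)\<^sup>2) = (\<integral>\<^sup>+\<xi>. ennreal (2 * (norm x)\<^sup>2) * indicator {0<..<2::real} \<xi> \<partial>lborel)"
  proof -
    have "(\<integral>\<^sup>+\<xi>. ennreal (2 * (norm x)\<^sup>2) * indicator {0<..<2::real} \<xi> \<partial>lborel) = ennreal (2 * (norm x)\<^sup>2) * ennreal 2"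
      by (subst nn_integral_cmult_indicator) auto
    also have "\<dots> = ennreal (2 * (norm x)\<^sup>2 * 2)" by (rule ennreal_mult[symmetric]) auto
    finally show ?thesis by (simp add: mult.commute)
  qed
  also have "\<dots> \<le> oscillation ?g {0<..<2} {0<..<2}"
    unfolding oscillation_def
  proof (rule nn_integral_mono)
    fix \<xi> :: real
    show "ennreal (2 * (norm x)\<^sup>2) * indicator {0<..<2} \<xi> \<le> (\<integral>\<^sup>+\<eta>. ennreal ((cmod (?g \<xi> - ?g \<eta>))\<^sup>2) * indicator {0<..<2} \<xi> * indicator {0<..<2} \<eta> \<partial>lborel)"
      using lower[of "?g \<xi>"] by (cases "\<xi> \<in> {0<..<2}") auto
  qed
  finally show ?thesis .
qed

lemma infdist_even_integers:
  fixes y :: real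
  shows "infdist y (range (\<lambda>k::int. 2 * real_of_int k)) = \<bar>fold2 y\<bar>"
proof (rule antisym)
  let ?S = "range (\<lambda>k::int. 2 * real_of_int k)"
  define k where "k = \<lfloor>(y + 1) / 2\<rfloor>"
  have y: "fold2 y = y - 2 * of_int k" by (simp add: fold2_def k_def)
  have "infdist y ?S \<le> dist y (2 * of_int k)" by (rule infdist_le) blast
  then show "infdist y ?S \<le> \<bar>fold2 y\<bar>" by (simp add: y dist_real_def)
  have "\<bar>fold2 y\<bar> \<le> dist y (2 * of_int j)" for j :: int
  proof (cases "j = k")
    case False
    then have "\<bar>j - k\<bar> \<ge> 1" by simp
    then have "\<bar>real_of_int j - real_of_int k\<bar> \<ge> 1" by (metis of_int_1 of_int_abs of_int_diff of_int_le_iff)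
    then show ?thesis using fold2(1,2)[of y] by (auto simp: y dist_real_def)
  qed (simp add: y dist_real_def)
  then show "\<bar>fold2 y\<bar> \<le> infdist y ?S" by (auto simp: infdist_def intro!: cINF_greatest)
qed

context periodic_damping begin

text \<open>The Riemann invariant is observed, up to a constant, on the interval.\<close>

definition controlled :: "real \<Rightarrow> real \<Rightarrow> bool"
  where "controlled a b \<longleftrightarrow> (\<exists>k\<ge>0. \<forall>x. oscillation (profile (riemann x)) {a<..<b} {a<..<b} \<le> ennreal k * ennreal (q x))"

lemma controlled_mono: "controlled a b \<Longrightarrow> a \<le> a' \<Longrightarrow> b' \<le> b \<Longrightarrow> controlled a' b'"
  unfolding controlled_def by (meson greaterThanLessThan_subseteq_greaterThanLessThan order_trans oscillation_mono)

lemma controlled_shift: "controlled (a + 2 * of_int n) (b + 2 * of_int n) \<Longrightarrow> controlled a b"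
  unfolding controlled_def
  using oscillation_shift[OF circle_funD(1,2)[OF circle_fun_profile]] by simp

text \<open>On a rectangle with sides in the characteristic directions the velocity is the difference
  of two functions of one variable each. If the damping acts there, then it observes the
  oscillation between the two intervals, and by the triangle inequality the oscillation within
  each of them.\<close>

lemma diamond_controlled:
  assumes one: "AE p in lborel. p \<in> U \<longrightarrow> \<beta> p = 1"
    and U: "U \<subseteq> period_cell" "\<And>s t. \<bar>t + s - \<mu>\<bar> < \<delta> \<Longrightarrow> \<bar>t - s - \<nu>\<bar> < \<delta> \<Longrightarrow> (s, t) \<in> U" and \<delta>: "\<delta> > 0"
  shows "controlled (\<mu> - \<delta>) (\<mu> + \<delta>)" "controlled (\<nu> - \<delta>) (\<nu> + \<delta>)"
proof -
  define I where "I = {\<mu> - \<delta><..<\<mu> + \<delta>}"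
  define J where "J = {\<nu> - \<delta><..<\<nu> + \<delta>}"
  have [measurable]: "I \<in> sets borel" "J \<in> sets borel" by (auto simp: I_def J_def)
  have m: "emeasure lborel I = ennreal (2 * \<delta>)" "emeasure lborel J = ennreal (2 * \<delta>)"
    using \<delta> by (auto simp: I_def J_def)
  have X: "oscillation (profile (riemann x)) I J \<le> ennreal 8 * ennreal (q x)" for x
  proof -
    let ?g = "profile (riemann x)"
    note [measurable] = circle_funD(1)[OF circle_fun_profile[of "riemann x"]]
    define f where "f \<xi> \<eta> = ennreal ((cmod (?g \<xi> - ?g \<eta>))\<^sup>2) * indicator I \<xi> * indicator J \<eta>" for \<xi> \<eta>
    have [measurable]: "case_prod f \<in> borel_measurable (borel \<Otimes>\<^sub>M borel)" unfolding f_def by measurable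
    have "ennreal (1/2) * oscillation ?g I J = (\<integral>\<^sup>+t. \<integral>\<^sup>+s. f (t + s) (t - s) \<partial>lborel \<partial>lborel)"
      unfolding oscillation_def f_def[symmetric] by (rule nn_integral_characteristic[symmetric]) measurable
    also have "\<dots> = (\<integral>\<^sup>+p. f (snd p + fst p) (snd p - fst p) \<partial>lborel)"
    proof -
      have "(\<lambda>p. f (snd p + fst p) (snd p - fst p)) \<in> borel_measurable (lborel \<Otimes>\<^sub>M lborel)" by measurable
      from lborel_pair.nn_integral_snd[OF this] show ?thesis by (simp add: lborel_prod)
    qed
    also have "\<dots> \<le> (\<integral>\<^sup>+p. ennreal 4 * ennreal (indicator period_cell p * (\<beta> p * (cmod (velocity_field x p))\<^sup>2)) \<partial>lborel)"
    proof (rule nn_integral_mono_AE, use one in eventually_elim)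
      fix p assume p: "p \<in> U \<longrightarrow> \<beta> p = 1"
      show "f (snd p + fst p) (snd p - fst p) \<le> ennreal 4 * ennreal (indicator period_cell p * (\<beta> p * (cmod (velocity_field x p))\<^sup>2))"
      proof (cases "snd p + fst p \<in> I \<and> snd p - fst p \<in> J")
        case True
        then have "(fst p, snd p) \<in> U" by (intro U(2)) (auto simp: I_def J_def abs_less_iff)
        then have "p \<in> U" by simp
        then have "p \<in> period_cell" "\<beta> p = 1" using U(1) p by auto
        define X where "X = (cmod (?g (snd p + fst p) - ?g (snd p - fst p)))\<^sup>2"
        have "f (snd p + fst p) (snd p - fst p) = ennreal (4 * (X / 4))" using True by (simp add: f_def X_def)
        also have "\<dots> = ennreal 4 * ennreal (X / 4)" by (rule ennreal_mult) (auto simp: X_def)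
        also have "X / 4 = indicator period_cell p * (\<beta> p * (cmod (velocity_field x p))\<^sup>2)"
          using \<open>p \<in> period_cell\<close> \<open>\<beta> p = 1\<close> by (simp add: X_def velocity_field_def norm_divide power_divide)
        finally show ?thesis by simp
      qed (auto simp: f_def)
    qed
    also have "\<dots> = ennreal 4 * ennreal (q x)"
    proof (subst nn_integral_cmult)
      have "period_cell \<in> sets borel" unfolding period_cell_def by (intro borel_open open_Times) auto
      then show "(\<lambda>p. ennreal (indicator period_cell p * (\<beta> p * (cmod (velocity_field x p))\<^sup>2))) \<in> borel_measurable lborel" by measurable
    qed (simp add: observed_energy_eq(2)[of \<beta>])
    finally have "ennreal 2 * (ennreal (1/2) * oscillation ?g I J) \<le> ennreal 2 * (ennreal 4 * ennreal (q x))"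
      by (intro mult_left_mono) auto
    moreover have "ennreal 2 * ennreal (1/2) = 1"
    proof -
      have "ennreal 2 * ennreal (1/2) = ennreal (2 * (1/2))" by (rule ennreal_mult[symmetric]) auto
      then show ?thesis by simp
    qed
    moreover have "ennreal 2 * ennreal 4 = ennreal 8" by (simp flip: ennreal_mult)
    ultimately show ?thesis by (simp only: mult.assoc[symmetric] mult_1)
  qed
  have cancel: "A \<le> ennreal k * ennreal y"
    if "ennreal (2 * \<delta>) * A \<le> 2 * ennreal (2 * \<delta>) * B + 2 * ennreal (2 * \<delta>) * B" "B \<le> ennreal 8 * ennreal y" "k = 32" "y \<ge> 0" for A B k y
  proof -
    have "ennreal (2 * \<delta>) * A \<le> ennreal (2 * \<delta>) * (4 * B)" using that(1) by (simp add: mult_ac distrib_left[symmetric] flip: mult_2)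
    then have "A \<le> 4 * B" using \<delta> by (subst (asm) ennreal_mult_le_mult_iff) (auto)
    also have "\<dots> \<le> 4 * (ennreal 8 * ennreal y)" by (intro mult_left_mono that(2)) auto
    also have "\<dots> = ennreal k * ennreal y" using that(3) by (simp add: mult.assoc[symmetric])
    finally show ?thesis .
  qed
  note gm = circle_funD(1)[OF circle_fun_profile]
  show "controlled (\<mu> - \<delta>) (\<mu> + \<delta>)"
    unfolding controlled_def I_def[symmetric]
  proof (intro exI[of _ 32] conjI allI)
    \<comment> \<open>\<open>8\<close> comes from the factor \<open>1/2\<close> in d'Alembert's formula, squared, and the Jacobian \<open>1/2\<close>; the
      triangle inequality contributes the factor \<open>4\<close>.\<close>
    fix x
    show "oscillation (profile (riemann x)) I I \<le> ennreal 32 * ennreal (q x)"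
      by (rule cancel[OF _ X refl q_nonneg]) (use oscillation_triangle[OF gm, of I I J] in \<open>simp add: m\<close>)
  qed simp
  show "controlled (\<nu> - \<delta>) (\<nu> + \<delta>)"
    unfolding controlled_def J_def[symmetric]
  proof (intro exI[of _ 32] conjI allI)
    fix x
    show "oscillation (profile (riemann x)) J J \<le> ennreal 32 * ennreal (q x)"
      by (rule cancel[OF _ X refl q_nonneg])
        (use oscillation_triangle[OF gm, of J J I] oscillation_sym[OF gm, of J I] in \<open>simp add: m\<close>)
  qed simp
qed

text \<open>Values in the two intervals are compared through their overlap, of length \<open>2 * \<delta>\<close>.\<close>

lemma controlled_glue:
  assumes A: "controlled a (b + \<delta>)" and B: "controlled (b - \<delta>) c" and \<delta>: "\<delta> > 0" and abc: "a \<le> b - \<delta>" "b + \<delta> \<le> c"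
  shows "controlled a c"
proof -
  define I where "I = {a<..<b + \<delta>}"
  define J where "J = {b - \<delta><..<c}"
  have [measurable]: "I \<in> sets borel" "J \<in> sets borel" by (auto simp: I_def J_def)
  have IJ: "I \<inter> J = {b - \<delta><..<b + \<delta>}" "I \<union> J = {a<..<c}" using abc \<delta> by (auto simp: I_def J_def)
  define l where "l = c - a"
  have l: "l \<ge> 0" using abc \<delta> by (simp add: l_def)
  have m: "emeasure lborel (I \<inter> J) = ennreal (2 * \<delta>)" "emeasure lborel I \<le> ennreal l" "emeasure lborel J \<le> ennreal l"
    unfolding IJ using abc \<delta> by (auto simp: I_def J_def l_def intro!: ennreal_leI)
  obtain k1 where k1: "k1 \<ge> 0" "\<And>x. oscillation (profile (riemann x)) I I \<le> ennreal k1 * ennreal (q x)"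
    using A unfolding controlled_def I_def by blast
  obtain k2 where k2: "k2 \<ge> 0" "\<And>x. oscillation (profile (riemann x)) J J \<le> ennreal k2 * ennreal (q x)"
    using B unfolding controlled_def J_def by blast
  define k where "k = l * (k1 + k2) / \<delta>"
  have k: "k \<ge> 0" using l k1(1) k2(1) \<delta> by (simp add: k_def)
  show ?thesis
    unfolding controlled_def IJ(2)[symmetric]
  proof (intro exI[of _ "k1 + 2 * k + k2"] conjI allI)
    fix x
    let ?g = "profile (riemann x)"
    note [measurable] = circle_funD(1)[OF circle_fun_profile[of "riemann x"]]
    have "ennreal (2 * \<delta>) * oscillation ?g I J \<le> 2 * emeasure lborel J * oscillation ?g I (I \<inter> J) + 2 * emeasure lborel I * oscillation ?g J (I \<inter> J)"
      unfolding m(1)[symmetric] by (rule oscillation_triangle) measurable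
    also have "\<dots> \<le> 2 * ennreal l * (ennreal k1 * ennreal (q x)) + 2 * ennreal l * (ennreal k2 * ennreal (q x))"
      by (intro add_mono mult_mono order_trans[OF oscillation_mono k1(2)] order_trans[OF oscillation_mono k2(2)] m) auto
    also have "\<dots> = ennreal (2 * \<delta>) * (ennreal k * ennreal (q x))"
    proof -
      have "2 * ennreal l * (ennreal k1 * ennreal (q x)) + 2 * ennreal l * (ennreal k2 * ennreal (q x)) = ennreal (2 * l * (k1 * q x) + 2 * l * (k2 * q x))"
        using l k1(1) k2(1) q_nonneg[of x] by (simp add: ennreal_mult ennreal_plus)
      also have "2 * l * (k1 * q x) + 2 * l * (k2 * q x) = 2 * \<delta> * (k * q x)" using \<delta> by (simp add: k_def field_simps)
      also have "ennreal \<dots> = ennreal (2 * \<delta>) * (ennreal k * ennreal (q x))"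
        using \<delta> k q_nonneg[of x] by (simp add: ennreal_mult)
      finally show ?thesis .
    qed
    finally have IJo: "oscillation ?g I J \<le> ennreal k * ennreal (q x)"
      using \<delta> by (subst (asm) ennreal_mult_le_mult_iff) auto
    have "oscillation ?g (I \<union> J) (I \<union> J) \<le> oscillation ?g I I + 2 * oscillation ?g I J + oscillation ?g J J"
      by (rule oscillation_Un) measurable
    also have "\<dots> \<le> ennreal k1 * ennreal (q x) + 2 * (ennreal k * ennreal (q x)) + ennreal k2 * ennreal (q x)"
      by (intro add_mono mult_left_mono k1(2) k2(2) IJo) auto
    also have "\<dots> = ennreal (k1 + 2 * k + k2) * ennreal (q x)"
      using k k1(1) k2(1) by (simp add: ennreal_plus ennreal_mult distrib_right mult.assoc)
    finally show "oscillation ?g (I \<union> J) (I \<union> J) \<le> ennreal (k1 + 2 * k + k2) * ennreal (q x)" .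
  qed (use k k1(1) k2(1) in simp)
qed

text \<open>By the control condition the characteristic on which the Riemann invariant takes its value
  at \<open>\<alpha>\<close>, followed through its reflections, meets an open set where the damping acts; so \<open>\<alpha>\<close> has
  a controlled neighbourhood. By compactness finitely many of these cover a period and can be
  glued.\<close>

theorem observable:
  assumes \<omega>: "open \<omega>" and one: "AE p in lborel. p \<in> \<omega> \<inter> period_cell \<longrightarrow> \<beta> p = 1" and gcc: "geometric_control 2 \<omega>"
  shows "\<exists>\<kappa>>0. \<forall>x. q x \<ge> \<kappa>\<^sup>2 * (norm x)\<^sup>2"
proof -
  have local: "\<exists>\<delta>>0. controlled (\<alpha> - \<delta>) (\<alpha> + \<delta>)" for \<alpha>
  proof -
    obtain t where t: "(infdist (- \<alpha> + t) (range (\<lambda>k::int. 2 * real_of_int k)), t) \<in> \<omega> \<inter> {0<..<1} \<times> {0<..<2}"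
      using gcc unfolding geometric_control_def by blast
    define \<sigma> where "\<sigma> = \<bar>fold2 (t - \<alpha>)\<bar>"
    define k where "k = \<lfloor>(t - \<alpha> + 1) / 2\<rfloor>"
    have mem: "(\<sigma>, t) \<in> \<omega> \<inter> period_cell" using t by (simp add: infdist_even_integers \<sigma>_def period_cell_def)
    have "open (\<omega> \<inter> period_cell)" using \<omega> unfolding period_cell_def by (intro open_Int open_Times) auto
    then obtain e where e: "e > 0" "ball (\<sigma>, t) e \<subseteq> \<omega> \<inter> period_cell" using mem openE by blast
    define \<delta> where "\<delta> = e / 2"
    have \<delta>: "\<delta> > 0" using e by (simp add: \<delta>_def)
    \<comment> \<open>The ball around the controlled point contains a characteristic diamond.\<close>
    have box: "(s', t') \<in> \<omega> \<inter> period_cell" if "\<bar>t' + s' - (t + \<sigma>)\<bar> < \<delta>" "\<bar>t' - s' - (t - \<sigma>)\<bar> < \<delta>" for s' t'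
    proof -
      have "\<bar>s' - \<sigma>\<bar> < \<delta>" "\<bar>t' - t\<bar> < \<delta>" using that by linarith+
      then have "dist (\<sigma>, t) (s', t') < e"
        using dist_Pair_Pair[of \<sigma> t s' t'] sqrt_sum_squares_le_sum_abs[of "dist \<sigma> s'" "dist t t'"]
        by (auto simp: \<delta>_def dist_real_def abs_minus_commute)
      then show ?thesis using e(2) by (auto simp: dist_commute)
    qed
    note c = diamond_controlled[where \<mu> = "t + \<sigma>" and \<nu> = "t - \<sigma>", OF one Int_lower2 box \<delta>]
    have f: "fold2 (t - \<alpha>) = t - \<alpha> - 2 * of_int k" by (simp add: fold2_def k_def)
    have "controlled (\<alpha> - \<delta>) (\<alpha> + \<delta>)"
    proof (cases "fold2 (t - \<alpha>) \<ge> 0")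
      case True
      then have "t - \<sigma> = \<alpha> + 2 * of_int k" using f by (simp add: \<sigma>_def)
      then have "controlled ((\<alpha> - \<delta>) + 2 * of_int k) ((\<alpha> + \<delta>) + 2 * of_int k)" using c(2) by (simp add: algebra_simps)
      then show ?thesis by (rule controlled_shift)
    next
      case False
      then have "t + \<sigma> = \<alpha> + 2 * of_int k" using f by (simp add: \<sigma>_def)
      then have "controlled ((\<alpha> - \<delta>) + 2 * of_int k) ((\<alpha> + \<delta>) + 2 * of_int k)" using c(1) by (simp add: algebra_simps)
      then show ?thesis by (rule controlled_shift)
    qed
    then show ?thesis using \<delta> by blast
  qed
  have "\<exists>\<delta>>0. controlled (0 - \<delta>) (2 + \<delta>)"
  proof (rule Bolzano[of 0 2 "\<lambda>a b. \<exists>\<delta>>0. controlled (a - \<delta>) (b + \<delta>)"])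
    fix a b c :: real assume "\<exists>\<delta>>0. controlled (a - \<delta>) (b + \<delta>)" "\<exists>\<delta>>0. controlled (b - \<delta>) (c + \<delta>)" "a \<le> b" "b \<le> c"
    then obtain d1 d2 where d: "d1 > 0" "controlled (a - d1) (b + d1)" "d2 > 0" "controlled (b - d2) (c + d2)" by blast
    define \<delta> where "\<delta> = min d1 d2"
    have "controlled (a - \<delta>) (c + \<delta>)"
      by (rule controlled_glue[of _ b \<delta>])
        (use d \<open>a \<le> b\<close> \<open>b \<le> c\<close> in \<open>auto simp: \<delta>_def intro: controlled_mono[OF d(2)] controlled_mono[OF d(4)]\<close>)
    then show "\<exists>\<delta>>0. controlled (a - \<delta>) (c + \<delta>)" using d by (intro exI[of _ \<delta>]) (auto simp: \<delta>_def)
  next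
    fix x :: real
    obtain \<delta> where \<delta>: "\<delta> > 0" "controlled (x - \<delta>) (x + \<delta>)" using local by blast
    show "\<exists>d>0. \<forall>a b. a \<le> x \<and> x \<le> b \<and> b - a < d \<longrightarrow> (\<exists>\<delta>>0. controlled (a - \<delta>) (b + \<delta>))"
    proof (rule exI[of _ "\<delta> / 2"], intro conjI allI impI)
      fix a b :: real assume "a \<le> x \<and> x \<le> b \<and> b - a < \<delta> / 2"
      then show "\<exists>\<delta>>0. controlled (a - \<delta>) (b + \<delta>)"
        using \<delta> by (intro exI[of _ "\<delta> / 2"]) (auto intro: controlled_mono[OF \<delta>(2)])
    qed (use \<delta> in simp)
  qed simp
  then obtain \<delta> where "\<delta> > 0" "controlled (0 - \<delta>) (2 + \<delta>)" by blast
  then have "controlled 0 2" by (auto intro: controlled_mono)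
  then obtain k where k: "k \<ge> 0" "\<And>x. oscillation (profile (riemann x)) {0<..<2} {0<..<2} \<le> ennreal k * ennreal (q x)"
    unfolding controlled_def by blast
  show ?thesis
  proof (intro exI[of _ "sqrt (4 / (k + 1))"] conjI allI)
    show "0 < sqrt (4 / (k + 1))" using k(1) by simp
    fix x
    have "ennreal (4 * (norm x)\<^sup>2) \<le> ennreal k * ennreal (q x)" by (rule order_trans[OF oscillation_period_ge k(2)])
    then have "4 * (norm x)\<^sup>2 \<le> k * q x" using k(1) q_nonneg[of x] by (simp add: ennreal_mult[symmetric])
    also have "\<dots> \<le> (k + 1) * q x" using q_nonneg[of x] by (intro mult_right_mono) auto
    finally show "(sqrt (4 / (k + 1)))\<^sup>2 * (norm x)\<^sup>2 \<le> q x" using k(1) by (simp add: field_simps)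
  qed
qed

end

section \<open>The damped wave equation\<close>

lemma bounded_linear_scaleC: "bounded_linear (\<lambda>x::'a::complex_inner. c *\<^sub>C x)"
  by (rule bounded_linear_intro[where K = "cmod c"])
    (simp_all add: scaleC_add_right scaleR_scaleC scaleC_scaleC norm_scaleC mult.commute)

context periodic_damping begin

lemma C_scaleC: "C r (c *\<^sub>C x) = c *\<^sub>C C r x"
proof -
  have "snd (c *\<^sub>C y) = c *\<^sub>C snd y" "(0, c *\<^sub>C v) = c *\<^sub>C ((0, v) :: energy_space)" for y :: energy_space and v :: L2
    by (simp_all add: scaleC_prod_def)
  then show ?thesis unfolding C_def by (simp only: wave.scaleC mult_scaleC)
qed

lemma q_scaleC: "q (c *\<^sub>C x) = (cmod c)\<^sup>2 * q x"
proof -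
  have "inner (C r (c *\<^sub>C x)) (c *\<^sub>C x) = (cmod c)\<^sup>2 * inner (C r x) x" for r
  proof -
    have "cinner (C r (c *\<^sub>C x)) (c *\<^sub>C x) = of_real ((cmod c)\<^sup>2) * cinner (C r x) x"
      unfolding C_scaleC complex_norm_square by (simp add: cinner_scaleC_left cinner_scaleC_right)
    then show ?thesis by (simp add: inner_eq_Re_cinner)
  qed
  then show ?thesis unfolding q_def by simp
qed

lemma sol_scaleC: "t \<ge> 0 \<Longrightarrow> sol (c *\<^sub>C x) t = c *\<^sub>C sol x t"
proof (rule sol_eqI)
  show "solution (c *\<^sub>C x) (\<lambda>t. c *\<^sub>C sol x t)"
    unfolding solution_def
  proof (intro conjI allI impI)
    show "continuous_on {0..} (\<lambda>t. c *\<^sub>C sol x t)"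
      by (rule bounded_linear.continuous_on[OF bounded_linear_scaleC sol_cont])
    fix t :: real assume t: "t \<ge> 0"
    have i: "integrable lborel (\<lambda>r. indicat_real {0..t} r *\<^sub>R C r (sol x r))"
      using set_integrable_C[OF sol_cont, of 0 t x] by (simp add: set_integrable_def)
    have "(LINT r:{0..t}|lborel. C r (c *\<^sub>C sol x r)) = c *\<^sub>C (LINT r:{0..t}|lborel. C r (sol x r))"
      unfolding set_lebesgue_integral_def integral_bounded_linear[OF bounded_linear_scaleC i, symmetric]
      by (intro Bochner_Integration.integral_cong) (auto simp: C_scaleC scaleR_scaleC scaleC_scaleC mult.commute)
    then show "c *\<^sub>C sol x t = c *\<^sub>C x - (LINT r:{0..t}|lborel. C r (c *\<^sub>C sol x r))"
      using sol_eq[OF t, of x] by (simp add: scaleC_diff_right)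
  qed
qed

text \<open>The kernel of \<open>q\<close> is a complex subspace, so real and complex orthogonality to it
  coincide.\<close>

lemma orthocomp_kernel: "x \<in> orthocomp {u. q u = 0} \<longleftrightarrow> (\<forall>u. q u = 0 \<longrightarrow> inner x u = 0)"
proof
  assume "x \<in> orthocomp {u. q u = 0}"
  then show "\<forall>u. q u = 0 \<longrightarrow> inner x u = 0" by (simp add: orthocomp_def inner_eq_Re_cinner)
next
  assume "\<forall>u. q u = 0 \<longrightarrow> inner x u = 0"
  then show "x \<in> orthocomp {u. q u = 0}"
    unfolding orthocomp_def
    by (auto intro!: inner_zero_cinner_zero[of "{u. q u = 0}"] simp: q_scaleC)
qed

definition P :: "energy_space \<Rightarrow> energy_space" where "P = orthoproj {u. q u = 0}"

lemma P: "q (P x) = 0" "q u = 0 \<Longrightarrow> inner (x - P x) u = 0"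
proof -
  obtain y where y: "q y = 0" "\<And>u. q u = 0 \<Longrightarrow> inner (x - y) u = 0" by (rule q_decomposition) blast
  have "P x = y"
    unfolding P_def orthoproj_def
    by (rule the_equality) (use y in \<open>auto simp: orthocomp_kernel intro: q_projection_unique[of _ x y]\<close>)
  then show "q (P x) = 0" "q u = 0 \<Longrightarrow> inner (x - P x) u = 0" using y by auto
qed

lemma P_eqI: "q y = 0 \<Longrightarrow> (\<And>u. q u = 0 \<Longrightarrow> inner (x - y) u = 0) \<Longrightarrow> P x = y"
  by (rule q_projection_unique[OF P])

lemma q_zero_add: "q u = 0 \<Longrightarrow> q v = 0 \<Longrightarrow> q (u + v) = 0"
  using linear_add[OF linear_V, of u v] by (simp flip: fixed_iff_q)

lemma P_add: "P (x + y) = P x + P y"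
proof (rule P_eqI[OF q_zero_add[OF P(1) P(1)]])
  fix u assume "q u = 0"
  then have "inner (x - P x) u + inner (y - P y) u = 0" by (simp add: P(2))
  then show "inner (x + y - (P x + P y)) u = 0" by (simp add: inner_diff_left inner_add_left)
qed

lemma P_scaleC: "P (c *\<^sub>C x) = c *\<^sub>C P x"
proof (rule P_eqI)
  show "q (c *\<^sub>C P x) = 0" by (simp add: q_scaleC P(1))
  fix u assume u: "q u = 0"
  have "x - P x \<in> orthocomp {u. q u = 0}" using P(2) by (simp add: orthocomp_kernel)
  then have "cinner (x - P x) u = 0" using u unfolding orthocomp_def by blast
  then have "cinner (c *\<^sub>C (x - P x)) u = 0" by (simp add: cinner_scaleC_left)
  then show "inner (c *\<^sub>C x - c *\<^sub>C P x) u = 0" by (simp add: inner_eq_Re_cinner scaleC_diff_right)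
qed

definition fast :: "energy_space set"
  where "fast = {x. \<forall>\<gamma>>0. (\<lambda>t. norm (sol x t - P x)) \<in> o[at_top](\<lambda>t. t powr (- \<gamma>))}"

lemma csubspace_fast: "csubspace fast"
  unfolding csubspace_def
proof (intro conjI ballI allI)
  have ev: "f \<in> o[at_top](\<lambda>t. t powr (- \<gamma>))" if "g \<in> o[at_top](\<lambda>t. t powr (- \<gamma>))" "\<And>t. t \<ge> 0 \<Longrightarrow> norm (f t) \<le> norm (g t)"
    for f g :: "real \<Rightarrow> real" and \<gamma>
    by (rule landau_o.big_small_trans[OF _ that(1)])
      (rule landau_o.big_mono, rule eventually_mono[OF eventually_ge_at_top[of 0]], rule that(2))
  have "sol 0 t = 0" if "t \<ge> 0" for t using sol_scaleC[OF that, of 0 0] by simp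
  moreover have "P 0 = 0" using P_scaleC[of 0 0] by simp
  ultimately show "0 \<in> fast" unfolding fast_def by (auto intro: ev[of "\<lambda>t. 0"])
  show "x + y \<in> fast" if x: "x \<in> fast" and y: "y \<in> fast" for x y
    unfolding fast_def
  proof (intro CollectI allI impI)
    fix \<gamma> :: real assume \<gamma>: "\<gamma> > 0"
    have "(\<lambda>t. norm (sol x t - P x) + norm (sol y t - P y)) \<in> o[at_top](\<lambda>t. t powr (- \<gamma>))"
      using x y \<gamma> unfolding fast_def by (intro sum_in_smallo) auto
    then show "(\<lambda>t. norm (sol (x + y) t - P (x + y))) \<in> o[at_top](\<lambda>t. t powr (- \<gamma>))"
    proof (rule ev)
      fix t :: real assume "t \<ge> 0"
      then have "sol (x + y) t - P (x + y) = (sol x t - P x) + (sol y t - P y)"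
        by (simp add: linear_add[OF sol_linear] P_add)
      then show "norm (norm (sol (x + y) t - P (x + y))) \<le> norm (norm (sol x t - P x) + norm (sol y t - P y))"
        by (simp add: norm_triangle_ineq)
    qed
  qed
  show "c *\<^sub>C x \<in> fast" if x: "x \<in> fast" for c x
    unfolding fast_def
  proof (intro CollectI allI impI)
    fix \<gamma> :: real assume \<gamma>: "\<gamma> > 0"
    have "(\<lambda>t. cmod c * norm (sol x t - P x)) \<in> o[at_top](\<lambda>t. t powr (- \<gamma>))"
      using x \<gamma> unfolding fast_def by simp
    then show "(\<lambda>t. norm (sol (c *\<^sub>C x) t - P (c *\<^sub>C x))) \<in> o[at_top](\<lambda>t. t powr (- \<gamma>))"
      by (rule ev) (simp add: sol_scaleC P_scaleC norm_scaleC flip: scaleC_diff_right)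
  qed
qed

lemma closure_fast: "closure fast = UNIV"
proof (intro equalityI subset_UNIV subsetI)
  fix x
  show "x \<in> closure fast"
    unfolding closure_approachable
  proof (intro allI impI)
    fix e :: real assume "e > 0"
    obtain x' where x': "norm (x' - x) < e" "\<forall>u. q u = 0 \<longrightarrow> inner (x' - P x) u = 0"
      "\<forall>\<gamma>. (\<lambda>t. norm (sol x' t - P x)) \<in> o[at_top](\<lambda>t. t powr (- \<gamma>))"
      by (rule superpolynomial_dense[OF P(1)[of x] P(2)[where x = x] \<open>e > 0\<close>]) blast+
    have "P x' = P x" by (rule P_eqI[OF P(1)]) (use x'(2) in blast)
    then show "\<exists>y\<in>fast. dist y x < e" using x' by (intro bexI[of _ x']) (auto simp: fast_def dist_norm)
  qed
qed

end

theorem theorem5p1: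
  fixes b :: "real \<times> real \<Rightarrow> real"
  assumes bounded: "essentially_bounded_on_strip b"
    and nonneg: "AE p in lebesgue_on strip. 0 \<le> b p"
    and periodic: "AE (s, t) in lebesgue_on strip. b (s, t + 2) = b (s, t)"
  shows
    "((\<forall>x. ((\<lambda>t. norm (damped_solution b x t - wave_group t (orthoproj (unobserved b) x)))
          \<longlongrightarrow> 0) at_top) \<and>
      asymptotically_periodic b \<and>
      (damped_stable b \<longleftrightarrow> unobserved b = {0})) \<and>
     ((\<exists>M \<beta>. M > 0 \<and> \<beta> > 0 \<and> (\<forall>x. \<forall>t\<ge>0.
          norm (damped_solution b x t - wave_group t (orthoproj (unobserved b) x))
            \<le> M * exp (- \<beta> * t) * norm x)) \<longleftrightarrow>
      (\<exists>\<kappa>>0. \<forall>x\<in>orthocomp (unobserved b). observed_energy b x \<ge> \<kappa>\<^sup>2 * (norm x)\<^sup>2)) \<and>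
     (\<forall>\<omega>. open \<omega> \<and> \<omega> \<subseteq> strip \<and> translation_invariant 2 \<omega> \<and>
          (AE p in lebesgue_on strip. b p = indicator \<omega> p) \<and> geometric_control 2 \<omega> \<longrightarrow>
        (\<exists>\<kappa>>0. \<forall>x. observed_energy b x \<ge> \<kappa>\<^sup>2 * (norm x)\<^sup>2)) \<and>
     (\<exists>X\<^sub>0. csubspace X\<^sub>0 \<and> closure X\<^sub>0 = UNIV \<and> (\<forall>x\<in>X\<^sub>0. \<forall>\<gamma>>0.
        (\<lambda>t. norm (damped_solution b x t - wave_group t (orthoproj (unobserved b) x)))
          \<in> o[at_top](\<lambda>t. t powr (- \<gamma>))))"
proof -
  obtain \<beta> K where D: "periodic_damping \<beta> K" and b: "AE p in lborel. p \<in> strip \<longrightarrow> b p = \<beta> p"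
    by (rule periodic_damping_exists[OF bounded nonneg periodic])
  interpret D: periodic_damping \<beta> K by (rule D)
  have E: "observed_energy b x = D.q x" for x by (rule D.observed_energy_eq(1)[OF b])
  have Y: "unobserved b = {x. D.q x = 0}" by (simp add: unobserved_def E)
  have P: "orthoproj (unobserved b) = D.P" by (simp add: Y D.P_def)
  have dist: "norm (damped_solution b x t - wave_group t (D.P x)) = norm (D.sol x t - D.P x)" if "t \<ge> 0" for x t
    by (simp add: D.damped_solution_eq[OF b that] wave_group_eq norm_wave_T flip: wave.simps)
  have ev: "\<forall>\<^sub>F t in at_top. norm (damped_solution b x t - wave_group t (D.P x)) = norm (D.sol x t - D.P x)" for x
    unfolding eventually_at_top_linorder using dist by blast
  have conv: "((\<lambda>t. norm (damped_solution b x t - wave_group t (D.P x))) \<longlongrightarrow> 0) at_top" for x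
    using D.sol_tendsto[OF D.P] by (subst tendsto_cong[OF ev])
  have per: "asymptotically_periodic b"
    unfolding asymptotically_periodic_def
  proof (intro allI exI[of _ "\<lambda>t. wave_group t (D.P x)" for x] exI[of _ 2] conjI impI)
    fix x
    show "(2::real) > 0" by simp
    show "wave_group (t + 2) (D.P x) = wave_group t (D.P x)" for t by (simp add: wave_group_eq D.wave_T_period)
    show "((\<lambda>t. norm (damped_solution b x t - wave_group t (D.P x))) \<longlongrightarrow> 0) at_top" by (rule conv)
  qed
  have stable: "damped_stable b \<longleftrightarrow> unobserved b = {0}"
  proof
    assume s: "damped_stable b"
    have "x = 0" if x: "D.q x = 0" for x
    proof -
      have "((\<lambda>t. norm (damped_solution b x t)) \<longlongrightarrow> 0) at_top" using s unfolding damped_stable_def by blast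
      moreover have "\<forall>\<^sub>F t in at_top. norm (damped_solution b x t) = norm x"
        using eventually_ge_at_top[of "0::real"]
        by eventually_elim (simp add: D.damped_solution_eq[OF b] norm_wave_T D.sol_fixed[OF x])
      ultimately have "((\<lambda>t::real. norm x) \<longlongrightarrow> 0) at_top" by (simp add: tendsto_cong)
      then show "x = 0" by (simp add: tendsto_const_iff)
    qed
    moreover have "D.q 0 = 0" by (simp add: D.q_def)
    ultimately show "unobserved b = {0}" by (auto simp: Y)
  next
    assume "unobserved b = {0}"
    then have "D.q u = 0 \<Longrightarrow> u = 0" for u by (auto simp: Y)
    then have "D.P x = 0" for x using D.P(1) by blast
    then show "damped_stable b" using conv unfolding damped_stable_def by (simp add: wave_group_eq wave.simps)
  qed
  have exp: "(\<exists>M \<beta>. M > 0 \<and> \<beta> > 0 \<and> (\<forall>x. \<forall>t\<ge>0.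
          norm (damped_solution b x t - wave_group t (orthoproj (unobserved b) x)) \<le> M * exp (- \<beta> * t) * norm x)) \<longleftrightarrow>
      (\<exists>\<kappa>>0. \<forall>x\<in>orthocomp (unobserved b). observed_energy b x \<ge> \<kappa>\<^sup>2 * (norm x)\<^sup>2)"
    using D.exponential_iff_coercive[OF D.P] unfolding P E
    by (simp add: Y dist Ball_def D.orthocomp_kernel del: split_paired_All)
  have gcc: "\<exists>\<kappa>>0. \<forall>x. observed_energy b x \<ge> \<kappa>\<^sup>2 * (norm x)\<^sup>2"
    if \<omega>: "open \<omega>" "AE p in lebesgue_on strip. b p = indicator \<omega> p" "geometric_control 2 \<omega>" for \<omega>
    unfolding E
  proof (rule D.observable[OF \<omega>(1) _ \<omega>(3)])
    have "AE p in lborel. p \<in> strip \<longrightarrow> b p = indicator \<omega> p"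
      using \<omega>(2) strip_borel by (simp add: AE_restrict_space_iff AE_completion_iff)
    then show "AE p in lborel. p \<in> \<omega> \<inter> period_cell \<longrightarrow> \<beta> p = 1"
      using b by eventually_elim (auto simp: period_cell_def strip_def)
  qed
  have dense: "\<exists>X\<^sub>0. csubspace X\<^sub>0 \<and> closure X\<^sub>0 = UNIV \<and> (\<forall>x\<in>X\<^sub>0. \<forall>\<gamma>>0.
        (\<lambda>t. norm (damped_solution b x t - wave_group t (D.P x))) \<in> o[at_top](\<lambda>t. t powr (- \<gamma>)))"
  proof (intro exI[of _ D.fast] conjI ballI allI impI D.csubspace_fast D.closure_fast)
    fix x and \<gamma> :: real assume "x \<in> D.fast" "\<gamma> > 0"
    then have "(\<lambda>t. norm (D.sol x t - D.P x)) \<in> o[at_top](\<lambda>t. t powr (- \<gamma>))" by (simp add: D.fast_def)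
    then show "(\<lambda>t. norm (damped_solution b x t - wave_group t (D.P x))) \<in> o[at_top](\<lambda>t. t powr (- \<gamma>))"
      by (subst landau_o.small.in_cong[OF ev])
  qed
  have "\<forall>\<omega>. open \<omega> \<and> \<omega> \<subseteq> strip \<and> translation_invariant 2 \<omega> \<and>
      (AE p in lebesgue_on strip. b p = indicator \<omega> p) \<and> geometric_control 2 \<omega> \<longrightarrow>
    (\<exists>\<kappa>>0. \<forall>x. observed_energy b x \<ge> \<kappa>\<^sup>2 * (norm x)\<^sup>2)"
    using gcc by blast
  moreover have "\<forall>x. ((\<lambda>t. norm (damped_solution b x t - wave_group t (D.P x))) \<longlongrightarrow> 0) at_top"
    using conv by blast
  ultimately show ?thesis using per stable exp dense unfolding P by (intro conjI)
qed

end
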